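(* Let $(G,N,\theta)_{\mathcal H}$ and $(H,M,\varphi)_{\mathcal H}$ be $\mathcal H$-triples with $(G,N,\theta)_{\mathcal H}\ge_c(H,M,\varphi)_{\mathcal H}$. Suppose that $Z\trianglelefteq G$ is abelian with $Z\subseteq\mathbf C_G(N)$. Let $\nu\in\mathrm{Irr}(Z\cap N)$ lie under $\theta$ and let $\lambda\in\mathrm{Irr}(Z|\nu)$. Then $$(G_{(\theta\cdot\lambda)^{\mathcal H}},NZ,\theta\cdot\lambda)_{\mathcal H}\ge_c(H_{(\varphi\cdot\lambda)^{\mathcal H}},MZ,\varphi\cdot\lambda)_{\mathcal H}.$$ In particular, there exists an $\mathcal H$-equivariant bijection $\mathrm{Irr}(G_{(\theta\cdot\lambda)^{\mathcal H}}|(\theta\cdot\lambda)^{\mathcal H})\to\mathrm{Irr}(H_{(\varphi\cdot\lambda)^{\mathcal H}}|(\varphi\cdot\lambda)^{\mathcal H})$ that preserves ratios of character degrees.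
   Context: All groups are finite; $p$ is a fixed prime. $\mathbb Q^{\mathrm{ab}}\subseteq\mathbb C$ is generated by all roots of unity, $\mathcal G=\mathrm{Gal}(\mathbb Q^{\mathrm{ab}}/\mathbb Q)$, $\mathcal H\le\mathcal G$ consists of those $\sigma$ for which there is an integer $f$ with $\sigma(\xi)=\xi^{p^f}$ for all roots of unity $\xi$ of order prime to $p$. For $N\trianglelefteq G$, $\theta\in\mathrm{Irr}(N)$, $g\in G$, $\sigma\in\mathcal G$: $\theta^{g\sigma}(n)=\sigma(\theta(gng^{-1}))$; $A_\theta$ the stabilizer in $A\le G\times\mathcal G$; $\theta^{\mathcal H}$ the $\mathcal H$-orbit; $G_{\theta^{\mathcal H}}=\{g:\theta^g\in\theta^{\mathcal H}\}$; $\mathrm{Irr}(G|\theta^{\mathcal H})=\bigcup_{\sigma\in\mathcal H}\mathrm{Irr}(G|\theta^\sigma)$. $(G,N,\theta)_{\mathcal H}$ is an $\mathcal H$-triple if $N\trianglelefteq G$, $\theta\in\mathrm{Irr}(N)$, $G_{\theta^{\mathcal H}}=G$. A bijection $\tau$ between such sets (over $\psi$, resp. $\psi'$) preserves ratios of character degrees if $\chi(1)/\psi(1)=\tau(\chi)(1)/\psi'(1)$. Central products: if $K=N'Z$ with $N'\trianglelefteq K$, $Z\le\mathbf C_K(N')$, and $\psi\in\mathrm{Irr}(N')$, $\lambda\in\mathrm{Irr}(Z)$ lie over the same character of $N'\cap Z$, then $\psi\cdot\lambda\in\mathrm{Irr}(K)$ is given by $(\psi\cdot\lambda)(nz)=\psi(n)\lambda(z)$.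 Projective representation $\mathcal P$ with factor set $\alpha$: $\mathcal P(x)\mathcal P(y)=\alpha(x,y)\mathcal P(xy)$. For $G$-invariant $\theta$, $\mathcal P$ is associated with $\theta$ if $\mathcal P_N$ affords $\theta$ and $\mathcal P(ng)=\mathcal P(n)\mathcal P(g)$, $\mathcal P(gn)=\mathcal P(g)\mathcal P(n)$. $\mathcal Q\sim\mu\mathcal P$ means $\mathcal Q(x)=\mu(x)M^{-1}\mathcal P(x)M$ for fixed invertible $M$. For $\mathcal P$ associated with $\theta$ on $G_\theta$ with entries in $\mathbb Q^{\mathrm{ab}}$ and $\theta^{x\sigma}=\theta$: $\mathcal P^{x\sigma}(y)=\sigma(\mathcal P(xyx^{-1}))$, and $\mu_{x\sigma}$ is the unique function $G_\theta\to\mathbb C^\times$, constant on $N$-cosets, $\mu_{x\sigma}(1)=1$, with $\mathcal P^{x\sigma}\sim\mu_{x\sigma}\mathcal P$. $(G,N,\theta)_{\mathcal H}\ge_c(H,M,\varphi)_{\mathcal H}$ (both $\mathcal H$-triples, $H\le G$) means: (i) $G=NH$, $N\cap H=M$, $\mathbf C_G(N)\subseteq H$; (ii) $(H\times\mathcal H)_\theta=(H\times\mathcal H)_\varphi$; (iii) there are projective representations $\mathcal P$ of $G_\theta$ associated with $\theta$ and $\mathcal P'$ of $H_\varphi$ associated with $\varphi$, entries in $\mathbb Q^{\mathrm{ab}}$, factor sets with root-of-unity values agreeing on $H_\theta\times H_\theta$, and $\mathcal P(c),\mathcal P'(c)$ the same scalar for all $c\in\mathbf C_G(N)$; (iv)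 $\mu_a=\mu'_a$ on $H_\theta$ for all $a\in(H\times\mathcal H)_\theta$. *)

theory Defs
  imports "HOL-Algebra.Group" "HOL-Algebra.Coset" "Jordan_Normal_Form.Matrix" "HOL-Computational_Algebra.Primes"
begin

definition root_of_unity :: "complex \<Rightarrow> bool" where
  "root_of_unity z \<longleftrightarrow> (\<exists>n::nat. n > 0 \<and> z ^ n = 1)"

definition is_subfield_C :: "complex set \<Rightarrow> bool" where
  "is_subfield_C F \<longleftrightarrow> 0 \<in> F \<and> 1 \<in> F \<and>
     (\<forall>x\<in>F. \<forall>y\<in>F. x + y \<in> F \<and> x * y \<in> F) \<and> (\<forall>x\<in>F. - x \<in> F) \<and>
     (\<forall>x\<in>F. x \<noteq> 0 \<longrightarrow> inverse x \<in> F)"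

definition Qab :: "complex set" where
  "Qab = \<Inter>{F. is_subfield_C F \<and> {z. root_of_unity z} \<subseteq> F}"

definition GalAb :: "(complex \<Rightarrow> complex) set" where
  "GalAb = {\<sigma>. bij_betw \<sigma> Qab Qab \<and>
     (\<forall>x\<in>Qab. \<forall>y\<in>Qab. \<sigma> (x + y) = \<sigma> x + \<sigma> y \<and> \<sigma> (x * y) = \<sigma> x * \<sigma> y) \<and>
     (\<forall>x. x \<notin> Qab \<longrightarrow> \<sigma> x = x)}"

text \<open>The subgroup H: sigma acts on roots of unity of order prime to p as xi to xi^(p^f), f an integer
  (for negative f this means the inverse of the Frobenius power).\<close>
definition Hgal :: "nat \<Rightarrow> (complex \<Rightarrow> complex) set" where
  "Hgal p = {\<sigma>\<in>GalAb. \<exists>f::int. \<forall>\<xi>::complex.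
      (\<exists>n::nat. n > 0 \<and> coprime n p \<and> \<xi> ^ n = 1) \<longrightarrow>
      (if f \<ge> 0 then \<sigma> \<xi> = \<xi> ^ (p ^ nat f) else (\<sigma> \<xi>) ^ (p ^ nat (- f)) = \<xi>)}"

definition nsub :: "('g, 'b) monoid_scheme \<Rightarrow> 'g set \<Rightarrow> 'g set \<Rightarrow> bool" where
  "nsub \<Gamma> N G \<longleftrightarrow> subgroup G \<Gamma> \<and> subgroup N \<Gamma> \<and> N \<subseteq> G \<and>
     (\<forall>g\<in>G. \<forall>n\<in>N. g \<otimes>\<^bsub>\<Gamma>\<^esub> n \<otimes>\<^bsub>\<Gamma>\<^esub> inv\<^bsub>\<Gamma>\<^esub> g \<in> N)"

definition centr :: "('g, 'b) monoid_scheme \<Rightarrow> 'g set \<Rightarrow> 'g set \<Rightarrow> 'g set" where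
  "centr \<Gamma> G N = {g\<in>G. \<forall>n\<in>N. g \<otimes>\<^bsub>\<Gamma>\<^esub> n = n \<otimes>\<^bsub>\<Gamma>\<^esub> g}"

definition setprod :: "('g, 'b) monoid_scheme \<Rightarrow> 'g set \<Rightarrow> 'g set \<Rightarrow> 'g set" where
  "setprod \<Gamma> A B = {a \<otimes>\<^bsub>\<Gamma>\<^esub> b | a b. a \<in> A \<and> b \<in> B}"

definition mtrace :: "complex mat \<Rightarrow> complex" where
  "mtrace A = (\<Sum>i<dim_row A. A $$ (i, i))"

definition is_rep :: "('g, 'b) monoid_scheme \<Rightarrow> 'g set \<Rightarrow> nat \<Rightarrow> ('g \<Rightarrow> complex mat) \<Rightarrow> bool" where
  "is_rep \<Gamma> K n \<rho> \<longleftrightarrow> (\<forall>x\<in>K. \<rho> x \<in> carrier_mat n n) \<and> \<rho> \<one>\<^bsub>\<Gamma>\<^esub> = 1\<^sub>m n \<and>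
     (\<forall>x\<in>K. \<forall>y\<in>K. \<rho> (x \<otimes>\<^bsub>\<Gamma>\<^esub> y) = \<rho> x * \<rho> y)"

definition inv_subspace :: "'g set \<Rightarrow> nat \<Rightarrow> ('g \<Rightarrow> complex mat) \<Rightarrow> complex vec set \<Rightarrow> bool" where
  "inv_subspace K n \<rho> W \<longleftrightarrow> W \<subseteq> carrier_vec n \<and> 0\<^sub>v n \<in> W \<and>
     (\<forall>v\<in>W. \<forall>w\<in>W. v + w \<in> W) \<and> (\<forall>c. \<forall>v\<in>W. c \<cdot>\<^sub>v v \<in> W) \<and>
     (\<forall>x\<in>K. \<forall>w\<in>W. \<rho> x *\<^sub>v w \<in> W)"

definition irred_rep :: "('g, 'b) monoid_scheme \<Rightarrow> 'g set \<Rightarrow> nat \<Rightarrow> ('g \<Rightarrow> complex mat) \<Rightarrow> bool" where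
  "irred_rep \<Gamma> K n \<rho> \<longleftrightarrow> n > 0 \<and> is_rep \<Gamma> K n \<rho> \<and>
     (\<forall>W. inv_subspace K n \<rho> W \<longrightarrow> W = {0\<^sub>v n} \<or> W = carrier_vec n)"

definition char_of :: "'g set \<Rightarrow> ('g \<Rightarrow> complex mat) \<Rightarrow> 'g \<Rightarrow> complex" where
  "char_of K \<rho> = (\<lambda>x. if x \<in> K then mtrace (\<rho> x) else 0)"

definition Irr :: "('g, 'b) monoid_scheme \<Rightarrow> 'g set \<Rightarrow> ('g \<Rightarrow> complex) set" where
  "Irr \<Gamma> K = {\<chi>. \<exists>n \<rho>. irred_rep \<Gamma> K n \<rho> \<and> \<chi> = char_of K \<rho>}"

definition cinner :: "'g set \<Rightarrow> ('g \<Rightarrow> complex) \<Rightarrow> ('g \<Rightarrow> complex) \<Rightarrow> complex" where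
  "cinner K \<chi> \<psi> = (\<Sum>x\<in>K. \<chi> x * cnj (\<psi> x)) / of_nat (card K)"

definition Irr_over :: "('g, 'b) monoid_scheme \<Rightarrow> 'g set \<Rightarrow> 'g set \<Rightarrow> ('g \<Rightarrow> complex) \<Rightarrow> ('g \<Rightarrow> complex) set" where
  "Irr_over \<Gamma> K L \<psi> = {\<chi>\<in>Irr \<Gamma> K. cinner L \<chi> \<psi> \<noteq> 0}"

definition char_act :: "('g, 'b) monoid_scheme \<Rightarrow> 'g set \<Rightarrow> 'g \<Rightarrow> (complex \<Rightarrow> complex) \<Rightarrow> ('g \<Rightarrow> complex) \<Rightarrow> 'g \<Rightarrow> complex" where
  "char_act \<Gamma> N g \<sigma> \<theta> = (\<lambda>n. if n \<in> N then \<sigma> (\<theta> (g \<otimes>\<^bsub>\<Gamma>\<^esub> n \<otimes>\<^bsub>\<Gamma>\<^esub> inv\<^bsub>\<Gamma>\<^esub> g)) else 0)"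

definition Horbit :: "('g, 'b) monoid_scheme \<Rightarrow> nat \<Rightarrow> 'g set \<Rightarrow> ('g \<Rightarrow> complex) \<Rightarrow> ('g \<Rightarrow> complex) set" where
  "Horbit \<Gamma> p N \<theta> = {char_act \<Gamma> N \<one>\<^bsub>\<Gamma>\<^esub> \<sigma> \<theta> | \<sigma>. \<sigma> \<in> Hgal p}"

definition stab :: "('g, 'b) monoid_scheme \<Rightarrow> 'g set \<Rightarrow> 'g set \<Rightarrow> ('g \<Rightarrow> complex) \<Rightarrow> 'g set" where
  "stab \<Gamma> G N \<theta> = {g\<in>G. char_act \<Gamma> N g id \<theta> = \<theta>}"

definition stab_orb :: "('g, 'b) monoid_scheme \<Rightarrow> nat \<Rightarrow> 'g set \<Rightarrow> 'g set \<Rightarrow> ('g \<Rightarrow> complex) \<Rightarrow> 'g set" where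
  "stab_orb \<Gamma> p G N \<theta> = {g\<in>G. char_act \<Gamma> N g id \<theta> \<in> Horbit \<Gamma> p N \<theta>}"

definition stabH :: "('g, 'b) monoid_scheme \<Rightarrow> nat \<Rightarrow> 'g set \<Rightarrow> 'g set \<Rightarrow> ('g \<Rightarrow> complex) \<Rightarrow> ('g \<times> (complex \<Rightarrow> complex)) set" where
  "stabH \<Gamma> p H N \<theta> = {(h, \<sigma>). h \<in> H \<and> \<sigma> \<in> Hgal p \<and> char_act \<Gamma> N h \<sigma> \<theta> = \<theta>}"

definition Irr_over_orb :: "('g, 'b) monoid_scheme \<Rightarrow> nat \<Rightarrow> 'g set \<Rightarrow> 'g set \<Rightarrow> ('g \<Rightarrow> complex) \<Rightarrow> ('g \<Rightarrow> complex) set" where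
  "Irr_over_orb \<Gamma> p G N \<theta> = (\<Union>\<sigma>\<in>Hgal p. Irr_over \<Gamma> G N (char_act \<Gamma> N \<one>\<^bsub>\<Gamma>\<^esub> \<sigma> \<theta>))"

definition Htriple :: "('g, 'b) monoid_scheme \<Rightarrow> nat \<Rightarrow> 'g set \<Rightarrow> 'g set \<Rightarrow> ('g \<Rightarrow> complex) \<Rightarrow> bool" where
  "Htriple \<Gamma> p G N \<theta> \<longleftrightarrow> nsub \<Gamma> N G \<and> \<theta> \<in> Irr \<Gamma> N \<and> stab_orb \<Gamma> p G N \<theta> = G"

definition cprod :: "('g, 'b) monoid_scheme \<Rightarrow> 'g set \<Rightarrow> 'g set \<Rightarrow> ('g \<Rightarrow> complex) \<Rightarrow> ('g \<Rightarrow> complex) \<Rightarrow> 'g \<Rightarrow> complex" where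
  "cprod \<Gamma> N Z \<psi> lam = (\<lambda>x. if x \<in> setprod \<Gamma> N Z
      then (SOME v. \<exists>n\<in>N. \<exists>z\<in>Z. x = n \<otimes>\<^bsub>\<Gamma>\<^esub> z \<and> v = \<psi> n * lam z) else 0)"

definition proj_rep :: "('g, 'b) monoid_scheme \<Rightarrow> 'g set \<Rightarrow> nat \<Rightarrow> ('g \<Rightarrow> complex mat) \<Rightarrow> ('g \<Rightarrow> 'g \<Rightarrow> complex) \<Rightarrow> bool" where
  "proj_rep \<Gamma> K d P \<alpha> \<longleftrightarrow> (\<forall>x\<in>K. P x \<in> carrier_mat d d \<and> invertible_mat (P x)) \<and>
     (\<forall>x\<in>K. \<forall>y\<in>K. \<alpha> x y \<noteq> 0 \<and> P x * P y = \<alpha> x y \<cdot>\<^sub>m P (x \<otimes>\<^bsub>\<Gamma>\<^esub> y))"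

definition assoc_with :: "('g, 'b) monoid_scheme \<Rightarrow> 'g set \<Rightarrow> 'g set \<Rightarrow> nat \<Rightarrow> ('g \<Rightarrow> complex mat) \<Rightarrow> ('g \<Rightarrow> complex) \<Rightarrow> bool" where
  "assoc_with \<Gamma> K N d P \<theta> \<longleftrightarrow> is_rep \<Gamma> N d P \<and> char_of N P = \<theta> \<and>
     (\<forall>n\<in>N. \<forall>g\<in>K. P (n \<otimes>\<^bsub>\<Gamma>\<^esub> g) = P n * P g \<and> P (g \<otimes>\<^bsub>\<Gamma>\<^esub> n) = P g * P n)"

definition entries_Qab :: "'g set \<Rightarrow> nat \<Rightarrow> ('g \<Rightarrow> complex mat) \<Rightarrow> bool" where
  "entries_Qab K d P \<longleftrightarrow> (\<forall>x\<in>K. \<forall>i<d. \<forall>j<d. P x $$ (i, j) \<in> Qab)"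

definition Pconj :: "('g, 'b) monoid_scheme \<Rightarrow> ('g \<Rightarrow> complex mat) \<Rightarrow> 'g \<Rightarrow> (complex \<Rightarrow> complex) \<Rightarrow> 'g \<Rightarrow> complex mat" where
  "Pconj \<Gamma> P x \<sigma> = (\<lambda>y. map_mat \<sigma> (P (x \<otimes>\<^bsub>\<Gamma>\<^esub> y \<otimes>\<^bsub>\<Gamma>\<^esub> inv\<^bsub>\<Gamma>\<^esub> x)))"

text \<open>mu_(x sigma): the unique function K -> C^x, constant on N-cosets, mu(1)=1, with
  P^(x sigma) ~ mu P. (Normalised to 1 outside K so that it is unique as a HOL function.)\<close>
definition mu :: "('g, 'b) monoid_scheme \<Rightarrow> 'g set \<Rightarrow> 'g set \<Rightarrow> nat \<Rightarrow> ('g \<Rightarrow> complex mat) \<Rightarrow> 'g \<Rightarrow> (complex \<Rightarrow> complex) \<Rightarrow> 'g \<Rightarrow> complex" where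
  "mu \<Gamma> K N d P x \<sigma> = (THE \<mu>. (\<forall>y. y \<notin> K \<longrightarrow> \<mu> y = 1) \<and> (\<forall>y\<in>K. \<mu> y \<noteq> 0) \<and>
      (\<forall>y\<in>K. \<forall>n\<in>N. \<mu> (n \<otimes>\<^bsub>\<Gamma>\<^esub> y) = \<mu> y) \<and> \<mu> \<one>\<^bsub>\<Gamma>\<^esub> = 1 \<and>
      (\<exists>A B. A \<in> carrier_mat d d \<and> B \<in> carrier_mat d d \<and> A * B = 1\<^sub>m d \<and> B * A = 1\<^sub>m d \<and>
         (\<forall>y\<in>K. Pconj \<Gamma> P x \<sigma> y = \<mu> y \<cdot>\<^sub>m (B * P y * A))))"

definition geq_c :: "('g, 'b) monoid_scheme \<Rightarrow> nat \<Rightarrow> 'g set \<Rightarrow> 'g set \<Rightarrow> ('g \<Rightarrow> complex)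
    \<Rightarrow> 'g set \<Rightarrow> 'g set \<Rightarrow> ('g \<Rightarrow> complex) \<Rightarrow> bool" where
  "geq_c \<Gamma> p G N \<theta> H M \<phi> \<longleftrightarrow>
     Htriple \<Gamma> p G N \<theta> \<and> Htriple \<Gamma> p H M \<phi> \<and> H \<subseteq> G \<and>
     G = setprod \<Gamma> N H \<and> N \<inter> H = M \<and> centr \<Gamma> G N \<subseteq> H \<and>
     stabH \<Gamma> p H N \<theta> = stabH \<Gamma> p H M \<phi> \<and>
     (\<exists>d d' P P' \<alpha> \<alpha>'.
        proj_rep \<Gamma> (stab \<Gamma> G N \<theta>) d P \<alpha> \<and> assoc_with \<Gamma> (stab \<Gamma> G N \<theta>) N d P \<theta> \<and>
        entries_Qab (stab \<Gamma> G N \<theta>) d P \<and>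
        proj_rep \<Gamma> (stab \<Gamma> H M \<phi>) d' P' \<alpha>' \<and> assoc_with \<Gamma> (stab \<Gamma> H M \<phi>) M d' P' \<phi> \<and>
        entries_Qab (stab \<Gamma> H M \<phi>) d' P' \<and>
        (\<forall>x\<in>stab \<Gamma> G N \<theta>. \<forall>y\<in>stab \<Gamma> G N \<theta>. root_of_unity (\<alpha> x y)) \<and>
        (\<forall>x\<in>stab \<Gamma> H M \<phi>. \<forall>y\<in>stab \<Gamma> H M \<phi>. root_of_unity (\<alpha>' x y)) \<and>
        (\<forall>x\<in>stab \<Gamma> H N \<theta>. \<forall>y\<in>stab \<Gamma> H N \<theta>. \<alpha> x y = \<alpha>' x y) \<and>
        (\<forall>c\<in>centr \<Gamma> G N. \<exists>s. P c = s \<cdot>\<^sub>m 1\<^sub>m d \<and> P' c = s \<cdot>\<^sub>m 1\<^sub>m d') \<and>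
        (\<forall>(x, \<sigma>)\<in>stabH \<Gamma> p H N \<theta>. \<forall>y\<in>stab \<Gamma> H N \<theta>.
            mu \<Gamma> (stab \<Gamma> G N \<theta>) N d P x \<sigma> y = mu \<Gamma> (stab \<Gamma> H M \<phi>) M d' P' x \<sigma> y))"

end

theory Submission
  imports Defs "Jordan_Normal_Form.Schur_Decomposition" "Jordan_Normal_Form.Spectral_Radius" "HOL-Algebra.Multiplicative_Group"
begin

text \<open>
  The irreducible characters of a finite group \<open>K\<close> are exactly the functions \<open>f\<close> with
  \<open>f(x) f(y) = f(1)/|K| \<Sum>\<^sub>g f(x g y g\<^sup>-\<^sup>1)\<close> together with \<open>\<Sum>\<^sub>g f(g) f(g\<^sup>-\<^sup>1) = |K|\<close> and \<open>f(1) > 0\<close>.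
  These conditions are rational in the values of \<open>f\<close>, so Galois conjugates of irreducible characters are
  irreducible although an element of \<open>\<G>\<close> acts on \<open>\<rat>\<^sup>a\<^sup>b\<close> only and cannot be applied to a complex representation.

  If \<open>\<P>\<close> is associated with \<open>\<theta>\<close> on \<open>T = G\<^sub>\<theta>\<close>, the irreducible characters of \<open>T\<close> over \<open>\<theta>\<close> are the products
  \<open>tr \<P> \<cdot> q\<close>, where \<open>q\<close> is a function on \<open>T/N\<close> satisfying a functional equation twisted by the factor set
  \<open>\<alpha>\<close>. That equation involves \<open>T/N\<close> and \<open>\<alpha>\<close> only, hence restriction of \<open>q\<close> to \<open>H\<^sub>\<theta>\<close> matches the characters over
  \<open>\<theta>\<close> with those over \<open>\<phi>\<close>; induction to \<open>G\<close> and \<open>H\<close> (Clifford) and the equality of the functions \<open>\<mu>\<^sub>a\<close>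
  turn this into an equivariant bijection, extended to the orbit of \<open>\<theta>\<close> by the Galois action.

  For the central product, \<open>\<P>(z) = \<zeta>(z)\<close> is scalar on \<open>Z\<close>. A function \<open>\<kappa>\<close> on \<open>T\<close> with
  \<open>\<kappa>(n x) = \<kappa>(x)\<close> and \<open>\<kappa>(z x) \<zeta>(z) = \<lambda>(z) \<alpha>(z,x) \<kappa>(x)\<close> makes \<open>\<kappa>\<P>\<close> associated with \<open>\<theta>\<cdot>\<lambda>\<close>. Since
  \<open>\<kappa>\<close> is subject to conditions on \<open>\<alpha>\<close>, \<open>\<zeta>\<close> and \<open>\<lambda>\<close> alone, the same \<open>\<kappa>\<close> serves for \<open>\<P>'\<close>.
\<close>

section \<open>Finite subgroups and matrix sums\<close>

text \<open>All subgroups live in one ambient group, and statements about \<open>T/N\<close> are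
  statements about functions constant on cosets of \<open>N\<close>. The engine is the identity
  \<open>e (g e g^-1) = e\<close> or \<open>0\<close> for the central idempotent \<open>e\<close> of
  \<theta>, which yields both directions of the Clifford correspondence.

  The delicate point is the passage from characters over \<theta> to characters over its whole
  orbit. A character may be written as the conjugate by some \<sigma> of a character over \<theta>
  in several ways, so extension by equivariance is well defined only if every \<sigma> carrying one
  character over \<theta> to another is already respected. By Clifford's theorem such a \<sigma>
  fixes \<theta> together with some \<open>g\<close>. Because \<open>G = N H\<close> and
  \<open>N\<close> fixes \<theta>, this \<open>g\<close> can be taken in \<open>H\<close>; then the
  equality of the stabilizers of \<theta> and \<phi> and the equality of the functions \<mu> apply
  to the same pair on both sides.\<close>

locale fsub = group \<Gamma> for \<Gamma> :: "('g, 'b) monoid_scheme" (structure) +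
  fixes K :: "'g set"
  assumes sub: "subgroup K \<Gamma>" and fin: "finite K"
begin

lemma memb [simp]:
  "\<one> \<in> K" "x \<in> K \<Longrightarrow> y \<in> K \<Longrightarrow> x \<otimes> y \<in> K" "x \<in> K \<Longrightarrow> inv x \<in> K"
  using sub by (auto simp: subgroup.one_closed subgroup.m_closed subgroup.m_inv_closed)

lemma carr [simp]: "x \<in> K \<Longrightarrow> x \<in> carrier \<Gamma>"
  using sub subgroup.mem_carrier by metis

lemma card_nz [simp]: "card K \<noteq> 0" "0 < card K" "K \<noteq> {}"
  using memb(1) fin by (auto simp: card_gt_0_iff simp del: memb)

lemma mult_inv_cancel [simp]:
  "x \<in> carrier \<Gamma> \<Longrightarrow> y \<in> carrier \<Gamma> \<Longrightarrow> x \<otimes> (inv x \<otimes> y) = y"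
  "x \<in> carrier \<Gamma> \<Longrightarrow> y \<in> carrier \<Gamma> \<Longrightarrow> inv x \<otimes> (x \<otimes> y) = y"
  by (simp_all add: m_assoc[symmetric])

lemma conj_mult_inv:
  "g \<in> carrier \<Gamma> \<Longrightarrow> h \<in> carrier \<Gamma> \<Longrightarrow> x \<in> carrier \<Gamma> \<Longrightarrow>
   (g \<otimes> h) \<otimes> x \<otimes> inv (g \<otimes> h) = g \<otimes> (h \<otimes> x \<otimes> inv h) \<otimes> inv g"
  by (simp add: inv_mult_group m_assoc)

lemma conj_mult:
  "g \<in> carrier \<Gamma> \<Longrightarrow> x \<in> carrier \<Gamma> \<Longrightarrow> y \<in> carrier \<Gamma> \<Longrightarrow>
   g \<otimes> (x \<otimes> y) \<otimes> inv g = (g \<otimes> x \<otimes> inv g) \<otimes> (g \<otimes> y \<otimes> inv g)"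
  by (simp add: m_assoc)

lemma conj_inv:
  "g \<in> carrier \<Gamma> \<Longrightarrow> x \<in> carrier \<Gamma> \<Longrightarrow> inv (g \<otimes> x \<otimes> inv g) = g \<otimes> inv x \<otimes> inv g"
  by (simp add: inv_mult_group m_assoc)

lemma conj_cancel:
  assumes "a \<in> carrier \<Gamma>" "x \<in> carrier \<Gamma>"
  shows "inv a \<otimes> (a \<otimes> x \<otimes> inv a) \<otimes> a = x" "a \<otimes> (inv a \<otimes> x \<otimes> a) \<otimes> inv a = x"
  using assms by (simp_all add: m_assoc)

lemma sum_inv: "(\<Sum>x\<in>K. f (inv x)) = (\<Sum>x\<in>K. f x)"
  by (rule sum.reindex_bij_witness[of _ "\<lambda>x. inv x" "\<lambda>x. inv x"]) auto

lemma sum_left: "a \<in> K \<Longrightarrow> (\<Sum>x\<in>K. f (a \<otimes> x)) = (\<Sum>x\<in>K. f x)"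
  by (rule sum.reindex_bij_witness[of _ "\<lambda>x. inv a \<otimes> x" "\<lambda>x. a \<otimes> x"]) auto

lemma sum_right: "a \<in> K \<Longrightarrow> (\<Sum>x\<in>K. f (x \<otimes> a)) = (\<Sum>x\<in>K. f x)"
  by (rule sum.reindex_bij_witness[of _ "\<lambda>x. x \<otimes> inv a" "\<lambda>x. x \<otimes> a"]) (auto simp: m_assoc)

lemma sum_conj: 
  assumes "a \<in> carrier \<Gamma>" "\<And>x. x \<in> K \<Longrightarrow> a \<otimes> x \<otimes> inv a \<in> K" "\<And>x. x \<in> K \<Longrightarrow> inv a \<otimes> x \<otimes> a \<in> K"
  shows "(\<Sum>x\<in>K. f (a \<otimes> x \<otimes> inv a)) = (\<Sum>x\<in>K. f x)"
  by (rule sum.reindex_bij_witness[of _ "\<lambda>x. inv a \<otimes> x \<otimes> a" "\<lambda>x. a \<otimes> x \<otimes> inv a"])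
    (use assms(1) assms(2,3) in \<open>simp_all add: conj_cancel\<close>)

end

section \<open>Matrix sums, traces and elementary matrices\<close>

lemma square_mult_carrier [simp]:
  "A \<in> carrier_mat n n \<Longrightarrow> B \<in> carrier_mat n n \<Longrightarrow> A * B \<in> carrier_mat n n"
  by (rule mult_carrier_mat)

lemma square_mult_vec_carrier [simp]:
  "A \<in> carrier_mat n n \<Longrightarrow> v \<in> carrier_vec n \<Longrightarrow> A *\<^sub>v v \<in> carrier_vec n"
  by (rule mult_mat_vec_carrier)

text \<open>The size is an argument because matrices of all sizes share one type; an empty sum would
  otherwise have no dimensions.\<close>

definition msum :: "nat \<Rightarrow> 'a set \<Rightarrow> ('a \<Rightarrow> complex mat) \<Rightarrow> complex mat" where
  "msum n K F = mat n n (\<lambda>(i, j). \<Sum>x\<in>K. F x $$ (i, j))"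

lemma msum_carrier [simp]: "msum n K F \<in> carrier_mat n n" "dim_row (msum n K F) = n" "dim_col (msum n K F) = n"
  by (auto simp: msum_def)

lemma msum_index [simp]: "i < n \<Longrightarrow> j < n \<Longrightarrow> msum n K F $$ (i, j) = (\<Sum>x\<in>K. F x $$ (i, j))"
  by (simp add: msum_def)

lemma mult_index:
  assumes "A \<in> carrier_mat a n" "B \<in> carrier_mat n b" "i < a" "j < b"
  shows "(A * B) $$ (i, j) = (\<Sum>k<n. A $$ (i, k) * B $$ (k, j))"
  using assms by (auto simp: scalar_prod_def lessThan_atLeast0 intro!: sum.cong)

lemma msum_mult_left:
  assumes "A \<in> carrier_mat n n" "\<And>x. x \<in> K \<Longrightarrow> F x \<in> carrier_mat n n"
  shows "A * msum n K F = msum n K (\<lambda>x. A * F x)"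
proof (rule eq_matI)
  fix i j assume "i < dim_row (msum n K (\<lambda>x. A * F x))" "j < dim_col (msum n K (\<lambda>x. A * F x))"
  hence ij: "i < n" "j < n" by auto
  have "(A * msum n K F) $$ (i, j) = (\<Sum>k<n. A $$ (i, k) * (\<Sum>x\<in>K. F x $$ (k, j)))"
    using ij assms by (subst mult_index[of A n n _ n]) auto
  also have "\<dots> = (\<Sum>x\<in>K. \<Sum>k<n. A $$ (i, k) * F x $$ (k, j))"
    by (subst sum.swap) (simp add: sum_distrib_left)
  also have "\<dots> = msum n K (\<lambda>x. A * F x) $$ (i, j)"
    using ij assms by (auto intro!: sum.cong simp: mult_index[of A n n _ n])
  finally show "(A * msum n K F) $$ (i, j) = msum n K (\<lambda>x. A * F x) $$ (i, j)" .
qed (use assms in auto)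

lemma msum_mult_right:
  assumes "A \<in> carrier_mat n n" "\<And>x. x \<in> K \<Longrightarrow> F x \<in> carrier_mat n n"
  shows "msum n K F * A = msum n K (\<lambda>x. F x * A)"
proof (rule eq_matI)
  fix i j assume "i < dim_row (msum n K (\<lambda>x. F x * A))" "j < dim_col (msum n K (\<lambda>x. F x * A))"
  hence ij: "i < n" "j < n" by auto
  have "(msum n K F * A) $$ (i, j) = (\<Sum>k<n. (\<Sum>x\<in>K. F x $$ (i, k)) * A $$ (k, j))"
    using ij assms by (subst mult_index[of _ n n _ n]) auto
  also have "\<dots> = (\<Sum>x\<in>K. \<Sum>k<n. F x $$ (i, k) * A $$ (k, j))"
    by (subst sum.swap) (simp add: sum_distrib_right)
  also have "\<dots> = msum n K (\<lambda>x. F x * A) $$ (i, j)"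
    using ij assms by (auto intro!: sum.cong simp: mult_index[of _ n n _ n])
  finally show "(msum n K F * A) $$ (i, j) = msum n K (\<lambda>x. F x * A) $$ (i, j)" .
qed (use assms in auto)

lemma mtrace_carrier: "A \<in> carrier_mat n n \<Longrightarrow> mtrace A = (\<Sum>i<n. A $$ (i, i))"
  by (auto simp: mtrace_def)

lemma mtrace_msum:
  assumes "\<And>x. x \<in> K \<Longrightarrow> F x \<in> carrier_mat n n"
  shows "mtrace (msum n K F) = (\<Sum>x\<in>K. mtrace (F x))"
  using assms by (simp add: mtrace_carrier[of _ n] sum.swap[of _ K])

lemma mtrace_mult_comm:
  assumes "A \<in> carrier_mat n m" "B \<in> carrier_mat m n"
  shows "mtrace (A * B) = mtrace (B * A)"
proof -
  have "mtrace (A * B) = (\<Sum>i<n. \<Sum>k<m. A $$ (i, k) * B $$ (k, i))"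
    using assms by (subst mtrace_carrier[of _ n]) (auto intro!: sum.cong simp del: index_mult_mat(1) simp: mult_index[of A n m B n])
  also have "\<dots> = (\<Sum>k<m. \<Sum>i<n. B $$ (k, i) * A $$ (i, k))"
    by (subst sum.swap) (simp add: mult.commute)
  also have "\<dots> = mtrace (B * A)"
    using assms by (subst mtrace_carrier[of _ m]) (auto intro!: sum.cong simp del: index_mult_mat(1) simp: mult_index[of B m n A m])
  finally show ?thesis .
qed

lemma mtrace_smult: "A \<in> carrier_mat n n \<Longrightarrow> mtrace (c \<cdot>\<^sub>m A) = c * mtrace A"
  by (auto simp: mtrace_def sum_distrib_left)

lemma mtrace_one [simp]: "mtrace (1\<^sub>m n) = of_nat n"
  by (simp add: mtrace_def)

lemma mtrace_conj:
  assumes "A \<in> carrier_mat n n" "B \<in> carrier_mat n n" "X \<in> carrier_mat n n" "A * B = 1\<^sub>m n"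
  shows "mtrace (B * X * A) = mtrace X"
proof -
  have "mtrace (B * X * A) = mtrace (A * (B * X))"
    using assms by (intro mtrace_mult_comm) auto
  also have "A * (B * X) = X"
    using assms by (subst assoc_mult_mat[symmetric]) auto
  finally show ?thesis .
qed

lemma smult_one_eq_iff: "n > 0 \<Longrightarrow> a \<cdot>\<^sub>m 1\<^sub>m n = b \<cdot>\<^sub>m (1\<^sub>m n :: complex mat) \<longleftrightarrow> a = b"
proof -
  assume n: "n > 0"
  have "a = b" if h: "a \<cdot>\<^sub>m 1\<^sub>m n = b \<cdot>\<^sub>m (1\<^sub>m n :: complex mat)"
    using arg_cong[OF h, of "\<lambda>M. M $$ (0,0)"] n by simp
  thus ?thesis by auto
qed

lemma mat_unit_vec_col:
  assumes "(A :: complex mat) \<in> carrier_mat n n" "j < n"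
  shows "A *\<^sub>v unit_vec n j = col A j"
  using assms by (intro eq_vecI) auto

text \<open>The elementary matrix \<open>E_jk\<close>. Sandwiching it between two representations
  turns averaged identities into relations between single matrix entries.\<close>

definition mat_unit :: "nat \<Rightarrow> nat \<Rightarrow> nat \<Rightarrow> complex mat" where
  "mat_unit n j k = mat n n (\<lambda>(a, b). if a = j \<and> b = k then 1 else 0)"

lemma mat_unit_carrier [simp]: "mat_unit n j k \<in> carrier_mat n n"
  by (simp add: mat_unit_def)

lemma mat_unit_sandwich:
  assumes A: "A \<in> carrier_mat n n" and B: "B \<in> carrier_mat n n" and ij: "i < n" "j < n" "k < n" "l < n"
  shows "(A * mat_unit n j k * B) $$ (i,l) = A $$ (i,j) * B $$ (k,l)"
proof -
  have "(A * mat_unit n j k) $$ (i,b) = (if b = k then A $$ (i,j) else 0)" if "b < n" for b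
  proof -
    have "(A * mat_unit n j k) $$ (i,b) = (\<Sum>a<n. A $$ (i,a) * mat_unit n j k $$ (a,b))"
      using A ij that by (intro mult_index[of _ n n]) auto
    also have "\<dots> = (\<Sum>a<n. if a = j then (if b = k then A $$ (i,a) else 0) else 0)"
      using that by (intro sum.cong) (auto simp: mat_unit_def)
    finally show ?thesis using ij by simp
  qed
  moreover have "(A * mat_unit n j k * B) $$ (i,l) = (\<Sum>b<n. (A * mat_unit n j k) $$ (i,b) * B $$ (b,l))"
    using A B ij by (intro mult_index[of _ n n]) auto
  ultimately have "(A * mat_unit n j k * B) $$ (i,l) = (\<Sum>b<n. (if b = k then A $$ (i,j) else 0) * B $$ (b,l))"
    by simp
  also have "\<dots> = (\<Sum>b<n. if b = k then A $$ (i,j) * B $$ (b,l) else 0)"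
    by (intro sum.cong) auto
  finally show ?thesis using ij by simp
qed

lemma mtrace_mat_unit: "j < n \<Longrightarrow> k < n \<Longrightarrow> mtrace (mat_unit n j k) = (if j = k then 1 else 0)"
proof -
  assume j: "j < n" "k < n"
  have "mtrace (mat_unit n j k) = (\<Sum>a<n. if a = j then (if j = k then 1 else 0) else 0)"
    unfolding mtrace_carrier[OF mat_unit_carrier] by (intro sum.cong) (auto simp: mat_unit_def)
  thus ?thesis using j by simp
qed

section \<open>Schur's lemma and orthogonality\<close>

context fsub
begin

lemma repD:
  assumes "is_rep \<Gamma> K n \<rho>"
  shows "x \<in> K \<Longrightarrow> \<rho> x \<in> carrier_mat n n" "\<rho> \<one> = 1\<^sub>m n"
    "x \<in> K \<Longrightarrow> y \<in> K \<Longrightarrow> \<rho> (x \<otimes> y) = \<rho> x * \<rho> y"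
    "x \<in> K \<Longrightarrow> \<rho> x * \<rho> (inv x) = 1\<^sub>m n" "x \<in> K \<Longrightarrow> \<rho> (inv x) * \<rho> x = 1\<^sub>m n"
proof -
  show 1: "x \<in> K \<Longrightarrow> \<rho> x \<in> carrier_mat n n" "\<rho> \<one> = 1\<^sub>m n" 
    and 2: "x \<in> K \<Longrightarrow> y \<in> K \<Longrightarrow> \<rho> (x \<otimes> y) = \<rho> x * \<rho> y" for x y
    using assms by (auto simp: is_rep_def)
  show "x \<in> K \<Longrightarrow> \<rho> x * \<rho> (inv x) = 1\<^sub>m n" "x \<in> K \<Longrightarrow> \<rho> (inv x) * \<rho> x = 1\<^sub>m n"
    using 1 by (simp_all add: 2[symmetric])
qed

lemma irredD: assumes "irred_rep \<Gamma> K n \<rho>" shows "n > 0" "is_rep \<Gamma> K n \<rho>"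
  using assms by (auto simp: irred_rep_def)

text \<open>An eigenspace of \<open>A\<close> is nonzero and invariant under the representation,
  hence it is the whole space.\<close>

lemma schur:
  assumes \<rho>: "irred_rep \<Gamma> K n \<rho>" and A: "A \<in> carrier_mat n n"
    and comm: "\<And>x. x \<in> K \<Longrightarrow> A * \<rho> x = \<rho> x * A"
  shows "\<exists>a. A = a \<cdot>\<^sub>m 1\<^sub>m n"
proof -
  note rep = repD[OF irredD(2)[OF \<rho>]]
  from spectrum_non_empty[OF A irredD(1)[OF \<rho>]] obtain a where "eigenvalue A a"
    by (auto simp: spectrum_def)
  then obtain v where v: "v \<in> carrier_vec n" "v \<noteq> 0\<^sub>v n" "A *\<^sub>v v = a \<cdot>\<^sub>v v"
    using A unfolding eigenvalue_def eigenvector_def by auto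
  let ?W = "{v \<in> carrier_vec n. A *\<^sub>v v = a \<cdot>\<^sub>v v}"
  have "inv_subspace K n \<rho> ?W"
    unfolding inv_subspace_def
  proof (intro conjI ballI allI)
    show "0\<^sub>v n \<in> ?W" using A by auto
    fix v w assume "v \<in> ?W" "w \<in> ?W" thus "v + w \<in> ?W"
      using A by (auto simp: mult_add_distrib_mat_vec[of A n n] smult_add_distrib_vec[of _ n])
  next
    fix c v assume "v \<in> ?W" thus "c \<cdot>\<^sub>v v \<in> ?W"
      using A by (auto simp: mult_mat_vec[of A n n] smult_smult_assoc mult.commute)
  next
    fix x w assume x: "x \<in> K" and w: "w \<in> ?W"
    have "A *\<^sub>v (\<rho> x *\<^sub>v w) = (A * \<rho> x) *\<^sub>v w"
      using x w A rep(1) by (simp add: assoc_mult_mat_vec[of _ n n _ n])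
    also have "\<dots> = \<rho> x *\<^sub>v (A *\<^sub>v w)" unfolding comm[OF x]
      using x w A rep(1) by (simp add: assoc_mult_mat_vec[of _ n n _ n])
    also have "\<dots> = a \<cdot>\<^sub>v (\<rho> x *\<^sub>v w)" using x w rep by (auto simp: mult_mat_vec[of _ n n])
    finally show "\<rho> x *\<^sub>v w \<in> ?W" using x w rep(1) by simp
  qed auto
  hence "?W = {0\<^sub>v n} \<or> ?W = carrier_vec n" using \<rho> unfolding irred_rep_def by blast
  with v have W: "?W = carrier_vec n" by auto
  have "A = a \<cdot>\<^sub>m 1\<^sub>m n"
  proof (rule eq_matI)
    fix i j assume "i < dim_row (a \<cdot>\<^sub>m 1\<^sub>m n)" "j < dim_col (a \<cdot>\<^sub>m (1\<^sub>m n :: complex mat))"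
    hence ij: "i < n" "j < n" by auto
    have "unit_vec n j \<in> ?W" unfolding W by simp
    hence "(A *\<^sub>v unit_vec n j) $ i = (a \<cdot>\<^sub>v unit_vec n j) $ i" by auto
    thus "A $$ (i, j) = (a \<cdot>\<^sub>m 1\<^sub>m n) $$ (i, j)"
      using ij A by (simp add: mat_unit_vec_col)
  qed (use A in auto)
  thus ?thesis by blast
qed

lemma intertwine_avg:
  assumes \<rho>: "is_rep \<Gamma> K n \<rho>" and \<rho>': "is_rep \<Gamma> K n \<rho>'" and Y: "Y \<in> carrier_mat n n"
    and y: "y \<in> K"
  shows "msum n K (\<lambda>x. \<rho> x * Y * \<rho>' (inv x)) * \<rho>' y = \<rho> y * msum n K (\<lambda>x. \<rho> x * Y * \<rho>' (inv x))"
proof -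
  note rep = repD[OF \<rho>] and rep' = repD[OF \<rho>']
  let ?A = "msum n K (\<lambda>x. \<rho> x * Y * \<rho>' (inv x))"
  have c: "\<rho> x * Y * \<rho>' (inv x) \<in> carrier_mat n n" if "x \<in> K" for x using that rep(1) rep'(1) Y by simp
  show ?thesis
  proof (rule eq_matI)
    fix i j assume "i < dim_row (\<rho> y * ?A)" "j < dim_col (\<rho> y * ?A)"
    hence ij: "i < n" "j < n" using y rep by auto
    have "(\<rho> y * ?A) $$ (i,j) = (\<Sum>x\<in>K. (\<rho> y * (\<rho> x * Y * \<rho>' (inv x))) $$ (i,j))"
      using y rep c ij by (simp add: msum_mult_left)
    also have "\<dots> = (\<Sum>x\<in>K. (\<rho> (y \<otimes> x) * Y * \<rho>' (inv (y \<otimes> x) \<otimes> y)) $$ (i,j))"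
    proof (intro sum.cong refl)
      fix x assume x: "x \<in> K"
      have "inv (y \<otimes> x) \<otimes> y = inv x" using x y by (simp add: inv_mult_group m_assoc)
      moreover have "\<rho> (y \<otimes> x) * Y * \<rho>' (inv x) = \<rho> y * (\<rho> x * Y * \<rho>' (inv x))"
        using x y rep(1)[of x] rep(1)[of y] rep'(1)[of "inv x"] Y
        by (simp add: rep(3) assoc_mult_mat[of _ n n _ n _ n])
      ultimately show "(\<rho> y * (\<rho> x * Y * \<rho>' (inv x))) $$ (i,j) = (\<rho> (y \<otimes> x) * Y * \<rho>' (inv (y \<otimes> x) \<otimes> y)) $$ (i,j)"
        by simp
    qed
    also have "\<dots> = (\<Sum>x\<in>K. (\<rho> x * Y * \<rho>' (inv x \<otimes> y)) $$ (i,j))"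
      by (rule sum_left[OF y])
    also have "\<dots> = (\<Sum>x\<in>K. (\<rho> x * Y * \<rho>' (inv x) * \<rho>' y) $$ (i,j))"
      using y rep(1) rep'(1,3) Y by (intro sum.cong refl) (simp add: assoc_mult_mat[of _ n n _ n _ n])
    also have "\<dots> = (?A * \<rho>' y) $$ (i,j)"
      using y rep' c ij by (simp add: msum_mult_right)
    finally show "(?A * \<rho>' y) $$ (i,j) = (\<rho> y * ?A) $$ (i,j)" by simp
  qed (use y rep(1)[OF y] rep'(1)[OF y] in auto)
qed

text \<open>The average is scalar by Schur's lemma; taking traces, which conjugation does not
  change, determines the scalar.\<close>

lemma schur_avg:
  assumes \<rho>: "irred_rep \<Gamma> K n \<rho>" and Y: "Y \<in> carrier_mat n n"
  shows "msum n K (\<lambda>x. \<rho> x * Y * \<rho> (inv x)) = (of_nat (card K) * mtrace Y / of_nat n) \<cdot>\<^sub>m 1\<^sub>m n"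
proof -
  note rep = repD[OF irredD(2)[OF \<rho>]]
  let ?A = "msum n K (\<lambda>x. \<rho> x * Y * \<rho> (inv x))"
  have c: "\<rho> x * Y * \<rho> (inv x) \<in> carrier_mat n n" if "x \<in> K" for x using that rep(1) Y by simp
  from schur[OF \<rho> _ intertwine_avg[OF irredD(2)[OF \<rho>] irredD(2)[OF \<rho>] Y]]
  obtain a where a: "?A = a \<cdot>\<^sub>m 1\<^sub>m n" by auto
  have "mtrace ?A = (\<Sum>x\<in>K. mtrace (\<rho> x * Y * \<rho> (inv x)))"
    using c by (rule mtrace_msum)
  also have "\<dots> = (\<Sum>x\<in>K. mtrace Y)"
    using rep Y by (intro sum.cong refl mtrace_conj[of _ n]) auto
  finally have "a * of_nat n = of_nat (card K) * mtrace Y"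
    by (simp add: a mtrace_smult[of _ n])
  hence "a = of_nat (card K) * mtrace Y / of_nat n" using irredD(1)[OF \<rho>] by (simp add: field_simps)
  thus ?thesis unfolding a by simp
qed

lemma char_of_one: "is_rep \<Gamma> K n \<rho> \<Longrightarrow> char_of K \<rho> \<one> = of_nat n"
  using repD(2)[of n \<rho>] by (simp add: char_of_def)

lemma schur_orth:
  assumes \<rho>: "irred_rep \<Gamma> K n \<rho>" and ij: "i < n" "j < n" "k < n" "l < n"
  shows "(\<Sum>x\<in>K. \<rho> x $$ (i,j) * \<rho> (inv x) $$ (k,l)) = (if i = l \<and> j = k then of_nat (card K) / of_nat n else 0)"
proof -
  note rep = repD[OF irredD(2)[OF \<rho>]]
  have "(\<Sum>x\<in>K. \<rho> x $$ (i,j) * \<rho> (inv x) $$ (k,l))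
      = msum n K (\<lambda>x. \<rho> x * mat_unit n j k * \<rho> (inv x)) $$ (i,l)"
    using ij rep(1) by (simp add: mat_unit_sandwich)
  also have "\<dots> = (if i = l \<and> j = k then of_nat (card K) / of_nat n else 0)"
    unfolding schur_avg[OF \<rho> mat_unit_carrier] mtrace_mat_unit[OF ij(2,3)] using ij by auto
  finally show ?thesis .
qed

text \<open>Of the products of diagonal entries \<open>(i,i)\<close> and \<open>(k,k)\<close> only
  those with \<open>i = k\<close> contribute, each \<open>card K / n\<close>.\<close>

lemma char_norm:
  assumes \<rho>: "irred_rep \<Gamma> K n \<rho>" and \<chi>: "\<chi> = char_of K \<rho>"
  shows "(\<Sum>x\<in>K. \<chi> x * \<chi> (inv x)) = of_nat (card K)"
proof -
  note rep = repD[OF irredD(2)[OF \<rho>]]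
  have "(\<Sum>x\<in>K. \<chi> x * \<chi> (inv x)) = (\<Sum>x\<in>K. \<Sum>i<n. \<Sum>k<n. \<rho> x $$ (i,i) * \<rho> (inv x) $$ (k,k))"
    using rep by (intro sum.cong refl) (auto simp: \<chi> char_of_def mtrace_carrier[of _ n] sum_product)
  also have "\<dots> = (\<Sum>i<n. \<Sum>k<n. \<Sum>x\<in>K. \<rho> x $$ (i,i) * \<rho> (inv x) $$ (k,k))"
    by (subst sum.swap, intro sum.cong refl, rule sum.swap)
  also have "\<dots> = (\<Sum>i<n. \<Sum>k<n. if k = i then of_nat (card K) / of_nat n else 0)"
    by (intro sum.cong refl) (auto simp: schur_orth[OF \<rho>])
  also have "\<dots> = of_nat (card K)" using irredD(1)[OF \<rho>] by simp
  finally show ?thesis .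
qed

text \<open>By \<open>schur_avg\<close> the sum of
  \<open>\<rho> (g \<otimes> y \<otimes> inv g)\<close> over \<open>g\<close> is a scalar matrix;
  this is the action of a class sum. Multiplying by \<open>\<rho> x\<close> and taking traces gives
  the identity.\<close>

lemma char_FE:
  assumes \<rho>: "irred_rep \<Gamma> K n \<rho>" and \<chi>: "\<chi> = char_of K \<rho>" and x: "x \<in> K" and y: "y \<in> K"
  shows "\<chi> x * \<chi> y = \<chi> \<one> / of_nat (card K) * (\<Sum>g\<in>K. \<chi> (x \<otimes> g \<otimes> y \<otimes> inv g))"
proof -
  note rep = repD[OF irredD(2)[OF \<rho>]]
  have n: "n > 0" using irredD(1)[OF \<rho>] .
  have "(\<Sum>g\<in>K. \<chi> (x \<otimes> g \<otimes> y \<otimes> inv g)) = (\<Sum>g\<in>K. mtrace (\<rho> x * (\<rho> g * \<rho> y * \<rho> (inv g))))"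
  proof (intro sum.cong refl)
    fix g assume g: "g \<in> K"
    have "\<rho> (x \<otimes> g \<otimes> y \<otimes> inv g) = \<rho> x * (\<rho> g * \<rho> y * \<rho> (inv g))"
      using g x y rep(1)[of x] rep(1)[of y] rep(1)[of g] rep(1)[of "inv g"]
      by (simp add: rep(3) assoc_mult_mat[of _ n n _ n _ n])
    thus "\<chi> (x \<otimes> g \<otimes> y \<otimes> inv g) = mtrace (\<rho> x * (\<rho> g * \<rho> y * \<rho> (inv g)))"
      using g x y by (simp add: \<chi> char_of_def)
  qed
  also have "\<dots> = mtrace (msum n K (\<lambda>g. \<rho> x * (\<rho> g * \<rho> y * \<rho> (inv g))))"
    using x y rep(1) by (intro mtrace_msum[symmetric]) simp
  also have "msum n K (\<lambda>g. \<rho> x * (\<rho> g * \<rho> y * \<rho> (inv g))) = \<rho> x * msum n K (\<lambda>g. \<rho> g * \<rho> y * \<rho> (inv g))"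
    using x y rep(1) by (intro msum_mult_left[symmetric]) simp_all
  also have "\<dots> = (of_nat (card K) * mtrace (\<rho> y) / of_nat n) \<cdot>\<^sub>m \<rho> x"
    using x y rep by (simp add: schur_avg[OF \<rho>] mult_smult_distrib[of _ n n _ n] right_mult_one_mat[of _ n n])
  finally have "(\<Sum>g\<in>K. \<chi> (x \<otimes> g \<otimes> y \<otimes> inv g)) = of_nat (card K) * mtrace (\<rho> y) / of_nat n * mtrace (\<rho> x)"
    using x rep by (simp add: mtrace_smult[of _ n])
  moreover have "\<chi> \<one> = of_nat n" unfolding \<chi> by (rule char_of_one[OF irredD(2)[OF \<rho>]])
  moreover have "\<chi> x = mtrace (\<rho> x)" "\<chi> y = mtrace (\<rho> y)" using x y by (auto simp: \<chi> char_of_def)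
  ultimately show ?thesis using n by simp
qed

end

section \<open>Decomposition into irreducible constituents\<close>

lemma injective_imp_invertible:
  assumes X: "(X :: complex mat) \<in> carrier_mat n n"
    and inj: "\<And>v. v \<in> carrier_vec n \<Longrightarrow> X *\<^sub>v v = 0\<^sub>v n \<Longrightarrow> v = 0\<^sub>v n"
  shows "\<exists>Y \<in> carrier_mat n n. X * Y = 1\<^sub>m n \<and> Y * X = 1\<^sub>m n"
proof -
  have "det X \<noteq> 0" using inj unfolding det_0_iff_vec_prod_zero[OF X] by blast
  from det_non_zero_imp_unit[OF X this] show ?thesis
    unfolding Units_def ring_mat_def by auto
qed

lemma inverse_mult:
  assumes "A \<in> carrier_mat n n" "B \<in> carrier_mat n n" "C \<in> carrier_mat n n" "D \<in> carrier_mat n n"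
    and "B * C = 1\<^sub>m n" "A * D = (1\<^sub>m n :: complex mat)"
  shows "(A * B) * (C * D) = 1\<^sub>m n"
proof -
  have "(A * B) * (C * D) = A * ((B * C) * D)"
    using assms(1-4) by (simp add: assoc_mult_mat[of _ n n _ n _ n])
  thus ?thesis using assms by (simp add: left_mult_one_mat[of _ n n])
qed

lemma mult_zero_vec [simp]: "(S :: complex mat) \<in> carrier_mat n n \<Longrightarrow> S *\<^sub>v 0\<^sub>v n = 0\<^sub>v n"
  by (intro eq_vecI) auto

text \<open>Exchange argument: among invertible matrices choose one with as many leading columns in
  \<open>W\<close> as possible. If some \<open>w\<close> in \<open>W\<close> had a nonzero
  coordinate at a position \<open>j \<ge> m\<close>, one more leading column could be made to lie in
  \<open>W\<close>.\<close>

lemma adapted_basis: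
  fixes W :: "complex vec set"
  assumes W: "W \<subseteq> carrier_vec n"
  shows "\<exists>S S' m. S \<in> carrier_mat n n \<and> S' \<in> carrier_mat n n \<and> S * S' = 1\<^sub>m n \<and> S' * S = 1\<^sub>m n \<and> m \<le> n \<and>
     (\<forall>j<m. col S j \<in> W) \<and> (\<forall>w\<in>W. \<forall>i. m \<le> i \<and> i < n \<longrightarrow> (S' *\<^sub>v w) $ i = 0)"
proof -
  let ?P = "\<lambda>m. m \<le> n \<and> (\<exists>S S'. S \<in> carrier_mat n n \<and> S' \<in> carrier_mat n n \<and> S * S' = 1\<^sub>m n \<and> S' * S = 1\<^sub>m n \<and>
     (\<forall>j<m. col S j \<in> W))"
  have "?P 0" by (auto intro!: exI[of _ "1\<^sub>m n"])
  define m where "m = (GREATEST m. ?P m)"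
  have "?P m" unfolding m_def by (rule GreatestI_nat[of ?P 0 n]) (use \<open>?P 0\<close> in auto)
  then obtain S S' where S: "S \<in> carrier_mat n n" "S' \<in> carrier_mat n n" "S * S' = 1\<^sub>m n" "S' * S = 1\<^sub>m n"
    and m: "m \<le> n" and col: "\<forall>j<m. col S j \<in> W" by blast
  have "(S' *\<^sub>v w) $ j = 0" if w: "w \<in> W" and j: "m \<le> j" "j < n" for w j
  proof (rule ccontr)
    define c where "c = S' *\<^sub>v w"
    assume "(S' *\<^sub>v w) $ j \<noteq> 0"
    hence cj: "c $ j \<noteq> 0" by (simp add: c_def)
    have wc: "w \<in> carrier_vec n" using w W by auto
    have c: "c \<in> carrier_vec n" using S wc by (simp add: c_def)
    have Sc: "S *\<^sub>v c = w" using S wc unfolding c_def by (simp add: assoc_mult_mat_vec[of _ n n _ n, symmetric])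
    \<comment> \<open>\<open>S * X\<close> has \<open>w\<close> as column \<open>m\<close>, and for
      \<open>j \<noteq> m\<close> the former column \<open>m\<close> is moved to position
      \<open>j\<close>. \<open>X\<close> is invertible since \<open>c $ j\<close> is
      nonzero.\<close>
    define X where "X = mat n n (\<lambda>(i,k). if k = m then c $ i else if k = j then (if i = m then 1 else 0)
      else if i = k then 1 else 0)"
    have X: "X \<in> carrier_mat n n" by (simp add: X_def)
    have "v = 0\<^sub>v n" if v: "v \<in> carrier_vec n" and Xv: "X *\<^sub>v v = 0\<^sub>v n" for v
    proof -
      have eq: "c $ i * v $ m + (if i = m \<and> j \<noteq> m then v $ j else 0) + (if i \<noteq> m \<and> i \<noteq> j then v $ i else 0) = 0"
        if i: "i < n" for i
      proof -
        have "(X *\<^sub>v v) $ i = (\<Sum>k<n. X $$ (i,k) * v $ k)"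
          using i v X by (auto simp: scalar_prod_def lessThan_atLeast0 intro!: sum.cong)
        also have "\<dots> = (\<Sum>k<n. (if k = m then c $ i * v $ m else 0) + (if k = j then (if i = m \<and> j \<noteq> m then v $ j else 0) else 0)
           + (if k = i then (if i \<noteq> m \<and> i \<noteq> j then v $ i else 0) else 0))"
          using i by (intro sum.cong) (auto simp: X_def)
        also have "\<dots> = c $ i * v $ m + (if i = m \<and> j \<noteq> m then v $ j else 0) + (if i \<noteq> m \<and> i \<noteq> j then v $ i else 0)"
          using i j by (simp add: sum.distrib)
        finally show ?thesis using Xv i by simp
      qed
      have "v $ m = 0" using eq[OF j(2)] cj by (cases "j = m") auto
      moreover have "v $ j = 0"
        using eq[of m] j \<open>v $ m = 0\<close> by (cases "j = m") auto
      ultimately have "v $ i = 0" if "i < n" for i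
        using eq[OF that] by (cases "i = m"; cases "i = j") auto
      thus ?thesis using v by (intro eq_vecI) auto
    qed
    from injective_imp_invertible[OF X this] obtain Y
      where Y: "Y \<in> carrier_mat n n" "X * Y = 1\<^sub>m n" "Y * X = 1\<^sub>m n" by blast
    have 1: "(S * X) * (Y * S') = 1\<^sub>m n" by (rule inverse_mult) (use S X Y in auto)
    have 2: "(Y * S') * (S * X) = 1\<^sub>m n" by (rule inverse_mult) (use S X Y in auto)
    have 3: "col (S * X) k \<in> W" if k: "k < Suc m" for k
    proof -
      have kn: "k < n" using k j by simp
      have e: "col (S * X) k = S *\<^sub>v col X k" using kn S X by (intro col_mult2) auto
      show ?thesis
      proof (cases "k = m")
        case True
        have "col X k = c" using kn c True by (intro eq_vecI) (auto simp: X_def)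
        thus ?thesis using e Sc w by simp
      next
        case False
        have "col X k = unit_vec n k" using kn k j False by (intro eq_vecI) (auto simp: X_def unit_vec_def)
        thus ?thesis using e col k False mat_unit_vec_col[OF S(1) kn] by auto
      qed
    qed
    have "?P (Suc m)" using 1 2 3 S X Y j by (intro conjI exI[of _ "S * X"] exI[of _ "Y * S'"]) auto
    hence "Suc m \<le> m" unfolding m_def by (rule Greatest_le_nat[of ?P _ n]) auto
    thus False by simp
  qed
  thus ?thesis using S m col by blast
qed

lemma subspace_from_columns:
  assumes S: "S \<in> carrier_mat n n"
    and W: "0\<^sub>v n \<in> W" "\<And>v w. v \<in> W \<Longrightarrow> w \<in> W \<Longrightarrow> v + w \<in> W"
      "\<And>c v. v \<in> W \<Longrightarrow> c \<cdot>\<^sub>v v \<in> W"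
    and col: "\<And>j. j < n \<Longrightarrow> col S j \<in> W" and "c \<in> carrier_vec n"
  shows "S *\<^sub>v c \<in> (W :: complex vec set)"
proof -
  \<comment> \<open>The bound \<open>k\<close> on the support of \<open>c\<close> is the induction
    variable; the last coordinate is split off as a multiple of a unit vector.\<close>
  have "S *\<^sub>v c \<in> W"
    if "k \<le> n" "c \<in> carrier_vec n" "\<And>i. k \<le> i \<Longrightarrow> i < n \<Longrightarrow> c $ i = 0" for k c
    using that
  proof (induction k arbitrary: c)
    case 0
    have "c = 0\<^sub>v n" using 0 by (intro eq_vecI) auto
    thus ?case using W S by simp
  next
    case (Suc k)
    define c' where "c' = vec n (\<lambda>i. if i = k then 0 else c $ i)"
    have c': "c' \<in> carrier_vec n" by (simp add: c'_def)
    have "c = c' + c $ k \<cdot>\<^sub>v unit_vec n k" using Suc.prems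
      by (intro eq_vecI) (auto simp: c'_def unit_vec_def)
    hence "S *\<^sub>v c = S *\<^sub>v c' + c $ k \<cdot>\<^sub>v (S *\<^sub>v unit_vec n k)"
      using S c' by (metis mult_add_distrib_mat_vec mult_mat_vec smult_carrier_vec unit_vec_carrier)
    moreover have "S *\<^sub>v c' \<in> W" using Suc.prems c' by (intro Suc.IH) (auto simp: c'_def)
    moreover have "S *\<^sub>v unit_vec n k \<in> W" using Suc.prems col S by (simp add: mat_unit_vec_col)
    ultimately show ?case using W by simp
  qed
  from this[of n c] assms(6) show ?thesis by simp
qed

lemma sum_split_at: "(\<Sum>k<m + d. f k) = (\<Sum>k<m. f k) + (\<Sum>k<d. (f (m + k) :: complex))" for d :: nat
  by (induct d) (simp_all add: add.assoc)

section \<open>Reducible representations and the regular representation\<close>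

context fsub
begin

text \<open>In a basis adapted to \<open>W\<close> all matrices are block triangular with zero lower
  left block, so both diagonal blocks multiply like representations and together carry the whole
  trace.\<close>

lemma reducible_split:
  assumes \<rho>: "is_rep \<Gamma> K n \<rho>"
    and W: "inv_subspace K n \<rho> W" "W \<noteq> {0\<^sub>v n}" "W \<noteq> carrier_vec n"
  shows "\<exists>m k \<rho>1 \<rho>2. m < n \<and> k < n \<and> is_rep \<Gamma> K m \<rho>1 \<and> is_rep \<Gamma> K k \<rho>2 \<and>
    (\<forall>x\<in>K. mtrace (\<rho> x) = mtrace (\<rho>1 x) + mtrace (\<rho>2 x))"
proof -
  note rep = repD[OF \<rho>]
  have W': "W \<subseteq> carrier_vec n" "0\<^sub>v n \<in> W" "\<And>v w. v \<in> W \<Longrightarrow> w \<in> W \<Longrightarrow> v + w \<in> W"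
      "\<And>c v. v \<in> W \<Longrightarrow> c \<cdot>\<^sub>v v \<in> W" "\<And>x w. x \<in> K \<Longrightarrow> w \<in> W \<Longrightarrow> \<rho> x *\<^sub>v w \<in> W"
    using W(1) by (auto simp: inv_subspace_def)
  from adapted_basis[OF W'(1)] obtain S S' m
    where S: "S \<in> carrier_mat n n" "S' \<in> carrier_mat n n" "S * S' = 1\<^sub>m n" "S' * S = 1\<^sub>m n"
    and m: "m \<le> n" and col: "\<And>j. j < m \<Longrightarrow> col S j \<in> W"
    and z: "\<And>w i. w \<in> W \<Longrightarrow> m \<le> i \<Longrightarrow> i < n \<Longrightarrow> (S' *\<^sub>v w) $ i = 0"
      by metis
  have inv: "S *\<^sub>v (S' *\<^sub>v v) = v" if "v \<in> carrier_vec n" for v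
    using S that by (simp add: assoc_mult_mat_vec[of _ n n _ n, symmetric])
  have m0: "m \<noteq> 0"
  proof
    assume "m = 0"
    have "w = 0\<^sub>v n" if w: "w \<in> W" for w
    proof -
      have wc: "w \<in> carrier_vec n" using w W' by auto
      have "S' *\<^sub>v w = 0\<^sub>v n" using z[OF w] S \<open>m = 0\<close> by (intro eq_vecI) auto
      with inv[OF wc] S show ?thesis by simp
    qed
    with W'(2) W(2) show False by blast
  qed
  have mn: "m \<noteq> n"
  proof
    assume "m = n"
    hence "v \<in> W" if "v \<in> carrier_vec n" for v
      using subspace_from_columns[OF S(1) W'(2,3,4) col, of "S' *\<^sub>v v"] inv[OF that] that S(2) by simp
    with W'(1) W(3) show False by blast
  qed
  define d where "d = n - m"
  have n: "n = m + d" using m by (simp add: d_def)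
  define B where "B x = S' * \<rho> x * S" for x
  have B: "B x \<in> carrier_mat n n" if "x \<in> K" for x using S rep(1)[OF that] by (simp add: B_def)
  have Bm: "B (x \<otimes> y) = B x * B y" if "x \<in> K" "y \<in> K" for x y
  proof -
    have "B x * B y = S' * \<rho> x * (S * S') * \<rho> y * S"
      using S(1,2) rep(1)[OF that(1)] rep(1)[OF that(2)] by (simp add: B_def assoc_mult_mat[of _ n n _ n _ n])
    also have "\<dots> = B (x \<otimes> y)"
      using S(1,2) rep(1)[OF that(1)] rep(1)[OF that(2)] that
      by (simp add: S(3) B_def rep(3) assoc_mult_mat[of _ n n _ n _ n] left_mult_one_mat[of _ n n])
    finally show ?thesis by simp
  qed
  have B1: "B \<one> = 1\<^sub>m n" using S rep by (simp add: B_def right_mult_one_mat[of _ n n])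
  have Bz: "B x $$ (i,j) = 0" if x: "x \<in> K" and ij: "m \<le> i" "i < n" "j < m" for x i j
  proof -
    have jn: "j < n" using ij by simp
    have "col (B x) j = B x *\<^sub>v unit_vec n j" using mat_unit_vec_col[OF B[OF x] jn] by simp
    also have "\<dots> = S' *\<^sub>v (\<rho> x *\<^sub>v (S *\<^sub>v unit_vec n j))"
      using S rep(1)[OF x] by (simp add: B_def assoc_mult_mat_vec[of _ n n _ n])
    also have "S *\<^sub>v unit_vec n j = col S j" by (rule mat_unit_vec_col[OF S(1) jn])
    finally have "col (B x) j $ i = 0" using z[OF W'(5)[OF x col[OF ij(3)]]] ij by simp
    thus ?thesis using B[OF x] ij by auto
  qed
  have Bm': "(\<Sum>k<m+d. B x $$ (i,k) * B y $$ (k,j)) = B (x \<otimes> y) $$ (i,j)" if "x \<in> K" "y \<in> K" "i < n" "j < n"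
    for x y i j
    unfolding Bm[OF that(1,2)] using mult_index[OF B[OF that(1)] B[OF that(2)] that(3,4)] n by simp
  define \<rho>1 where "\<rho>1 x = mat m m (\<lambda>(i,j). B x $$ (i,j))" for x
  define \<rho>2 where "\<rho>2 x = mat d d (\<lambda>(i,j). B x $$ (m+i,m+j))" for x
  have c12: "\<rho>1 x \<in> carrier_mat m m" "\<rho>2 x \<in> carrier_mat d d" for x by (auto simp: \<rho>1_def \<rho>2_def)
  have "is_rep \<Gamma> K m \<rho>1" unfolding is_rep_def
  proof (intro conjI ballI)
    show "\<rho>1 \<one> = 1\<^sub>m m" using n by (intro eq_matI) (auto simp: \<rho>1_def B1)
    fix x y assume xy: "x \<in> K" "y \<in> K"
    show "\<rho>1 (x \<otimes> y) = \<rho>1 x * \<rho>1 y"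
    proof (rule eq_matI)
      fix i j assume "i < dim_row (\<rho>1 x * \<rho>1 y)" "j < dim_col (\<rho>1 x * \<rho>1 y)"
      hence ij: "i < m" "j < m" by (auto simp: \<rho>1_def)
      have "(\<rho>1 x * \<rho>1 y) $$ (i,j) = (\<Sum>k<m. B x $$ (i,k) * B y $$ (k,j))"
        using ij by (subst mult_index[OF c12(1) c12(1)]) (auto simp: \<rho>1_def)
      also have "\<dots> = (\<Sum>k<m+d. B x $$ (i,k) * B y $$ (k,j))"
        using ij xy n Bz unfolding sum_split_at by simp
      finally show "\<rho>1 (x \<otimes> y) $$ (i,j) = (\<rho>1 x * \<rho>1 y) $$ (i,j)"
        using Bm'[OF xy, of i j] ij n by (simp add: \<rho>1_def)
    qed (auto simp: \<rho>1_def)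
  qed (auto simp: \<rho>1_def)
  moreover have "is_rep \<Gamma> K d \<rho>2" unfolding is_rep_def
  proof (intro conjI ballI)
    show "\<rho>2 \<one> = 1\<^sub>m d" using n by (intro eq_matI) (auto simp: \<rho>2_def B1)
    fix x y assume xy: "x \<in> K" "y \<in> K"
    show "\<rho>2 (x \<otimes> y) = \<rho>2 x * \<rho>2 y"
    proof (rule eq_matI)
      fix i j assume "i < dim_row (\<rho>2 x * \<rho>2 y)" "j < dim_col (\<rho>2 x * \<rho>2 y)"
      hence ij: "i < d" "j < d" by (auto simp: \<rho>2_def)
      have "(\<rho>2 x * \<rho>2 y) $$ (i,j) = (\<Sum>k<d. B x $$ (m+i,m+k) * B y $$ (m+k,m+j))"
        using ij by (subst mult_index[OF c12(2) c12(2)]) (auto simp: \<rho>2_def)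
      also have "\<dots> = (\<Sum>k<m+d. B x $$ (m+i,k) * B y $$ (k,m+j))"
        using ij xy n Bz unfolding sum_split_at by simp
      finally show "\<rho>2 (x \<otimes> y) $$ (i,j) = (\<rho>2 x * \<rho>2 y) $$ (i,j)"
        using Bm'[OF xy, of "m+i" "m+j"] ij n by (simp add: \<rho>2_def)
    qed (auto simp: \<rho>2_def)
  qed (auto simp: \<rho>2_def)
  moreover have "mtrace (\<rho> x) = mtrace (\<rho>1 x) + mtrace (\<rho>2 x)" if x: "x \<in> K" for x
  proof -
    have "mtrace (\<rho> x) = mtrace (B x)"
      unfolding B_def using S rep(1)[OF x] by (intro mtrace_conj[symmetric, of _ n]) auto
    also have "\<dots> = (\<Sum>k<m+d. B x $$ (k,k))" using mtrace_carrier[OF B[OF x]] n by simp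
    also have "\<dots> = mtrace (\<rho>1 x) + mtrace (\<rho>2 x)"
      unfolding mtrace_carrier[OF c12(1)] mtrace_carrier[OF c12(2)] sum_split_at
      by (simp add: \<rho>1_def \<rho>2_def)
    finally show ?thesis .
  qed
  moreover have "m < n" "d < n" using m0 mn n by auto
  ultimately show ?thesis by blast
qed

text \<open>Strong induction on the degree. A list keeps the multiplicities.\<close>

lemma char_decomp:
  assumes "is_rep \<Gamma> K n \<rho>"
  shows "\<exists>xs. set xs \<subseteq> Irr \<Gamma> K \<and> (\<forall>x\<in>K. mtrace (\<rho> x) = (\<Sum>\<chi>\<leftarrow>xs. \<chi> x))"
  using assms
proof (induction n arbitrary: \<rho> rule: less_induct)
  case (less n \<rho>)
  note rep = repD[OF less.prems]
  show ?case
  proof (cases "n = 0")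
    case True
    show ?thesis using rep(1) True by (intro exI[of _ "[]"]) (auto simp: mtrace_carrier[of _ 0])
  next
    case n: False
    show ?thesis
    proof (cases "\<exists>W. inv_subspace K n \<rho> W \<and> W \<noteq> {0\<^sub>v n} \<and> W \<noteq> carrier_vec n")
      case True
      then obtain m k \<rho>1 \<rho>2 where h: "m < n" "k < n" "is_rep \<Gamma> K m \<rho>1" "is_rep \<Gamma> K k \<rho>2"
        "\<forall>x\<in>K. mtrace (\<rho> x) = mtrace (\<rho>1 x) + mtrace (\<rho>2 x)"
        using reducible_split[OF less.prems] by blast
      from less.IH[OF h(1,3)] less.IH[OF h(2,4)] obtain xs ys where
        "set xs \<subseteq> Irr \<Gamma> K" "\<forall>x\<in>K. mtrace (\<rho>1 x) = (\<Sum>\<chi>\<leftarrow>xs. \<chi> x)"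
        "set ys \<subseteq> Irr \<Gamma> K" "\<forall>x\<in>K. mtrace (\<rho>2 x) = (\<Sum>\<chi>\<leftarrow>ys. \<chi> x)"
          by blast
      thus ?thesis using h(5) by (intro exI[of _ "xs @ ys"]) auto
    next
      case False
      hence "char_of K \<rho> \<in> Irr \<Gamma> K" using less.prems n unfolding Irr_def irred_rep_def by blast
      thus ?thesis by (intro exI[of _ "[char_of K \<rho>]"]) (auto simp: char_of_def)
    qed
  qed
qed

text \<open>Permutation matrices of left multiplication with respect to an enumeration
  \<open>h\<close> of \<open>K\<close>; an element other than the identity fixes no point.\<close>

lemma regular_rep:
  "\<exists>\<rho>. is_rep \<Gamma> K (card K) \<rho> \<and> (\<forall>x\<in>K. mtrace (\<rho> x) = (if x = \<one> then of_nat (card K) else 0))"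
proof -
  let ?n = "card K"
  obtain h where h: "bij_betw h {0..<?n} K" using ex_bij_betw_nat_finite[OF fin] by blast
  hence hK: "h i \<in> K" if "i < ?n" for i using that by (auto simp: bij_betw_def)
  have hinj: "h i = h j \<longleftrightarrow> i = j" if "i < ?n" "j < ?n" for i j
    using h that by (auto simp: bij_betw_def inj_on_def)
  define \<rho> :: "'g \<Rightarrow> complex mat"
    where "\<rho> g = mat ?n ?n (\<lambda>(i,j). if h i = g \<otimes> h j then 1 else 0)" for g
  have c: "\<rho> g \<in> carrier_mat ?n ?n" for g by (simp add: \<rho>_def)
  have "is_rep \<Gamma> K ?n \<rho>" unfolding is_rep_def
  proof (intro conjI ballI)
    show "\<rho> \<one> = 1\<^sub>m ?n" using hK hinj by (intro eq_matI) (auto simp: \<rho>_def)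
    fix x y assume xy: "x \<in> K" "y \<in> K"
    show "\<rho> (x \<otimes> y) = \<rho> x * \<rho> y"
    proof (rule eq_matI)
      fix i j assume "i < dim_row (\<rho> x * \<rho> y)" "j < dim_col (\<rho> x * \<rho> y)"
      hence ij: "i < ?n" "j < ?n" by (auto simp: \<rho>_def)
      have "y \<otimes> h j \<in> h ` {0..<?n}" using h hK[OF ij(2)] xy by (simp add: bij_betw_def)
      then obtain k0 where k0: "k0 < ?n" "h k0 = y \<otimes> h j" by auto
      have "(\<rho> x * \<rho> y) $$ (i,j) = (\<Sum>k<?n. \<rho> x $$ (i,k) * \<rho> y $$ (k,j))"
        using ij by (intro mult_index[OF c c])
      also have "\<dots> = (\<Sum>k<?n. if k = k0 then \<rho> x $$ (i,k) else 0)"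
        using ij hinj[OF _ k0(1)] k0(2) by (intro sum.cong) (auto simp: \<rho>_def)
      also have "\<dots> = \<rho> (x \<otimes> y) $$ (i,j)"
        using k0 ij xy hK by (simp add: \<rho>_def m_assoc)
      finally show "\<rho> (x \<otimes> y) $$ (i,j) = (\<rho> x * \<rho> y) $$ (i,j)" by simp
    qed (auto simp: \<rho>_def)
  qed (use c in auto)
  moreover have "mtrace (\<rho> x) = (if x = \<one> then of_nat ?n else 0)" if x: "x \<in> K" for x
  proof -
    have "h i = x \<otimes> h i \<longleftrightarrow> x = \<one>" if "i < ?n" for i
      using hK[OF that] x by (metis carr l_one one_closed right_cancel)
    thus ?thesis unfolding mtrace_carrier[OF c] by (simp add: \<rho>_def)
  qed
  ultimately show ?thesis by blast
qed

text \<open>The regular character is \<open>card K\<close> times the indicator of the identity and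
  also a sum of irreducible characters; if \<open>f\<close> paired to zero with all of them,
  \<open>f \<one>\<close> would vanish.\<close>

lemma exists_irr_pairing:
  assumes "f \<one> \<noteq> 0"
  shows "\<exists>\<chi> \<in> Irr \<Gamma> K. (\<Sum>x\<in>K. f x * \<chi> x) \<noteq> 0"
proof (rule ccontr)
  assume neg: "\<not> ?thesis"
  obtain \<rho> where \<rho>: "is_rep \<Gamma> K (card K) \<rho>" "\<forall>x\<in>K. mtrace (\<rho> x) = (if x = \<one> then of_nat (card K) else 0)"
    using regular_rep by blast
  from char_decomp[OF \<rho>(1)] obtain xs
    where xs: "set xs \<subseteq> Irr \<Gamma> K" "\<forall>x\<in>K. mtrace (\<rho> x) = (\<Sum>\<chi>\<leftarrow>xs. \<chi> x)"
      by blast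
  have "(\<Sum>x\<in>K. f x * (\<Sum>\<chi>\<leftarrow>ys. \<chi> x)) = 0" if "set ys \<subseteq> Irr \<Gamma> K" for ys
    using that neg by (induction ys) (auto simp: distrib_left sum.distrib)
  from this[OF xs(1)] have "(\<Sum>x\<in>K. f x * mtrace (\<rho> x)) = 0" using xs(2) by simp
  moreover have "(\<Sum>x\<in>K. f x * mtrace (\<rho> x)) = (\<Sum>x\<in>K. if x = \<one> then f \<one> * of_nat (card K) else 0)"
    using \<rho>(2) by (intro sum.cong) auto
  ultimately show False using assms fin by simp
qed

end

section \<open>Irreducible characters as solutions of a functional equation\<close>

text \<open>The equation is homogeneous of degree two, so it is blind to scalar factors; the norm
  condition fixes such a factor up to sign, and positivity of the degree fixes the sign. Vanishing
  off \<open>K\<close> makes \<open>f\<close> unique as a function on the ambient group.\<close>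

definition irr_fun :: "('g, 'b) monoid_scheme \<Rightarrow> 'g set \<Rightarrow> ('g \<Rightarrow> complex) \<Rightarrow> bool" where
  "irr_fun \<Gamma> K f \<longleftrightarrow> (\<forall>x. x \<notin> K \<longrightarrow> f x = 0) \<and> (\<exists>r::real. r > 0 \<and> f \<one>\<^bsub>\<Gamma>\<^esub> = of_real r) \<and>
     (\<forall>x\<in>K. \<forall>y\<in>K. f x * f y = f \<one>\<^bsub>\<Gamma>\<^esub> / of_nat (card K) *
        (\<Sum>g\<in>K. f (x \<otimes>\<^bsub>\<Gamma>\<^esub> g \<otimes>\<^bsub>\<Gamma>\<^esub> y \<otimes>\<^bsub>\<Gamma>\<^esub> inv\<^bsub>\<Gamma>\<^esub> g))) \<and>
     (\<Sum>x\<in>K. f x * f (inv\<^bsub>\<Gamma>\<^esub> x)) = of_nat (card K)"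

context fsub
begin

lemma irr_funD:
  assumes "irr_fun \<Gamma> K f"
  shows "x \<notin> K \<Longrightarrow> f x = 0" "f \<one> \<noteq> 0"
    "x \<in> K \<Longrightarrow> y \<in> K \<Longrightarrow> f x * f y = f \<one> / of_nat (card K) * (\<Sum>g\<in>K. f (x \<otimes> g \<otimes> y \<otimes> inv g))"
    "(\<Sum>x\<in>K. f x * f (inv x)) = of_nat (card K)"
  using assms by (auto simp: irr_fun_def)

text \<open>With the identity as first argument, the equation writes \<open>f\<close> as the mean
  over the conjugates of its argument.\<close>

lemma irr_fun_conj:
  assumes f: "irr_fun \<Gamma> K f" and gx: "g \<in> K" "x \<in> K"
  shows "f (g \<otimes> x \<otimes> inv g) = f x"
proof -
  have avg: "f y = (\<Sum>h\<in>K. f (h \<otimes> y \<otimes> inv h)) / of_nat (card K)" if "y \<in> K" for y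
    using irr_funD(3)[OF f memb(1) that] irr_funD(2)[OF f] that by (simp add: field_simps)
  have "f (g \<otimes> x \<otimes> inv g) = (\<Sum>h\<in>K. f ((h \<otimes> g) \<otimes> x \<otimes> inv (h \<otimes> g))) / of_nat (card K)"
    using gx by (subst avg) (auto simp: inv_mult_group m_assoc intro!: sum.cong)
  also have "(\<Sum>h\<in>K. f ((h \<otimes> g) \<otimes> x \<otimes> inv (h \<otimes> g))) = (\<Sum>h\<in>K. f (h \<otimes> x \<otimes> inv h))"
    by (rule sum_right[OF gx(1)])
  finally show ?thesis using avg[OF gx(2)] by simp
qed

lemma irr_fun_comm:
  assumes f: "irr_fun \<Gamma> K f" and "x \<in> K" "y \<in> K"
  shows "f (x \<otimes> y) = f (y \<otimes> x)"
  using irr_fun_conj[OF f assms(3), of "x \<otimes> y"] assms(2,3) by (simp add: m_assoc)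

lemma sum_conj_mem: "a \<in> K \<Longrightarrow> (\<Sum>x\<in>K. f (a \<otimes> x \<otimes> inv a)) = (\<Sum>x\<in>K. f x)"
  by (rule sum_conj) auto

text \<open>The functional equation of \<open>f\<close> is multiplied by \<open>h (inv x)\<close>
  and summed over \<open>x\<close>. As \<open>f\<close> and \<open>h\<close> are class functions,
  the inner sum does not depend on \<open>g\<close>, which leaves a convolution of \<open>h\<close>
  and \<open>f\<close>.\<close>

lemma irr_fun_pair:
  assumes f: "irr_fun \<Gamma> K f" and h: "irr_fun \<Gamma> K h" and y: "y \<in> K"
  shows "(\<Sum>x\<in>K. h (inv x) * f x) * f y = f \<one> * (\<Sum>x\<in>K. h (y \<otimes> inv x) * f x)"
proof -
  have inner: "(\<Sum>x\<in>K. h (inv x) * f (x \<otimes> g \<otimes> y \<otimes> inv g)) = (\<Sum>x\<in>K. h (y \<otimes> inv x) * f x)" if g: "g \<in> K" for g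
  proof -
    define c where "c = g \<otimes> y \<otimes> inv g"
    have c: "c \<in> K" using g y by (simp add: c_def)
    have "(\<Sum>x\<in>K. h (inv x) * f (x \<otimes> g \<otimes> y \<otimes> inv g)) = (\<Sum>x\<in>K. h (c \<otimes> inv (x \<otimes> c)) * f (x \<otimes> c))"
      using g y by (intro sum.cong refl) (simp add: c_def m_assoc inv_mult_group)
    also have "\<dots> = (\<Sum>x\<in>K. h (c \<otimes> inv x) * f x)" by (rule sum_right[OF c])
    also have "\<dots> = (\<Sum>x\<in>K. h (c \<otimes> inv (g \<otimes> x \<otimes> inv g)) * f (g \<otimes> x \<otimes> inv g))"
      by (rule sum_conj_mem[OF g, symmetric])
    also have "\<dots> = (\<Sum>x\<in>K. h (y \<otimes> inv x) * f x)"
    proof (intro sum.cong refl)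
      fix x assume x: "x \<in> K"
      have "c \<otimes> inv (g \<otimes> x \<otimes> inv g) = g \<otimes> (y \<otimes> inv x) \<otimes> inv g"
        using x g y by (simp add: c_def m_assoc inv_mult_group)
      thus "h (c \<otimes> inv (g \<otimes> x \<otimes> inv g)) * f (g \<otimes> x \<otimes> inv g) = h (y \<otimes> inv x) * f x"
        using irr_fun_conj[OF f g x] irr_fun_conj[OF h g, of "y \<otimes> inv x"] x y by simp
    qed
    finally show ?thesis .
  qed
  have "(\<Sum>x\<in>K. h (inv x) * f x) * f y = (\<Sum>x\<in>K. h (inv x) * (f x * f y))"
    by (simp add: sum_distrib_right mult.assoc)
  also have "\<dots> = (\<Sum>x\<in>K. h (inv x) * (f \<one> / of_nat (card K) * (\<Sum>g\<in>K. f (x \<otimes> g \<otimes> y \<otimes> inv g))))"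
    using y by (intro sum.cong refl) (simp add: irr_funD(3)[OF f])
  also have "\<dots> = f \<one> / of_nat (card K) * (\<Sum>g\<in>K. \<Sum>x\<in>K. h (inv x) * f (x \<otimes> g \<otimes> y \<otimes> inv g))"
    by (subst sum.swap) (simp add: sum_distrib_left mult_ac)
  also have "\<dots> = f \<one> / of_nat (card K) * (\<Sum>g\<in>K. \<Sum>x\<in>K. h (y \<otimes> inv x) * f x)"
    using inner by simp
  also have "\<dots> = f \<one> * (\<Sum>x\<in>K. h (y \<otimes> inv x) * f x)" by simp
  finally show ?thesis .
qed

text \<open>Class functions are central for convolution.\<close>

lemma irr_fun_convolution_comm:
  assumes f: "irr_fun \<Gamma> K f" and y: "y \<in> K"
  shows "(\<Sum>x\<in>K. h (y \<otimes> inv x) * f x) = (\<Sum>x\<in>K. f (y \<otimes> inv x) * h x)"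
proof -
  have "(\<Sum>x\<in>K. h (y \<otimes> inv x) * f x) = (\<Sum>x\<in>K. h (y \<otimes> x) * f (inv x))"
    by (subst sum_inv[symmetric]) auto
  also have "\<dots> = (\<Sum>x\<in>K. h (y \<otimes> x) * f (y \<otimes> inv (y \<otimes> x)))"
  proof (intro sum.cong refl)
    fix x assume x: "x \<in> K"
    have "y \<otimes> inv (y \<otimes> x) = y \<otimes> inv x \<otimes> inv y" using x y by (simp add: inv_mult_group m_assoc)
    thus "h (y \<otimes> x) * f (inv x) = h (y \<otimes> x) * f (y \<otimes> inv (y \<otimes> x))"
      using irr_fun_conj[OF f y, of "inv x"] x by simp
  qed
  also have "\<dots> = (\<Sum>x\<in>K. h x * f (y \<otimes> inv x))" by (rule sum_left[OF y])
  finally show ?thesis by (simp add: mult.commute)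
qed

text \<open>Let \<open>p\<close> be the pairing. By \<open>irr_fun_pair\<close> in both orders,
  \<open>p * f y / f \<one>\<close> and \<open>p * h y / h \<one>\<close> are the same convolution,
  so \<open>f\<close> and \<open>h\<close> are proportional. Equal norms make the square of the
  ratio 1, and positive degrees make the ratio 1.\<close>

lemma irr_fun_eq:
  assumes f: "irr_fun \<Gamma> K f" and h: "irr_fun \<Gamma> K h" and nz: "(\<Sum>x\<in>K. h (inv x) * f x) \<noteq> 0"
  shows "f = h"
proof -
  let ?p = "\<Sum>x\<in>K. h (inv x) * f x"
  have p': "(\<Sum>x\<in>K. f (inv x) * h x) = ?p"
    by (subst sum_inv[symmetric]) (auto intro!: sum.cong simp: mult.commute)
  have eq: "f y * h \<one> = f \<one> * h y" if y: "y \<in> K" for y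
  proof -
    have "?p * f y * h \<one> = f \<one> * ((\<Sum>x\<in>K. h (y \<otimes> inv x) * f x) * h \<one>)" using irr_fun_pair[OF f h y]
      by simp
    also have "(\<Sum>x\<in>K. h (y \<otimes> inv x) * f x) * h \<one> = ?p * h y"
      using irr_fun_pair[OF h f y] irr_fun_convolution_comm[OF f y, of h] p' by (simp add: mult.commute)
    finally have "?p * (f y * h \<one>) = ?p * (f \<one> * h y)" by (simp add: mult_ac)
    thus ?thesis using nz by simp
  qed
  obtain r s :: real where r: "r > 0" "f \<one> = of_real r" and s: "s > 0" "h \<one> = of_real s"
    using f h by (auto simp: irr_fun_def)
  have fy: "f y = of_real (r / s) * h y" if "y \<in> K" for y
    using eq[OF that] r s by (simp add: field_simps)
  have "of_nat (card K) = (\<Sum>x\<in>K. f x * f (inv x))" using irr_funD(4)[OF f] by simp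
  also have "\<dots> = (\<Sum>x\<in>K. of_real ((r / s)\<^sup>2) * (h x * h (inv x)))"
    by (intro sum.cong refl) (simp add: fy power2_eq_square)
  also have "\<dots> = of_real ((r / s)\<^sup>2) * of_nat (card K)"
    unfolding sum_distrib_left[symmetric] irr_funD(4)[OF h] ..
  finally have "complex_of_real ((r / s)\<^sup>2) = 1" by simp
  hence "(r / s)\<^sup>2 = 1" using of_real_eq_1_iff by blast
  hence "r / s = 1" using r s
    by (simp add: power2_eq_1_iff) (metis divide_pos_pos less_minus_one_simps(1) less_asym zero_less_one)
  hence "f y = h y" for y using fy[of y] irr_funD(1)[OF f, of y] irr_funD(1)[OF h, of y] by (cases "y \<in> K") auto
  thus ?thesis by auto
qed

lemma Irr_imp_irr_fun:
  assumes "\<chi> \<in> Irr \<Gamma> K" shows "irr_fun \<Gamma> K \<chi>"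
proof -
  from assms obtain n \<rho> where \<rho>: "irred_rep \<Gamma> K n \<rho>" "\<chi> = char_of K \<rho>" by (auto simp: Irr_def)
  have "\<exists>r::real. r > 0 \<and> \<chi> \<one> = of_real r"
    using char_of_one[OF irredD(2)[OF \<rho>(1)]] irredD(1)[OF \<rho>(1)] \<rho>(2) by (intro exI[of _ "real n"]) auto
  moreover have "\<chi> x = 0" if "x \<notin> K" for x using that \<rho>(2) by (simp add: char_of_def)
  ultimately show ?thesis unfolding irr_fun_def using char_FE[OF \<rho>] char_norm[OF \<rho>] by blast
qed

text \<open>Completeness: a solution pairs nontrivially with some irreducible character because its
  value at the identity is nonzero. This character is itself a solution, so
  \<open>irr_fun_eq\<close> identifies the two.\<close>

lemma Irr_iff: "\<chi> \<in> Irr \<Gamma> K \<longleftrightarrow> irr_fun \<Gamma> K \<chi>"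
proof
  assume f: "irr_fun \<Gamma> K \<chi>"
  have "\<chi> (inv \<one>) \<noteq> 0" using irr_funD(2)[OF f] by simp
  from exists_irr_pairing[of "\<lambda>x. \<chi> (inv x)", OF this] obtain \<psi> where
    \<psi>: "\<psi> \<in> Irr \<Gamma> K" "(\<Sum>x\<in>K. \<chi> (inv x) * \<psi> x) \<noteq> 0" by blast
  from irr_fun_eq[OF Irr_imp_irr_fun[OF \<psi>(1)] f \<psi>(2)] \<psi>(1) show "\<chi> \<in> Irr \<Gamma> K" by simp
qed (rule Irr_imp_irr_fun)

lemma Irr_degree: assumes "\<chi> \<in> Irr \<Gamma> K" shows "\<exists>n::nat. n > 0 \<and> \<chi> \<one> = of_nat n"
proof -
  from assms obtain n \<rho> where \<rho>: "irred_rep \<Gamma> K n \<rho>" "\<chi> = char_of K \<rho>" by (auto simp: Irr_def)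
  thus ?thesis using char_of_one[OF irredD(2)[OF \<rho>(1)]] irredD(1)[OF \<rho>(1)] by auto
qed

text \<open>A nonzero pairing would force equality by \<open>irr_fun_eq\<close>.\<close>

lemma Irr_orth:
  assumes "\<chi> \<in> Irr \<Gamma> K" "\<psi> \<in> Irr \<Gamma> K"
  shows "(\<Sum>x\<in>K. \<psi> (inv x) * \<chi> x) = (if \<chi> = \<psi> then of_nat (card K) else 0)"
  using irr_fun_eq[of \<chi> \<psi>] assms irr_funD(4)[of \<chi>] by (auto simp: Irr_iff mult.commute)

text \<open>Orthogonality shifted by \<open>y\<close>: up to scalar factors the irreducible
  characters are orthogonal idempotents for convolution. The products of idempotents in the Clifford
  correspondence are computed with it.\<close>

lemma Irr_convolution:
  assumes \<chi>: "\<chi> \<in> Irr \<Gamma> K" and \<psi>: "\<psi> \<in> Irr \<Gamma> K" and y: "y \<in> K"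
  shows "(\<Sum>x\<in>K. \<psi> (y \<otimes> inv x) * \<chi> x) = (if \<chi> = \<psi> then of_nat (card K) * \<chi> y / \<chi> \<one> else 0)"
proof -
  have "\<chi> \<one> * (\<Sum>x\<in>K. \<psi> (y \<otimes> inv x) * \<chi> x) = (\<Sum>x\<in>K. \<psi> (inv x) * \<chi> x) * \<chi> y"
    using irr_fun_pair[of \<chi> \<psi>] \<chi> \<psi> y by (simp add: Irr_iff)
  moreover have "\<chi> \<one> \<noteq> 0" using irr_funD(2) \<chi> by (simp add: Irr_iff)
  ultimately show ?thesis unfolding Irr_orth[OF \<chi> \<psi>] by (auto simp: field_simps)
qed

text \<open>\<open>assoc_with\<close> provides a representation with irreducible character, while
  Schur's lemma asks for an irreducible representation. In a proper splitting every constituent of a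
  block has degree at most that of the block, which is below \<open>n\<close>; so the character of
  degree \<open>n\<close> occurs in neither block and would be orthogonal to itself.\<close>

lemma irred_rep_of_Irr_char:
  assumes \<rho>: "is_rep \<Gamma> K n \<rho>" and \<chi>: "char_of K \<rho> \<in> Irr \<Gamma> K"
  shows "irred_rep \<Gamma> K n \<rho>"
proof -
  let ?\<chi> = "char_of K \<rho>"
  have deg: "?\<chi> \<one> = of_nat n" by (rule char_of_one[OF \<rho>])
  have n: "n > 0" using irr_funD(2)[OF Irr_imp_irr_fun[OF \<chi>]] deg by (cases n) auto
  have "W = {0\<^sub>v n} \<or> W = carrier_vec n" if W: "inv_subspace K n \<rho> W" for W
  proof (rule ccontr)
    assume "\<not> ?thesis"
    then obtain m k \<rho>1 \<rho>2 where h: "m < n" "k < n" "is_rep \<Gamma> K m \<rho>1" "is_rep \<Gamma> K k \<rho>2"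
      "\<forall>x\<in>K. mtrace (\<rho> x) = mtrace (\<rho>1 x) + mtrace (\<rho>2 x)"
      using reducible_split[OF \<rho> W] by blast
    have notin: "?\<chi> \<notin> set xs"
      if xs: "set xs \<subseteq> Irr \<Gamma> K" "\<forall>x\<in>K. mtrace (\<rho>' x) = (\<Sum>\<chi>\<leftarrow>xs. \<chi> x)"
      and \<rho>': "is_rep \<Gamma> K j \<rho>'" "j < n" for xs \<rho>' j
    proof
      assume "?\<chi> \<in> set xs"
      \<comment> \<open>Degrees are complex numbers here, so they are compared through their real
        parts.\<close>
      have "Re (?\<chi> \<one>) \<le> Re (\<Sum>\<chi>\<leftarrow>xs. \<chi> \<one>)"
        using xs(1) \<open>?\<chi> \<in> set xs\<close>
      proof (induction xs)
        case (Cons a xs)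
        have nonneg: "0 \<le> Re (\<Sum>\<chi>\<leftarrow>ys. \<chi> \<one>)" if "set ys \<subseteq> Irr \<Gamma> K" for ys
          using that
        proof (induction ys)
          case (Cons b ys)
          from Cons.prems Irr_degree[of b] obtain c :: nat where "b \<one> = of_nat c" by auto
          thus ?case using Cons by simp
        qed simp
        from Cons.prems Irr_degree[of a] obtain c :: nat where "a \<one> = of_nat c" by auto
        moreover have "0 \<le> Re (\<Sum>\<chi>\<leftarrow>xs. \<chi> \<one>)" using nonneg Cons.prems by simp
        ultimately show ?case using Cons by (cases "a = ?\<chi>") auto
      qed simp
      also have "(\<Sum>\<chi>\<leftarrow>xs. \<chi> \<one>) = of_nat j" using xs(2) repD(2)[OF \<rho>'(1)]
        by (metis memb(1) mtrace_one)
      finally show False using deg \<rho>'(2) by simp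
    qed
    from char_decomp[OF h(3)] char_decomp[OF h(4)] obtain xs ys where
      xs: "set xs \<subseteq> Irr \<Gamma> K" "\<forall>x\<in>K. mtrace (\<rho>1 x) = (\<Sum>\<chi>\<leftarrow>xs. \<chi> x)" and
      ys: "set ys \<subseteq> Irr \<Gamma> K" "\<forall>x\<in>K. mtrace (\<rho>2 x) = (\<Sum>\<chi>\<leftarrow>ys. \<chi> x)"
        by blast
    have zero: "(\<Sum>x\<in>K. ?\<chi> (inv x) * (\<Sum>\<chi>\<leftarrow>zs. \<chi> x)) = 0"
      if "set zs \<subseteq> Irr \<Gamma> K" "?\<chi> \<notin> set zs" for zs
      using that
    proof (induction zs)
      case (Cons a zs)
      thus ?case using Irr_orth[of a ?\<chi>] \<chi> by (auto simp: distrib_left sum.distrib)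
    qed simp
    have "(\<Sum>x\<in>K. ?\<chi> (inv x) * ?\<chi> x) = (\<Sum>x\<in>K. ?\<chi> (inv x) * (\<Sum>\<chi>\<leftarrow>xs. \<chi> x)) + (\<Sum>x\<in>K. ?\<chi> (inv x) * (\<Sum>\<chi>\<leftarrow>ys. \<chi> x))"
      unfolding sum.distrib[symmetric] distrib_left[symmetric]
    proof (intro sum.cong refl)
      fix x assume x: "x \<in> K"
      hence "?\<chi> x = (\<Sum>\<chi>\<leftarrow>xs. \<chi> x) + (\<Sum>\<chi>\<leftarrow>ys. \<chi> x)" using h(5) xs(2) ys(2)
        by (simp add: char_of_def)
      thus "?\<chi> (inv x) * ?\<chi> x = ?\<chi> (inv x) * ((\<Sum>\<chi>\<leftarrow>xs. \<chi> x) + (\<Sum>\<chi>\<leftarrow>ys. \<chi> x))" by (rule arg_cong)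
    qed
    also have "\<dots> = 0" using zero[OF xs(1) notin[OF xs h(3,1)]] zero[OF ys(1) notin[OF ys h(4,2)]] by simp
    finally show False using Irr_orth[OF \<chi> \<chi>] fin by simp
  qed
  thus ?thesis unfolding irred_rep_def using \<rho> n by blast
qed

text \<open>If all averages of elementary matrices vanished, summing their diagonal entries would
  give norm 0 for the common character. A nonzero average intertwines the two representations, and
  its kernel is a proper invariant subspace, hence zero.\<close>

lemma irred_rep_equiv:
  assumes \<rho>: "irred_rep \<Gamma> K n \<rho>" and \<rho>': "irred_rep \<Gamma> K n \<rho>'"
    and eq: "char_of K \<rho> = char_of K \<rho>'"
  shows "\<exists>A B. A \<in> carrier_mat n n \<and> B \<in> carrier_mat n n \<and> A * B = 1\<^sub>m n \<and> B * A = 1\<^sub>m n \<and>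
     (\<forall>x\<in>K. \<rho> x = B * \<rho>' x * A)"
proof -
  note rep = repD[OF irredD(2)[OF \<rho>]] and rep' = repD[OF irredD(2)[OF \<rho>']]
  let ?T = "\<lambda>j k. msum n K (\<lambda>x. \<rho> x * mat_unit n j k * \<rho>' (inv x))"
  have "\<exists>j<n. \<exists>k<n. ?T j k \<noteq> 0\<^sub>m n n"
  proof (rule ccontr)
    assume "\<not> ?thesis"
    hence z: "?T j k $$ (j,k) = 0" if "j < n" "k < n" for j k using that by auto
    have z': "(\<Sum>x\<in>K. \<rho> x $$ (j,j) * \<rho>' (inv x) $$ (k,k)) = 0" if "j < n" "k < n" for j k
      using z[OF that] that rep(1) rep'(1) by (simp add: mat_unit_sandwich)
    have "of_nat (card K) = (\<Sum>x\<in>K. char_of K \<rho> x * char_of K \<rho> (inv x))"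
      using char_norm[OF \<rho>] by simp
    also have "\<dots> = (\<Sum>x\<in>K. \<Sum>i<n. \<Sum>k<n. \<rho> x $$ (i,i) * \<rho>' (inv x) $$ (k,k))"
    proof (intro sum.cong refl)
      fix x assume x: "x \<in> K"
      have "char_of K \<rho> (inv x) = mtrace (\<rho>' (inv x))" using x unfolding eq by (simp add: char_of_def)
      thus "char_of K \<rho> x * char_of K \<rho> (inv x) = (\<Sum>i<n. \<Sum>k<n. \<rho> x $$ (i,i) * \<rho>' (inv x) $$ (k,k))"
        using x mtrace_carrier[OF rep(1)[OF x]] mtrace_carrier[OF rep'(1)[of "inv x"]]
        by (simp add: char_of_def sum_product)
    qed
    also have "\<dots> = (\<Sum>i<n. \<Sum>k<n. \<Sum>x\<in>K. \<rho> x $$ (i,i) * \<rho>' (inv x) $$ (k,k))"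
      by (subst sum.swap, intro sum.cong refl, rule sum.swap)
    also have "\<dots> = 0" using z' by simp
    finally show False by (simp add: fin)
  qed
  then obtain j k where jk: "j < n" "k < n" "?T j k \<noteq> 0\<^sub>m n n" by blast
  define B where "B = ?T j k"
  have B: "B \<in> carrier_mat n n" "B \<noteq> 0\<^sub>m n n" using jk(3) by (auto simp: B_def)
  have tw: "B * \<rho>' y = \<rho> y * B" if "y \<in> K" for y
    unfolding B_def by (rule intertwine_avg) (use irredD(2)[OF \<rho>] irredD(2)[OF \<rho>'] that in auto)
  let ?W = "{v \<in> carrier_vec n. B *\<^sub>v v = 0\<^sub>v n}"
  have "inv_subspace K n \<rho>' ?W"
    unfolding inv_subspace_def
  proof (intro conjI ballI allI)
    fix v w assume "v \<in> ?W" "w \<in> ?W" thus "v + w \<in> ?W"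
      using B(1) by (auto simp: mult_add_distrib_mat_vec[of B n n])
  next
    fix c v assume "v \<in> ?W" thus "c \<cdot>\<^sub>v v \<in> ?W"
      using B(1) by (auto simp: mult_mat_vec[of B n n])
  next
    fix x w assume x: "x \<in> K" and w: "w \<in> ?W"
    have "B *\<^sub>v (\<rho>' x *\<^sub>v w) = (B * \<rho>' x) *\<^sub>v w"
      using x w B(1) rep'(1) by (simp add: assoc_mult_mat_vec[of _ n n _ n])
    also have "\<dots> = \<rho> x *\<^sub>v (B *\<^sub>v w)" unfolding tw[OF x]
      using x w B(1) rep(1) by (simp add: assoc_mult_mat_vec[of _ n n _ n])
    also have "\<dots> = 0\<^sub>v n" using w rep(1)[OF x] by simp
    finally show "\<rho>' x *\<^sub>v w \<in> ?W" using x w rep'(1) by simp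
  qed (use B(1) in auto)
  hence "?W = {0\<^sub>v n} \<or> ?W = carrier_vec n" using \<rho>' unfolding irred_rep_def by blast
  moreover have "?W \<noteq> carrier_vec n"
  proof
    assume W: "?W = carrier_vec n"
    have "B = 0\<^sub>m n n"
    proof (rule eq_matI)
      fix a b assume "a < dim_row (0\<^sub>m n n)" "b < dim_col (0\<^sub>m n n)"
      hence ab: "a < n" "b < n" by auto
      have "unit_vec n b \<in> ?W" unfolding W by simp
      hence "col B b $ a = 0" using ab B(1) by (auto simp: mat_unit_vec_col)
      thus "B $$ (a,b) = 0\<^sub>m n n $$ (a,b)" using ab B(1) by simp
    qed (use B(1) in auto)
    with B(2) show False by simp
  qed
  ultimately have "?W = {0\<^sub>v n}" by blast
  with injective_imp_invertible[OF B(1)] obtain A where A: "A \<in> carrier_mat n n" "B * A = 1\<^sub>m n" "A * B = 1\<^sub>m n"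
    by blast
  have "\<rho> x = B * \<rho>' x * A" if x: "x \<in> K" for x
  proof -
    have "B * \<rho>' x * A = \<rho> x * (B * A)" unfolding tw[OF x]
      using A(1) B(1) rep(1)[OF x] by (simp add: assoc_mult_mat[of _ n n _ n _ n])
    thus ?thesis using A rep(1)[OF x] by (simp add: right_mult_one_mat[of _ n n])
  qed
  thus ?thesis using A B(1) by blast
qed

end

section \<open>Character values\<close>

lemma upper_triangular_mult_diag:
  assumes A: "(A :: complex mat) \<in> carrier_mat n n" "upper_triangular A" and B: "B \<in> carrier_mat n n" "upper_triangular B"
  shows "upper_triangular (A * B)" "i < n \<Longrightarrow> (A * B) $$ (i,i) = A $$ (i,i) * B $$ (i,i)"
proof -
  have Az: "A $$ (i,j) = 0" if "j < i" "i < n" for i j using A that by (auto simp: upper_triangular_def)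
  have Bz: "B $$ (i,j) = 0" if "j < i" "i < n" for i j using B that by (auto simp: upper_triangular_def)
  show "upper_triangular (A * B)"
  proof (rule upper_triangularI)
    fix i j assume ij: "j < i" "i < dim_row (A * B)"
    hence n: "i < n" "j < n" using A by auto
    have "(A * B) $$ (i,j) = (\<Sum>k<n. A $$ (i,k) * B $$ (k,j))"
      using A B n by (intro mult_index[of _ n n]) auto
    also have "\<dots> = 0"
    proof (intro sum.neutral ballI)
      fix k assume "k \<in> {..<n}"
      thus "A $$ (i,k) * B $$ (k,j) = 0" using Az[of k i] Bz[of j k] ij n by (cases "k < i") auto
    qed
    finally show "(A * B) $$ (i,j) = 0" .
  qed
  show "(A * B) $$ (i,i) = A $$ (i,i) * B $$ (i,i)" if i: "i < n"
  proof -
    have "(A * B) $$ (i,i) = (\<Sum>k<n. A $$ (i,k) * B $$ (k,i))"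
      using A B i by (intro mult_index[of _ n n]) auto
    also have "\<dots> = (\<Sum>k<n. if k = i then A $$ (i,i) * B $$ (i,i) else 0)"
    proof (intro sum.cong refl)
      fix k assume "k \<in> {..<n}"
      thus "A $$ (i,k) * B $$ (k,i) = (if k = i then A $$ (i,i) * B $$ (i,i) else 0)"
        using Az[of k i] Bz[of i k] i by (cases k i rule: linorder_cases) auto
    qed
    finally show ?thesis using i by simp
  qed
qed

lemma upper_triangular_pow_diag:
  assumes A: "(A :: complex mat) \<in> carrier_mat n n" "upper_triangular A"
  shows "upper_triangular (A ^\<^sub>m k) \<and> (\<forall>i<n. (A ^\<^sub>m k) $$ (i,i) = A $$ (i,i) ^ k)"
proof (induction k)
  case (Suc k)
  have c: "A ^\<^sub>m k \<in> carrier_mat n n" using A by simp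
  show ?case using upper_triangular_mult_diag[OF c _ A] Suc by (auto simp: mult.commute)
qed (use A in \<open>auto simp: upper_triangular_def\<close>)

text \<open>After Schur triangularization the diagonal entries \<open>b\<close> are roots of unity,
  and those of the power \<open>k - 1\<close> are \<open>b ^ (k - 1)\<close>, the inverse and
  therefore the complex conjugate of \<open>b\<close>. Traces at an element and at its inverse are
  thus obtained together.\<close>

lemma finite_order_trace:
  assumes A: "(A :: complex mat) \<in> carrier_mat n n" and k: "k > 0" "A ^\<^sub>m k = 1\<^sub>m n"
  shows "\<exists>b. (\<forall>i<n. b i ^ k = 1) \<and> mtrace A = (\<Sum>i<n. b i) \<and> mtrace (A ^\<^sub>m (k - 1)) = (\<Sum>i<n. cnj (b i))"
proof -
  from char_poly_factorized[OF A] obtain as where as: "char_poly A = (\<Prod>a\<leftarrow>as. [:- a, 1:])" by blast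
  from schur_decomposition_exists[OF A as] obtain B where B: "B \<in> carrier_mat n n" "upper_triangular B" "similar_mat A B"
    by blast
  then obtain P Q where w: "similar_mat_wit A B P Q" by (auto simp: similar_mat_def)
  from similar_mat_witD2[OF A w] have PQ: "P * Q = 1\<^sub>m n" "Q * P = 1\<^sub>m n" "A = P * B * Q" "P \<in> carrier_mat n n" "Q \<in> carrier_mat n n" by auto
  have tr: "mtrace (A ^\<^sub>m j) = (\<Sum>i<n. B $$ (i,i) ^ j)" for j
  proof -
    have Bj: "B ^\<^sub>m j \<in> carrier_mat n n" using B by simp
    have "A ^\<^sub>m j = P * B ^\<^sub>m j * Q"
      using similar_mat_witD2[OF pow_carrier_mat[OF A] similar_mat_wit_pow[OF w]] by simp
    moreover have "mtrace (P * B ^\<^sub>m j * Q) = mtrace (B ^\<^sub>m j)"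
      by (rule mtrace_conj[of Q n]) (use PQ Bj in auto)
    ultimately have "mtrace (A ^\<^sub>m j) = mtrace (B ^\<^sub>m j)" by simp
    thus ?thesis using upper_triangular_pow_diag[OF B(1,2)] by (simp add: mtrace_carrier[OF Bj])
  qed
  have "B ^\<^sub>m k = Q * A ^\<^sub>m k * P"
    using similar_mat_witD2[OF pow_carrier_mat[OF B(1)] similar_mat_wit_pow[OF similar_mat_wit_sym[OF w]]] by simp
  hence Bk: "B ^\<^sub>m k = 1\<^sub>m n" using k PQ by (simp add: right_mult_one_mat[of _ n n])
  have b: "B $$ (i,i) ^ k = 1" if "i < n" for i
    using upper_triangular_pow_diag[OF B(1,2), of k] that unfolding Bk by auto
  have "B $$ (i,i) ^ (k - 1) = cnj (B $$ (i,i))" if i: "i < n" for i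
  proof -
    let ?b = "B $$ (i,i)"
    have "norm ?b = 1" using power_eq_1_iff[OF b[OF i]] k(1) by simp
    hence 1: "?b * cnj ?b = 1" by (simp add: complex_norm_square[symmetric])
    have "?b * ?b ^ (k - 1) = ?b ^ k" using k(1) by (cases k) auto
    hence "?b * ?b ^ (k - 1) = ?b * cnj ?b" unfolding b[OF i] 1 .
    moreover have "?b \<noteq> 0" using 1 by auto
    ultimately show ?thesis using mult_left_cancel by blast
  qed
  thus ?thesis using b tr[of 1] tr[of "k - 1"] A by (intro exI[of _ "\<lambda>i. B $$ (i,i)"]) auto
qed

context fsub
begin

lemma pow_card_eq_one: "x \<in> K \<Longrightarrow> x [^] card K = \<one>"
proof -
  assume x: "x \<in> K"
  interpret K: group "\<Gamma>\<lparr>carrier := K\<rparr>" by (rule subgroup.subgroup_is_group[OF sub]) (rule is_group)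
  have "x [^]\<^bsub>\<Gamma>\<lparr>carrier := K\<rparr>\<^esub> Coset.order (\<Gamma>\<lparr>carrier := K\<rparr>) = \<one>"
    using K.pow_order_eq_1[of x] x by simp
  thus ?thesis by (simp add: Coset.order_def nat_pow_def)
qed

lemma rep_pow:
  assumes \<rho>: "is_rep \<Gamma> K n \<rho>" and x: "x \<in> K"
  shows "x [^] (j::nat) \<in> K \<and> \<rho> (x [^] j) = \<rho> x ^\<^sub>m j"
proof (induction j)
  case 0
  show ?case using repD(1)[OF \<rho> x] repD(2)[OF \<rho>] by simp
next
  case (Suc j)
  thus ?case using repD(3)[OF \<rho>] x by simp
qed

lemma char_values:
  assumes "\<chi> \<in> Irr \<Gamma> K" and x: "x \<in> K"
  shows "\<exists>b n. (\<forall>i<n. root_of_unity (b i)) \<and> \<chi> x = (\<Sum>i<n::nat. b i) \<and> \<chi> (inv x) = (\<Sum>i<n. cnj (b i))"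
proof -
  from assms obtain n \<rho> where \<rho>: "irred_rep \<Gamma> K n \<rho>" "\<chi> = char_of K \<rho>" by (auto simp: Irr_def)
  note rep = repD[OF irredD(2)[OF \<rho>(1)]]
  have p: "\<rho> (x [^] j) = \<rho> x ^\<^sub>m j" for j :: nat using rep_pow[OF irredD(2)[OF \<rho>(1)] x] by simp
  have "x [^] (card K - 1) \<otimes> x = \<one>"
    using pow_card_eq_one[OF x] card_nz(2) by (metis One_nat_def Suc_pred nat_pow_Suc)
  hence inv: "inv x = x [^] (card K - 1)" using x by (metis carr inv_equality nat_pow_closed)
  have "\<rho> x ^\<^sub>m card K = 1\<^sub>m n" using p[of "card K"] pow_card_eq_one[OF x] rep by simp
  from finite_order_trace[OF rep(1)[OF x] card_nz(2) this] obtain b where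
    b: "\<forall>i<n. b i ^ card K = 1" "mtrace (\<rho> x) = (\<Sum>i<n. b i)" "mtrace (\<rho> x ^\<^sub>m (card K - 1)) = (\<Sum>i<n. cnj (b i))" by blast
  have "\<chi> (inv x) = mtrace (\<rho> (inv x))" using x by (simp add: \<rho>(2) char_of_def)
  hence "\<chi> (inv x) = (\<Sum>i<n. cnj (b i))" using b(3) p[of "card K - 1"] inv by simp
  moreover have "\<forall>i<n. root_of_unity (b i)" using b(1) card_nz(2) unfolding root_of_unity_def by blast
  ultimately show ?thesis using b(2) x by (intro exI[of _ b] exI[of _ n]) (simp add: \<rho>(2) char_of_def)
qed

lemma Irr_inv: "\<chi> \<in> Irr \<Gamma> K \<Longrightarrow> x \<in> K \<Longrightarrow> \<chi> (inv x) = cnj (\<chi> x)"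
  using char_values[of \<chi> x] by auto

end

section \<open>Galois action\<close>

lemma Qab_subfield: "is_subfield_C Qab"
proof -
  have *: "is_subfield_C (\<Inter>\<F>)" if "\<And>F. F \<in> \<F> \<Longrightarrow> is_subfield_C F" for \<F>
    using that unfolding is_subfield_C_def by (simp add: Ball_def)
  show ?thesis unfolding Qab_def by (rule *) auto
qed

lemma Qab_closed [simp]:
  "0 \<in> Qab" "1 \<in> Qab" "x \<in> Qab \<Longrightarrow> y \<in> Qab \<Longrightarrow> x + y \<in> Qab" "x \<in> Qab \<Longrightarrow> y \<in> Qab \<Longrightarrow> x * y \<in> Qab"
  "x \<in> Qab \<Longrightarrow> - x \<in> Qab" "x \<in> Qab \<Longrightarrow> inverse x \<in> Qab"
  using Qab_subfield unfolding is_subfield_C_def by (blast, blast, blast, blast, blast)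
    (use Qab_subfield in \<open>cases "x = 0"; auto simp: is_subfield_C_def\<close>)

lemma Qab_divide [simp]: "x \<in> Qab \<Longrightarrow> y \<in> Qab \<Longrightarrow> x / y \<in> Qab"
  by (simp add: divide_inverse)

lemma Qab_of_nat [simp]: "of_nat n \<in> Qab"
  by (induction n) auto

lemma Qab_sum [simp]: "(\<And>x. x \<in> A \<Longrightarrow> f x \<in> Qab) \<Longrightarrow> sum f A \<in> Qab"
  by (induction A rule: infinite_finite_induct) auto

lemma Qab_power [simp]: "x \<in> Qab \<Longrightarrow> x ^ n \<in> Qab"
  by (induction n) auto

lemma Qab_root [simp]: "root_of_unity x \<Longrightarrow> x \<in> Qab"
  unfolding Qab_def by auto

text \<open>As \<sigma> is the identity off \<open>Qab\<close>, it is bijective on all complex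
  numbers but additive and multiplicative only inside \<open>Qab\<close>; hence the membership
  conditions whenever \<sigma> is moved through a sum or a product.\<close>

lemma GalAbD:
  assumes "\<sigma> \<in> GalAb"
  shows "x \<in> Qab \<Longrightarrow> \<sigma> x \<in> Qab" "x \<in> Qab \<Longrightarrow> y \<in> Qab \<Longrightarrow> \<sigma> (x + y) = \<sigma> x + \<sigma> y"
    "x \<in> Qab \<Longrightarrow> y \<in> Qab \<Longrightarrow> \<sigma> (x * y) = \<sigma> x * \<sigma> y" "x \<notin> Qab \<Longrightarrow> \<sigma> x = x"
    "\<sigma> 0 = 0" "\<sigma> 1 = 1" "bij \<sigma>" "\<sigma> x = \<sigma> y \<longleftrightarrow> x = y" "\<sigma> x = 0 \<longleftrightarrow> x = 0"
    "x \<in> Qab \<Longrightarrow> y \<in> Qab \<Longrightarrow> \<sigma> (x / y) = \<sigma> x / \<sigma> y" "\<sigma> (of_nat n) = of_nat n"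
    "x \<in> Qab \<Longrightarrow> \<sigma> (x ^ n) = \<sigma> x ^ n"
proof -
  have b: "bij_betw \<sigma> Qab Qab"
    and add: "\<And>x y. x \<in> Qab \<Longrightarrow> y \<in> Qab \<Longrightarrow> \<sigma> (x + y) = \<sigma> x + \<sigma> y"
    and mult: "\<And>x y. x \<in> Qab \<Longrightarrow> y \<in> Qab \<Longrightarrow> \<sigma> (x * y) = \<sigma> x * \<sigma> y"
    and out: "\<And>x. x \<notin> Qab \<Longrightarrow> \<sigma> x = x"
    using assms by (auto simp: GalAb_def)
  have mem: "\<And>x. x \<in> Qab \<Longrightarrow> \<sigma> x \<in> Qab" using b by (auto simp: bij_betw_def)
  have "bij_betw \<sigma> (Qab \<union> - Qab) (Qab \<union> - Qab)"
    by (rule bij_betw_combine[OF b]) (auto simp: bij_betw_def inj_on_def out)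
  hence bij: "bij \<sigma>" by simp
  have inj: "\<sigma> x = \<sigma> y \<longleftrightarrow> x = y" for x y using bij by (auto simp: bij_def inj_def)
  have z: "\<sigma> 0 = 0" using add[of 0 0] by simp
  have "\<sigma> 1 \<noteq> 0" using inj[of 1 0] z by simp
  hence o: "\<sigma> 1 = 1" using mult[of 1 1] by simp
  show "\<sigma> 0 = 0" "\<sigma> 1 = 1" "bij \<sigma>" "\<sigma> x = \<sigma> y \<longleftrightarrow> x = y" "\<sigma> x = 0 \<longleftrightarrow> x = 0"
    using z o bij inj[of x y] inj[of x 0] by auto
  show "x \<in> Qab \<Longrightarrow> \<sigma> x \<in> Qab" "x \<in> Qab \<Longrightarrow> y \<in> Qab \<Longrightarrow> \<sigma> (x + y) = \<sigma> x + \<sigma> y"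
    "x \<in> Qab \<Longrightarrow> y \<in> Qab \<Longrightarrow> \<sigma> (x * y) = \<sigma> x * \<sigma> y" "x \<notin> Qab \<Longrightarrow> \<sigma> x = x"
    by (fact mem add mult out)+
  show "\<sigma> (x / y) = \<sigma> x / \<sigma> y" if "x \<in> Qab" "y \<in> Qab"
  proof (cases "y = 0")
    case False
    hence "\<sigma> (x / y) * \<sigma> y = \<sigma> x" using mult[of "x / y" y] that by simp
    moreover have "\<sigma> y \<noteq> 0" using inj[of y 0] z False by simp
    ultimately show ?thesis by (simp add: field_simps)
  qed (simp add: z)
  show "\<sigma> (of_nat n) = of_nat n" by (induction n) (auto simp: z o add)
  show "\<sigma> (x ^ n) = \<sigma> x ^ n" if "x \<in> Qab" by (induction n) (use that in \<open>auto simp: o mult\<close>)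
qed

lemma GalAb_sum: "\<sigma> \<in> GalAb \<Longrightarrow> (\<And>x. x \<in> A \<Longrightarrow> f x \<in> Qab) \<Longrightarrow> \<sigma> (sum f A) = (\<Sum>x\<in>A. \<sigma> (f x))"
  by (induction A rule: infinite_finite_induct) (auto simp: GalAbD(2,5))

lemma GalAb_id: "id \<in> GalAb" by (auto simp: GalAb_def)

lemma GalAb_comp: "\<sigma> \<in> GalAb \<Longrightarrow> \<tau> \<in> GalAb \<Longrightarrow> \<sigma> \<circ> \<tau> \<in> GalAb"
proof -
  assume s: "\<sigma> \<in> GalAb" and t: "\<tau> \<in> GalAb"
  have "bij_betw (\<sigma> \<circ> \<tau>) Qab Qab" using s t unfolding GalAb_def by (auto intro: bij_betw_trans)
  thus ?thesis using GalAbD(1-4)[OF s] GalAbD(1-4)[OF t] unfolding GalAb_def by simp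
qed

lemma GalAb_inv: assumes "\<sigma> \<in> GalAb"
  shows "inv_into UNIV \<sigma> \<in> GalAb" "\<sigma> (inv_into UNIV \<sigma> x) = x" "inv_into UNIV \<sigma> (\<sigma> x) = x"
proof -
  note g = GalAbD[OF assms]
  show 1: "\<sigma> (inv_into UNIV \<sigma> x) = x" "inv_into UNIV \<sigma> (\<sigma> x) = x" for x using g(7)
    by (auto simp: bij_def surj_f_inv_f)
  have b: "bij_betw \<sigma> Qab Qab" using assms by (auto simp: GalAb_def)
  have mem: "inv_into UNIV \<sigma> x \<in> Qab" if "x \<in> Qab" for x
  proof -
    from b that obtain y where "y \<in> Qab" "x = \<sigma> y" by (auto simp: bij_betw_def)
    thus ?thesis using 1(2) by simp
  qed
  have "bij_betw (inv_into UNIV \<sigma>) Qab Qab"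
    by (rule bij_betw_byWitness[where f' = \<sigma>]) (use 1 mem g(1) in auto)
  moreover have "inv_into UNIV \<sigma> (x + y) = inv_into UNIV \<sigma> x + inv_into UNIV \<sigma> y" "inv_into UNIV \<sigma> (x * y) = inv_into UNIV \<sigma> x * inv_into UNIV \<sigma> y" if "x \<in> Qab" "y \<in> Qab" for x y
    using g(2)[of "inv_into UNIV \<sigma> x" "inv_into UNIV \<sigma> y"] g(3)[of "inv_into UNIV \<sigma> x" "inv_into UNIV \<sigma> y"] mem that 1 by metis+
  moreover have "inv_into UNIV \<sigma> x = x" if "x \<notin> Qab" for x using g(4)[OF that] 1(2) by metis
  ultimately show "inv_into UNIV \<sigma> \<in> GalAb" by (simp add: GalAb_def)
qed

section \<open>Automorphisms acting by powers of p\<close>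

definition root_coprime :: "nat \<Rightarrow> complex \<Rightarrow> bool" where
  "root_coprime p \<xi> \<longleftrightarrow> (\<exists>n::nat. n > 0 \<and> coprime n p \<and> \<xi> ^ n = 1)"

lemma root_coprime_Qab [simp]: "root_coprime p \<xi> \<Longrightarrow> \<xi> \<in> Qab"
  by (auto simp: root_coprime_def root_of_unity_def intro!: Qab_root)

lemma root_coprime_gal: "\<sigma> \<in> GalAb \<Longrightarrow> root_coprime p \<xi> \<Longrightarrow> root_coprime p (\<sigma> \<xi>)"
  using root_coprime_Qab[of p \<xi>] unfolding root_coprime_def by (metis GalAbD(6,12))

text \<open>The order of \<open>x / y\<close> divides both a number coprime to \<open>p\<close> and
  \<open>p ^ c\<close>; Bezout's identity gives \<open>x / y = 1\<close>.\<close>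

lemma root_coprime_power_inj:
  assumes x: "root_coprime p x" and y: "root_coprime p y" and e: "x ^ (p ^ c) = y ^ (p ^ c)"
  shows "x = y"
proof -
  obtain n m where n: "n > 0" "coprime n p" "x ^ n = 1" and m: "m > 0" "coprime m p" "y ^ m = 1"
    using x y by (auto simp: root_coprime_def)
  have "coprime (n * m) (p ^ c)" using n m by simp
  then obtain u v where uv: "(n * m) * u = p ^ c * v + 1"
    using bezout_nat[of "n * m" "p ^ c"] n m by (auto simp: coprime_iff_gcd_eq_1)
  have y0: "y \<noteq> 0" using m by (metis power_0_left zero_neq_one less_numeral_extra(3))
  define z where "z = x / y"
  have zn: "z ^ (n * m) = 1"
    unfolding z_def power_divide using n(3) m(3) by (metis div_self mult.commute power_mult power_one zero_neq_one)
  have zc: "z ^ (p ^ c) = 1" unfolding z_def power_divide using e y0 by simp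
  have "1 = z ^ ((n * m) * u)" using zn by (simp add: power_mult)
  also have "\<dots> = (z ^ (p ^ c)) ^ v * z" unfolding uv by (simp add: power_add power_mult)
  finally have "z = 1" using zc by simp
  thus ?thesis using y0 by (simp add: z_def)
qed

text \<open>Two nonnegative exponents represent the integer \<open>f\<close> as
  \<open>a - b\<close>, so products and inverses are treated without distinguishing signs. In the
  converse a common power of \<open>p\<close> is cancelled by
  \<open>root_coprime_power_inj\<close>.\<close>

lemma Hgal_iff:
  "\<sigma> \<in> Hgal p \<longleftrightarrow> \<sigma> \<in> GalAb \<and> (\<exists>a b. \<forall>\<xi>. root_coprime p \<xi> \<longrightarrow> (\<sigma> \<xi>) ^ (p ^ b) = \<xi> ^ (p ^ a))"
proof
  assume "\<sigma> \<in> Hgal p"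
  then obtain f :: int where g: "\<sigma> \<in> GalAb" and f: "\<And>\<xi>. root_coprime p \<xi> \<Longrightarrow>
      (if f \<ge> 0 then \<sigma> \<xi> = \<xi> ^ (p ^ nat f) else (\<sigma> \<xi>) ^ (p ^ nat (- f)) = \<xi>)"
    unfolding Hgal_def root_coprime_def by blast
  show "\<sigma> \<in> GalAb \<and> (\<exists>a b. \<forall>\<xi>. root_coprime p \<xi> \<longrightarrow> (\<sigma> \<xi>) ^ (p ^ b) = \<xi> ^ (p ^ a))"
  proof (cases "f \<ge> 0")
    case True thus ?thesis using g f by (intro conjI exI[of _ "nat f"] exI[of _ 0]) auto
  next
    case False thus ?thesis using g f by (intro conjI exI[of _ 0] exI[of _ "nat (- f)"]) auto
  qed
next
  assume "\<sigma> \<in> GalAb \<and> (\<exists>a b. \<forall>\<xi>. root_coprime p \<xi> \<longrightarrow> (\<sigma> \<xi>) ^ (p ^ b) = \<xi> ^ (p ^ a))"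
  then obtain a b where g: "\<sigma> \<in> GalAb"
    and ab: "\<And>\<xi>. root_coprime p \<xi> \<Longrightarrow> (\<sigma> \<xi>) ^ (p ^ b) = \<xi> ^ (p ^ a)" by blast
  have pw: "root_coprime p (\<xi> ^ k)" if "root_coprime p \<xi>" for \<xi> k
    using that unfolding root_coprime_def by (metis mult.commute power_mult power_one)
  define f where "f = int a - int b"
  have "if f \<ge> 0 then \<sigma> \<xi> = \<xi> ^ (p ^ nat f) else (\<sigma> \<xi>) ^ (p ^ nat (- f)) = \<xi>"
    if r: "root_coprime p \<xi>" for \<xi>
  proof (cases "f \<ge> 0")
    case True
    hence "a = nat f + b" by (simp add: f_def)
    hence "(\<sigma> \<xi>) ^ (p ^ b) = (\<xi> ^ (p ^ nat f)) ^ (p ^ b)" using ab[OF r] by (simp add: power_add power_mult)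
    hence "\<sigma> \<xi> = \<xi> ^ (p ^ nat f)"
      by (rule root_coprime_power_inj[rotated 2]) (use root_coprime_gal[OF g r] pw[OF r] in auto)
    thus ?thesis using True by simp
  next
    case False
    hence "b = nat (- f) + a" by (simp add: f_def)
    hence "((\<sigma> \<xi>) ^ (p ^ nat (- f))) ^ (p ^ a) = \<xi> ^ (p ^ a)" using ab[OF r] by (simp add: power_add power_mult)
    hence "(\<sigma> \<xi>) ^ (p ^ nat (- f)) = \<xi>"
      by (rule root_coprime_power_inj[rotated 2]) (use pw[OF root_coprime_gal[OF g r]] r in auto)
    thus ?thesis using False by simp
  qed
  thus "\<sigma> \<in> Hgal p" using g unfolding Hgal_def root_coprime_def[symmetric] by blast
qed

lemma Hgal_GalAb: "\<sigma> \<in> Hgal p \<Longrightarrow> \<sigma> \<in> GalAb" by (simp add: Hgal_iff)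

lemma Hgal_id: "id \<in> Hgal p"
  unfolding Hgal_iff by (auto simp: GalAb_id intro!: exI[of _ 0])

lemma Hgal_comp: assumes "\<sigma> \<in> Hgal p" "\<tau> \<in> Hgal p" shows "\<sigma> \<circ> \<tau> \<in> Hgal p"
proof -
  from assms obtain a b c d where g: "\<sigma> \<in> GalAb" "\<tau> \<in> GalAb"
    and ab: "\<And>\<xi>. root_coprime p \<xi> \<Longrightarrow> (\<sigma> \<xi>) ^ (p ^ b) = \<xi> ^ (p ^ a)"
    and cd: "\<And>\<xi>. root_coprime p \<xi> \<Longrightarrow> (\<tau> \<xi>) ^ (p ^ d) = \<xi> ^ (p ^ c)" unfolding Hgal_iff
      by blast
  have "((\<sigma> \<circ> \<tau>) \<xi>) ^ (p ^ (b + d)) = \<xi> ^ (p ^ (c + a))" if r: "root_coprime p \<xi>" for \<xi>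
  proof -
    have "((\<sigma> \<circ> \<tau>) \<xi>) ^ (p ^ (b + d)) = ((\<tau> \<xi>) ^ (p ^ a)) ^ (p ^ d)"
      using ab[OF root_coprime_gal[OF g(2) r]] by (simp add: power_add power_mult)
    also have "\<dots> = ((\<tau> \<xi>) ^ (p ^ d)) ^ (p ^ a)" by (metis mult.commute power_mult)
    finally show ?thesis using cd[OF r] by (simp add: power_add power_mult)
  qed
  thus ?thesis using GalAb_comp[OF g] unfolding Hgal_iff by blast
qed

lemma Hgal_inv: assumes "\<sigma> \<in> Hgal p" shows "inv_into UNIV \<sigma> \<in> Hgal p"
proof -
  from assms obtain a b where g: "\<sigma> \<in> GalAb"
    and ab: "\<And>\<xi>. root_coprime p \<xi> \<Longrightarrow> (\<sigma> \<xi>) ^ (p ^ b) = \<xi> ^ (p ^ a)" unfolding Hgal_iff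
      by blast
  have "(inv_into UNIV \<sigma> \<xi>) ^ (p ^ a) = \<xi> ^ (p ^ b)" if r: "root_coprime p \<xi>" for \<xi>
    using ab[OF root_coprime_gal[OF GalAb_inv(1)[OF g] r]] GalAb_inv(2)[OF g] by simp
  thus ?thesis using GalAb_inv(1)[OF g] unfolding Hgal_iff by blast
qed

lemma Hgal_inv_comp: assumes "\<sigma> \<in> Hgal p"
  shows "\<sigma> \<circ> inv_into UNIV \<sigma> = id" "inv_into UNIV \<sigma> \<circ> \<sigma> = id"
  using GalAb_inv(2,3)[OF Hgal_GalAb[OF assms]] by auto

section \<open>Action of group elements and automorphisms on characters\<close>

context fsub
begin

definition normalizes :: "'g \<Rightarrow> bool" where
  "normalizes g \<longleftrightarrow> g \<in> carrier \<Gamma> \<and> (\<forall>x\<in>K. g \<otimes> x \<otimes> inv g \<in> K) \<and> (\<forall>x\<in>K. inv g \<otimes> x \<otimes> g \<in> K)"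

lemma normalizes_mem: "g \<in> K \<Longrightarrow> normalizes g" by (simp add: normalizes_def)

lemma sum_normalizes: "normalizes g \<Longrightarrow> (\<Sum>x\<in>K. f (g \<otimes> x \<otimes> inv g)) = (\<Sum>x\<in>K. f x)"
  by (rule sum_conj) (auto simp: normalizes_def)

lemma Irr_Qab [simp]: assumes "\<chi> \<in> Irr \<Gamma> K" shows "\<chi> x \<in> Qab"
proof (cases "x \<in> K")
  case True
  from char_values[OF assms this] obtain b n where b: "\<forall>i<n. root_of_unity (b i)" "\<chi> x = (\<Sum>i<n::nat. b i)"
    by blast
  show ?thesis unfolding b(2) by (intro Qab_sum Qab_root) (use b(1) in auto)
next
  case False
  thus ?thesis using irr_funD(1)[OF Irr_imp_irr_fun[OF assms]] by simp
qed

lemma char_act_Irr: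
  assumes \<chi>: "\<chi> \<in> Irr \<Gamma> K" and g: "normalizes g" and \<sigma>: "\<sigma> \<in> GalAb"
  shows "char_act \<Gamma> K g \<sigma> \<chi> \<in> Irr \<Gamma> K"
proof -
  note s = GalAbD[OF \<sigma>]
  note I = irr_funD[OF Irr_imp_irr_fun[OF \<chi>]]
  have gc: "g \<in> carrier \<Gamma>" and gK: "\<And>x. x \<in> K \<Longrightarrow> g \<otimes> x \<otimes> inv g \<in> K" using g
    by (auto simp: normalizes_def)
  let ?f = "char_act \<Gamma> K g \<sigma> \<chi>"
  have f: "?f x = \<sigma> (\<chi> (g \<otimes> x \<otimes> inv g))" if "x \<in> K" for x using that by (simp add: char_act_def)
  from Irr_degree[OF \<chi>] obtain n :: nat where n: "n > 0" "\<chi> \<one> = of_nat n" by blast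
  \<comment> \<open>The degree is a natural number, so \<sigma> fixes it. Only for this reason is
    the positivity condition preserved, since \<sigma> does not respect the order of real
    numbers.\<close>
  have f1: "?f \<one> = \<chi> \<one>" using f[OF memb(1)] gc n s(11) by simp
  have "?f x * ?f y = ?f \<one> / of_nat (card K) * (\<Sum>h\<in>K. ?f (x \<otimes> h \<otimes> y \<otimes> inv h))"
    if xy: "x \<in> K" "y \<in> K" for x y
  proof -
    let ?c = "\<lambda>x. g \<otimes> x \<otimes> inv g"
    have "?f x * ?f y = \<sigma> (\<chi> (?c x) * \<chi> (?c y))" using xy f s \<chi> by simp
    also have "\<dots> = \<sigma> (\<chi> \<one> / of_nat (card K) * (\<Sum>h\<in>K. \<chi> (?c x \<otimes> h \<otimes> ?c y \<otimes> inv h)))"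
      using I(3)[OF gK[OF xy(1)] gK[OF xy(2)]] by simp
    also have "(\<Sum>h\<in>K. \<chi> (?c x \<otimes> h \<otimes> ?c y \<otimes> inv h)) = (\<Sum>h\<in>K. \<chi> (?c x \<otimes> ?c h \<otimes> ?c y \<otimes> inv (?c h)))"
      by (rule sum_normalizes[OF g, symmetric])
    also have "\<dots> = (\<Sum>h\<in>K. \<chi> (?c (x \<otimes> h \<otimes> y \<otimes> inv h)))"
      using xy gc by (intro sum.cong refl) (simp add: m_assoc inv_mult_group)
    also have "\<sigma> (\<chi> \<one> / of_nat (card K) * (\<Sum>h\<in>K. \<chi> (?c (x \<otimes> h \<otimes> y \<otimes> inv h)))) =
        \<chi> \<one> / of_nat (card K) * (\<Sum>h\<in>K. \<sigma> (\<chi> (?c (x \<otimes> h \<otimes> y \<otimes> inv h))))"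
      using \<chi> n by (simp add: s GalAb_sum[OF \<sigma>])
    also have "(\<Sum>h\<in>K. \<sigma> (\<chi> (?c (x \<otimes> h \<otimes> y \<otimes> inv h)))) = (\<Sum>h\<in>K. ?f (x \<otimes> h \<otimes> y \<otimes> inv h))"
      using xy f by (intro sum.cong refl) simp
    finally show ?thesis by (simp add: f1)
  qed
  moreover have "(\<Sum>x\<in>K. ?f x * ?f (inv x)) = of_nat (card K)"
  proof -
    have "(\<Sum>x\<in>K. ?f x * ?f (inv x)) = (\<Sum>x\<in>K. \<sigma> (\<chi> (g \<otimes> x \<otimes> inv g) * \<chi> (inv (g \<otimes> x \<otimes> inv g))))"
      using f s \<chi> gc by (intro sum.cong refl) (simp add: conj_inv)
    also have "\<dots> = (\<Sum>x\<in>K. \<sigma> (\<chi> x * \<chi> (inv x)))" by (rule sum_normalizes[OF g])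
    also have "\<dots> = \<sigma> (of_nat (card K))" unfolding I(4)[symmetric] using \<chi> by (subst GalAb_sum[OF \<sigma>]) auto
    finally show ?thesis by (simp add: s)
  qed
  moreover have "\<exists>r::real. r > 0 \<and> ?f \<one> = of_real r" unfolding f1 n(2) using n(1)
    by (intro exI[of _ "real n"]) auto
  ultimately show ?thesis unfolding Irr_iff irr_fun_def by (auto simp: char_act_def)
qed

text \<open>A right action: \<sigma> acts on values and commutes with conjugation of arguments, and
  the element applied later ends up on the right of the product.\<close>

lemma char_act_comp:
  assumes "normalizes g" "normalizes h"
  shows "char_act \<Gamma> K h \<tau> (char_act \<Gamma> K g \<sigma> \<chi>) = char_act \<Gamma> K (g \<otimes> h) (\<tau> \<circ> \<sigma>) \<chi>"
  using assms by (auto simp: char_act_def normalizes_def conj_mult_inv fun_eq_iff)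

lemma char_act_inner: "\<chi> \<in> Irr \<Gamma> K \<Longrightarrow> g \<in> K \<Longrightarrow> char_act \<Gamma> K g id \<chi> = \<chi>"
  using irr_fun_conj[of \<chi> g] irr_funD(1)[of \<chi>] by (auto simp: char_act_def Irr_iff fun_eq_iff)

lemma char_act_one_id: "\<chi> \<in> Irr \<Gamma> K \<Longrightarrow> char_act \<Gamma> K \<one> id \<chi> = \<chi>"
  by (rule char_act_inner) auto

lemma cinner_Irr: "\<psi> \<in> Irr \<Gamma> K \<Longrightarrow> cinner K \<chi> \<psi> = (\<Sum>x\<in>K. \<chi> x * \<psi> (inv x)) / of_nat (card K)"
  unfolding cinner_def by (simp add: Irr_inv)

end

section \<open>Projective representations associated with a character\<close>

lemma map_mat_gal_mult:
  assumes \<sigma>: "\<sigma> \<in> GalAb" and A: "A \<in> carrier_mat n n" and B: "B \<in> carrier_mat n n"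
    and q: "\<And>i j. i < n \<Longrightarrow> j < n \<Longrightarrow> A $$ (i,j) \<in> Qab" "\<And>i j. i < n \<Longrightarrow> j < n \<Longrightarrow> B $$ (i,j) \<in> Qab"
  shows "map_mat \<sigma> (A * B) = map_mat \<sigma> A * map_mat \<sigma> B"
proof (rule eq_matI)
  fix i j assume "i < dim_row (map_mat \<sigma> A * map_mat \<sigma> B)" "j < dim_col (map_mat \<sigma> A * map_mat \<sigma> B)"
  hence ij: "i < n" "j < n" using A B by auto
  have "map_mat \<sigma> (A * B) $$ (i,j) = \<sigma> ((A * B) $$ (i,j))" using ij A B by (intro index_map_mat) auto
  also have "(A * B) $$ (i,j) = (\<Sum>k<n. A $$ (i,k) * B $$ (k,j))" by (rule mult_index[OF A B ij])
  also have "\<sigma> \<dots> = (\<Sum>k<n. \<sigma> (A $$ (i,k) * B $$ (k,j)))"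
    using q ij by (intro GalAb_sum[OF \<sigma>]) auto
  also have "\<dots> = (\<Sum>k<n. map_mat \<sigma> A $$ (i,k) * map_mat \<sigma> B $$ (k,j))"
    using q ij A B by (intro sum.cong refl) (simp add: GalAbD(3)[OF \<sigma>])
  also have "\<dots> = (map_mat \<sigma> A * map_mat \<sigma> B) $$ (i,j)"
    using A B ij by (intro mult_index[symmetric, of _ n n]) auto
  finally show "map_mat \<sigma> (A * B) $$ (i,j) = (map_mat \<sigma> A * map_mat \<sigma> B) $$ (i,j)" .
qed (use A B in auto)

lemma mtrace_map_mat_gal:
  assumes \<sigma>: "\<sigma> \<in> GalAb" and A: "A \<in> carrier_mat n n"
    and q: "\<And>i j. i < n \<Longrightarrow> j < n \<Longrightarrow> A $$ (i,j) \<in> Qab"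
  shows "mtrace (map_mat \<sigma> A) = \<sigma> (mtrace A)"
  using A q by (simp add: mtrace_carrier[of _ n]) (rule GalAb_sum[OF \<sigma>, symmetric], simp)

lemma nsubD:
  assumes "nsub \<Gamma> N G"
  shows "subgroup G \<Gamma>" "subgroup N \<Gamma>" "N \<subseteq> G" "\<And>g n. g \<in> G \<Longrightarrow> n \<in> N \<Longrightarrow> g \<otimes>\<^bsub>\<Gamma>\<^esub> n \<otimes>\<^bsub>\<Gamma>\<^esub> inv\<^bsub>\<Gamma>\<^esub> g \<in> N"
  using assms by (auto simp: nsub_def)

section \<open>A character of a normal subgroup and its stabilizer\<close>

locale nchar = group \<Gamma> for \<Gamma> :: "('g, 'b) monoid_scheme" (structure) +
  fixes G N :: "'g set" and \<theta> :: "'g \<Rightarrow> complex"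
  assumes finG: "finite G" and nsub: "nsub \<Gamma> N G" and \<theta>: "\<theta> \<in> Irr \<Gamma> N"
begin

lemma NG: "n \<in> N \<Longrightarrow> n \<in> G" using nsubD(3)[OF nsub] by auto

sublocale G: fsub \<Gamma> G
  by (intro fsub.intro fsub_axioms.intro is_group nsubD(1)[OF nsub] finG)

sublocale N: fsub \<Gamma> N
  by (intro fsub.intro fsub_axioms.intro is_group nsubD(2)[OF nsub] finite_subset[OF nsubD(3)[OF nsub] finG])

abbreviation T where "T \<equiv> stab \<Gamma> G N \<theta>"

lemma conjN: "g \<in> G \<Longrightarrow> n \<in> N \<Longrightarrow> g \<otimes> n \<otimes> inv g \<in> N"
  using nsubD(4)[OF nsub] by auto

lemma conjN': "g \<in> G \<Longrightarrow> n \<in> N \<Longrightarrow> inv g \<otimes> n \<otimes> g \<in> N"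
  using conjN[of "inv g" n] by simp

lemma normN: "g \<in> G \<Longrightarrow> N.normalizes g"
  unfolding N.normalizes_def using conjN conjN' by auto

lemma T_iff: "g \<in> T \<longleftrightarrow> g \<in> G \<and> (\<forall>n\<in>N. \<theta> (g \<otimes> n \<otimes> inv g) = \<theta> n)"
  using N.irr_funD(1)[OF N.Irr_imp_irr_fun[OF \<theta>]]
  by (auto simp: stab_def char_act_def fun_eq_iff)

lemma TG: "g \<in> T \<Longrightarrow> g \<in> G" by (simp add: T_iff)

lemma NT: "n \<in> N \<Longrightarrow> n \<in> T"
  using N.char_act_inner[OF \<theta>] NG by (auto simp: stab_def)

lemma T_subgroup: "subgroup T \<Gamma>"
proof
  show "T \<subseteq> carrier \<Gamma>" using TG by auto
  show "\<one> \<in> T" using NT by simp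
  fix x y assume x: "x \<in> T" and y: "y \<in> T"
  have "char_act \<Gamma> N (x \<otimes> y) (id \<circ> id) \<theta> = \<theta>"
    using x y N.char_act_comp[OF normN normN, of x y id id \<theta>] by (simp add: stab_def)
  thus "x \<otimes> y \<in> T" using x y by (simp add: stab_def)
next
  fix x assume x: "x \<in> T"
  hence xG: "x \<in> G" by (rule TG)
  have "char_act \<Gamma> N (inv x) id \<theta> = char_act \<Gamma> N (inv x) id (char_act \<Gamma> N x id \<theta>)"
    using x by (simp add: stab_def)
  also have "\<dots> = char_act \<Gamma> N (x \<otimes> inv x) (id \<circ> id) \<theta>"
    using xG by (intro N.char_act_comp normN) auto
  also have "\<dots> = \<theta>" using xG N.char_act_one_id[OF \<theta>] by simp
  finally show "inv x \<in> T" using xG by (simp add: stab_def)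
qed

sublocale T: fsub \<Gamma> T
proof (intro fsub.intro fsub_axioms.intro is_group)
  show "subgroup T \<Gamma>" by (rule T_subgroup)
  show "finite T" using finG by (simp add: stab_def)
qed

lemma \<theta>_conj: "t \<in> T \<Longrightarrow> n \<in> N \<Longrightarrow> \<theta> (t \<otimes> n \<otimes> inv t) = \<theta> n" by (simp add: T_iff)

text \<open>\<open>x\<close> carries the stabilizer of \<theta> to that of a conjugate of \<theta>,
  which here is a Galois conjugate; Galois conjugates have the same stabilizer because \<sigma> is
  injective on values.\<close>

lemma T_conj_semi:
  assumes x: "x \<in> G" and \<sigma>: "\<sigma> \<in> GalAb" and st: "char_act \<Gamma> N x \<sigma> \<theta> = \<theta>"
  shows "T.normalizes x"
proof -
  have st': "\<sigma> (\<theta> (x \<otimes> m \<otimes> inv x)) = \<theta> m" if "m \<in> N" for m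
    using fun_cong[OF st, of m] that by (simp add: char_act_def)
  have "x \<otimes> y \<otimes> inv x \<in> T" if y: "y \<in> T" for y
  proof -
    have yG: "y \<in> G" by (rule TG[OF y])
    have "\<theta> ((x \<otimes> y \<otimes> inv x) \<otimes> n \<otimes> inv (x \<otimes> y \<otimes> inv x)) = \<theta> n"
      if n: "n \<in> N" for n
    proof -
      define m where "m = inv x \<otimes> n \<otimes> x"
      have m: "m \<in> N" using conjN'[OF x n] by (simp add: m_def)
      have nm: "n = x \<otimes> m \<otimes> inv x" using n x by (simp add: m_def m_assoc)
      have "(x \<otimes> y \<otimes> inv x) \<otimes> n \<otimes> inv (x \<otimes> y \<otimes> inv x) = x \<otimes> (y \<otimes> m \<otimes> inv y) \<otimes> inv x"
        using x yG n by (simp add: m_def m_assoc inv_mult_group)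
      hence "\<sigma> (\<theta> ((x \<otimes> y \<otimes> inv x) \<otimes> n \<otimes> inv (x \<otimes> y \<otimes> inv x))) = \<theta> (y \<otimes> m \<otimes> inv y)"
        using st'[OF conjN[OF yG m]] by simp
      also have "\<dots> = \<sigma> (\<theta> n)" using \<theta>_conj[OF y m] st'[OF m] nm by simp
      finally show ?thesis using GalAbD(8)[OF \<sigma>] by blast
    qed
    thus ?thesis using x yG by (simp add: T_iff)
  qed
  moreover have "inv x \<otimes> y \<otimes> x \<in> T" if y: "y \<in> T" for y
  proof -
    have yG: "y \<in> G" by (rule TG[OF y])
    have "\<theta> ((inv x \<otimes> y \<otimes> x) \<otimes> m \<otimes> inv (inv x \<otimes> y \<otimes> x)) = \<theta> m"
      if m: "m \<in> N" for m
    proof -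
      let ?k = "(inv x \<otimes> y \<otimes> x) \<otimes> m \<otimes> inv (inv x \<otimes> y \<otimes> x)"
      have k: "?k \<in> N" using x yG m by (intro conjN) auto
      have "x \<otimes> ?k \<otimes> inv x = y \<otimes> (x \<otimes> m \<otimes> inv x) \<otimes> inv y"
        using x yG m by (simp add: m_assoc inv_mult_group)
      thus ?thesis using st'[OF k] st'[OF m] \<theta>_conj[OF y conjN[OF x m]] by simp
    qed
    thus ?thesis using x yG by (simp add: T_iff)
  qed
  ultimately show ?thesis using x by (simp add: T.normalizes_def)
qed

end

section \<open>Schur's lemma and Fourier inversion for an associated projective
  representation\<close>

locale projchar = nchar +
  fixes d :: nat and P :: "'a \<Rightarrow> complex mat" and \<alpha> :: "'a \<Rightarrow> 'a \<Rightarrow> complex"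
  assumes proj: "proj_rep \<Gamma> (stab \<Gamma> G N \<theta>) d P \<alpha>"
    and assoc: "assoc_with \<Gamma> (stab \<Gamma> G N \<theta>) N d P \<theta>"
begin

lemma P_carr [simp]: "x \<in> T \<Longrightarrow> P x \<in> carrier_mat d d"
  using proj by (simp add: proj_rep_def)

lemma \<alpha>_nz [simp]: "x \<in> T \<Longrightarrow> y \<in> T \<Longrightarrow> \<alpha> x y \<noteq> 0"
  using proj by (simp add: proj_rep_def)

lemma P_mult: "x \<in> T \<Longrightarrow> y \<in> T \<Longrightarrow> P x * P y = \<alpha> x y \<cdot>\<^sub>m P (x \<otimes> y)"
  using proj by (simp add: proj_rep_def)

lemma P_repN: "is_rep \<Gamma> N d P" and P_char: "char_of N P = \<theta>"
  and P_left: "n \<in> N \<Longrightarrow> g \<in> T \<Longrightarrow> P (n \<otimes> g) = P n * P g"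
  and P_right: "n \<in> N \<Longrightarrow> g \<in> T \<Longrightarrow> P (g \<otimes> n) = P g * P n"
  using assoc by (simp_all add: assoc_with_def)

lemma P_one: "P \<one> = 1\<^sub>m d" by (rule N.repD(2)[OF P_repN])

lemma P_irred: "irred_rep \<Gamma> N d P"
  using N.irred_rep_of_Irr_char[OF P_repN] \<theta> P_char by simp

lemma d_pos: "d > 0" by (rule N.irredD(1)[OF P_irred])

lemma \<theta>_trace: "n \<in> N \<Longrightarrow> \<theta> n = mtrace (P n)"
  using P_char by (auto simp: char_of_def)

lemma \<theta>_one: "\<theta> \<one> = of_nat d" using \<theta>_trace[OF N.memb(1)] P_one by simp

definition Pinv :: "'a \<Rightarrow> complex mat" where
  "Pinv x = (1 / \<alpha> x (inv x)) \<cdot>\<^sub>m P (inv x)"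

lemma Pinv_carr [simp]: "x \<in> T \<Longrightarrow> Pinv x \<in> carrier_mat d d"
  by (simp add: Pinv_def)

lemma P_Pinv: assumes x: "x \<in> T" shows "P x * Pinv x = 1\<^sub>m d" "Pinv x * P x = 1\<^sub>m d"
proof -
  have "P x * Pinv x = (1 / \<alpha> x (inv x)) \<cdot>\<^sub>m (P x * P (inv x))"
    unfolding Pinv_def using x by (intro mult_smult_distrib[of _ d d _ d]) auto
  also have "\<dots> = (1 / \<alpha> x (inv x)) \<cdot>\<^sub>m (\<alpha> x (inv x) \<cdot>\<^sub>m 1\<^sub>m d)"
    using x P_mult[OF x, of "inv x"] P_one by simp
  also have "\<dots> = 1\<^sub>m d" using x by (intro eq_matI) auto
  finally show 1: "P x * Pinv x = 1\<^sub>m d" .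
  show "Pinv x * P x = 1\<^sub>m d" using mat_mult_left_right_inverse[OF _ _ 1] x by simp
qed

lemma P_inv_eq: "x \<in> T \<Longrightarrow> P (inv x) = \<alpha> x (inv x) \<cdot>\<^sub>m Pinv x"
  by (intro eq_matI) (auto simp: Pinv_def)

lemma smult_P_eq_iff: "x \<in> T \<Longrightarrow> a \<cdot>\<^sub>m P x = b \<cdot>\<^sub>m P x \<longleftrightarrow> a = b"
proof -
  assume x: "x \<in> T"
  have "a = b" if e: "a \<cdot>\<^sub>m P x = b \<cdot>\<^sub>m P x"
  proof -
    have "a \<cdot>\<^sub>m (P x * Pinv x) = b \<cdot>\<^sub>m (P x * Pinv x)"
      using arg_cong[OF e, of "\<lambda>M. M * Pinv x"] x by (simp add: mult_smult_assoc_mat[of _ d d _ d])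
    thus ?thesis using P_Pinv(1)[OF x] smult_one_eq_iff[OF d_pos] by simp
  qed
  thus ?thesis by auto
qed

lemma P_conjN:
  assumes y: "y \<in> T" and n: "n \<in> N"
  shows "P (y \<otimes> n \<otimes> inv y) * P y = P y * P n"
proof -
  have yG: "y \<in> G" by (rule TG[OF y])
  have "P (y \<otimes> n \<otimes> inv y) * P y = P ((y \<otimes> n \<otimes> inv y) \<otimes> y)"
    by (rule P_left[symmetric, OF conjN[OF yG n] y])
  also have "(y \<otimes> n \<otimes> inv y) \<otimes> y = y \<otimes> n" using yG NG[OF n] by (simp add: m_assoc)
  finally show ?thesis using P_right[OF n y] by simp
qed

text \<open>\<open>Pinv y * X\<close> commutes with the irreducible representation \<open>P\<close>
  of \<open>N\<close>, so it is scalar. A matrix is thereby recognized as a multiple of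
  \<open>P y\<close> from its behaviour under \<open>N\<close> alone.\<close>

lemma twisted_schur:
  assumes X: "X \<in> carrier_mat d d" and y: "y \<in> T"
    and tw: "\<And>n. n \<in> N \<Longrightarrow> X * P n = P (y \<otimes> n \<otimes> inv y) * X"
  shows "\<exists>c. X = c \<cdot>\<^sub>m P y"
proof -
  note inv = P_Pinv[OF y]
  have c: "P y \<in> carrier_mat d d" "Pinv y \<in> carrier_mat d d" using y by auto
  let ?A = "Pinv y * X"
  have "?A * P n = P n * ?A" if n: "n \<in> N" for n
  proof -
    have nT: "n \<in> T" "y \<otimes> n \<otimes> inv y \<in> T" using NT[OF n] y by auto
    let ?n = "P n" and ?n' = "P (y \<otimes> n \<otimes> inv y)"
    have c': "?n \<in> carrier_mat d d" "?n' \<in> carrier_mat d d" using nT by auto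
    have "Pinv y * ?n' = Pinv y * ?n' * (P y * Pinv y)" using c c' inv by (simp add: right_mult_one_mat[of _ d d])
    also have "\<dots> = Pinv y * (?n' * P y) * Pinv y" using c c' by (simp add: assoc_mult_mat[of _ d d _ d _ d])
    also have "\<dots> = (Pinv y * P y) * ?n * Pinv y" unfolding P_conjN[OF y n] using c c'
      by (simp add: assoc_mult_mat[of _ d d _ d _ d])
    finally have 1: "Pinv y * ?n' = ?n * Pinv y" using c' inv by (simp add: left_mult_one_mat[of _ d d])
    have "?A * ?n = Pinv y * (X * ?n)" using c c' X by (simp add: assoc_mult_mat[of _ d d _ d _ d])
    also have "\<dots> = (Pinv y * ?n') * X" unfolding tw[OF n] using c c' X by (simp add: assoc_mult_mat[of _ d d _ d _ d])
    also have "\<dots> = ?n * ?A" unfolding 1 using c c' X by (simp add: assoc_mult_mat[of _ d d _ d _ d])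
    finally show ?thesis .
  qed
  from N.schur[OF P_irred _ this] X c obtain a where a: "?A = a \<cdot>\<^sub>m 1\<^sub>m d" by auto
  have "X = (P y * Pinv y) * X" using inv X by (simp add: left_mult_one_mat[of _ d d])
  also have "\<dots> = P y * ?A" using c X by (simp add: assoc_mult_mat[of _ d d _ d _ d])
  also have "\<dots> = a \<cdot>\<^sub>m P y" unfolding a using c
    by (simp add: mult_smult_distrib[of _ d d _ d] right_mult_one_mat[of _ d d])
  finally show ?thesis by blast
qed

text \<open>Fourier inversion on \<open>N\<close>: since \<open>P\<close> is irreducible there,
  orthogonality of its entries recovers a matrix from the traces of its products with the
  \<open>P n\<close>.\<close>

lemma fourier:
  assumes A: "A \<in> carrier_mat d d" and kl: "k < d" "l < d"
  shows "(\<Sum>n\<in>N. mtrace (A * P n) * P (inv n) $$ (k,l)) = of_nat (card N) / of_nat d * A $$ (k,l)"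
proof -
  have c: "P n \<in> carrier_mat d d" if "n \<in> N" for n using NT[OF that] by simp
  define c :: complex where "c = of_nat (card N) / of_nat d"
  have "(\<Sum>n\<in>N. mtrace (A * P n) * P (inv n) $$ (k,l)) = (\<Sum>n\<in>N. \<Sum>j<d. \<Sum>i<d. A $$ (j,i) * (P n $$ (i,j) * P (inv n) $$ (k,l)))"
  proof (intro sum.cong refl)
    fix n assume n: "n \<in> N"
    have "mtrace (A * P n) = (\<Sum>j<d. \<Sum>i<d. A $$ (j,i) * P n $$ (i,j))"
      using A c[OF n] mtrace_carrier[of "A * P n" d] by (simp add: mult_index[OF A c[OF n]] del: index_mult_mat(1))
    thus "mtrace (A * P n) * P (inv n) $$ (k,l) = (\<Sum>j<d. \<Sum>i<d. A $$ (j,i) * (P n $$ (i,j) * P (inv n) $$ (k,l)))"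
      by (simp add: sum_distrib_right mult.assoc)
  qed
  also have "\<dots> = (\<Sum>j<d. \<Sum>i<d. \<Sum>n\<in>N. A $$ (j,i) * (P n $$ (i,j) * P (inv n) $$ (k,l)))"
    by (subst sum.swap, intro sum.cong refl, rule sum.swap)
  also have "\<dots> = (\<Sum>j<d. \<Sum>i<d. A $$ (j,i) * (if i = l \<and> j = k then c else 0))"
    using kl by (intro sum.cong refl) (simp add: sum_distrib_left[symmetric] N.schur_orth[OF P_irred] c_def)
  also have "\<dots> = (\<Sum>j<d. if j = k then (\<Sum>i<d. if i = l then A $$ (j,i) * c else 0) else 0)"
  proof (intro sum.cong refl)
    fix j
    show "(\<Sum>i<d. A $$ (j,i) * (if i = l \<and> j = k then c else 0))
        = (if j = k then (\<Sum>i<d. if i = l then A $$ (j,i) * c else 0) else 0)"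
    proof (cases "j = k")
      case True
      have "(\<Sum>i<d. A $$ (j,i) * (if i = l \<and> j = k then c else 0)) = (\<Sum>i<d. if i = l then A $$ (j,i) * c else 0)"
        by (intro sum.cong refl) (simp add: True)
      thus ?thesis unfolding if_P[OF True] .
    qed simp
  qed
  also have "\<dots> = (\<Sum>i<d. if i = l then A $$ (k,i) * c else 0)"
    by (simp only: sum.delta finite_lessThan lessThan_iff kl if_True mult.commute)
  also have "\<dots> = c * A $$ (k,l)" by (simp only: sum.delta finite_lessThan lessThan_iff kl if_True mult.commute)
  finally show ?thesis unfolding c_def .
qed

text \<open>The Parseval form of \<open>fourier\<close>.\<close>

lemma fourier_trace:
  assumes A: "A \<in> carrier_mat d d" and B: "B \<in> carrier_mat d d"
  shows "(\<Sum>n\<in>N. mtrace (A * P n) * mtrace (P (inv n) * B)) = of_nat (card N) / of_nat d * mtrace (A * B)"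
proof -
  have c: "P n \<in> carrier_mat d d" if "n \<in> N" for n using NT[OF that] by simp
  have tr: "mtrace (X * B) = (\<Sum>k<d. \<Sum>l<d. X $$ (k,l) * B $$ (l,k))" if X: "X \<in> carrier_mat d d" for X
    using X B mtrace_carrier[of "X * B" d] by (simp add: mult_index[OF X B] del: index_mult_mat(1))
  have "(\<Sum>n\<in>N. mtrace (A * P n) * mtrace (P (inv n) * B)) =
      (\<Sum>n\<in>N. \<Sum>k<d. \<Sum>l<d. mtrace (A * P n) * P (inv n) $$ (k,l) * B $$ (l,k))"
    using c by (intro sum.cong refl) (simp add: tr sum_distrib_left mult.assoc)
  also have "\<dots> = (\<Sum>k<d. \<Sum>l<d. \<Sum>n\<in>N. mtrace (A * P n) * P (inv n) $$ (k,l) * B $$ (l,k))"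
    by (subst sum.swap, intro sum.cong refl, rule sum.swap)
  also have "\<dots> = (\<Sum>k<d. \<Sum>l<d. of_nat (card N) / of_nat d * A $$ (k,l) * B $$ (l,k))"
    by (intro sum.cong refl) (simp add: sum_distrib_right[symmetric] fourier[OF A])
  also have "\<dots> = of_nat (card N) / of_nat d * mtrace (A * B)"
    unfolding tr[OF A] by (simp add: sum_distrib_left mult.assoc)
  finally show ?thesis .
qed

text \<open>For \<open>A = P x\<close>: the trace of \<open>P\<close> may vanish at
  \<open>x\<close>, but not on the whole coset of \<open>N\<close>. So traces can be cancelled from
  identities between functions constant on cosets.\<close>

lemma exists_trace_nz:
  assumes A: "A \<in> carrier_mat d d" "A \<noteq> 0\<^sub>m d d"
  shows "\<exists>n\<in>N. mtrace (A * P n) \<noteq> 0"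
proof (rule ccontr)
  assume "\<not> ?thesis"
  hence "A $$ (k,l) = 0" if "k < d" "l < d" for k l
    using fourier[OF A(1) that] d_pos N.card_nz N.fin by auto
  hence "A = 0\<^sub>m d d" using A(1) by (intro eq_matI) auto
  with A(2) show False by simp
qed

lemma P_nz: "x \<in> T \<Longrightarrow> P x \<noteq> 0\<^sub>m d d"
proof
  assume x: "x \<in> T" and "P x = 0\<^sub>m d d"
  hence "P x * Pinv x = 0\<^sub>m d d" using x by (simp add: left_mult_zero_mat[of _ d d])
  hence "(1\<^sub>m d :: complex mat) $$ (0,0) = 0" using P_Pinv(1)[OF x] d_pos by simp
  thus False using d_pos by simp
qed

lemma trace_avg:
  assumes X: "X \<in> carrier_mat d d" and Y: "Y \<in> carrier_mat d d"
  shows "(\<Sum>n\<in>N. mtrace (X * (P n * Y * P (inv n)))) = of_nat (card N) / of_nat d * (mtrace X * mtrace Y)"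
proof -
  have c: "P n \<in> carrier_mat d d" if "n \<in> N" for n using NT[OF that] by simp
  have "(\<Sum>n\<in>N. mtrace (X * (P n * Y * P (inv n)))) = mtrace (msum d N (\<lambda>n. X * (P n * Y * P (inv n))))"
    using c X Y by (intro mtrace_msum[symmetric]) simp
  also have "msum d N (\<lambda>n. X * (P n * Y * P (inv n))) = X * msum d N (\<lambda>n. P n * Y * P (inv n))"
    using c X Y by (intro msum_mult_left[symmetric]) simp_all
  also have "\<dots> = (of_nat (card N) * mtrace Y / of_nat d) \<cdot>\<^sub>m X"
    using X Y by (simp add: N.schur_avg[OF P_irred Y] mult_smult_distrib[of _ d d _ d] right_mult_one_mat[of _ d d])
  finally show ?thesis using X by (simp add: mtrace_smult[of _ d])
qed

end

section \<open>Galois conjugates of a projective representation and the functions \<mu>\<close>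

locale projchar_Qab = projchar +
  assumes entries: "entries_Qab (stab \<Gamma> G N \<theta>) d P"
begin

lemma P_Qab: "x \<in> T \<Longrightarrow> i < d \<Longrightarrow> j < d \<Longrightarrow> P x $$ (i,j) \<in> Qab"
  using entries by (simp add: entries_Qab_def)

context
  fixes x \<sigma> assumes x: "x \<in> G" and \<sigma>: "\<sigma> \<in> GalAb"
    and st: "char_act \<Gamma> N x \<sigma> \<theta> = \<theta>"
begin

lemma conj_T: "y \<in> T \<Longrightarrow> x \<otimes> y \<otimes> inv x \<in> T"
  using T_conj_semi[OF x \<sigma> st] by (simp add: T.normalizes_def)

lemma Pconj_carr: "y \<in> T \<Longrightarrow> Pconj \<Gamma> P x \<sigma> y \<in> carrier_mat d d"
  using conj_T by (simp add: Pconj_def)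

lemma Pconj_one: "Pconj \<Gamma> P x \<sigma> \<one> = 1\<^sub>m d"
  using x P_one GalAbD(5,6)[OF \<sigma>] by (auto simp: Pconj_def intro!: eq_matI)

lemma Pconj_left: "n \<in> N \<Longrightarrow> y \<in> T \<Longrightarrow> Pconj \<Gamma> P x \<sigma> (n \<otimes> y) = Pconj \<Gamma> P x \<sigma> n * Pconj \<Gamma> P x \<sigma> y"
  and Pconj_right: "n \<in> N \<Longrightarrow> y \<in> T \<Longrightarrow> Pconj \<Gamma> P x \<sigma> (y \<otimes> n) = Pconj \<Gamma> P x \<sigma> y * Pconj \<Gamma> P x \<sigma> n"
  using conj_T[of n] conj_T[of y] NT[of n] x conjN[OF x, of n]
  by (simp_all add: Pconj_def N.conj_mult TG P_left P_right map_mat_gal_mult[OF \<sigma>, of _ d, symmetric] P_Qab NT)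

lemma Pconj_rep: "is_rep \<Gamma> N d (Pconj \<Gamma> P x \<sigma>)"
  unfolding is_rep_def using Pconj_one Pconj_carr Pconj_left NT by auto

lemma Pconj_char: "char_of N (Pconj \<Gamma> P x \<sigma>) = \<theta>"
proof -
  have "mtrace (Pconj \<Gamma> P x \<sigma> n) = \<theta> n" if n: "n \<in> N" for n
  proof -
    have "mtrace (Pconj \<Gamma> P x \<sigma> n) = \<sigma> (mtrace (P (x \<otimes> n \<otimes> inv x)))"
      unfolding Pconj_def using NT[OF conjN[OF x n]] P_Qab by (intro mtrace_map_mat_gal[OF \<sigma>, of _ d]) auto
    also have "\<dots> = \<theta> n" using fun_cong[OF st, of n] n \<theta>_trace[OF conjN[OF x n]] by (simp add: char_act_def)
    finally show ?thesis .
  qed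
  thus ?thesis using N.irr_funD(1)[OF N.Irr_imp_irr_fun[OF \<theta>]] by (auto simp: char_of_def fun_eq_iff)
qed

text \<open>After transport by \<open>A\<close> and \<open>B\<close> the conjugate matrix at
  \<open>y\<close> intertwines \<open>P\<close> on \<open>N\<close> with its conjugate by
  \<open>y\<close>, so \<open>twisted_schur\<close> makes it a multiple of \<open>P y\<close>. The
  factor is nonzero as \<sigma> is injective on entries.\<close>

lemma Pconj_similar:
  assumes A: "A \<in> carrier_mat d d" "B \<in> carrier_mat d d" "A * B = 1\<^sub>m d" "B * A = 1\<^sub>m d"
    and N: "\<And>n. n \<in> N \<Longrightarrow> Pconj \<Gamma> P x \<sigma> n = B * P n * A" and y: "y \<in> T"
  shows "\<exists>c. c \<noteq> 0 \<and> Pconj \<Gamma> P x \<sigma> y = c \<cdot>\<^sub>m (B * P y * A)"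
proof -
  let ?R = "Pconj \<Gamma> P x \<sigma>"
  have yG: "y \<in> G" by (rule TG[OF y])
  have c: "?R y \<in> carrier_mat d d" "P y \<in> carrier_mat d d" using Pconj_carr[OF y] y by auto
  let ?X = "A * ?R y * B"
  have "?X * P n = P (y \<otimes> n \<otimes> inv y) * ?X" if n: "n \<in> N" for n
  proof -
    let ?n = "P n" and ?n' = "P (y \<otimes> n \<otimes> inv y)"
    have nN: "y \<otimes> n \<otimes> inv y \<in> N" by (rule conjN[OF yG n])
    have c': "?n \<in> carrier_mat d d" "?n' \<in> carrier_mat d d" using NT[OF n] NT[OF nN] by auto
    have "?X * ?n = A * ?R y * (B * ?n) * (A * B)" using c c' A
      by (simp add: assoc_mult_mat[of _ d d _ d _ d] right_mult_one_mat[of _ d d])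
    also have "\<dots> = A * (?R y * (B * ?n * A)) * B" using c c' A(1,2) by (simp add: assoc_mult_mat[of _ d d _ d _ d])
    also have "?R y * (B * ?n * A) = ?R (y \<otimes> n)" unfolding N[OF n, symmetric] by (rule Pconj_right[OF n y, symmetric])
    also have "y \<otimes> n = (y \<otimes> n \<otimes> inv y) \<otimes> y" using yG NG[OF n] by (simp add: m_assoc)
    also have "?R ((y \<otimes> n \<otimes> inv y) \<otimes> y) = B * ?n' * A * ?R y" unfolding Pconj_left[OF nN y] N[OF nN] ..
    also have "A * (B * ?n' * A * ?R y) * B = (A * B) * (?n' * ?X)" using c c' A(1,2)
      by (simp add: assoc_mult_mat[of _ d d _ d _ d])
    also have "\<dots> = ?n' * ?X" using c c' A by (simp add: left_mult_one_mat[of _ d d])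
    finally show ?thesis .
  qed
  from twisted_schur[OF _ y this] A c obtain a where a: "?X = a \<cdot>\<^sub>m P y" by auto
  have "?R y = (B * A) * ?R y * (B * A)" using A c by (simp add: left_mult_one_mat[of _ d d] right_mult_one_mat[of _ d d])
  also have "\<dots> = B * ?X * A" using c A(1,2) by (simp add: assoc_mult_mat[of _ d d _ d _ d])
  also have "\<dots> = a \<cdot>\<^sub>m (B * P y * A)" unfolding a using A c
    by (simp add: mult_smult_distrib[of _ d d _ d] mult_smult_assoc_mat[of _ d d _ d])
  finally have eq: "?R y = a \<cdot>\<^sub>m (B * P y * A)" .
  have "a \<noteq> 0"
  proof
    assume "a = 0"
    hence z: "?R y = 0\<^sub>m d d" using eq A c by auto
    have "\<sigma> (P (x \<otimes> y \<otimes> inv x) $$ (i,j)) = 0" if "i < d" "j < d" for i j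
    proof -
      have "\<sigma> (P (x \<otimes> y \<otimes> inv x) $$ (i,j)) = ?R y $$ (i,j)"
        using that P_carr[OF conj_T[OF y]] by (simp add: Pconj_def)
      thus ?thesis unfolding z using that by simp
    qed
    hence "P (x \<otimes> y \<otimes> inv x) = 0\<^sub>m d d" using P_carr[OF conj_T[OF y]] GalAbD(9)[OF \<sigma>]
      by (intro eq_matI) auto
    thus False using P_nz[OF conj_T[OF y]] by simp
  qed
  thus ?thesis using eq by blast
qed

lemma BPA_nz:
  assumes A: "A \<in> carrier_mat d d" "B \<in> carrier_mat d d" "A * B = 1\<^sub>m d" "B * A = 1\<^sub>m d" and y: "y \<in> T"
    and e: "a \<cdot>\<^sub>m (B * P y * A) = b \<cdot>\<^sub>m (B * P y * A)"
  shows "a = b"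
proof -
  have c: "P y \<in> carrier_mat d d" using y by auto
  have "a \<cdot>\<^sub>m P y = b \<cdot>\<^sub>m P y"
  proof -
    have *: "A * (c \<cdot>\<^sub>m (B * P y * A)) * B = c \<cdot>\<^sub>m P y" for c
    proof -
      have "A * (c \<cdot>\<^sub>m (B * P y * A)) * B = c \<cdot>\<^sub>m ((A * B) * P y * (A * B))"
        using A(1,2) c by (simp add: mult_smult_distrib[of _ d d _ d] mult_smult_assoc_mat[of _ d d _ d] assoc_mult_mat[of _ d d _ d _ d])
      thus ?thesis using A c by (simp add: left_mult_one_mat[of _ d d] right_mult_one_mat[of _ d d])
    qed
    show ?thesis using *[of a] *[of b] e by simp
  qed
  thus ?thesis using smult_P_eq_iff[OF y] by simp
qed

text \<open>Existence: a similarity on \<open>N\<close> extends to each \<open>y\<close> by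
  \<open>Pconj_similar\<close>. Uniqueness: two similarities realizing the same conjugate on
  \<open>N\<close> differ by a scalar matrix, which cancels in \<open>B * P y * A\<close>.
  \<open>mu_unique\<close> asks for similarity on \<open>N\<close> only; in this form it compares
  two projective representations in \<open>mu_hat\<close>.\<close>

lemma mu_spec:
  defines "m \<equiv> mu \<Gamma> T N d P x \<sigma>"
  shows mu_outside: "y \<notin> T \<Longrightarrow> m y = 1" and mu_nz: "y \<in> T \<Longrightarrow> m y \<noteq> 0"
    and mu_N: "y \<in> T \<Longrightarrow> n \<in> N \<Longrightarrow> m (n \<otimes> y) = m y" and mu_one: "m \<one> = 1"
    and mu_sim: "\<exists>A B. A \<in> carrier_mat d d \<and> B \<in> carrier_mat d d \<and> A * B = 1\<^sub>m d \<and> B * A = 1\<^sub>m d \<and>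
         (\<forall>y\<in>T. Pconj \<Gamma> P x \<sigma> y = m y \<cdot>\<^sub>m (B * P y * A))"
    and mu_unique: "A \<in> carrier_mat d d \<Longrightarrow> B \<in> carrier_mat d d \<Longrightarrow> A * B = 1\<^sub>m d \<Longrightarrow> B * A = 1\<^sub>m d \<Longrightarrow>
      (\<And>n. n \<in> N \<Longrightarrow> Pconj \<Gamma> P x \<sigma> n = B * P n * A) \<Longrightarrow> y \<in> T \<Longrightarrow>
      Pconj \<Gamma> P x \<sigma> y = c \<cdot>\<^sub>m (B * P y * A) \<Longrightarrow> c = m y"
proof -
  let ?R = "Pconj \<Gamma> P x \<sigma>"
  let ?Q = "\<lambda>\<mu>. (\<forall>y. y \<notin> T \<longrightarrow> \<mu> y = 1) \<and> (\<forall>y\<in>T. \<mu> y \<noteq> 0) \<and>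
      (\<forall>y\<in>T. \<forall>n\<in>N. \<mu> (n \<otimes> y) = \<mu> y) \<and> \<mu> \<one> = 1 \<and>
      (\<exists>A B. A \<in> carrier_mat d d \<and> B \<in> carrier_mat d d \<and> A * B = 1\<^sub>m d \<and> B * A = 1\<^sub>m d \<and>
         (\<forall>y\<in>T. ?R y = \<mu> y \<cdot>\<^sub>m (B * P y * A)))"
  have uniq: "c = c'"
    if A: "A \<in> carrier_mat d d" "B \<in> carrier_mat d d" "A * B = 1\<^sub>m d" "B * A = 1\<^sub>m d"
      and A': "A' \<in> carrier_mat d d" "B' \<in> carrier_mat d d" "A' * B' = 1\<^sub>m d" "B' * A' = 1\<^sub>m d"
      and n: "\<And>n. n \<in> N \<Longrightarrow> ?R n = B * P n * A"
        and n': "\<And>n. n \<in> N \<Longrightarrow> ?R n = B' * P n * A'"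
      and y: "y \<in> T" and e: "?R y = c \<cdot>\<^sub>m (B * P y * A)" and e': "?R y = c' \<cdot>\<^sub>m (B' * P y * A')"
    for A B A' B' y c c'
  proof -
    have sch: "\<exists>a. A' * B = a \<cdot>\<^sub>m 1\<^sub>m d"
    proof (rule N.schur[OF P_irred])
      fix z assume z: "z \<in> N"
      have cz: "P z \<in> carrier_mat d d" using NT[OF z] by simp
      have "(A' * B) * P z = A' * (B * P z * A) * B" using A cz A'
        by (simp add: assoc_mult_mat[of _ d d _ d _ d] right_mult_one_mat[of _ d d])
      also have "\<dots> = (A' * B') * P z * (A' * B)" unfolding n[OF z, symmetric] n'[OF z] using A(1,2) A'(1,2) cz
        by (simp add: assoc_mult_mat[of _ d d _ d _ d])
      finally show "(A' * B) * P z = P z * (A' * B)" using A' cz by (simp add: left_mult_one_mat[of _ d d])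
    qed (use A A' in auto)
    then obtain a where a: "A' * B = a \<cdot>\<^sub>m 1\<^sub>m d" by blast
    have cy: "P y \<in> carrier_mat d d" using y by simp
    have "B = (B' * A') * B" using A A' by (simp add: left_mult_one_mat[of _ d d])
    also have "\<dots> = B' * (A' * B)" using A(1,2) A'(1,2) by (simp add: assoc_mult_mat[of _ d d _ d _ d])
    also have "\<dots> = a \<cdot>\<^sub>m B'" unfolding a using A'
      by (simp add: mult_smult_distrib[of _ d d _ d] right_mult_one_mat[of _ d d])
    finally have B: "B = a \<cdot>\<^sub>m B'" .
    have "A' = (A' * B) * A" using A A' by (simp add: assoc_mult_mat[of _ d d _ d _ d] right_mult_one_mat[of _ d d])
    also have "\<dots> = a \<cdot>\<^sub>m A" unfolding a using A
      by (simp add: mult_smult_assoc_mat[of _ d d _ d] left_mult_one_mat[of _ d d])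
    finally have A'a: "A' = a \<cdot>\<^sub>m A" .
    have "B * P y * A = B' * P y * A'" unfolding B A'a using A A' cy
      by (simp add: mult_smult_distrib[of _ d d _ d] mult_smult_assoc_mat[of _ d d _ d])
    thus ?thesis using BPA_nz[OF A' y, of c c'] e e' by simp
  qed
  have Pr: "irred_rep \<Gamma> N d ?R" using N.irred_rep_of_Irr_char[OF Pconj_rep] Pconj_char \<theta> by simp
  from N.irred_rep_equiv[OF Pr P_irred] Pconj_char P_char obtain A B where
    A: "A \<in> carrier_mat d d" "B \<in> carrier_mat d d" "A * B = 1\<^sub>m d" "B * A = 1\<^sub>m d"
    and n: "\<And>n. n \<in> N \<Longrightarrow> ?R n = B * P n * A" by auto
  \<comment> \<open>The value 1 off \<open>T\<close> is the normalization in \<open>mu\<close> that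
    makes the function unique.\<close>
  define f where "f y = (if y \<in> T then (SOME c. c \<noteq> 0 \<and> ?R y = c \<cdot>\<^sub>m (B * P y * A)) else 1)" for y
  have f: "f y \<noteq> 0 \<and> ?R y = f y \<cdot>\<^sub>m (B * P y * A)" if y: "y \<in> T" for y
    using someI_ex[OF Pconj_similar[OF A n y]] y by (simp add: f_def)
  have fN: "f (n \<otimes> y) = f y" if y: "y \<in> T" and nN: "n \<in> N" for y n
  proof -
    have ny: "n \<otimes> y \<in> T" using y NT[OF nN] by simp
    have c: "P y \<in> carrier_mat d d" "P n \<in> carrier_mat d d" using y NT[OF nN] by auto
    have "?R (n \<otimes> y) = B * P n * A * (f y \<cdot>\<^sub>m (B * P y * A))"
      using Pconj_left[OF nN y] n[OF nN] f[OF y] by simp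
    also have "\<dots> = f y \<cdot>\<^sub>m (B * P n * (A * B) * P y * A)"
      using A(1,2) c by (simp add: mult_smult_distrib[of _ d d _ d] assoc_mult_mat[of _ d d _ d _ d])
    also have "B * P n * (A * B) * P y * A = B * P (n \<otimes> y) * A"
      using A c P_left[OF nN y]
        by (simp add: assoc_mult_mat[of _ d d _ d _ d] right_mult_one_mat[of _ d d] left_mult_one_mat[of _ d d])
    finally show ?thesis using BPA_nz[OF A ny] f[OF ny] by simp
  qed
  have f1: "f n = 1" if "n \<in> N" for n
  proof -
    have "1 \<cdot>\<^sub>m (B * P n * A) = B * P n * A" by (intro eq_matI) auto
    thus ?thesis using BPA_nz[OF A NT[OF that], of "f n" 1] f[OF NT[OF that]] n[OF that] by simp
  qed
  have Qf: "?Q f" using f fN f1[OF N.memb(1)] A by (auto simp: f_def)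
  have Qu: "h = f" if h: "?Q h" for h
  proof
    fix y
    from h obtain A' B' where A': "A' \<in> carrier_mat d d" "B' \<in> carrier_mat d d" "A' * B' = 1\<^sub>m d" "B' * A' = 1\<^sub>m d"
      and hy: "\<And>y. y \<in> T \<Longrightarrow> ?R y = h y \<cdot>\<^sub>m (B' * P y * A')" by blast
    have h1: "h n = 1" if "n \<in> N" for n using h that by (metis N.carr N.memb(1) NT r_one)
    show "h y = f y"
    proof (cases "y \<in> T")
      case True
      show ?thesis
        by (rule uniq[OF A' A _ n True hy[OF True]]) (use hy[OF NT] h1 f[OF True] in auto)
    next
      case False thus ?thesis using h by (simp add: f_def)
    qed
  qed
  have mf: "m = f" unfolding m_def mu_def using Qf Qu by (rule the_equality)
  show "y \<notin> T \<Longrightarrow> m y = 1" "y \<in> T \<Longrightarrow> m y \<noteq> 0" "y \<in> T \<Longrightarrow> n \<in> N \<Longrightarrow> m (n \<otimes> y) = m y" "m \<one> = 1"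
    "\<exists>A B. A \<in> carrier_mat d d \<and> B \<in> carrier_mat d d \<and> A * B = 1\<^sub>m d \<and> B * A = 1\<^sub>m d \<and>
         (\<forall>y\<in>T. ?R y = m y \<cdot>\<^sub>m (B * P y * A))" for n
    using Qf unfolding mf by blast+
  show "c = m y" if "A \<in> carrier_mat d d" "B \<in> carrier_mat d d" "A * B = 1\<^sub>m d" "B * A = 1\<^sub>m d"
      "\<And>n. n \<in> N \<Longrightarrow> ?R n = B * P n * A" "y \<in> T" "?R y = c \<cdot>\<^sub>m (B * P y * A)" for A B c
    unfolding mf by (rule uniq[OF that(1-4) A that(5) n that(6,7)]) (use f[OF that(6)] in auto)
qed

end

end

section \<open>Characters over an invariant character\<close>

context nchar
begin

text \<open>The coefficient at \<open>n\<close> of the central idempotent of \<theta> in the group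
  algebra of \<open>N\<close>.\<close>

definition idem :: "'g \<Rightarrow> complex" where
  "idem n = \<theta> \<one> / of_nat (card N) * \<theta> (inv n)"

lemma \<theta>_one_nz: "\<theta> \<one> \<noteq> 0"
  using N.irr_funD(2)[OF N.Irr_imp_irr_fun[OF \<theta>]] .

lemma idem_T: "t \<in> T \<Longrightarrow> n \<in> N \<Longrightarrow> idem (t \<otimes> n \<otimes> inv t) = idem n"
  using \<theta>_conj[of t "inv n"] N.conj_inv[of t n] TG[of t] NG[of n] by (simp add: idem_def)

lemma sum_idem_conj:
  "t \<in> T \<Longrightarrow> (\<Sum>n\<in>N. idem n * F (t \<otimes> n \<otimes> inv t)) = (\<Sum>n\<in>N. idem n * F n)"
  using N.sum_normalizes[OF normN[OF TG], of t "\<lambda>n. idem n * F n"] by (simp add: idem_T)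

text \<open>Writing \<open>e\<close> for the central idempotent of \<open>\<theta>\<close>, this is \<open>e (g e g\<^sup>-\<^sup>1) = e\<close> or \<open>0\<close>
  according to whether \<open>g\<close> fixes \<open>\<theta>\<close>, tested against an arbitrary function \<open>F\<close>.\<close>
lemma idem_conj_mult:
  assumes g: "g \<in> G"
  shows "(\<Sum>n\<in>N. \<Sum>m\<in>N. idem n * idem m * F (n \<otimes> (g \<otimes> m \<otimes> inv g))) = (if g \<in> T then \<Sum>n\<in>N. idem n * F n else 0)"
proof -
  define \<theta>' where "\<theta>' = char_act \<Gamma> N (inv g) id \<theta>"
  have ig: "inv g \<in> G" using g by simp
  have \<theta>': "\<theta>' \<in> Irr \<Gamma> N" unfolding \<theta>'_def
    by (rule N.char_act_Irr[OF \<theta> normN[OF ig] GalAb_id])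
  have eq: "\<theta> = \<theta>' \<longleftrightarrow> g \<in> T"
    using T.memb(3)[of g] T.memb(3)[of "inv g"] g by (auto simp: \<theta>'_def stab_def)
  let ?c = "\<theta> \<one> / of_nat (card N)"
  have id': "idem (inv g \<otimes> m \<otimes> g) = ?c * \<theta>' (inv m)" if m: "m \<in> N" for m
    using m g NG[OF m] N.conj_inv[of "inv g" m] by (simp add: idem_def \<theta>'_def char_act_def)
  have conv: "(\<Sum>n\<in>N. idem n * idem (inv g \<otimes> (inv n \<otimes> k) \<otimes> g)) = (if g \<in> T then idem k else 0)" if k: "k \<in> N" for k
  proof -
    have "(\<Sum>n\<in>N. idem n * idem (inv g \<otimes> (inv n \<otimes> k) \<otimes> g)) = (\<Sum>n\<in>N. ?c * ?c * (\<theta>' (inv k \<otimes> n) * \<theta> (inv n)))"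
    proof (intro sum.cong refl)
      fix n assume n: "n \<in> N"
      have "idem (inv g \<otimes> (inv n \<otimes> k) \<otimes> g) = ?c * \<theta>' (inv k \<otimes> n)"
        using id'[of "inv n \<otimes> k"] n k by (simp add: inv_mult_group)
      thus "idem n * idem (inv g \<otimes> (inv n \<otimes> k) \<otimes> g) = ?c * ?c * (\<theta>' (inv k \<otimes> n) * \<theta> (inv n))"
        by (simp add: idem_def[of n])
    qed
    also have "\<dots> = (\<Sum>n\<in>N. ?c * ?c * (\<theta>' (inv k \<otimes> inv n) * \<theta> (inv (inv n))))"
      by (rule N.sum_inv[symmetric])
    also have "\<dots> = ?c * ?c * (\<Sum>n\<in>N. \<theta>' (inv k \<otimes> inv n) * \<theta> n)"
      by (simp add: sum_distrib_left)
    also have "\<dots> = (if g \<in> T then ?c * ?c * (of_nat (card N) * \<theta> (inv k) / \<theta> \<one>) else 0)"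
      using N.Irr_convolution[OF \<theta> \<theta>', of "inv k"] k eq by simp
    also have "\<dots> = (if g \<in> T then idem k else 0)"
      using \<theta>_one_nz by (simp add: idem_def)
    finally show ?thesis .
  qed
  have "(\<Sum>n\<in>N. \<Sum>m\<in>N. idem n * idem m * F (n \<otimes> (g \<otimes> m \<otimes> inv g)))
      = (\<Sum>n\<in>N. \<Sum>m\<in>N. idem n * idem (inv g \<otimes> m \<otimes> g) * F (n \<otimes> m))"
  proof (rule sum.cong[OF refl])
    fix n assume n: "n \<in> N"
    have "(\<Sum>m\<in>N. idem n * idem m * F (n \<otimes> (g \<otimes> m \<otimes> inv g))) =
        (\<Sum>m\<in>N. idem n * idem (inv g \<otimes> (g \<otimes> m \<otimes> inv g) \<otimes> g) * F (n \<otimes> (g \<otimes> m \<otimes> inv g)))"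
      using g by (intro sum.cong refl) (simp add: N.conj_cancel NG)
    also have "\<dots> = (\<Sum>m\<in>N. idem n * idem (inv g \<otimes> m \<otimes> g) * F (n \<otimes> m))"
      by (rule N.sum_normalizes[OF normN[OF g]])
    finally show "(\<Sum>m\<in>N. idem n * idem m * F (n \<otimes> (g \<otimes> m \<otimes> inv g))) = (\<Sum>m\<in>N. idem n * idem (inv g \<otimes> m \<otimes> g) * F (n \<otimes> m))" .
  qed
  also have "\<dots> = (\<Sum>n\<in>N. \<Sum>k\<in>N. idem n * idem (inv g \<otimes> (inv n \<otimes> k) \<otimes> g) * F (n \<otimes> (inv n \<otimes> k)))"
    by (rule sum.cong[OF refl], rule N.sum_left[symmetric]) simp
  also have "\<dots> = (\<Sum>k\<in>N. \<Sum>n\<in>N. idem n * idem (inv g \<otimes> (inv n \<otimes> k) \<otimes> g) * F k)"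
    by (subst sum.swap) (intro sum.cong refl, simp)
  also have "\<dots> = (\<Sum>k\<in>N. (\<Sum>n\<in>N. idem n * idem (inv g \<otimes> (inv n \<otimes> k) \<otimes> g)) * F k)"
    by (simp add: sum_distrib_right)
  also have "\<dots> = (\<Sum>k\<in>N. (if g \<in> T then idem k else 0) * F k)"
    by (intro sum.cong refl) (simp only: conv)
  also have "\<dots> = (if g \<in> T then \<Sum>n\<in>N. idem n * F n else 0)" by simp
  finally show ?thesis .
qed

lemma idem_mult: "(\<Sum>n\<in>N. \<Sum>m\<in>N. idem n * idem m * F (n \<otimes> m)) = (\<Sum>n\<in>N. idem n * F n)"
  using idem_conj_mult[OF G.memb(1), of F] T.memb(1) by simp

lemma sum_idem: "(\<Sum>n\<in>N. idem n * F n) = \<theta> \<one> * cinner N F \<theta>"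
  unfolding N.cinner_Irr[OF \<theta>] by (simp add: idem_def sum_distrib_left sum_divide_distrib mult_ac)

text \<open>\<open>T\<close> fixes \<theta>, so the idempotent is central in the group algebra of
  \<open>T\<close> and acts on \<psi> by a scalar \<open>b\<close>. Applying it twice gives
  \<open>b * b = b\<close>, and \<open>b\<close> is nonzero because \<psi> lies over
  \<theta>.\<close>

lemma idem_absorb:
  assumes \<psi>: "\<psi> \<in> Irr \<Gamma> T" and over: "cinner N \<psi> \<theta> \<noteq> 0" and x: "x \<in> T"
  shows "(\<Sum>n\<in>N. idem n * \<psi> (x \<otimes> n)) = \<psi> x"
proof -
  note I = T.irr_funD[OF T.Irr_imp_irr_fun[OF \<psi>]]
  define a where "a = (\<Sum>n\<in>N. idem n * \<psi> n)"
  have a0: "a \<noteq> 0" using over \<theta>_one_nz by (simp add: a_def sum_idem)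
  define b where "b = a / \<psi> \<one>"
  have b0: "b \<noteq> 0" using a0 I(2) by (simp add: b_def)
  have key: "(\<Sum>n\<in>N. idem n * \<psi> (x \<otimes> n)) = b * \<psi> x" if x: "x \<in> T" for x
  proof -
    have "a * \<psi> x = (\<Sum>n\<in>N. idem n * (\<psi> x * \<psi> n))"
      by (simp add: a_def sum_distrib_left sum_distrib_right mult_ac)
    also have "\<dots> = (\<Sum>n\<in>N. idem n * (\<psi> \<one> / of_nat (card T) * (\<Sum>g\<in>T. \<psi> (x \<otimes> g \<otimes> n \<otimes> inv g))))"
      using x NT by (intro sum.cong refl) (simp add: I(3))
    also have "\<dots> = \<psi> \<one> / of_nat (card T) * (\<Sum>g\<in>T. \<Sum>n\<in>N. idem n * \<psi> (x \<otimes> g \<otimes> n \<otimes> inv g))"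
      by (subst sum.swap) (simp add: sum_distrib_left mult_ac)
    also have "(\<Sum>g\<in>T. \<Sum>n\<in>N. idem n * \<psi> (x \<otimes> g \<otimes> n \<otimes> inv g)) = (\<Sum>g\<in>T. \<Sum>n\<in>N. idem n * \<psi> (x \<otimes> n))"
    proof (rule sum.cong[OF refl])
      fix g assume g: "g \<in> T"
      have "(\<Sum>n\<in>N. idem n * \<psi> (x \<otimes> g \<otimes> n \<otimes> inv g)) = (\<Sum>n\<in>N. idem n * \<psi> (x \<otimes> (g \<otimes> n \<otimes> inv g)))"
        using x g by (intro sum.cong refl) (simp add: m_assoc NG TG)
      also have "\<dots> = (\<Sum>n\<in>N. idem n * \<psi> (x \<otimes> n))" by (rule sum_idem_conj[OF g])
      finally show "(\<Sum>n\<in>N. idem n * \<psi> (x \<otimes> g \<otimes> n \<otimes> inv g)) = (\<Sum>n\<in>N. idem n * \<psi> (x \<otimes> n))" .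
    qed
    finally have "a * \<psi> x = \<psi> \<one> * (\<Sum>n\<in>N. idem n * \<psi> (x \<otimes> n))" by simp
    thus ?thesis using I(2) by (simp add: b_def field_simps)
  qed
  have "b * (b * \<psi> \<one>) = b * (\<Sum>n\<in>N. idem n * \<psi> n)"
    using key[OF T.memb(1)] by (simp add: NG)
  also have "\<dots> = (\<Sum>n\<in>N. idem n * (b * \<psi> n))"
    by (simp add: sum_distrib_left mult_ac)
  also have "\<dots> = (\<Sum>n\<in>N. \<Sum>m\<in>N. idem n * idem m * \<psi> (n \<otimes> m))"
    by (intro sum.cong refl) (simp add: key[OF NT, symmetric] sum_distrib_left mult.assoc)
  also have "\<dots> = (\<Sum>n\<in>N. idem n * \<psi> n)" by (rule idem_mult)
  also have "\<dots> = b * \<psi> \<one>" using I(2) by (simp add: b_def a_def)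
  finally have "b = 1" using b0 I(2) by simp
  thus ?thesis using key[OF x] by simp
qed

end

text \<open>The scalar relating \<open>P x * P g * P y * Pinv g\<close> to the value of
  \<open>P\<close> at \<open>x \<otimes> g \<otimes> y \<otimes> inv g\<close>.\<close>

definition tw_cc :: "('g, 'b) monoid_scheme \<Rightarrow> ('g \<Rightarrow> 'g \<Rightarrow> complex) \<Rightarrow> 'g \<Rightarrow> 'g \<Rightarrow> 'g \<Rightarrow> complex" where
  "tw_cc \<Gamma> \<alpha> x g y = \<alpha> x g * \<alpha> (x \<otimes>\<^bsub>\<Gamma>\<^esub> g) y * \<alpha> (x \<otimes>\<^bsub>\<Gamma>\<^esub> g \<otimes>\<^bsub>\<Gamma>\<^esub> y) (inv\<^bsub>\<Gamma>\<^esub> g) / \<alpha> g (inv\<^bsub>\<Gamma>\<^esub> g)"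

text \<open>A function on \<open>T/N\<close>; the value 0 off \<open>T\<close> makes it unique on
  the ambient group. Invariance from the right follows from normality of \<open>N\<close>.\<close>

definition coset_fun :: "('g, 'b) monoid_scheme \<Rightarrow> 'g set \<Rightarrow> 'g set \<Rightarrow> ('g \<Rightarrow> complex) \<Rightarrow> bool" where
  "coset_fun \<Gamma> T N q \<longleftrightarrow> (\<forall>x. x \<notin> T \<longrightarrow> q x = 0) \<and> (\<forall>n\<in>N. \<forall>x\<in>T. q (n \<otimes>\<^bsub>\<Gamma>\<^esub> x) = q x)"

text \<open>The functional equation of the trace of an irreducible projective representation of \<open>T/N\<close>
  with factor set inverse to \<open>\<alpha>\<close>; for trivial \<open>\<alpha>\<close>
    and \<open>N\<close> it reduces to \<open>irr_fun\<close>.\<close>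
definition tw_fun :: "('g, 'b) monoid_scheme \<Rightarrow> 'g set \<Rightarrow> 'g set \<Rightarrow> ('g \<Rightarrow> 'g \<Rightarrow> complex) \<Rightarrow> ('g \<Rightarrow> complex) \<Rightarrow> bool" where
  "tw_fun \<Gamma> T N \<alpha> q \<longleftrightarrow> coset_fun \<Gamma> T N q \<and> (\<exists>r::real. r > 0 \<and> q \<one>\<^bsub>\<Gamma>\<^esub> = of_real r) \<and>
     (\<forall>x\<in>T. \<forall>y\<in>T. q x * q y = q \<one>\<^bsub>\<Gamma>\<^esub> / of_nat (card T) *
        (\<Sum>g\<in>T. q (x \<otimes>\<^bsub>\<Gamma>\<^esub> g \<otimes>\<^bsub>\<Gamma>\<^esub> y \<otimes>\<^bsub>\<Gamma>\<^esub> inv\<^bsub>\<Gamma>\<^esub> g) / tw_cc \<Gamma> \<alpha> x g y)) \<and>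
     (\<Sum>g\<in>T. \<alpha> g (inv\<^bsub>\<Gamma>\<^esub> g) * (q g * q (inv\<^bsub>\<Gamma>\<^esub> g))) = of_nat (card T)"

section \<open>Factorization of characters over \<theta>\<close>

context projchar
begin

lemma conjT_N: "t \<in> T \<Longrightarrow> n \<in> N \<Longrightarrow> t \<otimes> n \<otimes> inv t \<in> N" "t \<in> T \<Longrightarrow> n \<in> N \<Longrightarrow> inv t \<otimes> n \<otimes> t \<in> N"
  using conjN conjN' TG by auto

lemma right_as_left: "t \<in> T \<Longrightarrow> n \<in> N \<Longrightarrow> t \<otimes> n = (t \<otimes> n \<otimes> inv t) \<otimes> t"
  by (simp add: m_assoc NG TG)

lemma left_as_right: "t \<in> T \<Longrightarrow> n \<in> N \<Longrightarrow> n \<otimes> t = t \<otimes> (inv t \<otimes> n \<otimes> t)"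
  by (simp add: m_assoc NG TG)

text \<open>\<open>P\<close> is strictly multiplicative when one factor lies in \<open>N\<close>, so
  the factor set depends only on cosets of \<open>N\<close>. With the variants below, twisted sums
  can be taken over \<open>T\<close> in place of \<open>T/N\<close>.\<close>

lemma \<alpha>_left: assumes "n \<in> N" "x \<in> T" "y \<in> T" shows "\<alpha> (n \<otimes> x) y = \<alpha> x y"
proof -
  have nT: "n \<in> T" using assms NT by simp
  have "\<alpha> (n \<otimes> x) y \<cdot>\<^sub>m P (n \<otimes> (x \<otimes> y)) = P (n \<otimes> x) * P y"
    using P_mult[of "n \<otimes> x" y] assms nT by (simp add: m_assoc)
  also have "\<dots> = P n * (P x * P y)" using assms nT by (simp add: P_left assoc_mult_mat[of _ d d _ d _ d])
  also have "\<dots> = \<alpha> x y \<cdot>\<^sub>m (P n * P (x \<otimes> y))"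
    unfolding P_mult[OF assms(2,3)] using assms nT by (intro mult_smult_distrib[of _ d d _ d]) auto
  also have "P n * P (x \<otimes> y) = P (n \<otimes> (x \<otimes> y))" using P_left[of n "x \<otimes> y"] assms by simp
  finally show ?thesis using smult_P_eq_iff[of "n \<otimes> (x \<otimes> y)"] assms nT by simp
qed

lemma \<alpha>_right: assumes "n \<in> N" "x \<in> T" "y \<in> T" shows "\<alpha> x (y \<otimes> n) = \<alpha> x y"
proof -
  have nT: "n \<in> T" using assms NT by simp
  have "\<alpha> x (y \<otimes> n) \<cdot>\<^sub>m P (x \<otimes> y \<otimes> n) = P x * P (y \<otimes> n)"
    using P_mult[of x "y \<otimes> n"] assms nT by (simp add: m_assoc)
  also have "\<dots> = (P x * P y) * P n" using assms nT by (simp add: P_right assoc_mult_mat[of _ d d _ d _ d])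
  also have "\<dots> = \<alpha> x y \<cdot>\<^sub>m (P (x \<otimes> y) * P n)"
    unfolding P_mult[OF assms(2,3)] using assms nT by (intro mult_smult_assoc_mat[of _ d d _ d]) auto
  also have "P (x \<otimes> y) * P n = P (x \<otimes> y \<otimes> n)" using P_right[of n "x \<otimes> y"] assms by simp
  finally show ?thesis using smult_P_eq_iff[of "x \<otimes> y \<otimes> n"] assms nT by simp
qed

lemma \<alpha>_left': assumes "n \<in> N" "x \<in> T" "y \<in> T" shows "\<alpha> (x \<otimes> n) y = \<alpha> x y"
  by (subst right_as_left[OF assms(2,1)]) (intro \<alpha>_left conjT_N assms)

lemma \<alpha>_right': assumes "n \<in> N" "x \<in> T" "y \<in> T" shows "\<alpha> x (n \<otimes> y) = \<alpha> x y"
  by (subst left_as_right[OF assms(3,1)]) (intro \<alpha>_right conjT_N assms)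

lemma tw_cc_P:
  assumes x: "x \<in> T" and g: "g \<in> T" and y: "y \<in> T"
  shows "P x * P g * P y * Pinv g = tw_cc \<Gamma> \<alpha> x g y \<cdot>\<^sub>m P (x \<otimes> g \<otimes> y \<otimes> inv g)"
proof -
  have 1: "P x * P g * P y = (\<alpha> x g * \<alpha> (x \<otimes> g) y) \<cdot>\<^sub>m P (x \<otimes> g \<otimes> y)"
    using x g y by (simp add: P_mult mult_smult_assoc_mat[of _ d d _ d]) (intro eq_matI, auto)
  have 2: "P (x \<otimes> g \<otimes> y) * P (inv g) = \<alpha> (x \<otimes> g \<otimes> y) (inv g) \<cdot>\<^sub>m P (x \<otimes> g \<otimes> y \<otimes> inv g)"
    using x g y by (intro P_mult) auto
  have "P x * P g * P y * Pinv g = (\<alpha> x g * \<alpha> (x \<otimes> g) y) \<cdot>\<^sub>m ((1 / \<alpha> g (inv g)) \<cdot>\<^sub>m (P (x \<otimes> g \<otimes> y) * P (inv g)))"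
    unfolding 1 Pinv_def using x g y
    by (simp add: mult_smult_assoc_mat[of _ d d _ d] mult_smult_distrib[of _ d d _ d]) (intro eq_matI, auto)
  also have "\<dots> = tw_cc \<Gamma> \<alpha> x g y \<cdot>\<^sub>m P (x \<otimes> g \<otimes> y \<otimes> inv g)"
    unfolding 2 by (intro eq_matI) (auto simp: tw_cc_def)
  finally show ?thesis .
qed

lemma tw_cc_nz: "x \<in> T \<Longrightarrow> g \<in> T \<Longrightarrow> y \<in> T \<Longrightarrow> tw_cc \<Gamma> \<alpha> x g y \<noteq> 0"
  by (simp add: tw_cc_def)

lemma tw_cc_1: assumes "n \<in> N" "x \<in> T" "g \<in> T" "y \<in> T"
  shows "tw_cc \<Gamma> \<alpha> (n \<otimes> x) g y = tw_cc \<Gamma> \<alpha> x g y"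
proof -
  have "n \<in> T" using assms NT by simp
  thus ?thesis using assms \<alpha>_left[of n x g] \<alpha>_left[of n "x \<otimes> g" y] \<alpha>_left[of n "x \<otimes> g \<otimes> y" "inv g"]
    by (simp add: tw_cc_def m_assoc)
qed

lemma tw_cc_3: assumes "n \<in> N" "x \<in> T" "g \<in> T" "y \<in> T"
  shows "tw_cc \<Gamma> \<alpha> x g (n \<otimes> y) = tw_cc \<Gamma> \<alpha> x g y"
proof -
  have nT: "n \<in> T" using assms NT by simp
  define n' where "n' = (x \<otimes> g) \<otimes> n \<otimes> inv (x \<otimes> g)"
  have n': "n' \<in> N" unfolding n'_def using assms by (intro conjT_N) auto
  have e: "x \<otimes> g \<otimes> (n \<otimes> y) = n' \<otimes> (x \<otimes> g \<otimes> y)" unfolding n'_def using assms nT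
    by (simp add: m_assoc inv_mult_group)
  show ?thesis unfolding tw_cc_def e using assms n' by (simp add: \<alpha>_left \<alpha>_right')
qed

lemma tw_cc_2: assumes "n \<in> N" "x \<in> T" "g \<in> T" "y \<in> T"
  shows "tw_cc \<Gamma> \<alpha> x (g \<otimes> n) y = tw_cc \<Gamma> \<alpha> x g y"
proof -
  have nT: "n \<in> T" using assms NT by simp
  define n' where "n' = inv y \<otimes> n \<otimes> y"
  have n': "n' \<in> N" unfolding n'_def using assms by (intro conjT_N) auto
  have e: "x \<otimes> (g \<otimes> n) = (x \<otimes> g) \<otimes> n" "(x \<otimes> g) \<otimes> n \<otimes> y = (x \<otimes> g \<otimes> y) \<otimes> n'"
    unfolding n'_def using assms nT by (simp_all add: m_assoc)
  have i: "inv (g \<otimes> n) = inv n \<otimes> inv g" using assms nT by (simp add: inv_mult_group)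
  show ?thesis unfolding tw_cc_def e i using assms n' nT by (simp add: \<alpha>_left' \<alpha>_right \<alpha>_right')
qed

lemma coset_fun_right:
  assumes q: "coset_fun \<Gamma> T N q" and "n \<in> N" "x \<in> T"
  shows "q (x \<otimes> n) = q x"
  using q conjT_N(1)[OF assms(3,2)] assms(3) right_as_left[OF assms(3,2)] by (metis coset_fun_def)

lemma coset_fun_mid:
  assumes q: "coset_fun \<Gamma> T N q" and n: "n \<in> N" and xy: "x \<in> T" "y \<in> T"
  shows "q (x \<otimes> n \<otimes> y) = q (x \<otimes> y)"
proof -
  have nT: "n \<in> T" using n NT by simp
  have "x \<otimes> n \<otimes> y = (x \<otimes> n \<otimes> inv x) \<otimes> (x \<otimes> y)" using xy nT by (simp add: m_assoc)
  thus ?thesis using q conjT_N(1)[OF xy(1) n] xy by (simp add: coset_fun_def)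
qed

definition twF :: "('a \<Rightarrow> complex) \<Rightarrow> 'a \<Rightarrow> 'a \<Rightarrow> 'a \<Rightarrow> complex" where
  "twF q x y g = q (x \<otimes> g \<otimes> y \<otimes> inv g) / tw_cc \<Gamma> \<alpha> x g y"

text \<open>Constancy on cosets in \<open>g\<close> permits averaging over \<open>N\<close> in
  \<open>FE_sum\<close>, and later the comparison of sums over \<open>T\<close> with sums over its
  intersection with \<open>H\<close>.\<close>

lemma twF_g:
  assumes q: "coset_fun \<Gamma> T N q" and n: "n \<in> N" and xy: "x \<in> T" "y \<in> T" "g \<in> T"
  shows "twF q x y (g \<otimes> n) = twF q x y g" "twF q x y (n \<otimes> g) = twF q x y g"
proof -
  have r: "twF q x y (g \<otimes> n) = twF q x y g" if n: "n \<in> N" for n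
  proof -
    have nT: "n \<in> T" using n NT by simp
    have e: "x \<otimes> (g \<otimes> n) \<otimes> y \<otimes> inv (g \<otimes> n) = (x \<otimes> g) \<otimes> n \<otimes> (y \<otimes> (inv n \<otimes> inv g))"
      using xy nT by (simp add: m_assoc inv_mult_group)
    have "q (x \<otimes> (g \<otimes> n) \<otimes> y \<otimes> inv (g \<otimes> n)) = q ((x \<otimes> g) \<otimes> (y \<otimes> (inv n \<otimes> inv g)))"
      unfolding e using xy nT by (intro coset_fun_mid[OF q n]) auto
    also have "(x \<otimes> g) \<otimes> (y \<otimes> (inv n \<otimes> inv g)) = (x \<otimes> g \<otimes> y) \<otimes> inv n \<otimes> inv g"
      using xy nT by (simp add: m_assoc)
    also have "q \<dots> = q (x \<otimes> g \<otimes> y \<otimes> inv g)"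
      using xy n by (intro coset_fun_mid[OF q]) auto
    finally show ?thesis using tw_cc_2[OF n xy(1,3,2)] by (simp add: twF_def)
  qed
  show "twF q x y (g \<otimes> n) = twF q x y g" by (rule r[OF n])
  show "twF q x y (n \<otimes> g) = twF q x y g"
    by (subst left_as_right[OF xy(3) n]) (rule r[OF conjT_N(2)[OF xy(3) n]])
qed

lemma twF_xy:
  assumes q: "coset_fun \<Gamma> T N q" and n: "n \<in> N" "m \<in> N" and xy: "x \<in> T" "y \<in> T" "g \<in> T"
  shows "twF q (n \<otimes> x) (m \<otimes> y) g = twF q x y g"
proof -
  have nT: "n \<in> T" "m \<in> T" using n NT by auto
  have "n \<otimes> x \<otimes> g \<otimes> (m \<otimes> y) \<otimes> inv g = n \<otimes> ((x \<otimes> g) \<otimes> m \<otimes> (y \<otimes> inv g))"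
    using nT xy by (simp add: m_assoc)
  hence "q (n \<otimes> x \<otimes> g \<otimes> (m \<otimes> y) \<otimes> inv g) = q ((x \<otimes> g) \<otimes> m \<otimes> (y \<otimes> inv g))"
    using q n nT xy by (simp add: coset_fun_def)
  also have "\<dots> = q ((x \<otimes> g) \<otimes> (y \<otimes> inv g))" using n xy by (intro coset_fun_mid[OF q]) auto
  finally have "q (n \<otimes> x \<otimes> g \<otimes> (m \<otimes> y) \<otimes> inv g) = q (x \<otimes> g \<otimes> y \<otimes> inv g)" using xy by (simp add: m_assoc)
  thus ?thesis using n nT xy by (simp add: twF_def tw_cc_1 tw_cc_3)
qed

lemma sum_T_avg_N: "(\<Sum>g\<in>T. f g) = (\<Sum>g\<in>T. \<Sum>n\<in>N. f (g \<otimes> n)) / (of_nat (card N) :: complex)"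
proof -
  have "(\<Sum>g\<in>T. \<Sum>n\<in>N. f (g \<otimes> n)) = (\<Sum>n\<in>N. \<Sum>g\<in>T. f (g \<otimes> n))" by (rule sum.swap)
  also have "\<dots> = (\<Sum>n\<in>N. \<Sum>g\<in>T. f g)" using NT by (intro sum.cong refl T.sum_right) auto
  finally show ?thesis by simp
qed

lemma Pinv_mult_N: assumes "g \<in> T" "n \<in> N" shows "Pinv (g \<otimes> n) = P (inv n) * Pinv g"
proof -
  have nT: "n \<in> T" "inv n \<in> T" using assms NT by auto
  have 1: "P (g \<otimes> n) * (P (inv n) * Pinv g) = 1\<^sub>m d"
    unfolding P_right[OF assms(2,1)]
    by (rule inverse_mult) (use assms nT N.repD(4)[OF P_repN assms(2)] P_Pinv in auto)
  have "Pinv (g \<otimes> n) = Pinv (g \<otimes> n) * (P (g \<otimes> n) * (P (inv n) * Pinv g))"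
    unfolding 1 using assms nT by (simp add: right_mult_one_mat[of _ d d])
  also have "\<dots> = (Pinv (g \<otimes> n) * P (g \<otimes> n)) * (P (inv n) * Pinv g)"
    using assms nT by (simp add: assoc_mult_mat[of _ d d _ d _ d])
  also have "\<dots> = P (inv n) * Pinv g"
    using assms nT P_Pinv(2)[of "g \<otimes> n"] by (simp add: left_mult_one_mat[of _ d d])
  finally show ?thesis .
qed

text \<open>When \<open>g\<close> is replaced by \<open>g \<otimes> n\<close> and \<open>n\<close>
  averaged over \<open>N\<close>, \<open>trace_avg\<close> turns the trace of the product into
  \<open>mtrace (P x) * mtrace (P y) / d\<close>, which does not depend on \<open>g\<close>. An
  equation for trace times \<open>q\<close> thereby becomes one for \<open>q\<close> alone.\<close>

lemma FE_sum:
  assumes q: "coset_fun \<Gamma> T N q" and x: "x \<in> T" and y: "y \<in> T"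
  shows "(\<Sum>g\<in>T. mtrace (P (x \<otimes> g \<otimes> y \<otimes> inv g)) * q (x \<otimes> g \<otimes> y \<otimes> inv g))
     = mtrace (P x) * mtrace (P y) / of_nat d * (\<Sum>g\<in>T. twF q x y g)"
proof -
  define f where "f g = mtrace (P (x \<otimes> g \<otimes> y \<otimes> inv g)) * q (x \<otimes> g \<otimes> y \<otimes> inv g)"
    for g
  have f: "f g = twF q x y g * mtrace (P x * P g * P y * Pinv g)" if g: "g \<in> T" for g
    using tw_cc_nz[OF x g y] x y g by (simp add: f_def twF_def tw_cc_P[OF x g y] mtrace_smult[of _ d])
  have inner: "(\<Sum>n\<in>N. f (g \<otimes> n)) = of_nat (card N) * (mtrace (P x) * mtrace (P y) / of_nat d * twF q x y g)"
    if g: "g \<in> T" for g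
  proof -
    have "(\<Sum>n\<in>N. f (g \<otimes> n)) = (\<Sum>n\<in>N. twF q x y g * mtrace ((Pinv g * P x * P g) * (P n * P y * P (inv n))))"
    proof (intro sum.cong refl)
      fix n assume n: "n \<in> N"
      have nT: "n \<in> T" "inv n \<in> T" using n NT by auto
      have "P x * P (g \<otimes> n) * P y * Pinv (g \<otimes> n) = (P x * P g * (P n * P y * P (inv n))) * Pinv g"
        unfolding P_right[OF n g] Pinv_mult_N[OF g n] using x y g nT by (simp add: assoc_mult_mat[of _ d d _ d _ d])
      hence "mtrace (P x * P (g \<otimes> n) * P y * Pinv (g \<otimes> n)) = mtrace (Pinv g * (P x * P g * (P n * P y * P (inv n))))"
        using x y g nT by (simp add: mtrace_mult_comm[of _ d d])
      also have "Pinv g * (P x * P g * (P n * P y * P (inv n))) = (Pinv g * P x * P g) * (P n * P y * P (inv n))"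
        using x y g nT by (simp add: assoc_mult_mat[of _ d d _ d _ d])
      finally show "f (g \<otimes> n) = twF q x y g * mtrace ((Pinv g * P x * P g) * (P n * P y * P (inv n)))"
        using f[of "g \<otimes> n"] g nT twF_g(1)[OF q n x y g] by simp
    qed
    also have "\<dots> = twF q x y g * (of_nat (card N) / of_nat d * (mtrace (Pinv g * P x * P g) * mtrace (P y)))"
      unfolding sum_distrib_left[symmetric] using x y g by (subst trace_avg) auto
    also have "mtrace (Pinv g * P x * P g) = mtrace (P x)"
      using x g P_Pinv[OF g] by (intro mtrace_conj[of _ d]) auto
    finally show ?thesis by (simp add: mult_ac)
  qed
  have "(\<Sum>g\<in>T. f g) = (\<Sum>g\<in>T. of_nat (card N) * (mtrace (P x) * mtrace (P y) / of_nat d * twF q x y g)) / of_nat (card N)"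
    unfolding sum_T_avg_N[of f] using inner by simp
  also have "\<dots> = mtrace (P x) * mtrace (P y) / of_nat d * (\<Sum>g\<in>T. twF q x y g)"
    unfolding sum_distrib_left[symmetric] by simp
  finally show ?thesis by (simp add: f_def)
qed

text \<open>Averaging over \<open>N\<close> once more, \<open>fourier_trace\<close> evaluates the
  mean of the product of the traces at \<open>g \<otimes> n\<close> and at its inverse: up to the
  factor \<open>\<alpha> g (inv g)\<close> it is
  \<open>mtrace (P g * Pinv g) / d = 1\<close>.\<close>

lemma norm_sum:
  assumes q: "coset_fun \<Gamma> T N q"
  shows "(\<Sum>g\<in>T. (mtrace (P g) * q g) * (mtrace (P (inv g)) * q (inv g))) = (\<Sum>g\<in>T. \<alpha> g (inv g) * (q g * q (inv g)))"
proof -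
  define f where "f g = (mtrace (P g) * q g) * (mtrace (P (inv g)) * q (inv g))" for g
  have inner: "(\<Sum>n\<in>N. f (g \<otimes> n)) = of_nat (card N) * (\<alpha> g (inv g) * (q g * q (inv g)))" if g: "g \<in> T"
    for g
  proof -
    have "(\<Sum>n\<in>N. f (g \<otimes> n)) = (\<Sum>n\<in>N. \<alpha> g (inv g) * (q g * q (inv g)) * (mtrace (P g * P n) * mtrace (P (inv n) * Pinv g)))"
    proof (intro sum.cong refl)
      fix n assume n: "n \<in> N"
      have nT: "n \<in> T" "inv n \<in> T" using n NT by auto
      have i: "inv (g \<otimes> n) = inv n \<otimes> inv g" using g nT by (simp add: inv_mult_group)
      have "\<alpha> (g \<otimes> n) (inv (g \<otimes> n)) = \<alpha> g (inv g)" unfolding i using g n nT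
        by (simp add: \<alpha>_left' \<alpha>_right')
      hence "mtrace (P (inv (g \<otimes> n))) = \<alpha> g (inv g) * mtrace (P (inv n) * Pinv g)"
        using P_inv_eq[of "g \<otimes> n"] g nT Pinv_mult_N[OF g n] by (simp add: mtrace_smult[of _ d])
      moreover have "q (g \<otimes> n) = q g" by (rule coset_fun_right[OF q n g])
      moreover have "q (inv (g \<otimes> n)) = q (inv g)" unfolding i using q n g by (simp add: coset_fun_def)
      ultimately show "f (g \<otimes> n) = \<alpha> g (inv g) * (q g * q (inv g)) * (mtrace (P g * P n) * mtrace (P (inv n) * Pinv g))"
        by (simp add: f_def P_right[OF n g])
    qed
    also have "\<dots> = \<alpha> g (inv g) * (q g * q (inv g)) * (of_nat (card N) / of_nat d * mtrace (P g * Pinv g))"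
      unfolding sum_distrib_left[symmetric] using g by (subst fourier_trace) auto
    also have "mtrace (P g * Pinv g) = of_nat d" using P_Pinv[OF g] by simp
    finally show ?thesis using d_pos by simp
  qed
  have "(\<Sum>g\<in>T. f g) = (\<Sum>g\<in>T. of_nat (card N) * (\<alpha> g (inv g) * (q g * q (inv g)))) / of_nat (card N)"
    unfolding sum_T_avg_N[of f] using inner by simp
  also have "\<dots> = (\<Sum>g\<in>T. \<alpha> g (inv g) * (q g * q (inv g)))"
    unfolding sum_distrib_left[symmetric] by simp
  finally show ?thesis by (simp add: f_def)
qed

lemma exists_left_trace_nz: "x \<in> T \<Longrightarrow> \<exists>n\<in>N. mtrace (P (n \<otimes> x)) \<noteq> 0"
proof -
  assume x: "x \<in> T"
  from exists_trace_nz[OF P_carr[OF x] P_nz[OF x]] obtain n where n: "n \<in> N" "mtrace (P x * P n) \<noteq> 0" by blast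
  have "x \<otimes> n = (x \<otimes> n \<otimes> inv x) \<otimes> x" by (rule right_as_left[OF x n(1)])
  thus ?thesis using n conjT_N(1)[OF x n(1)] P_right[OF n(1) x] by metis
qed

text \<open>Each coset contains an element with nonzero trace, where the trace can be
  cancelled.\<close>

lemma coset_fun_unique:
  assumes q: "coset_fun \<Gamma> T N q" and q': "coset_fun \<Gamma> T N q'"
    and e: "\<And>x. x \<in> T \<Longrightarrow> mtrace (P x) * q x = mtrace (P x) * q' x"
  shows "q = q'"
proof
  fix x
  show "q x = q' x"
  proof (cases "x \<in> T")
    case True
    from exists_left_trace_nz[OF True] obtain n where n: "n \<in> N" "mtrace (P (n \<otimes> x)) \<noteq> 0" by blast
    have "q (n \<otimes> x) = q' (n \<otimes> x)" using e[of "n \<otimes> x"] n NT True by simp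
    thus ?thesis using q q' n True by (simp add: coset_fun_def)
  next
    case False thus ?thesis using q q' by (simp add: coset_fun_def)
  qed
qed

lemma tw_fun_imp_Irr:
  assumes q: "tw_fun \<Gamma> T N \<alpha> q"
  shows "(\<lambda>x. mtrace (P x) * q x) \<in> Irr \<Gamma> T" "cinner N (\<lambda>x. mtrace (P x) * q x) \<theta> \<noteq> 0"
proof -
  let ?f = "\<lambda>x. mtrace (P x) * q x"
  have c: "coset_fun \<Gamma> T N q" using q by (simp add: tw_fun_def)
  from q obtain r :: real where r: "r > 0" "q \<one> = of_real r" by (auto simp: tw_fun_def)
  have f1: "?f \<one> = of_nat d * q \<one>" using P_one by simp
  have "?f x * ?f y = ?f \<one> / of_nat (card T) * (\<Sum>g\<in>T. ?f (x \<otimes> g \<otimes> y \<otimes> inv g))"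
    if xy: "x \<in> T" "y \<in> T" for x y
  proof -
    have "q x * q y = q \<one> / of_nat (card T) * (\<Sum>g\<in>T. twF q x y g)"
      using q xy by (simp add: tw_fun_def twF_def)
    moreover have "?f x * ?f y = mtrace (P x) * mtrace (P y) * (q x * q y)" by simp
    ultimately have "?f x * ?f y = mtrace (P x) * mtrace (P y) * (q \<one> / of_nat (card T) * (\<Sum>g\<in>T. twF q x y g))"
      by (simp only:)
    also have "\<dots> = ?f \<one> / of_nat (card T) * (mtrace (P x) * mtrace (P y) / of_nat d * (\<Sum>g\<in>T. twF q x y g))"
      unfolding f1 using d_pos by simp
    finally show ?thesis unfolding FE_sum[OF c xy] .
  qed
  moreover have "(\<Sum>x\<in>T. ?f x * ?f (inv x)) = of_nat (card T)"
    using q unfolding norm_sum[OF c] tw_fun_def by blast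
  moreover have "\<exists>s::real. s > 0 \<and> ?f \<one> = of_real s"
    using f1 r d_pos by (intro exI[of _ "real d * r"]) simp
  ultimately show "?f \<in> Irr \<Gamma> T" unfolding T.Irr_iff irr_fun_def using c by (auto simp: coset_fun_def)
  have "?f n = q \<one> * \<theta> n" if n: "n \<in> N" for n
    using c n T.memb(1) \<theta>_trace[OF n] NG[OF n] unfolding coset_fun_def by (metis G.carr mult.commute r_one)
  hence "cinner N ?f \<theta> = q \<one> * cinner N \<theta> \<theta>"
    by (simp add: cinner_def sum_distrib_left mult.assoc)
  also have "\<dots> = q \<one>" using N.cinner_Irr[OF \<theta>] N.irr_funD(4)[OF N.Irr_imp_irr_fun[OF \<theta>]] by simp
  finally show "cinner N ?f \<theta> \<noteq> 0" using r by simp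
qed

text \<open>Fourier inversion builds the matrix \<open>X t\<close> with
  \<open>mtrace (X t * P m) = \<psi> (t \<otimes> m)\<close>. Because \<psi> is a class function,
  \<open>X t\<close> satisfies the hypothesis of \<open>twisted_schur\<close> and is a multiple
  \<open>q t\<close> of \<open>P t\<close>; taking \<open>m = \<one>\<close> gives the
  factorization.\<close>

lemma Irr_over_factor:
  assumes \<psi>: "\<psi> \<in> Irr \<Gamma> T" and over: "cinner N \<psi> \<theta> \<noteq> 0"
  shows "\<exists>q. coset_fun \<Gamma> T N q \<and> \<psi> = (\<lambda>x. mtrace (P x) * q x)"
proof -
  note I = T.irr_funD[OF T.Irr_imp_irr_fun[OF \<psi>]]
  define X where "X t = msum d N (\<lambda>n. (of_nat d / of_nat (card N) * \<psi> (t \<otimes> n)) \<cdot>\<^sub>m P (inv n))"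
    for t
  have Xc: "X t \<in> carrier_mat d d" for t by (simp add: X_def)
  have cN: "n \<in> N \<Longrightarrow> P n \<in> carrier_mat d d" for n using NT by simp
  have Xtr: "mtrace (X t * P m) = \<psi> (t \<otimes> m)" if t: "t \<in> T" and m: "m \<in> N" for t m
  proof -
    have "X t * P m = msum d N (\<lambda>n. ((of_nat d / of_nat (card N) * \<psi> (t \<otimes> n)) \<cdot>\<^sub>m P (inv n)) * P m)"
      unfolding X_def using cN m by (intro msum_mult_right) auto
    also have "mtrace \<dots> = (\<Sum>n\<in>N. mtrace (((of_nat d / of_nat (card N) * \<psi> (t \<otimes> n)) \<cdot>\<^sub>m P (inv n)) * P m))"
      using cN m by (intro mtrace_msum) auto
    also have "\<dots> = (\<Sum>n\<in>N. \<psi> (t \<otimes> n) * idem (inv m \<otimes> n))"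
    proof (intro sum.cong refl)
      fix n assume n: "n \<in> N"
      have "((of_nat d / of_nat (card N) * \<psi> (t \<otimes> n)) \<cdot>\<^sub>m P (inv n)) * P m = (of_nat d / of_nat (card N) * \<psi> (t \<otimes> n)) \<cdot>\<^sub>m P (inv n \<otimes> m)"
        using cN n m by (simp add: mult_smult_assoc_mat[of _ d d _ d] N.repD(3)[OF P_repN])
      moreover have "mtrace (P (inv n \<otimes> m)) = \<theta> (inv (inv m \<otimes> n))"
        using n m by (simp add: \<theta>_trace inv_mult_group)
      ultimately show "mtrace (((of_nat d / of_nat (card N) * \<psi> (t \<otimes> n)) \<cdot>\<^sub>m P (inv n)) * P m) = \<psi> (t \<otimes> n) * idem (inv m \<otimes> n)"
        using cN n m by (simp add: idem_def mtrace_smult[of _ d] \<theta>_one)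
    qed
    also have "\<dots> = (\<Sum>n\<in>N. \<psi> (t \<otimes> (m \<otimes> n)) * idem (inv m \<otimes> (m \<otimes> n)))"
      by (rule N.sum_left[OF m, symmetric])
    also have "\<dots> = (\<Sum>n\<in>N. idem n * \<psi> ((t \<otimes> m) \<otimes> n))"
      using t m by (intro sum.cong refl) (simp add: m_assoc NG TG mult.commute)
    also have "\<dots> = \<psi> (t \<otimes> m)" using t NT[OF m] by (intro idem_absorb[OF \<psi> over]) auto
    finally show ?thesis .
  qed
  have "\<exists>c. X t = c \<cdot>\<^sub>m P t" if t: "t \<in> T" for t
  proof (rule twisted_schur[OF Xc t])
    fix m assume m: "m \<in> N"
    define m' where "m' = t \<otimes> m \<otimes> inv t"
    have m': "m' \<in> N" unfolding m'_def by (rule conjT_N(1)[OF t m])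
    let ?a = "\<lambda>n. of_nat d / of_nat (card N) * \<psi> (t \<otimes> n)"
    show "X t * P m = P (t \<otimes> m \<otimes> inv t) * X t"
      unfolding m'_def[symmetric]
    proof (rule eq_matI)
      fix i j assume "i < dim_row (P m' * X t)" "j < dim_col (P m' * X t)"
      hence ij: "i < d" "j < d" using cN[OF m'] Xc[of t] by auto
      have s1: "X t * P m = msum d N (\<lambda>n. (?a n \<cdot>\<^sub>m P (inv n)) * P m)"
        unfolding X_def using cN m by (intro msum_mult_right) auto
      have s2: "P m' * X t = msum d N (\<lambda>n. P m' * (?a n \<cdot>\<^sub>m P (inv n)))"
        unfolding X_def using cN m' by (intro msum_mult_left) auto
      have "(X t * P m) $$ (i,j) = (\<Sum>n\<in>N. ?a n * P (inv (inv m \<otimes> n)) $$ (i,j))"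
      proof -
        have "((?a n \<cdot>\<^sub>m P (inv n)) * P m) $$ (i,j) = ?a n * P (inv (inv m \<otimes> n)) $$ (i,j)" if n: "n \<in> N"
          for n
        proof -
          have "(?a n \<cdot>\<^sub>m P (inv n)) * P m = ?a n \<cdot>\<^sub>m P (inv (inv m \<otimes> n))"
            using n m cN by (simp add: mult_smult_assoc_mat[of _ d d _ d] N.repD(3)[OF P_repN, symmetric] inv_mult_group)
          thus ?thesis using cN[of "inv (inv m \<otimes> n)"] n m ij by simp
        qed
        thus ?thesis unfolding s1 using ij by (simp del: index_mult_mat(1))
      qed
      also have "\<dots> = (\<Sum>n\<in>N. ?a (m \<otimes> n) * P (inv (inv m \<otimes> (m \<otimes> n))) $$ (i,j))"
        by (rule N.sum_left[OF m, symmetric])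
      \<comment> \<open>\<open>t \<otimes> m\<close> equals \<open>m' \<otimes> t\<close>, and the
        class function \<psi> allows \<open>m'\<close> to be moved to the right end.\<close>
      also have "\<dots> = (\<Sum>n\<in>N. ?a (n \<otimes> m') * P (inv ((n \<otimes> m') \<otimes> inv m')) $$ (i,j))"
      proof (intro sum.cong refl)
        fix n assume n: "n \<in> N"
        have tn: "t \<otimes> n \<in> T" "m' \<in> T" using t NT[OF n] NT[OF m'] by auto
        have "t \<otimes> (m \<otimes> n) = m' \<otimes> (t \<otimes> n)" using t m n by (simp add: m'_def m_assoc NG TG)
        also have "\<psi> \<dots> = \<psi> ((t \<otimes> n) \<otimes> m')"
          by (rule T.irr_fun_comm[OF T.Irr_imp_irr_fun[OF \<psi>] tn(2,1)])
        finally have "\<psi> (t \<otimes> (m \<otimes> n)) = \<psi> (t \<otimes> (n \<otimes> m'))" using t n m'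
          by (simp add: m_assoc NG TG)
        moreover have "inv m \<otimes> (m \<otimes> n) = n" "(n \<otimes> m') \<otimes> inv m' = n" using n m m'
          by (simp_all add: m_assoc NG)
        ultimately show "?a (m \<otimes> n) * P (inv (inv m \<otimes> (m \<otimes> n))) $$ (i,j) = ?a (n \<otimes> m') * P (inv ((n \<otimes> m') \<otimes> inv m')) $$ (i,j)"
          by simp
      qed
      also have "\<dots> = (\<Sum>n\<in>N. ?a n * P (inv (n \<otimes> inv m')) $$ (i,j))" by (rule N.sum_right[OF m'])
      also have "\<dots> = (P m' * X t) $$ (i,j)"
      proof -
        have "(P m' * (?a n \<cdot>\<^sub>m P (inv n))) $$ (i,j) = ?a n * P (inv (n \<otimes> inv m')) $$ (i,j)" if n: "n \<in> N"
          for n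
        proof -
          have "P m' * (?a n \<cdot>\<^sub>m P (inv n)) = ?a n \<cdot>\<^sub>m P (inv (n \<otimes> inv m'))"
            using n m' cN by (simp add: mult_smult_distrib[of _ d d _ d] N.repD(3)[OF P_repN, symmetric] inv_mult_group)
          thus ?thesis using cN[of "inv (n \<otimes> inv m')"] n m' ij by simp
        qed
        thus ?thesis unfolding s2 using ij by (simp del: index_mult_mat(1))
      qed
      finally show "(X t * P m) $$ (i,j) = (P m' * X t) $$ (i,j)" .
    qed (use cN[OF m] cN[OF m'] Xc[of t] in auto)
  qed
  then obtain q0 where q0: "\<And>t. t \<in> T \<Longrightarrow> X t = q0 t \<cdot>\<^sub>m P t" by metis
  define q where "q t = (if t \<in> T then q0 t else 0)" for t
  have key: "\<psi> (t \<otimes> n) = q t * mtrace (P (t \<otimes> n))" if t: "t \<in> T" and n: "n \<in> N" for t n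
    using Xtr[OF t n] t n cN[OF n] by (simp add: q0 q_def P_right mult_smult_assoc_mat[of _ d d _ d] mtrace_smult[of _ d])
  have key1: "\<psi> x = mtrace (P x) * q x" for x
    using key[of x \<one>] I(1)[of x] by (cases "x \<in> T") (auto simp: q_def)
  \<comment> \<open>Both values are read off from \<psi> at one element of the coset where the trace
    is nonzero; \<open>key\<close> applies with base point \<open>n \<otimes> x\<close> as well as
    \<open>x\<close>.\<close>
  have "q (n \<otimes> x) = q x" if n: "n \<in> N" and x: "x \<in> T" for n x
  proof -
    have nx: "n \<otimes> x \<in> T" using NT[OF n] x by simp
    from exists_trace_nz[OF P_carr[OF nx] P_nz[OF nx]] obtain m where m: "m \<in> N" "mtrace (P (n \<otimes> x) * P m) \<noteq> 0"
      by blast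
    hence nz: "mtrace (P (n \<otimes> x \<otimes> m)) \<noteq> 0" using P_right[OF m(1) nx] by simp
    have e: "n \<otimes> x \<otimes> m = x \<otimes> ((inv x \<otimes> n \<otimes> x) \<otimes> m)" using n x m
      by (simp add: m_assoc NG TG)
    have "q (n \<otimes> x) * mtrace (P (n \<otimes> x \<otimes> m)) = \<psi> (n \<otimes> x \<otimes> m)"
      by (rule key[OF nx m(1), symmetric])
    also have "\<dots> = q x * mtrace (P (n \<otimes> x \<otimes> m))"
      unfolding e using conjT_N(2)[OF x n] m(1) by (intro key[OF x]) auto
    finally show ?thesis using nz by simp
  qed
  hence "coset_fun \<Gamma> T N q" by (auto simp: coset_fun_def q_def)
  thus ?thesis using key1 by blast
qed

lemma Irr_over_imp_tw_fun:
  assumes \<psi>: "(\<lambda>x. mtrace (P x) * q x) \<in> Irr \<Gamma> T" and c: "coset_fun \<Gamma> T N q"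
  shows "tw_fun \<Gamma> T N \<alpha> q"
proof -
  let ?f = "\<lambda>x. mtrace (P x) * q x"
  have I: "irr_fun \<Gamma> T ?f" using \<psi> by (simp add: T.Irr_iff)
  have f1: "?f \<one> = of_nat d * q \<one>" using P_one by simp
  from I obtain r :: real where r: "r > 0" "?f \<one> = of_real r" by (auto simp: irr_fun_def)
  have "q \<one> = of_real (r / real d)" using r d_pos unfolding f1 by (simp add: field_simps)
  hence 1: "\<exists>r::real. r > 0 \<and> q \<one> = of_real r" using r d_pos by (intro exI[of _ "r / real d"]) auto
  have 2: "q x * q y = q \<one> / of_nat (card T) * (\<Sum>g\<in>T. twF q x y g)" if xy: "x \<in> T" "y \<in> T" for x y
  proof -
    \<comment> \<open>The traces may vanish at \<open>x\<close> or \<open>y\<close>. The equation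
      for \<open>q\<close> depends on cosets only, so it is proved at representatives where they do
      not.\<close>
    from exists_left_trace_nz[OF xy(1)] exists_left_trace_nz[OF xy(2)] obtain n m where
      n: "n \<in> N" "mtrace (P (n \<otimes> x)) \<noteq> 0" and m: "m \<in> N" "mtrace (P (m \<otimes> y)) \<noteq> 0" by blast
    have T': "n \<otimes> x \<in> T" "m \<otimes> y \<in> T" using n m NT xy by auto
    let ?t = "mtrace (P (n \<otimes> x)) * mtrace (P (m \<otimes> y))"
    have "?t * (q (n \<otimes> x) * q (m \<otimes> y)) = ?f \<one> / of_nat (card T) * (?t / of_nat d * (\<Sum>g\<in>T. twF q (n \<otimes> x) (m \<otimes> y) g))"
      using T.irr_funD(3)[OF I T'] unfolding FE_sum[OF c T'] by (simp add: mult_ac)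
    also have "\<dots> = ?t * (q \<one> / of_nat (card T) * (\<Sum>g\<in>T. twF q x y g))"
      unfolding f1 using twF_xy[OF c n(1) m(1) xy] d_pos by simp
    finally have "q (n \<otimes> x) * q (m \<otimes> y) = q \<one> / of_nat (card T) * (\<Sum>g\<in>T. twF q x y g)"
      using n(2) m(2) mult_left_cancel[of ?t] by (metis mult_eq_0_iff)
    thus ?thesis using c n m xy by (simp add: coset_fun_def)
  qed
  have 3: "(\<Sum>g\<in>T. \<alpha> g (inv g) * (q g * q (inv g))) = of_nat (card T)"
    using T.irr_funD(4)[OF I] unfolding norm_sum[OF c] .
  show ?thesis unfolding tw_fun_def using c 1 2 3 by (simp add: twF_def)
qed

end

section \<open>The Clifford correspondence\<close>

lemma sum_rotate: "(\<Sum>n\<in>A. \<Sum>m\<in>B. \<Sum>g\<in>C. f n m g) = (\<Sum>g\<in>C. \<Sum>n\<in>A. \<Sum>m\<in>B. f n m g :: complex)"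
proof -
  have "(\<Sum>m\<in>B. \<Sum>g\<in>C. f n m g) = (\<Sum>g\<in>C. \<Sum>m\<in>B. f n m g)" for n by (rule sum.swap)
  hence "(\<Sum>n\<in>A. \<Sum>m\<in>B. \<Sum>g\<in>C. f n m g) = (\<Sum>n\<in>A. \<Sum>g\<in>C. \<Sum>m\<in>B. f n m g)"
    by (simp only:)
  also have "\<dots> = (\<Sum>g\<in>C. \<Sum>n\<in>A. \<Sum>m\<in>B. f n m g)" by (rule sum.swap)
  finally show ?thesis .
qed

context nchar
begin

text \<open>Induction from \<open>T\<close>. Characters of \<open>T\<close> are 0 off
  \<open>T\<close>, so the summation needs no case distinction on the conjugate.\<close>

definition ind :: "('g \<Rightarrow> complex) \<Rightarrow> 'g \<Rightarrow> complex" where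
  "ind \<psi> x = (if x \<in> G then (\<Sum>g\<in>G. \<psi> (g \<otimes> x \<otimes> inv g)) / of_nat (card T) else 0)"

text \<open>Multiplication by the idempotent of \<theta>, which inverts induction. It is written
  down on all of \<open>G\<close>; its support lies in \<open>T\<close> by
  \<open>cliff_outside\<close>.\<close>

definition cliff :: "('g \<Rightarrow> complex) \<Rightarrow> 'g \<Rightarrow> complex" where
  "cliff \<chi> x = (if x \<in> G then \<Sum>n\<in>N. idem n * \<chi> (x \<otimes> n) else 0)"

lemma mem_T_mult:
  assumes "g \<in> G" "t \<in> T"
  shows "g \<otimes> t \<in> T \<longleftrightarrow> g \<in> T" "t \<otimes> g \<in> T \<longleftrightarrow> g \<in> T"
proof -
  have "g = (g \<otimes> t) \<otimes> inv t" "g = inv t \<otimes> (t \<otimes> g)" using assms TG by (simp_all add: m_assoc)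
  thus "g \<otimes> t \<in> T \<longleftrightarrow> g \<in> T" "t \<otimes> g \<in> T \<longleftrightarrow> g \<in> T"
    using assms T.memb by metis+
qed

section \<open>From characters of G to the stabilizer\<close>

context
  fixes \<chi> assumes \<chi>: "\<chi> \<in> Irr \<Gamma> G"
begin

lemma \<chi>_comm: "x \<in> G \<Longrightarrow> y \<in> G \<Longrightarrow> \<chi> (x \<otimes> y) = \<chi> (y \<otimes> x)"
  by (rule G.irr_fun_comm[OF G.Irr_imp_irr_fun[OF \<chi>]])

lemma cliff_left: assumes x: "x \<in> G" shows "(\<Sum>n\<in>N. idem n * \<chi> (n \<otimes> x)) = cliff \<chi> x"
proof -
  have "\<chi> (n \<otimes> x) = \<chi> (x \<otimes> n)" if "n \<in> N" for n by (rule \<chi>_comm[OF NG[OF that] x])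
  thus ?thesis using x by (simp add: cliff_def)
qed

text \<open>With \<open>e\<close> the idempotent, \<open>\<chi> (x e) = \<chi> (e x e)\<close> since
  \<chi> is a class function, and \<open>e x e = e (x e x^-1) x\<close> vanishes when
  \<open>x\<close> moves \<theta>.\<close>

lemma cliff_outside: assumes x: "x \<notin> T" shows "cliff \<chi> x = 0"
proof (cases "x \<in> G")
  case xG: True
  have "cliff \<chi> x = (\<Sum>n\<in>N. \<Sum>m\<in>N. idem n * idem m * \<chi> (x \<otimes> (n \<otimes> m)))"
    using xG unfolding idem_mult[of "\<lambda>k. \<chi> (x \<otimes> k)"] by (simp add: cliff_def)
  also have "\<dots> = (\<Sum>n\<in>N. \<Sum>m\<in>N. idem m * idem n * \<chi> ((m \<otimes> (x \<otimes> n \<otimes> inv x)) \<otimes> x))"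
  proof (intro sum.cong refl)
    fix n m assume nm: "n \<in> N" "m \<in> N"
    have "\<chi> (x \<otimes> (n \<otimes> m)) = \<chi> ((x \<otimes> n) \<otimes> m)" using xG nm by (simp add: m_assoc NG)
    also have "\<dots> = \<chi> (m \<otimes> (x \<otimes> n))" using xG nm NG by (intro \<chi>_comm) auto
    also have "m \<otimes> (x \<otimes> n) = (m \<otimes> (x \<otimes> n \<otimes> inv x)) \<otimes> x" using xG nm
      by (simp add: m_assoc NG)
    finally show "idem n * idem m * \<chi> (x \<otimes> (n \<otimes> m)) = idem m * idem n * \<chi> ((m \<otimes> (x \<otimes> n \<otimes> inv x)) \<otimes> x)" by simp
  qed
  also have "\<dots> = (\<Sum>m\<in>N. \<Sum>n\<in>N. idem m * idem n * \<chi> ((m \<otimes> (x \<otimes> n \<otimes> inv x)) \<otimes> x))" by (rule sum.swap)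
  also have "\<dots> = 0" using idem_conj_mult[OF xG, of "\<lambda>k. \<chi> (k \<otimes> x)"] x by simp
  finally show ?thesis .
qed (simp add: cliff_def)

lemma cliff_comm: assumes x: "x \<in> T" and w: "w \<in> T" shows "cliff \<chi> (w \<otimes> x) = cliff \<chi> (x \<otimes> w)"
proof -
  have G: "x \<in> G" "w \<in> G" using x w TG by auto
  have "cliff \<chi> (w \<otimes> x) = (\<Sum>n\<in>N. idem n * \<chi> (x \<otimes> w \<otimes> (inv w \<otimes> n \<otimes> inv (inv w))))"
    unfolding cliff_def using G
  proof (simp, intro sum.cong refl)
    fix n assume n: "n \<in> N"
    have "\<chi> (w \<otimes> x \<otimes> n) = \<chi> ((x \<otimes> n) \<otimes> w)" using \<chi>_comm[of w "x \<otimes> n"] G n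
      by (simp add: m_assoc NG)
    also have "(x \<otimes> n) \<otimes> w = x \<otimes> w \<otimes> (inv w \<otimes> n \<otimes> w)" using G n
      by (simp add: m_assoc NG)
    finally show "idem n * \<chi> (w \<otimes> x \<otimes> n) = idem n * \<chi> (x \<otimes> w \<otimes> (inv w \<otimes> n \<otimes> w))" by simp
  qed
  also have "\<dots> = (\<Sum>n\<in>N. idem n * \<chi> (x \<otimes> w \<otimes> n))"
    using w by (intro sum_idem_conj) auto
  finally show ?thesis using G by (simp add: cliff_def)
qed

text \<open>The equation of \<chi> is weighted with the idempotent in both arguments. The summand at
  \<open>g\<close> then contains the product of the idempotent with its conjugate by
  \<open>g \<otimes> y\<close>, which removes every \<open>g\<close> outside
  \<open>T\<close>.\<close>

lemma cliff_FE:
  assumes x: "x \<in> T" and y: "y \<in> T"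
  shows "cliff \<chi> x * cliff \<chi> y = \<chi> \<one> / of_nat (card G) * (\<Sum>g\<in>T. cliff \<chi> (x \<otimes> g \<otimes> y \<otimes> inv g))"
proof -
  have xy: "x \<in> G" "y \<in> G" using x y TG by auto
  note FE = G.irr_funD(3)[OF G.Irr_imp_irr_fun[OF \<chi>]]
  have "cliff \<chi> x * cliff \<chi> y = (\<Sum>n\<in>N. \<Sum>m\<in>N. idem n * idem m * (\<chi> (x \<otimes> n) * \<chi> (y \<otimes> m)))"
    using xy by (simp add: cliff_def sum_product mult_ac)
  also have "\<dots> = (\<Sum>n\<in>N. \<Sum>m\<in>N. idem n * idem m * (\<chi> \<one> / of_nat (card G) * (\<Sum>g\<in>G. \<chi> (x \<otimes> n \<otimes> g \<otimes> (y \<otimes> m) \<otimes> inv g))))"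
    using xy by (intro sum.cong refl) (simp add: FE NG)
  also have "\<dots> = (\<Sum>n\<in>N. \<Sum>m\<in>N. \<Sum>g\<in>G. \<chi> \<one> / of_nat (card G) * (idem n * idem m * \<chi> (x \<otimes> n \<otimes> g \<otimes> (y \<otimes> m) \<otimes> inv g)))"
    by (simp add: sum_distrib_left mult_ac)
  also have "\<dots> = (\<Sum>g\<in>G. \<Sum>n\<in>N. \<Sum>m\<in>N. \<chi> \<one> / of_nat (card G) * (idem n * idem m * \<chi> (x \<otimes> n \<otimes> g \<otimes> (y \<otimes> m) \<otimes> inv g)))"
    by (rule sum_rotate)
  also have "\<dots> = \<chi> \<one> / of_nat (card G) * (\<Sum>g\<in>G. \<Sum>n\<in>N. \<Sum>m\<in>N. idem n * idem m * \<chi> (x \<otimes> n \<otimes> g \<otimes> (y \<otimes> m) \<otimes> inv g))"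
    by (simp only: sum_distrib_left)
  also have "(\<Sum>g\<in>G. \<Sum>n\<in>N. \<Sum>m\<in>N. idem n * idem m * \<chi> (x \<otimes> n \<otimes> g \<otimes> (y \<otimes> m) \<otimes> inv g))
      = (\<Sum>g\<in>G. if g \<in> T then cliff \<chi> (x \<otimes> g \<otimes> y \<otimes> inv g) else 0)"
  proof (rule sum.cong[OF refl])
    fix g assume g: "g \<in> G"
    define w where "w = g \<otimes> y \<otimes> inv g"
    have w: "w \<in> G" using g xy by (simp add: w_def)
    have gy: "g \<otimes> y \<in> G" using g xy by simp
    have "(\<Sum>n\<in>N. \<Sum>m\<in>N. idem n * idem m * \<chi> (x \<otimes> n \<otimes> g \<otimes> (y \<otimes> m) \<otimes> inv g))
       = (\<Sum>n\<in>N. \<Sum>m\<in>N. idem n * idem m * \<chi> ((n \<otimes> ((g \<otimes> y) \<otimes> m \<otimes> inv (g \<otimes> y))) \<otimes> (w \<otimes> x)))"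
    proof (intro sum.cong refl)
      fix n m assume nm: "n \<in> N" "m \<in> N"
      have "x \<otimes> n \<otimes> g \<otimes> (y \<otimes> m) \<otimes> inv g = x \<otimes> (n \<otimes> ((g \<otimes> y) \<otimes> m \<otimes> inv (g \<otimes> y)) \<otimes> w)"
        using nm g xy by (simp add: w_def m_assoc inv_mult_group NG)
      also have "\<chi> \<dots> = \<chi> ((n \<otimes> ((g \<otimes> y) \<otimes> m \<otimes> inv (g \<otimes> y)) \<otimes> w) \<otimes> x)"
        using nm xy w gy NG by (intro \<chi>_comm) auto
      also have "(n \<otimes> ((g \<otimes> y) \<otimes> m \<otimes> inv (g \<otimes> y)) \<otimes> w) \<otimes> x = (n \<otimes> ((g \<otimes> y) \<otimes> m \<otimes> inv (g \<otimes> y))) \<otimes> (w \<otimes> x)"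
        using nm xy w gy by (simp add: m_assoc NG)
      finally show "idem n * idem m * \<chi> (x \<otimes> n \<otimes> g \<otimes> (y \<otimes> m) \<otimes> inv g) = idem n * idem m * \<chi> ((n \<otimes> ((g \<otimes> y) \<otimes> m \<otimes> inv (g \<otimes> y))) \<otimes> (w \<otimes> x))"
        by simp
    qed
    also have "\<dots> = (if g \<otimes> y \<in> T then \<Sum>n\<in>N. idem n * \<chi> (n \<otimes> (w \<otimes> x)) else 0)"
      by (rule idem_conj_mult[OF gy, of "\<lambda>k. \<chi> (k \<otimes> (w \<otimes> x))"])
    also have "\<dots> = (if g \<in> T then cliff \<chi> (x \<otimes> g \<otimes> y \<otimes> inv g) else 0)"
    proof (cases "g \<in> T")
      case True
      have "w \<in> T" using True y by (simp add: w_def)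
      hence "cliff \<chi> (w \<otimes> x) = cliff \<chi> (x \<otimes> w)" by (rule cliff_comm[OF x])
      moreover have "x \<otimes> w = x \<otimes> g \<otimes> y \<otimes> inv g" using g xy by (simp add: w_def m_assoc)
      ultimately show ?thesis using True mem_T_mult(1)[OF g y] cliff_left[of "w \<otimes> x"] w xy by simp
    qed (use mem_T_mult(1)[OF g y] in simp)
    finally show "(\<Sum>n\<in>N. \<Sum>m\<in>N. idem n * idem m * \<chi> (x \<otimes> n \<otimes> g \<otimes> (y \<otimes> m) \<otimes> inv g))
       = (if g \<in> T then cliff \<chi> (x \<otimes> g \<otimes> y \<otimes> inv g) else 0)" .
  qed
  also have "\<dots> = (\<Sum>g\<in>T. cliff \<chi> (x \<otimes> g \<otimes> y \<otimes> inv g))"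
    using TG by (intro sum.mono_neutral_cong_right finG) auto
  finally show ?thesis .
qed

context
  assumes over: "cinner N \<chi> \<theta> \<noteq> 0"
begin

text \<open>\<open>cliff_FE\<close> at the identity, divided by the nonzero value there. This is the
  degree relation with the index of \<open>T\<close> in \<open>G\<close>.\<close>

lemma cliff_one: "cliff \<chi> \<one> = \<chi> \<one> * of_nat (card T) / of_nat (card G)" "cliff \<chi> \<one> \<noteq> 0"
proof -
  have "cliff \<chi> \<one> = (\<Sum>n\<in>N. idem n * \<chi> n)" unfolding cliff_def by (auto intro!: sum.cong simp: NG)
  thus nz: "cliff \<chi> \<one> \<noteq> 0" using over \<theta>_one_nz by (simp add: sum_idem)
  have "cliff \<chi> \<one> * cliff \<chi> \<one> = \<chi> \<one> / of_nat (card G) * (of_nat (card T) * cliff \<chi> \<one>)"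
    using cliff_FE[OF T.memb(1) T.memb(1)] by (simp add: TG)
  hence "cliff \<chi> \<one> * cliff \<chi> \<one> = (\<chi> \<one> * of_nat (card T) / of_nat (card G)) * cliff \<chi> \<one>"
    by simp
  thus "cliff \<chi> \<one> = \<chi> \<one> * of_nat (card T) / of_nat (card G)"
    using mult_right_cancel[OF nz] by blast
qed

lemma cliff_Irr: "cliff \<chi> \<in> Irr \<Gamma> T"
proof -
  note I = G.irr_funD[OF G.Irr_imp_irr_fun[OF \<chi>]]
  let ?\<psi> = "cliff \<chi>"
  have FE: "?\<psi> x * ?\<psi> y = ?\<psi> \<one> / of_nat (card T) * (\<Sum>g\<in>T. ?\<psi> (x \<otimes> g \<otimes> y \<otimes> inv g))" if "x \<in> T" "y \<in> T" for x y
    unfolding cliff_FE[OF that] unfolding cliff_one(1) by simp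
  obtain r :: real where r: "r > 0" "\<chi> \<one> = of_real r" using G.Irr_imp_irr_fun[OF \<chi>] by (auto simp: irr_fun_def)
  have pos: "\<exists>s::real. s > 0 \<and> ?\<psi> \<one> = of_real s"
    unfolding cliff_one(1) r(2) using r(1) by (intro exI[of _ "r * real (card T) / real (card G)"]) auto
  \<comment> \<open>The sum extends to \<open>G\<close> since \<open>cliff \<chi>\<close> vanishes
    off \<open>T\<close>. The idempotent of the first factor is then shifted to the second and
    absorbed there, and \<open>Irr_convolution\<close> evaluates the rest.\<close>
  have "(\<Sum>t\<in>T. ?\<psi> t * ?\<psi> (inv t)) = (\<Sum>g\<in>G. ?\<psi> g * ?\<psi> (inv g))"
    using TG cliff_outside by (intro sum.mono_neutral_left finG) auto
  also have "\<dots> = (\<Sum>g\<in>G. \<Sum>n\<in>N. idem n * \<chi> (g \<otimes> n) * ?\<psi> (inv g))"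
    by (intro sum.cong refl) (simp add: cliff_def[of _ g for g] sum_distrib_right)
  also have "\<dots> = (\<Sum>n\<in>N. \<Sum>g\<in>G. idem n * \<chi> (g \<otimes> n) * ?\<psi> (n \<otimes> inv (g \<otimes> n)))"
    by (subst sum.swap) (intro sum.cong refl, simp add: inv_mult_group NG)
  also have "\<dots> = (\<Sum>n\<in>N. \<Sum>g\<in>G. idem n * \<chi> g * ?\<psi> (n \<otimes> inv g))"
    using NG by (intro sum.cong[OF refl] G.sum_right) auto
  also have "\<dots> = (\<Sum>g\<in>G. \<chi> g * (\<Sum>n\<in>N. idem n * ?\<psi> (n \<otimes> inv g)))"
    by (subst sum.swap) (simp add: sum_distrib_left mult_ac)
  also have "\<dots> = (\<Sum>g\<in>G. \<chi> g * ?\<psi> (inv g))"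
  proof (rule sum.cong[OF refl])
    fix g assume g: "g \<in> G"
    have "(\<Sum>n\<in>N. idem n * ?\<psi> (n \<otimes> inv g)) = (\<Sum>n\<in>N. \<Sum>m\<in>N. idem n * idem m * \<chi> (m \<otimes> (n \<otimes> inv g)))"
      using g by (intro sum.cong[OF refl]) (simp add: cliff_left[symmetric] sum_distrib_left mult_ac NG)
    also have "\<dots> = (\<Sum>m\<in>N. \<Sum>n\<in>N. idem m * idem n * \<chi> ((m \<otimes> n) \<otimes> inv g))"
      using g by (subst sum.swap) (intro sum.cong refl, simp add: m_assoc NG)
    also have "\<dots> = (\<Sum>n\<in>N. idem n * \<chi> (n \<otimes> inv g))" by (rule idem_mult)
    also have "\<dots> = ?\<psi> (inv g)" using g by (intro cliff_left) auto
    finally show "\<chi> g * (\<Sum>n\<in>N. idem n * ?\<psi> (n \<otimes> inv g)) = \<chi> g * ?\<psi> (inv g)" by simp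
  qed
  also have "\<dots> = (\<Sum>g\<in>G. \<Sum>n\<in>N. idem n * (\<chi> (n \<otimes> inv g) * \<chi> g))"
    by (intro sum.cong[OF refl]) (simp add: cliff_left[symmetric] sum_distrib_left mult_ac)
  also have "\<dots> = (\<Sum>n\<in>N. idem n * (\<Sum>g\<in>G. \<chi> (n \<otimes> inv g) * \<chi> g))"
    by (subst sum.swap) (simp add: sum_distrib_left)
  also have "\<dots> = (\<Sum>n\<in>N. idem n * (of_nat (card G) * \<chi> n / \<chi> \<one>))"
    by (intro sum.cong refl) (simp add: G.Irr_convolution[OF \<chi> \<chi>] NG)
  also have "\<dots> = of_nat (card G) / \<chi> \<one> * (\<Sum>n\<in>N. idem n * \<chi> (n \<otimes> \<one>))"
    by (simp add: sum_distrib_left mult_ac NG)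
  also have "(\<Sum>n\<in>N. idem n * \<chi> (n \<otimes> \<one>)) = ?\<psi> \<one>" by (rule cliff_left) simp
  also have "of_nat (card G) / \<chi> \<one> * ?\<psi> \<one> = of_nat (card T)" unfolding cliff_one(1) using I(2) by simp
  finally show ?thesis unfolding T.Irr_iff irr_fun_def using FE pos cliff_outside by blast
qed

lemma cliff_over: "cinner N (cliff \<chi>) \<theta> \<noteq> 0"
proof -
  have "(\<Sum>n\<in>N. idem n * cliff \<chi> n) = (\<Sum>n\<in>N. \<Sum>m\<in>N. idem n * idem m * \<chi> (n \<otimes> m))"
    by (intro sum.cong[OF refl]) (simp add: cliff_def sum_distrib_left mult_ac NG)
  also have "\<dots> = (\<Sum>n\<in>N. idem n * \<chi> n)" by (rule idem_mult)
  finally show ?thesis using over \<theta>_one_nz by (simp add: sum_idem)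
qed

text \<open>The functional equation of \<chi>, with its first argument weighted by the idempotent,
  produces a multiple of \<open>cliff \<chi> \<one> * \<chi> x\<close>; \<open>cliff_one\<close>
  supplies the constant.\<close>

lemma ind_cliff: "ind (cliff \<chi>) = \<chi>"
proof
  fix x
  note I = G.irr_funD[OF G.Irr_imp_irr_fun[OF \<chi>]]
  show "ind (cliff \<chi>) x = \<chi> x"
  proof (cases "x \<in> G")
    case x: True
    have "(\<Sum>g\<in>G. cliff \<chi> (g \<otimes> x \<otimes> inv g)) = (\<Sum>g\<in>G. \<Sum>n\<in>N. idem n * \<chi> (n \<otimes> g \<otimes> x \<otimes> inv g))"
      using x by (intro sum.cong[OF refl]) (simp add: cliff_left[symmetric] m_assoc NG)
    also have "\<dots> = (\<Sum>n\<in>N. idem n * (\<Sum>g\<in>G. \<chi> (n \<otimes> g \<otimes> x \<otimes> inv g)))"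
      by (subst sum.swap) (simp add: sum_distrib_left)
    also have "\<dots> = (\<Sum>n\<in>N. idem n * (of_nat (card G) / \<chi> \<one> * (\<chi> n * \<chi> x)))"
      using I(2) x by (intro sum.cong refl) (simp add: I(3) NG)
    also have "\<dots> = of_nat (card G) / \<chi> \<one> * \<chi> x * (\<Sum>n\<in>N. idem n * \<chi> (n \<otimes> \<one>))"
      by (simp add: sum_distrib_left mult_ac NG)
    also have "(\<Sum>n\<in>N. idem n * \<chi> (n \<otimes> \<one>)) = cliff \<chi> \<one>" by (rule cliff_left) simp
    also have "of_nat (card G) / \<chi> \<one> * \<chi> x * cliff \<chi> \<one> = of_nat (card T) * \<chi> x"
      unfolding cliff_one(1) using I(2) by simp
    finally show ?thesis using x by (simp add: ind_def)
  qed (simp add: ind_def I(1))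
qed

end

end

section \<open>Induction from the stabilizer\<close>

context
  fixes \<psi> assumes \<psi>: "\<psi> \<in> Irr \<Gamma> T" and over: "cinner N \<psi> \<theta> \<noteq> 0"
begin

lemma \<psi>_out: "x \<notin> T \<Longrightarrow> \<psi> x = 0"
  by (rule T.irr_funD(1)[OF T.Irr_imp_irr_fun[OF \<psi>]])

lemma \<psi>_right: "x \<in> G \<Longrightarrow> (\<Sum>n\<in>N. idem n * \<psi> (x \<otimes> n)) = \<psi> x"
  using idem_absorb[OF \<psi> over, of x] \<psi>_out mem_T_mult(1)[OF _ NT, of x] by (cases "x \<in> T") auto

lemma \<psi>_left: assumes x: "x \<in> G" shows "(\<Sum>n\<in>N. idem n * \<psi> (n \<otimes> x)) = \<psi> x"
proof -
  have "\<psi> (n \<otimes> x) = \<psi> (x \<otimes> n)" if n: "n \<in> N" for n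
  proof (cases "x \<in> T")
    case True
    thus ?thesis using T.irr_fun_comm[OF T.Irr_imp_irr_fun[OF \<psi>] NT[OF n]] by simp
  next
    case False
    thus ?thesis using mem_T_mult[OF x NT[OF n]] \<psi>_out by simp
  qed
  thus ?thesis using \<psi>_right[OF x] by simp
qed

lemma \<psi>_conj: assumes "t \<in> T" "x \<in> G" shows "\<psi> (t \<otimes> x \<otimes> inv t) = \<psi> x"
proof (cases "x \<in> T")
  case True thus ?thesis using T.irr_fun_conj[OF T.Irr_imp_irr_fun[OF \<psi>]] assms by simp
next
  case False
  hence "t \<otimes> x \<otimes> inv t \<notin> T" using mem_T_mult(1)[of "t \<otimes> x" "inv t"] mem_T_mult(2)[of x t] assms TG
    by simp
  thus ?thesis using False \<psi>_out by simp
qed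

text \<open>For \<open>u\<close> in \<open>T\<close>, averaging over \<open>T\<close> reduces the
  claim to the functional equation of \<psi>. For \<open>u\<close> off \<open>T\<close> both sides
  vanish, because idempotents can be inserted on either side of \<open>u\<close> and
  \<open>e u e = 0\<close>. This gives the functional equation of \<open>ind \<psi>\<close>.\<close>

lemma sum_conj_absorb:
  assumes u: "u \<in> G" and y: "y \<in> G"
  shows "(\<Sum>k\<in>G. \<psi> (u \<otimes> (k \<otimes> y \<otimes> inv k))) = \<psi> u / \<psi> \<one> * (\<Sum>k\<in>G. \<psi> (k \<otimes> y \<otimes> inv k))"
proof (cases "u \<in> T")
  case True
  note I = T.irr_funD[OF T.Irr_imp_irr_fun[OF \<psi>]]
  have "of_nat (card T) * (\<Sum>k\<in>G. \<psi> (u \<otimes> (k \<otimes> y \<otimes> inv k))) = (\<Sum>t\<in>T. \<Sum>k\<in>G. \<psi> (u \<otimes> ((t \<otimes> k) \<otimes> y \<otimes> inv (t \<otimes> k))))"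
  proof -
    have "(\<Sum>k\<in>G. \<psi> (u \<otimes> ((t \<otimes> k) \<otimes> y \<otimes> inv (t \<otimes> k)))) = (\<Sum>k\<in>G. \<psi> (u \<otimes> (k \<otimes> y \<otimes> inv k)))" if "t \<in> T" for t
      using TG[OF that] by (rule G.sum_left)
    thus ?thesis by simp
  qed
  also have "\<dots> = (\<Sum>k\<in>G. \<Sum>t\<in>T. \<psi> (u \<otimes> t \<otimes> (k \<otimes> y \<otimes> inv k) \<otimes> inv t))"
    using u y by (subst sum.swap) (intro sum.cong refl, simp add: m_assoc inv_mult_group TG)
  also have "\<dots> = (\<Sum>k\<in>G. of_nat (card T) / \<psi> \<one> * (\<psi> u * \<psi> (k \<otimes> y \<otimes> inv k)))"
  proof (rule sum.cong[OF refl])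
    fix k assume k: "k \<in> G"
    define w where "w = k \<otimes> y \<otimes> inv k"
    have w: "w \<in> G" using k y by (simp add: w_def)
    show "(\<Sum>t\<in>T. \<psi> (u \<otimes> t \<otimes> (k \<otimes> y \<otimes> inv k) \<otimes> inv t)) = of_nat (card T) / \<psi> \<one> * (\<psi> u * \<psi> (k \<otimes> y \<otimes> inv k))"
    proof (cases "w \<in> T")
      case wT: True
      show ?thesis using I(2) I(3)[OF True wT] by (simp add: w_def)
    next
      case False
      have "u \<otimes> t \<otimes> w \<otimes> inv t \<notin> T" if t: "t \<in> T" for t
        using mem_T_mult(1)[of "u \<otimes> t \<otimes> w" "inv t"] mem_T_mult(2)[of w "u \<otimes> t"] t True w TG False u
          by simp
      thus ?thesis using False \<psi>_out by (simp add: w_def)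
    qed
  qed
  also have "\<dots> = of_nat (card T) * (\<psi> u / \<psi> \<one> * (\<Sum>k\<in>G. \<psi> (k \<otimes> y \<otimes> inv k)))"
    by (simp add: sum_distrib_left)
  finally show ?thesis by (simp only: mult_cancel_left of_nat_eq_0_iff T.card_nz) simp
next
  case False
  \<comment> \<open>The idempotent is inserted at the right end and carried next to \<open>u\<close>
    by the substitution of \<open>inv n \<otimes> k\<close> for \<open>k\<close>.\<close>
  have "(\<Sum>k\<in>G. \<psi> (u \<otimes> (k \<otimes> y \<otimes> inv k))) = (\<Sum>k\<in>G. \<Sum>n\<in>N. idem n * \<psi> (u \<otimes> (k \<otimes> y \<otimes> inv k) \<otimes> n))"
    using u y by (intro sum.cong[OF refl] \<psi>_right[symmetric]) auto
  also have "\<dots> = (\<Sum>n\<in>N. \<Sum>k\<in>G. idem n * \<psi> (u \<otimes> n \<otimes> ((inv n \<otimes> k) \<otimes> y \<otimes> inv (inv n \<otimes> k))))"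
    using u y by (subst sum.swap) (intro sum.cong refl, simp add: m_assoc inv_mult_group NG)
  also have "\<dots> = (\<Sum>n\<in>N. \<Sum>k\<in>G. idem n * \<psi> (u \<otimes> n \<otimes> (k \<otimes> y \<otimes> inv k)))"
    using NG by (intro sum.cong[OF refl] G.sum_left) auto
  also have "\<dots> = (\<Sum>k\<in>G. \<Sum>n\<in>N. idem n * \<psi> (u \<otimes> n \<otimes> (k \<otimes> y \<otimes> inv k)))"
    by (rule sum.swap)
  also have "\<dots> = (\<Sum>k\<in>G. 0)"
  proof (rule sum.cong[OF refl])
    fix k assume k: "k \<in> G"
    define w where "w = k \<otimes> y \<otimes> inv k"
    have w: "w \<in> G" using k y by (simp add: w_def)
    have "(\<Sum>n\<in>N. idem n * \<psi> (u \<otimes> n \<otimes> w)) = (\<Sum>n\<in>N. idem n * (\<Sum>m\<in>N. idem m * \<psi> (m \<otimes> (u \<otimes> n \<otimes> w))))"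
      using u w by (intro sum.cong[OF refl]) (simp add: \<psi>_left NG)
    also have "\<dots> = (\<Sum>m\<in>N. \<Sum>n\<in>N. idem m * idem n * \<psi> ((m \<otimes> (u \<otimes> n \<otimes> inv u)) \<otimes> (u \<otimes> w)))"
      unfolding sum_distrib_left using u w by (subst sum.swap) (intro sum.cong refl, simp add: m_assoc NG mult_ac)
    also have "\<dots> = 0" using idem_conj_mult[OF u, of "\<lambda>k. \<psi> (k \<otimes> (u \<otimes> w))"] False by simp
    finally show "(\<Sum>n\<in>N. idem n * \<psi> (u \<otimes> n \<otimes> (k \<otimes> y \<otimes> inv k))) = 0"
      by (simp add: w_def)
  qed
  finally show ?thesis using \<psi>_out[OF False] by simp
qed

lemma ind_one: "ind \<psi> \<one> = of_nat (card G) / of_nat (card T) * \<psi> \<one>"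
  by (simp add: ind_def)

lemma ind_conj: assumes "g \<in> G" "x \<in> G" shows "ind \<psi> (g \<otimes> x \<otimes> inv g) = ind \<psi> x"
proof -
  have "(\<Sum>h\<in>G. \<psi> (h \<otimes> (g \<otimes> x \<otimes> inv g) \<otimes> inv h)) = (\<Sum>h\<in>G. \<psi> ((h \<otimes> g) \<otimes> x \<otimes> inv (h \<otimes> g)))"
    using assms by (intro sum.cong refl) (simp add: m_assoc inv_mult_group)
  also have "\<dots> = (\<Sum>h\<in>G. \<psi> (h \<otimes> x \<otimes> inv h))" by (rule G.sum_right[OF assms(1)])
  finally show ?thesis using assms by (simp add: ind_def)
qed

text \<open>For \<open>b\<close> off \<open>T\<close> the idempotent is inserted at \<open>t\<close>
  and carried into the second factor, where it meets its conjugate by \<open>b\<close> and gives 0.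
  These are the cross terms in the norm of \<open>ind \<psi>\<close>.\<close>

lemma ind_norm_term:
  assumes b: "b \<in> G"
  shows "(\<Sum>t\<in>T. \<psi> t * \<psi> (b \<otimes> inv t \<otimes> inv b)) = (if b \<in> T then of_nat (card T) else 0)"
proof (cases "b \<in> T")
  case True
  thus ?thesis using T.irr_funD(4)[OF T.Irr_imp_irr_fun[OF \<psi>]] by (simp add: \<psi>_conj TG)
next
  case False
  have "(\<Sum>t\<in>T. \<psi> t * \<psi> (b \<otimes> inv t \<otimes> inv b)) = (\<Sum>t\<in>T. \<Sum>n\<in>N. idem n * \<psi> (t \<otimes> n) * \<psi> (b \<otimes> inv t \<otimes> inv b))"
    by (intro sum.cong[OF refl]) (simp add: \<psi>_right[symmetric, of t for t] sum_distrib_right TG)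
  also have "\<dots> = (\<Sum>n\<in>N. \<Sum>t\<in>T. idem n * \<psi> (t \<otimes> n) * \<psi> (b \<otimes> (n \<otimes> inv (t \<otimes> n)) \<otimes> inv b))"
    by (subst sum.swap) (intro sum.cong refl, simp add: inv_mult_group NG TG)
  also have "\<dots> = (\<Sum>n\<in>N. \<Sum>t\<in>T. idem n * \<psi> t * \<psi> (b \<otimes> (n \<otimes> inv t) \<otimes> inv b))"
    using NT by (intro sum.cong[OF refl] T.sum_right) auto
  also have "\<dots> = (\<Sum>t\<in>T. \<psi> t * (\<Sum>n\<in>N. idem n * \<psi> (b \<otimes> (n \<otimes> inv t) \<otimes> inv b)))"
    by (subst sum.swap) (simp add: sum_distrib_left mult_ac)
  also have "\<dots> = (\<Sum>t\<in>T. \<psi> t * 0)"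
  proof (rule sum.cong[OF refl])
    fix t assume t: "t \<in> T"
    have tG: "t \<in> G" by (rule TG[OF t])
    have "(\<Sum>n\<in>N. idem n * \<psi> (b \<otimes> (n \<otimes> inv t) \<otimes> inv b)) = (\<Sum>n\<in>N. idem n * (\<Sum>m\<in>N. idem m * \<psi> (m \<otimes> (b \<otimes> (n \<otimes> inv t) \<otimes> inv b))))"
      using b tG by (intro sum.cong[OF refl]) (simp add: \<psi>_left NG)
    also have "\<dots> = (\<Sum>m\<in>N. \<Sum>n\<in>N. idem m * idem n * \<psi> ((m \<otimes> (b \<otimes> n \<otimes> inv b)) \<otimes> (b \<otimes> inv t \<otimes> inv b)))"
      unfolding sum_distrib_left using b tG by (subst sum.swap) (intro sum.cong refl, simp add: m_assoc NG mult_ac)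
    also have "\<dots> = 0"
      using idem_conj_mult[OF b, of "\<lambda>k. \<psi> (k \<otimes> (b \<otimes> inv t \<otimes> inv b))"] False by simp
    finally show "\<psi> t * (\<Sum>n\<in>N. idem n * \<psi> (b \<otimes> (n \<otimes> inv t) \<otimes> inv b)) = \<psi> t * 0"
      by simp
  qed
  finally show ?thesis using False by simp
qed

lemma ind_Irr: "ind \<psi> \<in> Irr \<Gamma> G"
proof -
  note I = T.irr_funD[OF T.Irr_imp_irr_fun[OF \<psi>]]
  let ?\<chi> = "ind \<psi>"
  obtain r :: real where r: "r > 0" "\<psi> \<one> = of_real r" using T.Irr_imp_irr_fun[OF \<psi>] by (auto simp: irr_fun_def)
  have pos: "\<exists>s::real. s > 0 \<and> ?\<chi> \<one> = of_real s"
    unfolding ind_one r(2) using r(1) by (intro exI[of _ "real (card G) / real (card T) * r"]) auto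
  have FE: "?\<chi> x * ?\<chi> y = ?\<chi> \<one> / of_nat (card G) * (\<Sum>h\<in>G. ?\<chi> (x \<otimes> h \<otimes> y \<otimes> inv h))" if x: "x \<in> G" and y: "y \<in> G" for x y
  proof -
    let ?S = "\<lambda>x. \<Sum>g\<in>G. \<psi> (g \<otimes> x \<otimes> inv g)"
    have "(\<Sum>h\<in>G. ?S (x \<otimes> h \<otimes> y \<otimes> inv h)) = (\<Sum>g\<in>G. \<Sum>h\<in>G. \<psi> ((g \<otimes> x \<otimes> inv g) \<otimes> ((g \<otimes> h) \<otimes> y \<otimes> inv (g \<otimes> h))))"
      using x y by (subst sum.swap) (intro sum.cong refl, simp add: m_assoc inv_mult_group)
    also have "\<dots> = (\<Sum>g\<in>G. \<Sum>h\<in>G. \<psi> ((g \<otimes> x \<otimes> inv g) \<otimes> (h \<otimes> y \<otimes> inv h)))"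
    proof (rule sum.cong[OF refl])
      fix g assume g: "g \<in> G"
      show "(\<Sum>h\<in>G. \<psi> ((g \<otimes> x \<otimes> inv g) \<otimes> ((g \<otimes> h) \<otimes> y \<otimes> inv (g \<otimes> h)))) = (\<Sum>h\<in>G. \<psi> ((g \<otimes> x \<otimes> inv g) \<otimes> (h \<otimes> y \<otimes> inv h)))"
        by (rule G.sum_left[OF g, of "\<lambda>k. \<psi> ((g \<otimes> x \<otimes> inv g) \<otimes> (k \<otimes> y \<otimes> inv k))"])
    qed
    also have "\<dots> = (\<Sum>g\<in>G. \<psi> (g \<otimes> x \<otimes> inv g) / \<psi> \<one> * ?S y)"
      using x y by (intro sum.cong[OF refl] sum_conj_absorb) auto
    also have "\<dots> = ?S x / \<psi> \<one> * ?S y" by (simp add: sum_distrib_right sum_divide_distrib)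
    finally have S: "(\<Sum>h\<in>G. ?S (x \<otimes> h \<otimes> y \<otimes> inv h)) = ?S x / \<psi> \<one> * ?S y" .
    have "(\<Sum>h\<in>G. ?\<chi> (x \<otimes> h \<otimes> y \<otimes> inv h)) = (\<Sum>h\<in>G. ?S (x \<otimes> h \<otimes> y \<otimes> inv h)) / of_nat (card T)"
      using x y by (simp add: ind_def sum_divide_distrib)
    also have "\<dots> = of_nat (card T) / \<psi> \<one> * (?\<chi> x * ?\<chi> y)" unfolding S using x y by (simp add: ind_def)
    finally show ?thesis unfolding ind_one using I(2) by simp
  qed
  have "(\<Sum>x\<in>G. ?\<chi> x * ?\<chi> (inv x)) = (\<Sum>x\<in>G. \<Sum>g\<in>G. \<psi> (g \<otimes> x \<otimes> inv g) * ?\<chi> (inv (g \<otimes> x \<otimes> inv g)) / of_nat (card T))"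
  proof (rule sum.cong[OF refl])
    fix x assume x: "x \<in> G"
    have "?\<chi> (inv (g \<otimes> x \<otimes> inv g)) = ?\<chi> (inv x)" if g: "g \<in> G" for g
      using ind_conj[OF g, of "inv x"] x g by (simp add: N.conj_inv)
    thus "?\<chi> x * ?\<chi> (inv x) = (\<Sum>g\<in>G. \<psi> (g \<otimes> x \<otimes> inv g) * ?\<chi> (inv (g \<otimes> x \<otimes> inv g)) / of_nat (card T))"
      using x by (simp add: ind_def[of _ x] sum_distrib_right sum_divide_distrib)
  qed
  also have "\<dots> = (\<Sum>g\<in>G. \<Sum>x\<in>G. \<psi> (g \<otimes> x \<otimes> inv g) * ?\<chi> (inv (g \<otimes> x \<otimes> inv g)) / of_nat (card T))"
    by (rule sum.swap)
  also have "\<dots> = (\<Sum>g\<in>G. \<Sum>x\<in>G. \<psi> x * ?\<chi> (inv x) / of_nat (card T))"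
  proof (rule sum.cong[OF refl])
    fix g assume g: "g \<in> G"
    show "(\<Sum>x\<in>G. \<psi> (g \<otimes> x \<otimes> inv g) * ?\<chi> (inv (g \<otimes> x \<otimes> inv g)) / of_nat (card T)) = (\<Sum>x\<in>G. \<psi> x * ?\<chi> (inv x) / of_nat (card T))"
      by (rule G.sum_conj_mem[OF g, of "\<lambda>x. \<psi> x * ?\<chi> (inv x) / of_nat (card T)"])
  qed
  also have "\<dots> = of_nat (card G) / of_nat (card T) * (\<Sum>x\<in>G. \<psi> x * ?\<chi> (inv x))"
    by (simp add: sum_divide_distrib[symmetric])
  also have "(\<Sum>x\<in>G. \<psi> x * ?\<chi> (inv x)) = (\<Sum>t\<in>T. \<psi> t * ?\<chi> (inv t))"
    using TG \<psi>_out by (intro sum.mono_neutral_right finG) auto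
  also have "\<dots> = (\<Sum>t\<in>T. \<Sum>b\<in>G. \<psi> t * \<psi> (b \<otimes> inv t \<otimes> inv b)) / of_nat (card T)"
    by (simp add: ind_def TG sum_distrib_left sum_divide_distrib)
  also have "(\<Sum>t\<in>T. \<Sum>b\<in>G. \<psi> t * \<psi> (b \<otimes> inv t \<otimes> inv b)) = (\<Sum>b\<in>G. if b \<in> T then of_nat (card T) else 0)"
    by (subst sum.swap) (intro sum.cong refl ind_norm_term)
  also have "\<dots> = (\<Sum>b\<in>T. of_nat (card T))"
    using TG by (intro sum.mono_neutral_cong_right finG) auto
  finally have norm: "(\<Sum>x\<in>G. ?\<chi> x * ?\<chi> (inv x)) = of_nat (card G)" by simp
  have "?\<chi> x = 0" if "x \<notin> G" for x using that by (simp add: ind_def)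
  thus ?thesis unfolding G.Irr_iff irr_fun_def using pos FE norm by blast
qed

text \<open>In the double sum the idempotent meets its conjugate by \<open>g\<close>, so only the
  \<open>g\<close> in \<open>T\<close> contribute, each with \<open>\<psi> x\<close>.\<close>

lemma cliff_ind: "cliff (ind \<psi>) = \<psi>"
proof
  fix x
  show "cliff (ind \<psi>) x = \<psi> x"
  proof (cases "x \<in> T")
    case x: True
    have xG: "x \<in> G" by (rule TG[OF x])
    have inner: "(\<Sum>n\<in>N. idem n * \<psi> (g \<otimes> (x \<otimes> n) \<otimes> inv g)) = (if g \<in> T then \<psi> x else 0)" if g: "g \<in> G" for g
    proof -
      have "(\<Sum>n\<in>N. idem n * \<psi> (g \<otimes> (x \<otimes> n) \<otimes> inv g)) = (\<Sum>n\<in>N. idem n * \<psi> (g \<otimes> ((x \<otimes> n \<otimes> inv x) \<otimes> x) \<otimes> inv g))"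
        using g xG by (intro sum.cong refl) (simp add: m_assoc NG)
      also have "\<dots> = (\<Sum>n\<in>N. idem n * \<psi> (g \<otimes> (n \<otimes> x) \<otimes> inv g))"
        by (rule sum_idem_conj[OF x])
      also have "\<dots> = (\<Sum>n\<in>N. idem n * (\<Sum>m\<in>N. idem m * \<psi> (m \<otimes> (g \<otimes> (n \<otimes> x) \<otimes> inv g))))"
        using g xG by (intro sum.cong[OF refl]) (simp add: \<psi>_left NG)
      also have "\<dots> = (\<Sum>m\<in>N. \<Sum>n\<in>N. idem m * idem n * \<psi> ((m \<otimes> (g \<otimes> n \<otimes> inv g)) \<otimes> (g \<otimes> x \<otimes> inv g)))"
        unfolding sum_distrib_left using g xG by (subst sum.swap) (intro sum.cong refl, simp add: m_assoc NG mult_ac)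
      also have "\<dots> = (if g \<in> T then \<Sum>n\<in>N. idem n * \<psi> (n \<otimes> (g \<otimes> x \<otimes> inv g)) else 0)"
        by (rule idem_conj_mult[OF g])
      finally show ?thesis using \<psi>_left[of "g \<otimes> x \<otimes> inv g"] \<psi>_conj[of g x] g xG by simp
    qed
    have "cliff (ind \<psi>) x = (\<Sum>n\<in>N. \<Sum>g\<in>G. idem n * \<psi> (g \<otimes> (x \<otimes> n) \<otimes> inv g)) / of_nat (card T)"
      using xG by (simp add: cliff_def ind_def NG sum_distrib_left sum_divide_distrib)
    also have "\<dots> = (\<Sum>g\<in>G. if g \<in> T then \<psi> x else 0) / of_nat (card T)"
      using inner by (subst sum.swap) simp
    also have "(\<Sum>g\<in>G. if g \<in> T then \<psi> x else 0) = (\<Sum>g\<in>T. \<psi> x)"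
      using TG by (intro sum.mono_neutral_cong_right finG) auto
    finally show ?thesis by simp
  next
    case False
    thus ?thesis using cliff_outside[OF ind_Irr False] \<psi>_out by simp
  qed
qed

lemma ind_over: "cinner N (ind \<psi>) \<theta> \<noteq> 0"
proof -
  have "(\<Sum>n\<in>N. idem n * ind \<psi> n) = cliff (ind \<psi>) \<one>"
    unfolding cliff_def by (auto intro!: sum.cong simp: NG)
  thus ?thesis using sum_idem[of "ind \<psi>"] T.irr_funD(2)[OF T.Irr_imp_irr_fun[OF \<psi>]] by (auto simp: cliff_ind)
qed

text \<open>Replacing \<open>g\<close> by \<open>x \<otimes> g\<close> leaves the sum over
  \<open>G\<close> unchanged. So \<sigma>, which alone may move \<theta>, can be combined with an
  \<open>x\<close> normalizing \<open>T\<close>; the pair is later chosen to fix \<theta>.\<close>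

lemma ind_char_act:
  assumes x: "x \<in> G" and \<sigma>: "\<sigma> \<in> GalAb" and nT: "T.normalizes x"
  shows "char_act \<Gamma> G \<one> \<sigma> (ind \<psi>) = ind (char_act \<Gamma> T x \<sigma> \<psi>)"
proof
  fix y
  show "char_act \<Gamma> G \<one> \<sigma> (ind \<psi>) y = ind (char_act \<Gamma> T x \<sigma> \<psi>) y"
  proof (cases "y \<in> G")
    case y: True
    have c: "char_act \<Gamma> T x \<sigma> \<psi> w = \<sigma> (\<psi> (x \<otimes> w \<otimes> inv x))" if w: "w \<in> G" for w
    proof (cases "w \<in> T")
      case False
      have "x \<otimes> w \<otimes> inv x \<notin> T"
      proof
        assume "x \<otimes> w \<otimes> inv x \<in> T"
        hence "inv x \<otimes> (x \<otimes> w \<otimes> inv x) \<otimes> x \<in> T" using nT by (simp add: T.normalizes_def)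
        thus False using False N.conj_cancel(1)[of x w] x w by simp
      qed
      thus ?thesis using False \<psi>_out GalAbD(5)[OF \<sigma>] by (simp add: char_act_def)
    qed (simp add: char_act_def)
    have "char_act \<Gamma> G \<one> \<sigma> (ind \<psi>) y = \<sigma> ((\<Sum>g\<in>G. \<psi> (g \<otimes> y \<otimes> inv g)) / of_nat (card T))"
      using y by (simp add: char_act_def ind_def)
    also have "\<dots> = (\<Sum>g\<in>G. \<sigma> (\<psi> (g \<otimes> y \<otimes> inv g))) / of_nat (card T)"
      using \<psi> by (simp add: GalAbD(10,11)[OF \<sigma>] GalAb_sum[OF \<sigma>])
    also have "(\<Sum>g\<in>G. \<sigma> (\<psi> (g \<otimes> y \<otimes> inv g))) = (\<Sum>g\<in>G. \<sigma> (\<psi> ((x \<otimes> g) \<otimes> y \<otimes> inv (x \<otimes> g))))"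
      by (rule G.sum_left[OF x, symmetric])
    also have "\<dots> = (\<Sum>g\<in>G. char_act \<Gamma> T x \<sigma> \<psi> (g \<otimes> y \<otimes> inv g))"
      using x y by (intro sum.cong refl) (simp add: c m_assoc inv_mult_group)
    finally show ?thesis unfolding ind_def[of "char_act \<Gamma> T x \<sigma> \<psi>" y] using y by simp
  qed (simp add: char_act_def ind_def)
qed

end

text \<open>Clifford's theorem. The product of the two pairings is expanded by the functional
  equation of \<chi>; the summand at \<open>g\<close> contains a convolution of
  \<open>\<theta>'\<close> with a conjugate of \<theta>, which is 0 unless the two agree.\<close>

lemma constituents_conjugate:
  assumes \<chi>: "\<chi> \<in> Irr \<Gamma> G" and over: "cinner N \<chi> \<theta> \<noteq> 0"
    and \<theta>': "\<theta>' \<in> Irr \<Gamma> N" and over': "cinner N \<chi> \<theta>' \<noteq> 0"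
  shows "\<exists>g\<in>G. char_act \<Gamma> N g id \<theta> = \<theta>'"
proof (rule ccontr)
  assume neg: "\<not> ?thesis"
  note I = G.irr_funD[OF G.Irr_imp_irr_fun[OF \<chi>]]
  let ?p = "\<lambda>\<phi>. \<Sum>n\<in>N. \<phi> (inv n) * \<chi> n"
  have p: "?p \<theta> \<noteq> 0" "?p \<theta>' \<noteq> 0" using over over'
    unfolding N.cinner_Irr[OF \<theta>] N.cinner_Irr[OF \<theta>'] by (auto simp: mult.commute)
  have "?p \<theta>' * ?p \<theta> = (\<Sum>n\<in>N. \<Sum>m\<in>N. \<theta>' (inv n) * \<theta> (inv m) * (\<chi> n * \<chi> m))"
    unfolding sum_product by (intro sum.cong refl) simp
  also have "\<dots> = (\<Sum>n\<in>N. \<Sum>m\<in>N. \<theta>' (inv n) * \<theta> (inv m) * (\<chi> \<one> / of_nat (card G) * (\<Sum>g\<in>G. \<chi> (n \<otimes> g \<otimes> m \<otimes> inv g))))"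
    by (intro sum.cong refl) (simp add: I(3) NG)
  also have "\<dots> = (\<Sum>n\<in>N. \<Sum>m\<in>N. \<Sum>g\<in>G. \<chi> \<one> / of_nat (card G) * (\<theta>' (inv n) * \<theta> (inv m) * \<chi> (n \<otimes> g \<otimes> m \<otimes> inv g)))"
    by (simp add: sum_distrib_left mult_ac)
  also have "\<dots> = (\<Sum>g\<in>G. \<Sum>n\<in>N. \<Sum>m\<in>N. \<chi> \<one> / of_nat (card G) * (\<theta>' (inv n) * \<theta> (inv m) * \<chi> (n \<otimes> g \<otimes> m \<otimes> inv g)))"
    by (rule sum_rotate)
  also have "\<dots> = \<chi> \<one> / of_nat (card G) * (\<Sum>g\<in>G. \<Sum>n\<in>N. \<Sum>m\<in>N. \<theta>' (inv n) * \<theta> (inv m) * \<chi> (n \<otimes> g \<otimes> m \<otimes> inv g))"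
    by (simp only: sum_distrib_left)
  also have "(\<Sum>g\<in>G. \<Sum>n\<in>N. \<Sum>m\<in>N. \<theta>' (inv n) * \<theta> (inv m) * \<chi> (n \<otimes> g \<otimes> m \<otimes> inv g)) = (\<Sum>g\<in>G. 0)"
  proof (rule sum.cong[OF refl])
    fix g assume g: "g \<in> G"
    define \<eta> where "\<eta> = char_act \<Gamma> N (inv g) id \<theta>"
    have ig: "inv g \<in> G" using g by simp
    have \<eta>: "\<eta> \<in> Irr \<Gamma> N" unfolding \<eta>_def by (rule N.char_act_Irr[OF \<theta> normN[OF ig] GalAb_id])
    have ne: "\<theta>' \<noteq> \<eta>" using neg ig by (auto simp: \<eta>_def)
    have \<eta>v: "\<theta> (inv (inv g \<otimes> m \<otimes> g)) = \<eta> (inv m)" if m: "m \<in> N" for m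
      using m g NG[OF m] N.conj_inv[of "inv g" m] by (simp add: \<eta>_def char_act_def)
    have "(\<Sum>n\<in>N. \<Sum>m\<in>N. \<theta>' (inv n) * \<theta> (inv m) * \<chi> (n \<otimes> g \<otimes> m \<otimes> inv g))
        = (\<Sum>n\<in>N. \<Sum>m\<in>N. \<theta>' (inv n) * \<eta> (inv (inv n \<otimes> m)) * \<chi> m)"
    proof (rule sum.cong[OF refl])
      fix n assume n: "n \<in> N"
      have "(\<Sum>m\<in>N. \<theta>' (inv n) * \<theta> (inv m) * \<chi> (n \<otimes> g \<otimes> m \<otimes> inv g)) =
          (\<Sum>m\<in>N. \<theta>' (inv n) * \<eta> (inv (g \<otimes> m \<otimes> inv g)) * \<chi> (n \<otimes> (g \<otimes> m \<otimes> inv g)))"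
      proof (rule sum.cong[OF refl])
        fix m assume m: "m \<in> N"
        have "\<eta> (inv (g \<otimes> m \<otimes> inv g)) = \<theta> (inv m)"
          using \<eta>v[OF conjN[OF g m]] N.conj_cancel(1)[of g m] g NG[OF m] by simp
        moreover have "n \<otimes> g \<otimes> m \<otimes> inv g = n \<otimes> (g \<otimes> m \<otimes> inv g)" using g n m
          by (simp add: m_assoc NG)
        ultimately show "\<theta>' (inv n) * \<theta> (inv m) * \<chi> (n \<otimes> g \<otimes> m \<otimes> inv g) = \<theta>' (inv n) * \<eta> (inv (g \<otimes> m \<otimes> inv g)) * \<chi> (n \<otimes> (g \<otimes> m \<otimes> inv g))" by simp
      qed
      also have "\<dots> = (\<Sum>m\<in>N. \<theta>' (inv n) * \<eta> (inv m) * \<chi> (n \<otimes> m))"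
        by (rule N.sum_normalizes[OF normN[OF g], of "\<lambda>m. \<theta>' (inv n) * \<eta> (inv m) * \<chi> (n \<otimes> m)"])
      also have "\<dots> = (\<Sum>m\<in>N. \<theta>' (inv n) * \<eta> (inv (inv n \<otimes> m)) * \<chi> (n \<otimes> (inv n \<otimes> m)))"
        using n by (intro N.sum_left[symmetric]) auto
      also have "\<dots> = (\<Sum>m\<in>N. \<theta>' (inv n) * \<eta> (inv (inv n \<otimes> m)) * \<chi> m)"
        using n by (intro sum.cong refl) (simp add: NG)
      finally show "(\<Sum>m\<in>N. \<theta>' (inv n) * \<theta> (inv m) * \<chi> (n \<otimes> g \<otimes> m \<otimes> inv g)) = (\<Sum>m\<in>N. \<theta>' (inv n) * \<eta> (inv (inv n \<otimes> m)) * \<chi> m)" .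
    qed
    also have "\<dots> = (\<Sum>m\<in>N. (\<Sum>n\<in>N. \<eta> (inv m \<otimes> n) * \<theta>' (inv n)) * \<chi> m)"
      by (subst sum.swap) (intro sum.cong refl, simp add: sum_distrib_right sum_distrib_left inv_mult_group NG mult_ac)
    also have "\<dots> = 0"
    proof (rule sum.neutral, rule ballI)
      fix m assume m: "m \<in> N"
      have "(\<Sum>n\<in>N. \<eta> (inv m \<otimes> n) * \<theta>' (inv n)) = (\<Sum>n\<in>N. \<eta> (inv m \<otimes> inv n) * \<theta>' (inv (inv n)))"
        by (rule N.sum_inv[symmetric])
      also have "\<dots> = (\<Sum>n\<in>N. \<eta> (inv m \<otimes> inv n) * \<theta>' n)" by (intro sum.cong refl) (simp add: NG)
      also have "\<dots> = 0" using N.Irr_convolution[OF \<theta>' \<eta>, of "inv m"] m ne by simp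
      finally show "(\<Sum>n\<in>N. \<eta> (inv m \<otimes> n) * \<theta>' (inv n)) * \<chi> m = 0" by simp
    qed
    finally show "(\<Sum>n\<in>N. \<Sum>m\<in>N. \<theta>' (inv n) * \<theta> (inv m) * \<chi> (n \<otimes> g \<otimes> m \<otimes> inv g)) = 0" .
  qed
  finally show False using p by simp
qed

end

section \<open>The character bijection of an ordered pair of triples\<close>

text \<open>Well-definedness and injectivity both come from \<open>iff\<close>: after moving \<rho>
  to the other side, \<open>act \<sigma> a = act \<rho> b\<close> says that one element of
  \<open>S\<close> maps \<open>a\<close> to \<open>b\<close> inside \<open>X\<close>, and
  \<open>fwd\<close> and \<open>bwd\<close> compare exactly this situation with the corresponding
  one in \<open>Y\<close>.\<close>

lemma equivariant_extension:
  fixes S :: "('k \<Rightarrow> 'k) set" and act :: "('k \<Rightarrow> 'k) \<Rightarrow> 'x \<Rightarrow> 'x"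
    and act' :: "('k \<Rightarrow> 'k) \<Rightarrow> 'y \<Rightarrow> 'y"
  assumes S: "id \<in> S" "\<And>\<sigma> \<tau>. \<sigma> \<in> S \<Longrightarrow> \<tau> \<in> S \<Longrightarrow> \<sigma> \<circ> \<tau> \<in> S" "\<And>\<sigma>. \<sigma> \<in> S \<Longrightarrow> \<exists>\<tau>\<in>S. \<sigma> \<circ> \<tau> = id \<and> \<tau> \<circ> \<sigma> = id"
    and X: "\<And>a. a \<in> X \<Longrightarrow> act id a = a" "\<And>a \<sigma> \<tau>. a \<in> X \<Longrightarrow> \<sigma> \<in> S \<Longrightarrow> \<tau> \<in> S \<Longrightarrow> act \<sigma> (act \<tau> a) = act (\<sigma> \<circ> \<tau>) a"
    and Y: "\<And>a. a \<in> Y \<Longrightarrow> act' id a = a" "\<And>a \<sigma> \<tau>. a \<in> Y \<Longrightarrow> \<sigma> \<in> S \<Longrightarrow> \<tau> \<in> S \<Longrightarrow> act' \<sigma> (act' \<tau> a) = act' (\<sigma> \<circ> \<tau>) a"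
    and bij: "bij_betw f X Y"
    and fwd: "\<And>\<sigma> a. \<sigma> \<in> S \<Longrightarrow> a \<in> X \<Longrightarrow> act \<sigma> a \<in> X \<Longrightarrow> f (act \<sigma> a) = act' \<sigma> (f a)"
    and bwd: "\<And>\<sigma> a. \<sigma> \<in> S \<Longrightarrow> a \<in> X \<Longrightarrow> act' \<sigma> (f a) \<in> Y \<Longrightarrow> act \<sigma> a \<in> X"
  shows "\<exists>F. bij_betw F (\<Union>\<sigma>\<in>S. act \<sigma> ` X) (\<Union>\<sigma>\<in>S. act' \<sigma> ` Y) \<and>
     (\<forall>\<sigma>\<in>S. \<forall>a\<in>(\<Union>\<sigma>\<in>S. act \<sigma> ` X). F (act \<sigma> a) = act' \<sigma> (F a)) \<and>
     (\<forall>\<sigma>\<in>S. \<forall>a\<in>X. F (act \<sigma> a) = act' \<sigma> (f a))"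
proof -
  have fY: "f a \<in> Y" if "a \<in> X" for a using bij that by (auto simp: bij_betw_def)
  have finj: "a = b" if "f a = f b" "a \<in> X" "b \<in> X" for a b using bij that by (auto simp: bij_betw_def inj_on_def)
  have iff: "act \<sigma> a = act \<rho> b \<longleftrightarrow> act' \<sigma> (f a) = act' \<rho> (f b)"
    if sr: "\<sigma> \<in> S" "\<rho> \<in> S" and ab: "a \<in> X" "b \<in> X" for \<sigma> \<rho> a b
  proof -
    from S(3)[OF sr(2)] obtain \<rho>' where r: "\<rho>' \<in> S" "\<rho> \<circ> \<rho>' = id" "\<rho>' \<circ> \<rho> = id"
      by blast
    have rs: "\<rho>' \<circ> \<sigma> \<in> S" using S(2) r sr by blast
    have e: "\<rho> \<circ> (\<rho>' \<circ> \<sigma>) = \<sigma>" using r by (metis comp_assoc id_comp)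
    have 1: "act \<sigma> a = act \<rho> b \<longleftrightarrow> act (\<rho>' \<circ> \<sigma>) a = b"
      using X(1)[OF ab(2)] X(2)[OF ab(1) r(1) sr(1)] X(2)[OF ab(2) r(1) sr(2)] X(2)[OF ab(1) sr(2) rs] r e by metis
    have 2: "act' \<sigma> (f a) = act' \<rho> (f b) \<longleftrightarrow> act' (\<rho>' \<circ> \<sigma>) (f a) = f b"
      using Y(1)[OF fY[OF ab(2)]] Y(2)[OF fY[OF ab(1)] r(1) sr(1)] Y(2)[OF fY[OF ab(2)] r(1) sr(2)] Y(2)[OF fY[OF ab(1)] sr(2) rs] r e by metis
    have "act (\<rho>' \<circ> \<sigma>) a = b \<longleftrightarrow> act' (\<rho>' \<circ> \<sigma>) (f a) = f b"
    proof
      assume "act (\<rho>' \<circ> \<sigma>) a = b"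
      thus "act' (\<rho>' \<circ> \<sigma>) (f a) = f b" using fwd[OF rs ab(1)] ab(2) by metis
    next
      assume h: "act' (\<rho>' \<circ> \<sigma>) (f a) = f b"
      hence x: "act (\<rho>' \<circ> \<sigma>) a \<in> X" using bwd[OF rs ab(1)] fY[OF ab(2)] by simp
      hence "f (act (\<rho>' \<circ> \<sigma>) a) = f b" using fwd[OF rs ab(1)] h by simp
      thus "act (\<rho>' \<circ> \<sigma>) a = b" using finj x ab(2) by blast
    qed
    thus ?thesis using 1 2 by blast
  qed
  define F where "F c = (SOME z. \<exists>\<sigma>\<in>S. \<exists>a\<in>X. c = act \<sigma> a \<and> z = act' \<sigma> (f a))"
    for c
  have F: "F (act \<sigma> a) = act' \<sigma> (f a)" if "\<sigma> \<in> S" "a \<in> X" for \<sigma> a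
    unfolding F_def
  proof (rule some_equality)
    show "\<exists>\<sigma>'\<in>S. \<exists>a'\<in>X. act \<sigma> a = act \<sigma>' a' \<and> act' \<sigma> (f a) = act' \<sigma>' (f a')" using that by blast
    fix z assume "\<exists>\<sigma>'\<in>S. \<exists>a'\<in>X. act \<sigma> a = act \<sigma>' a' \<and> z = act' \<sigma>' (f a')"
    thus "z = act' \<sigma> (f a)" using iff that by metis
  qed
  have "inj_on F (\<Union>\<sigma>\<in>S. act \<sigma> ` X)"
    unfolding inj_on_def using F iff by auto
  moreover have "F ` (\<Union>\<sigma>\<in>S. act \<sigma> ` X) = (\<Union>\<sigma>\<in>S. act' \<sigma> ` Y)"
  proof -
    have "F ` (\<Union>\<sigma>\<in>S. act \<sigma> ` X) = (\<Union>\<sigma>\<in>S. act' \<sigma> ` (f ` X))" by (force simp: F)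
    thus ?thesis using bij by (simp add: bij_betw_def)
  qed
  moreover have "F (act \<sigma> c) = act' \<sigma> (F c)" if s: "\<sigma> \<in> S"
    and c: "c \<in> (\<Union>\<sigma>\<in>S. act \<sigma> ` X)" for \<sigma> c
  proof -
    from c obtain \<tau> a where t: "\<tau> \<in> S" "a \<in> X" "c = act \<tau> a" by blast
    have "F (act \<sigma> c) = act' (\<sigma> \<circ> \<tau>) (f a)" using X(2)[OF t(2) s t(1)] F[OF S(2)[OF s t(1)] t(2)] t(3)
      by simp
    thus ?thesis using Y(2)[OF fY[OF t(2)] s t(1)] F[OF t(1,2)] t(3) by simp
  qed
  ultimately show ?thesis using F unfolding bij_betw_def by blast
qed

section \<open>Sums over cosets\<close>

context group
begin

text \<open>Double count of the pairs \<open>x\<close>, \<open>t\<close> with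
  \<open>x \<otimes> inv t\<close> in \<open>N\<close>: each \<open>t\<close> has
  \<open>card N\<close> partners, each \<open>x\<close> has \<open>card (N \<inter> X')\<close>.
  This takes the place of the isomorphism between \<open>X/N\<close> and
  \<open>X'/(N \<inter> X')\<close>.\<close>

lemma coset_average:
  fixes F :: "'a \<Rightarrow> complex"
  assumes N: "subgroup N G" and X: "subgroup X G" "finite X" and X': "subgroup X' G" "X' \<subseteq> X" and NX: "N \<subseteq> X"
    and prod: "\<And>x. x \<in> X \<Longrightarrow> \<exists>n\<in>N. \<exists>t\<in>X'. x = n \<otimes> t"
    and inv: "\<And>n t. n \<in> N \<Longrightarrow> t \<in> X \<Longrightarrow> F (n \<otimes> t) = F t"
  shows "of_nat (card (N \<inter> X')) * sum F X = of_nat (card N) * sum F X'"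
proof -
  interpret N: fsub G N by (intro fsub.intro fsub_axioms.intro is_group N finite_subset[OF NX X(2)])
  interpret X: fsub G X by (intro fsub.intro fsub_axioms.intro is_group X)
  interpret X': fsub G X' by (intro fsub.intro fsub_axioms.intro is_group X' finite_subset[OF X'(2) X(2)])
  have 1: "(\<Sum>x\<in>X. if x \<otimes> inv t \<in> N then F x else 0) = of_nat (card N) * F t" if t: "t \<in> X'" for t
  proof -
    have tX: "t \<in> X" using t X' by auto
    have "(\<Sum>x\<in>X. if x \<otimes> inv t \<in> N then F x else 0) = (\<Sum>x\<in>X. if (x \<otimes> t) \<otimes> inv t \<in> N then F (x \<otimes> t) else 0)"
      by (rule X.sum_right[OF tX, symmetric])
    also have "\<dots> = (\<Sum>x\<in>X. if x \<in> N then F t else 0)"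
      using tX inv by (intro sum.cong refl) (simp add: m_assoc)
    also have "\<dots> = (\<Sum>x\<in>N. F t)" using NX X(2) by (intro sum.mono_neutral_cong_right) auto
    finally show ?thesis by simp
  qed
  have 2: "(\<Sum>t\<in>X'. if x \<otimes> inv t \<in> N then F x else 0) = of_nat (card (N \<inter> X')) * F x" if x: "x \<in> X"
    for x
  proof -
    from prod[OF x] obtain n s where ns: "n \<in> N" "s \<in> X'" "x = n \<otimes> s" by blast
    have "(\<Sum>t\<in>X'. if x \<otimes> inv t \<in> N then F x else 0) = (\<Sum>t\<in>X'. if x \<otimes> inv (t \<otimes> s) \<in> N then F x else 0)"
      by (rule X'.sum_right[OF ns(2), symmetric])
    also have "\<dots> = (\<Sum>t\<in>X'. if t \<in> N then F x else 0)"
    proof (intro sum.cong refl)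
      fix t assume t: "t \<in> X'"
      have e: "x \<otimes> inv (t \<otimes> s) = n \<otimes> inv t" using ns t by (simp add: m_assoc inv_mult_group)
      have "n \<otimes> inv t \<in> N \<longleftrightarrow> t \<in> N"
      proof
        assume "n \<otimes> inv t \<in> N"
        hence "inv (inv n \<otimes> (n \<otimes> inv t)) \<in> N" using ns by simp
        thus "t \<in> N" using ns t by simp
      qed (use ns in simp)
      thus "(if x \<otimes> inv (t \<otimes> s) \<in> N then F x else 0) = (if t \<in> N then F x else 0)" unfolding e by simp
    qed
    also have "\<dots> = (\<Sum>t\<in>N \<inter> X'. F x)" using X'.fin by (intro sum.mono_neutral_cong_right) auto
    finally show ?thesis by simp
  qed
  have "of_nat (card (N \<inter> X')) * sum F X = (\<Sum>x\<in>X. \<Sum>t\<in>X'. if x \<otimes> inv t \<in> N then F x else 0)"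
    using 2 by (simp add: sum_distrib_left)
  also have "\<dots> = (\<Sum>t\<in>X'. \<Sum>x\<in>X. if x \<otimes> inv t \<in> N then F x else 0)" by (rule sum.swap)
  also have "\<dots> = of_nat (card N) * sum F X'" using 1 by (simp add: sum_distrib_left)
  finally show ?thesis .
qed

end

section \<open>Galois orbits of characters over \<theta>\<close>

context nchar
begin

lemma cinner_gal:
  assumes \<chi>: "\<chi> \<in> Irr \<Gamma> G" and \<sigma>: "\<sigma> \<in> GalAb" and \<eta>: "\<eta> \<in> Irr \<Gamma> N"
  shows "cinner N (char_act \<Gamma> G \<one> \<sigma> \<chi>) (char_act \<Gamma> N \<one> \<sigma> \<eta>) = \<sigma> (cinner N \<chi> \<eta>)"
proof -
  have \<eta>': "char_act \<Gamma> N \<one> \<sigma> \<eta> \<in> Irr \<Gamma> N"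
    by (rule N.char_act_Irr[OF \<eta> normN \<sigma>]) simp
  have "cinner N (char_act \<Gamma> G \<one> \<sigma> \<chi>) (char_act \<Gamma> N \<one> \<sigma> \<eta>) = (\<Sum>n\<in>N. \<sigma> (\<chi> n * \<eta> (inv n))) / of_nat (card N)"
    unfolding N.cinner_Irr[OF \<eta>'] using \<chi> \<eta> by (simp add: char_act_def NG GalAbD(3)[OF \<sigma>])
  also have "\<dots> = \<sigma> (cinner N \<chi> \<eta>)"
    unfolding N.cinner_Irr[OF \<eta>] using \<chi> \<eta> by (simp add: GalAbD(10,11)[OF \<sigma>] GalAb_sum[OF \<sigma>])
  finally show ?thesis .
qed

lemma gal_comp:
  assumes "\<chi> \<in> Irr \<Gamma> G"
  shows "char_act \<Gamma> G \<one> \<sigma> (char_act \<Gamma> G \<one> \<tau> \<chi>) = char_act \<Gamma> G \<one> (\<sigma> \<circ> \<tau>) \<chi>"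
  using G.char_act_comp[OF G.normalizes_mem G.normalizes_mem, of \<one> \<one> \<sigma> \<tau> \<chi>] by simp

lemma gal_Irr: "\<chi> \<in> Irr \<Gamma> G \<Longrightarrow> \<sigma> \<in> GalAb \<Longrightarrow> char_act \<Gamma> G \<one> \<sigma> \<chi> \<in> Irr \<Gamma> G"
  by (rule G.char_act_Irr) (auto intro: G.normalizes_mem)

text \<open>\<chi> lies over \<theta> and over the conjugate of \<theta> by the inverse of \<sigma>;
  \<open>constituents_conjugate\<close> provides the \<open>g\<close> linking the two.\<close>

lemma semi_stabilizer:
  assumes \<chi>: "\<chi> \<in> Irr \<Gamma> G" and over: "cinner N \<chi> \<theta> \<noteq> 0"
    and \<sigma>: "\<sigma> \<in> GalAb"
    and over': "cinner N (char_act \<Gamma> G \<one> \<sigma> \<chi>) \<theta> \<noteq> 0"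
  shows "\<exists>g\<in>G. char_act \<Gamma> N g \<sigma> \<theta> = \<theta>"
proof -
  have i: "inv_into UNIV \<sigma> \<in> GalAb" "\<sigma> \<circ> inv_into UNIV \<sigma> = id" using GalAb_inv[OF \<sigma>] by auto
  have oneN: "N.normalizes \<one>" by (rule normN) simp
  define \<theta>' where "\<theta>' = char_act \<Gamma> N \<one> (inv_into UNIV \<sigma>) \<theta>"
  have \<theta>': "\<theta>' \<in> Irr \<Gamma> N" unfolding \<theta>'_def by (rule N.char_act_Irr[OF \<theta> oneN i(1)])
  have b: "char_act \<Gamma> N \<one> \<sigma> \<theta>' = \<theta>"
    unfolding \<theta>'_def
      using N.char_act_comp[OF oneN oneN, of \<sigma> "inv_into UNIV \<sigma>" \<theta>] N.char_act_one_id[OF \<theta>] i(2)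
        by simp
  have "\<sigma> (cinner N \<chi> \<theta>') \<noteq> 0" using cinner_gal[OF \<chi> \<sigma> \<theta>'] over' b by simp
  hence "cinner N \<chi> \<theta>' \<noteq> 0" using GalAbD(5)[OF \<sigma>] by auto
  from constituents_conjugate[OF \<chi> over \<theta>' this] obtain g
    where g: "g \<in> G" "char_act \<Gamma> N g id \<theta> = \<theta>'" by blast
  have "char_act \<Gamma> N g \<sigma> \<theta> = char_act \<Gamma> N \<one> \<sigma> (char_act \<Gamma> N g id \<theta>)"
    using N.char_act_comp[OF normN[OF g(1)] oneN, of \<sigma> id \<theta>] g(1) by simp
  thus ?thesis using g b by auto
qed

text \<open>Galois conjugation carries the characters over \<theta> onto those over the conjugate of
  \<theta>. This is the form of the set on which \<open>equivariant_extension\<close>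
  operates.\<close>

lemma Irr_over_orb_eq:
  "Irr_over_orb \<Gamma> p G N \<theta> = (\<Union>\<sigma>\<in>Hgal p. char_act \<Gamma> G \<one> \<sigma> ` {\<chi> \<in> Irr \<Gamma> G. cinner N \<chi> \<theta> \<noteq> 0})"
proof -
  have "Irr_over \<Gamma> G N (char_act \<Gamma> N \<one> \<sigma> \<theta>) = char_act \<Gamma> G \<one> \<sigma> ` {\<chi> \<in> Irr \<Gamma> G. cinner N \<chi> \<theta> \<noteq> 0}" if s: "\<sigma> \<in> Hgal p" for \<sigma>
  proof -
    have \<sigma>: "\<sigma> \<in> GalAb" by (rule Hgal_GalAb[OF s])
    have i: "inv_into UNIV \<sigma> \<in> GalAb" "\<sigma> \<circ> inv_into UNIV \<sigma> = id" using GalAb_inv[OF \<sigma>]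
      by auto
    show ?thesis
    proof (intro equalityI subsetI)
      fix \<chi> assume "\<chi> \<in> Irr_over \<Gamma> G N (char_act \<Gamma> N \<one> \<sigma> \<theta>)"
      hence \<chi>: "\<chi> \<in> Irr \<Gamma> G" "cinner N \<chi> (char_act \<Gamma> N \<one> \<sigma> \<theta>) \<noteq> 0"
        by (auto simp: Irr_over_def)
      let ?\<chi> = "char_act \<Gamma> G \<one> (inv_into UNIV \<sigma>) \<chi>"
      have c: "?\<chi> \<in> Irr \<Gamma> G" by (rule gal_Irr[OF \<chi>(1) i(1)])
      have e: "\<chi> = char_act \<Gamma> G \<one> \<sigma> ?\<chi>"
        using gal_comp[OF \<chi>(1), of \<sigma>] i(2) G.char_act_one_id[OF \<chi>(1)] by simp
      have "\<sigma> (cinner N ?\<chi> \<theta>) \<noteq> 0" using cinner_gal[OF c \<sigma> \<theta>] e \<chi>(2) by simp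
      hence "cinner N ?\<chi> \<theta> \<noteq> 0" using GalAbD(5)[OF \<sigma>] by auto
      thus "\<chi> \<in> char_act \<Gamma> G \<one> \<sigma> ` {\<chi> \<in> Irr \<Gamma> G. cinner N \<chi> \<theta> \<noteq> 0}"
        using c e by blast
    next
      fix \<chi> assume "\<chi> \<in> char_act \<Gamma> G \<one> \<sigma> ` {\<chi> \<in> Irr \<Gamma> G. cinner N \<chi> \<theta> \<noteq> 0}"
      then obtain \<chi>0 where c: "\<chi> = char_act \<Gamma> G \<one> \<sigma> \<chi>0" "\<chi>0 \<in> Irr \<Gamma> G" "cinner N \<chi>0 \<theta> \<noteq> 0" by blast
      thus "\<chi> \<in> Irr_over \<Gamma> G N (char_act \<Gamma> N \<one> \<sigma> \<theta>)"
        using cinner_gal[OF c(2) \<sigma> \<theta>] gal_Irr[OF c(2) \<sigma>] GalAbD(9)[OF \<sigma>] by (simp add: Irr_over_def)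
    qed
  qed
  thus ?thesis by (simp add: Irr_over_orb_def)
qed

end

lemma tw_fun_coset: "tw_fun \<Gamma> T N \<alpha> q \<Longrightarrow> coset_fun \<Gamma> T N q"
  by (simp add: tw_fun_def)

section \<open>Parameters for the characters of G over \<theta>\<close>

context projchar
begin

lemma tw_fun_alt:
  "tw_fun \<Gamma> T N \<alpha> q \<longleftrightarrow> coset_fun \<Gamma> T N q \<and> (\<exists>r::real. r > 0 \<and> q \<one> = of_real r) \<and>
     (\<forall>x\<in>T. \<forall>y\<in>T. q x * q y = q \<one> / of_nat (card T) * (\<Sum>g\<in>T. twF q x y g)) \<and>
     (\<Sum>g\<in>T. \<alpha> g (inv g) * (q g * q (inv g))) = of_nat (card T)"
  unfolding tw_fun_def twF_def ..

definition tw_ind :: "('a \<Rightarrow> complex) \<Rightarrow> 'a \<Rightarrow> complex" where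
  "tw_ind q = ind (\<lambda>x. mtrace (P x) * q x)"

lemma tw_ind_bij: "bij_betw tw_ind {q. tw_fun \<Gamma> T N \<alpha> q} {\<chi> \<in> Irr \<Gamma> G. cinner N \<chi> \<theta> \<noteq> 0}"
proof (rule bij_betw_imageI)
  show "inj_on tw_ind {q. tw_fun \<Gamma> T N \<alpha> q}"
  proof (rule inj_onI, simp)
    fix q q' assume q: "tw_fun \<Gamma> T N \<alpha> q" and q': "tw_fun \<Gamma> T N \<alpha> q'" and e: "tw_ind q = tw_ind q'"
    have c1: "cliff (tw_ind q) = (\<lambda>x. mtrace (P x) * q x)"
      unfolding tw_ind_def by (rule cliff_ind[OF tw_fun_imp_Irr[OF q]])
    have c2: "cliff (tw_ind q') = (\<lambda>x. mtrace (P x) * q' x)"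
      unfolding tw_ind_def by (rule cliff_ind[OF tw_fun_imp_Irr[OF q']])
    have eq: "(\<lambda>x. mtrace (P x) * q x) = (\<lambda>x. mtrace (P x) * q' x)"
      by (rule trans[OF c1[symmetric] trans[OF arg_cong[OF e, of cliff] c2]])
    have eq': "mtrace (P x) * q x = mtrace (P x) * q' x" for x by (rule fun_cong[OF eq])
    note c = tw_fun_coset[OF q] and c' = tw_fun_coset[OF q']
    show "q = q'" by (rule coset_fun_unique[OF c c' eq'])
  qed
  show "tw_ind ` {q. tw_fun \<Gamma> T N \<alpha> q} = {\<chi> \<in> Irr \<Gamma> G. cinner N \<chi> \<theta> \<noteq> 0}"
  proof (intro equalityI subsetI)
    fix \<chi> assume "\<chi> \<in> tw_ind ` {q. tw_fun \<Gamma> T N \<alpha> q}"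
    then obtain q where q: "tw_fun \<Gamma> T N \<alpha> q" "\<chi> = tw_ind q" by blast
    thus "\<chi> \<in> {\<chi> \<in> Irr \<Gamma> G. cinner N \<chi> \<theta> \<noteq> 0}"
      using ind_Irr[OF tw_fun_imp_Irr[OF q(1)]] ind_over[OF tw_fun_imp_Irr[OF q(1)]] by (simp add: tw_ind_def)
  next
    fix \<chi> assume "\<chi> \<in> {\<chi> \<in> Irr \<Gamma> G. cinner N \<chi> \<theta> \<noteq> 0}"
    hence \<chi>: "\<chi> \<in> Irr \<Gamma> G" "cinner N \<chi> \<theta> \<noteq> 0" by auto
    from Irr_over_factor[OF cliff_Irr[OF \<chi>] cliff_over[OF \<chi>]] obtain q where
      q: "coset_fun \<Gamma> T N q" "cliff \<chi> = (\<lambda>x. mtrace (P x) * q x)" by blast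
    have "tw_fun \<Gamma> T N \<alpha> q" using Irr_over_imp_tw_fun[of q] q cliff_Irr[OF \<chi>] by simp
    moreover have "tw_ind q = \<chi>" unfolding tw_ind_def q(2)[symmetric] by (rule ind_cliff[OF \<chi>])
    ultimately show "\<chi> \<in> tw_ind ` {q. tw_fun \<Gamma> T N \<alpha> q}" by blast
  qed
qed

lemma tw_ind_one: "tw_ind q \<one> = of_nat (card G) / of_nat (card T) * (of_nat d * q \<one>)"
  by (simp add: tw_ind_def ind_def P_one)

end

context projchar_Qab
begin

text \<open>The action of \<open>(x, \<sigma>)\<close> carried from characters to parameters:
  \<sigma> of the trace at the conjugate equals \<open>mu\<close> times the trace, and
  \<open>mu\<close> is absorbed into \<open>q\<close>.\<close>

definition twist :: "'a \<Rightarrow> (complex \<Rightarrow> complex) \<Rightarrow> ('a \<Rightarrow> complex) \<Rightarrow> 'a \<Rightarrow> complex" where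
  "twist x \<sigma> q y = (if y \<in> T then mu \<Gamma> T N d P x \<sigma> y * \<sigma> (q (x \<otimes> y \<otimes> inv x)) else 0)"

lemma mtrace_P_Qab: "x \<in> T \<Longrightarrow> mtrace (P x) \<in> Qab"
  unfolding mtrace_carrier[OF P_carr] by (intro Qab_sum P_Qab) auto

text \<open>On a suitable element of each coset a parameter is a character value divided by a
  nonzero trace, both in \<open>Qab\<close>. Thus \<sigma> may be distributed over the product of
  trace and parameter.\<close>

lemma tw_fun_Qab:
  assumes q: "tw_fun \<Gamma> T N \<alpha> q"
  shows "q x \<in> Qab"
proof (cases "x \<in> T")
  case True
  have c: "coset_fun \<Gamma> T N q" using q by (simp add: tw_fun_def)
  from exists_left_trace_nz[OF True] obtain n where n: "n \<in> N" "mtrace (P (n \<otimes> x)) \<noteq> 0" by blast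
  have nT: "n \<otimes> x \<in> T" using n NT True by simp
  have "mtrace (P (n \<otimes> x)) * q (n \<otimes> x) \<in> Qab" using T.Irr_Qab[OF tw_fun_imp_Irr(1)[OF q]] by simp
  hence "mtrace (P (n \<otimes> x)) * q (n \<otimes> x) / mtrace (P (n \<otimes> x)) \<in> Qab" using mtrace_P_Qab[OF nT]
    by (rule Qab_divide)
  hence "q (n \<otimes> x) \<in> Qab" using n by simp
  thus ?thesis using c n True by (simp add: coset_fun_def)
next
  case False thus ?thesis using q by (simp add: tw_fun_def coset_fun_def)
qed

lemma twist_tw_ind:
  assumes x: "x \<in> G" and \<sigma>: "\<sigma> \<in> GalAb" and st: "char_act \<Gamma> N x \<sigma> \<theta> = \<theta>"
    and q: "tw_fun \<Gamma> T N \<alpha> q"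
  shows "tw_fun \<Gamma> T N \<alpha> (twist x \<sigma> q)" "char_act \<Gamma> G \<one> \<sigma> (tw_ind q) = tw_ind (twist x \<sigma> q)"
proof -
  note mu = mu_spec[OF x \<sigma> st]
  have c: "coset_fun \<Gamma> T N q" using q by (simp add: tw_fun_def)
  have nT: "T.normalizes x" by (rule T_conj_semi[OF x \<sigma> st])
  let ?\<psi> = "\<lambda>x. mtrace (P x) * q x"
  from mu(5) obtain A B where A: "A \<in> carrier_mat d d" "B \<in> carrier_mat d d" "A * B = 1\<^sub>m d" "B * A = 1\<^sub>m d"
    and R: "\<And>y. y \<in> T \<Longrightarrow> Pconj \<Gamma> P x \<sigma> y = mu \<Gamma> T N d P x \<sigma> y \<cdot>\<^sub>m (B * P y * A)" by blast
  have eq: "char_act \<Gamma> T x \<sigma> ?\<psi> = (\<lambda>y. mtrace (P y) * twist x \<sigma> q y)"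
  proof
    fix y
    show "char_act \<Gamma> T x \<sigma> ?\<psi> y = mtrace (P y) * twist x \<sigma> q y"
    proof (cases "y \<in> T")
      case y: True
      have xy: "x \<otimes> y \<otimes> inv x \<in> T" using conj_T[OF x \<sigma> st y] .
      have "\<sigma> (mtrace (P (x \<otimes> y \<otimes> inv x))) = mtrace (Pconj \<Gamma> P x \<sigma> y)"
        unfolding Pconj_def using xy P_Qab by (intro mtrace_map_mat_gal[OF \<sigma>, of _ d, symmetric]) auto
      also have "\<dots> = mu \<Gamma> T N d P x \<sigma> y * mtrace (B * P y * A)"
        unfolding R[OF y] using A(1,2) y by (intro mtrace_smult[of _ d]) simp
      also have "mtrace (B * P y * A) = mtrace (P y)" using A y by (intro mtrace_conj[of _ d]) auto
      finally show ?thesis using y xy tw_fun_Qab[OF q] mtrace_P_Qab[OF xy]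
        by (simp add: char_act_def twist_def GalAbD(3)[OF \<sigma>])
    qed (simp add: char_act_def twist_def)
  qed
  have I: "(\<lambda>y. mtrace (P y) * twist x \<sigma> q y) \<in> Irr \<Gamma> T"
    unfolding eq[symmetric] by (rule T.char_act_Irr[OF tw_fun_imp_Irr(1)[OF q] nT \<sigma>])
  have "twist x \<sigma> q (n \<otimes> y) = twist x \<sigma> q y" if n: "n \<in> N" and y: "y \<in> T" for n y
  proof -
    have "x \<otimes> (n \<otimes> y) \<otimes> inv x = (x \<otimes> n \<otimes> inv x) \<otimes> (x \<otimes> y \<otimes> inv x)"
      using x n y by (intro N.conj_mult) (auto simp: NG TG)
    moreover have "q ((x \<otimes> n \<otimes> inv x) \<otimes> (x \<otimes> y \<otimes> inv x)) = q (x \<otimes> y \<otimes> inv x)"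
      using c conjN[OF x n] conj_T[OF x \<sigma> st y] by (simp add: coset_fun_def)
    ultimately show ?thesis using n y NT mu(3)[OF y n] by (simp add: twist_def)
  qed
  hence c': "coset_fun \<Gamma> T N (twist x \<sigma> q)" by (auto simp: coset_fun_def twist_def)
  show "tw_fun \<Gamma> T N \<alpha> (twist x \<sigma> q)" by (rule Irr_over_imp_tw_fun[OF I c'])
  show "char_act \<Gamma> G \<one> \<sigma> (tw_ind q) = tw_ind (twist x \<sigma> q)"
    unfolding tw_ind_def eq[symmetric] by (rule ind_char_act[OF tw_fun_imp_Irr[OF q] x \<sigma> nT])
qed

end

section \<open>Transfer between two triples\<close>

locale projpair = A: projchar_Qab \<Gamma> G N \<theta> d P \<alpha> + B: projchar_Qab \<Gamma> H M \<phi> d' P' \<alpha>'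
  for \<Gamma> :: "('g, 'b) monoid_scheme" (structure) and G N \<theta> d P \<alpha> H M \<phi> d' P' \<alpha>' +
  fixes p :: nat
  assumes HG: "H \<subseteq> G" and prodG: "G = setprod \<Gamma> N H" and NH: "N \<inter> H = M"
    and stabs: "stabH \<Gamma> p H N \<theta> = stabH \<Gamma> p H M \<phi>"
    and \<alpha>_eq: "\<And>x y. x \<in> stab \<Gamma> H N \<theta> \<Longrightarrow> y \<in> stab \<Gamma> H N \<theta> \<Longrightarrow> \<alpha> x y = \<alpha>' x y"
    and mu_eq: "\<And>x \<sigma> y. (x, \<sigma>) \<in> stabH \<Gamma> p H N \<theta> \<Longrightarrow> y \<in> stab \<Gamma> H N \<theta> \<Longrightarrow>
      mu \<Gamma> (stab \<Gamma> G N \<theta>) N d P x \<sigma> y = mu \<Gamma> (stab \<Gamma> H M \<phi>) M d' P' x \<sigma> y"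
begin

text \<open>The equality \<open>stabs\<close>, restricted to pairs whose Galois part is the
  identity.\<close>

lemma BT_eq: "stab \<Gamma> H N \<theta> = B.T" "x \<in> B.T \<longleftrightarrow> x \<in> A.T \<and> x \<in> H"
proof -
  have "(h, id) \<in> stabH \<Gamma> p H N \<theta> \<longleftrightarrow> (h, id) \<in> stabH \<Gamma> p H M \<phi>" for h
    using stabs by simp
  hence e: "h \<in> H \<and> char_act \<Gamma> N h id \<theta> = \<theta> \<longleftrightarrow> h \<in> H \<and> char_act \<Gamma> M h id \<phi> = \<phi>" for h
    by (auto simp: stabH_def Hgal_id)
  show "stab \<Gamma> H N \<theta> = B.T" using e by (auto simp: stab_def)
  show "x \<in> B.T \<longleftrightarrow> x \<in> A.T \<and> x \<in> H" using e[of x] HG by (auto simp: stab_def)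
qed

lemma prod_cases: assumes "x \<in> G" obtains n h where "n \<in> N" "h \<in> H" "x = n \<otimes> h"
  using assms prodG by (auto simp: setprod_def)

lemma T_prod: assumes "x \<in> A.T" obtains n t where "n \<in> N" "t \<in> B.T" "x = n \<otimes> t"
proof -
  from prod_cases[OF A.TG[OF assms]] obtain n h where h: "n \<in> N" "h \<in> H" "x = n \<otimes> h" by blast
  have "h = inv n \<otimes> x" using h A.NG HG by auto
  hence "h \<in> A.T" using h(1) assms A.NT by simp
  thus ?thesis using that h BT_eq(2) by blast
qed

lemma NBT: "N \<inter> B.T = M"
  using NH B.NT BT_eq(2) by auto

lemma sum_T:
  assumes "\<And>n t. n \<in> N \<Longrightarrow> t \<in> A.T \<Longrightarrow> F (n \<otimes> t) = F t"
  shows "of_nat (card M) * sum F A.T = (of_nat (card N) * sum F B.T :: complex)"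
proof -
  have "of_nat (card (N \<inter> B.T)) * sum F A.T = (of_nat (card N) * sum F B.T :: complex)"
  proof (rule A.coset_average[OF A.N.sub A.T.sub A.T.fin B.T.sub _ _ _ assms])
    show "B.T \<subseteq> A.T" "N \<subseteq> A.T" using BT_eq(2) A.NT by blast+
    show "\<exists>n\<in>N. \<exists>t\<in>B.T. x = n \<otimes> t" if "x \<in> A.T" for x using T_prod[OF that] by blast
  qed
  thus ?thesis unfolding NBT .
qed

lemma card_T: "card M * card A.T = card N * card B.T"
  using sum_T[of "\<lambda>_. 1"] by (simp flip: of_nat_mult)

lemma card_G: "card M * card G = card N * card H"
proof -
  have "of_nat (card (N \<inter> H)) * sum (\<lambda>_. 1) G = (of_nat (card N) * sum (\<lambda>_. 1) H :: complex)"
  proof (rule A.coset_average[OF A.N.sub A.G.sub A.G.fin B.G.sub HG])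
    show "N \<subseteq> G" using A.NG by blast
    show "\<exists>n\<in>N. \<exists>t\<in>H. x = n \<otimes> t" if "x \<in> G" for x using prod_cases[OF that] by blast
  qed simp
  thus ?thesis unfolding NH by (simp flip: of_nat_mult)
qed

text \<open>The functional equations contain sums divided by the order of the stabilizer, so they
  transfer as means.\<close>

lemma avg_T:
  assumes "\<And>n t. n \<in> N \<Longrightarrow> t \<in> A.T \<Longrightarrow> F (n \<otimes> t) = F t"
  shows "sum F A.T / of_nat (card A.T) = (sum F B.T / of_nat (card B.T) :: complex)"
proof -
  have "of_nat (card M) * sum F A.T = of_nat (card N) * sum F B.T"
    by (rule sum_T) (rule assms)
  hence "of_nat (card M) * sum F A.T * of_nat (card B.T) = of_nat (card N) * of_nat (card B.T) * sum F B.T"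
    by (simp add: mult_ac)
  also have "\<dots> = of_nat (card M) * of_nat (card A.T) * sum F B.T"
    using card_T by (simp flip: of_nat_mult)
  finally have "of_nat (card M) * (sum F A.T * of_nat (card B.T)) = of_nat (card M) * (of_nat (card A.T) * sum F B.T)"
    by (simp add: mult_ac)
  hence "sum F A.T * of_nat (card B.T) = of_nat (card A.T) * sum F B.T"
    by (simp only: mult_cancel_left of_nat_eq_0_iff B.N.card_nz simp_thms)
  thus ?thesis by (simp add: field_simps)
qed

definition restr :: "('g \<Rightarrow> complex) \<Rightarrow> 'g \<Rightarrow> complex" where
  "restr q x = (if x \<in> B.T then q x else 0)"

lemma tw_cc_eq: "x \<in> B.T \<Longrightarrow> g \<in> B.T \<Longrightarrow> y \<in> B.T \<Longrightarrow> tw_cc \<Gamma> \<alpha> x g y = tw_cc \<Gamma> \<alpha>' x g y"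
  by (simp add: tw_cc_def \<alpha>_eq BT_eq(1))

lemma BT_AT: "x \<in> B.T \<Longrightarrow> x \<in> A.T" using BT_eq(2) by simp

lemma restr_tw_fun:
  assumes c: "coset_fun \<Gamma> A.T N q"
  shows "tw_fun \<Gamma> A.T N \<alpha> q \<longleftrightarrow> tw_fun \<Gamma> B.T M \<alpha>' (restr q)"
proof -
  have MN: "m \<in> N" if "m \<in> M" for m using that NH by auto
  have rT: "restr q x = q x" if "x \<in> B.T" for x using that by (simp add: restr_def)
  have c': "coset_fun \<Gamma> B.T M (restr q)"
    using c BT_AT MN B.NT by (auto simp: coset_fun_def restr_def)
  have S: "(\<Sum>g\<in>A.T. A.twF q x y g) / of_nat (card A.T) = (\<Sum>g\<in>B.T. B.twF (restr q) x y g) / of_nat (card B.T)"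
    if xy: "x \<in> B.T" "y \<in> B.T" for x y
  proof -
    have "(\<Sum>g\<in>A.T. A.twF q x y g) / of_nat (card A.T) = (\<Sum>g\<in>B.T. A.twF q x y g) / of_nat (card B.T)"
      using xy BT_AT A.twF_g(2)[OF c] by (intro avg_T) auto
    also have "(\<Sum>g\<in>B.T. A.twF q x y g) = (\<Sum>g\<in>B.T. B.twF (restr q) x y g)"
      using xy by (intro sum.cong refl) (simp add: A.twF_def B.twF_def tw_cc_eq rT)
    finally show ?thesis .
  qed
  define FE where "FE x y \<longleftrightarrow> q x * q y = q \<one> / of_nat (card A.T) * (\<Sum>g\<in>A.T. A.twF q x y g)"
    for x y
  define FE' where "FE' x y \<longleftrightarrow> restr q x * restr q y = restr q \<one> / of_nat (card B.T) * (\<Sum>g\<in>B.T. B.twF (restr q) x y g)" for x y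
  have "FE x y \<longleftrightarrow> FE' x y" if "x \<in> B.T" "y \<in> B.T" for x y
    using S[OF that] that by (simp add: FE_def FE'_def rT times_divide_eq_right[symmetric] del: times_divide_eq_right)
  moreover have "FE (n \<otimes> x) (m \<otimes> y) \<longleftrightarrow> FE x y"
    if "n \<in> N" "m \<in> N" "x \<in> A.T" "y \<in> A.T" for n m x y
    using that A.twF_xy[OF c that] c by (simp add: FE_def coset_fun_def)
  \<comment> \<open>Each coset of \<open>N\<close> in \<open>A.T\<close> meets \<open>B.T\<close>,
    so the equation on \<open>A.T\<close> is tested completely by arguments from
    \<open>B.T\<close>.\<close>
  ultimately have FE_iff: "FE (n \<otimes> x) (m \<otimes> y) \<longleftrightarrow> FE' x y"
    if "n \<in> N" "m \<in> N" "x \<in> B.T" "y \<in> B.T" for n m x y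
    using that BT_AT by simp
  have 1: "(\<forall>x\<in>A.T. \<forall>y\<in>A.T. FE x y) \<longleftrightarrow> (\<forall>x\<in>B.T. \<forall>y\<in>B.T. FE' x y)"
  proof (intro iffI ballI)
    fix x y assume "\<forall>x\<in>A.T. \<forall>y\<in>A.T. FE x y" "x \<in> B.T" "y \<in> B.T"
    thus "FE' x y" using FE_iff[of \<one> \<one> x y] BT_AT by simp
  next
    fix x y assume h: "\<forall>x\<in>B.T. \<forall>y\<in>B.T. FE' x y" and xy: "x \<in> A.T" "y \<in> A.T"
    from T_prod[OF xy(1)] obtain n t where nt: "n \<in> N" "t \<in> B.T" "x = n \<otimes> t" .
    from T_prod[OF xy(2)] obtain m u where mu: "m \<in> N" "u \<in> B.T" "y = m \<otimes> u" .
    show "FE x y" using FE_iff[OF nt(1) mu(1) nt(2) mu(2)] h nt mu by simp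
  qed
  have "(\<Sum>g\<in>A.T. \<alpha> g (inv g) * (q g * q (inv g))) / of_nat (card A.T) = (\<Sum>g\<in>B.T. \<alpha> g (inv g) * (q g * q (inv g))) / of_nat (card B.T)"
  proof (rule avg_T)
    fix n t assume n: "n \<in> N" and t: "t \<in> A.T"
    have nT: "n \<in> A.T" by (rule A.NT[OF n])
    have i: "inv (n \<otimes> t) = inv t \<otimes> inv n" using nT t by (simp add: A.inv_mult_group)
    have "\<alpha> (n \<otimes> t) (inv (n \<otimes> t)) = \<alpha> t (inv t)" unfolding i using n t nT
      by (simp add: A.\<alpha>_left A.\<alpha>_right)
    moreover have "q (inv (n \<otimes> t)) = q (inv t)" unfolding i using n t by (intro A.coset_fun_right[OF c]) auto
    ultimately show "\<alpha> (n \<otimes> t) (inv (n \<otimes> t)) * (q (n \<otimes> t) * q (inv (n \<otimes> t))) = \<alpha> t (inv t) * (q t * q (inv t))"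
      using c n t by (simp add: coset_fun_def)
  qed
  also have "(\<Sum>g\<in>B.T. \<alpha> g (inv g) * (q g * q (inv g))) = (\<Sum>g\<in>B.T. \<alpha>' g (inv g) * (restr q g * restr q (inv g)))"
    by (intro sum.cong refl) (simp add: rT \<alpha>_eq BT_eq(1))
  finally have avg: "(\<Sum>g\<in>A.T. \<alpha> g (inv g) * (q g * q (inv g))) / of_nat (card A.T)
      = (\<Sum>g\<in>B.T. \<alpha>' g (inv g) * (restr q g * restr q (inv g))) / of_nat (card B.T)" .
  \<comment> \<open>The norm condition says that the mean is 1, and the means on both sides
    agree.\<close>
  have quot: "a = b \<longleftrightarrow> a' = b'" if "a / b = a' / b'" "b \<noteq> 0" "b' \<noteq> 0" for a b a' b' :: complex
    using that by (metis divide_eq_1_iff)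
  have 2: "(\<Sum>g\<in>A.T. \<alpha> g (inv g) * (q g * q (inv g))) = of_nat (card A.T) \<longleftrightarrow>
      (\<Sum>g\<in>B.T. \<alpha>' g (inv g) * (restr q g * restr q (inv g))) = of_nat (card B.T)"
    by (rule quot[OF avg]) (simp_all only: of_nat_eq_0_iff A.T.card_nz B.T.card_nz not_False_eq_True)
  have 3: "restr q \<one> = q \<one>" by (rule rT) simp
  show ?thesis
    unfolding A.tw_fun_alt B.tw_fun_alt
    using c c' 1 2 3 unfolding FE_def FE'_def by simp
qed

text \<open>Elements of \<open>B.T\<close> in a common coset of \<open>N\<close> differ by an
  element of \<open>N \<inter> B.T = M\<close>, so the value at a chosen representative is well
  defined.\<close>

lemma restr_ext:
  assumes c: "coset_fun \<Gamma> B.T M q"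
  shows "\<exists>q'. coset_fun \<Gamma> A.T N q' \<and> restr q' = q"
proof -
  define q' where "q' x = (if x \<in> A.T then q (SOME t. t \<in> B.T \<and> (\<exists>n\<in>N. x = n \<otimes> t)) else 0)" for x
  have key: "q' (n \<otimes> t) = q t" if n: "n \<in> N" and t: "t \<in> B.T" for n t
  proof -
    define s where "s = (SOME s. s \<in> B.T \<and> (\<exists>m\<in>N. n \<otimes> t = m \<otimes> s))"
    have "s \<in> B.T \<and> (\<exists>m\<in>N. n \<otimes> t = m \<otimes> s)"
      unfolding s_def by (rule someI[of _ t]) (use n t in blast)
    then obtain m where s: "s \<in> B.T" "m \<in> N" "n \<otimes> t = m \<otimes> s" by blast
    have G: "n \<in> G" "t \<in> G" "m \<in> G" "s \<in> G" using n s t A.NG BT_AT A.TG by auto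
    have "s = inv m \<otimes> (n \<otimes> t)" unfolding s(3) using G by simp
    hence st: "s = (inv m \<otimes> n) \<otimes> t" using G by (simp add: A.m_assoc)
    have "inv m \<otimes> n = s \<otimes> inv t" unfolding st using G by (simp add: A.m_assoc)
    hence "inv m \<otimes> n \<in> B.T" using s(1) t by simp
    hence "inv m \<otimes> n \<in> N \<inter> B.T" using n s(2) by simp
    hence "inv m \<otimes> n \<in> M" by (simp only: NBT)
    hence "q s = q t" using c t st by (simp add: coset_fun_def)
    thus ?thesis using n t A.NT BT_AT by (simp add: q'_def s_def)
  qed
  have "q' (n \<otimes> x) = q' x" if n: "n \<in> N" and x: "x \<in> A.T" for n x
  proof -
    from T_prod[OF x] obtain m t where mt: "m \<in> N" "t \<in> B.T" "x = m \<otimes> t" by blast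
    have "n \<otimes> x = (n \<otimes> m) \<otimes> t" using mt n by (simp add: A.m_assoc A.NG A.TG BT_AT)
    thus ?thesis using key[of "n \<otimes> m" t] key[of m t] mt n by simp
  qed
  hence "coset_fun \<Gamma> A.T N q'" by (auto simp: coset_fun_def q'_def)
  moreover have "restr q' = q"
  proof
    fix x
    show "restr q' x = q x" using key[of \<one> x] c A.N.memb(1)
      by (cases "x \<in> B.T") (auto simp: restr_def coset_fun_def)
  qed
  ultimately show ?thesis by blast
qed

lemma restr_bij: "bij_betw restr {q. tw_fun \<Gamma> A.T N \<alpha> q} {q. tw_fun \<Gamma> B.T M \<alpha>' q}"
proof (rule bij_betw_imageI)
  show "inj_on restr {q. tw_fun \<Gamma> A.T N \<alpha> q}"
  proof (rule inj_onI, simp)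
    fix q q' assume q: "tw_fun \<Gamma> A.T N \<alpha> q" and q': "tw_fun \<Gamma> A.T N \<alpha> q'" and e: "restr q = restr q'"
    show "q = q'"
    proof
      fix x
      show "q x = q' x"
      proof (cases "x \<in> A.T")
        case True
        from T_prod[OF True] obtain n t where nt: "n \<in> N" "t \<in> B.T" "x = n \<otimes> t" by blast
        have "q t = q' t" using fun_cong[OF e, of t] nt by (simp add: restr_def)
        thus ?thesis using tw_fun_coset[OF q] tw_fun_coset[OF q'] nt BT_AT by (simp add: coset_fun_def)
      next
        case False thus ?thesis using tw_fun_coset[OF q] tw_fun_coset[OF q'] by (simp add: coset_fun_def)
      qed
    qed
  qed
  show "restr ` {q. tw_fun \<Gamma> A.T N \<alpha> q} = {q. tw_fun \<Gamma> B.T M \<alpha>' q}"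
  proof (intro equalityI subsetI)
    fix r assume "r \<in> restr ` {q. tw_fun \<Gamma> A.T N \<alpha> q}"
    then obtain q where q: "tw_fun \<Gamma> A.T N \<alpha> q" "r = restr q" by blast
    thus "r \<in> {q. tw_fun \<Gamma> B.T M \<alpha>' q}" using restr_tw_fun[OF tw_fun_coset[OF q(1)]] by simp
  next
    fix r assume "r \<in> {q. tw_fun \<Gamma> B.T M \<alpha>' q}"
    hence r: "tw_fun \<Gamma> B.T M \<alpha>' r" by simp
    then obtain q where q: "coset_fun \<Gamma> A.T N q" "restr q = r" using restr_ext[OF tw_fun_coset[OF r]] by blast
    hence "tw_fun \<Gamma> A.T N \<alpha> q" using restr_tw_fun[OF q(1)] r by simp
    thus "r \<in> restr ` {q. tw_fun \<Gamma> A.T N \<alpha> q}" using q(2) by blast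
  qed
qed

lemma stabHD:
  assumes "(x, \<sigma>) \<in> stabH \<Gamma> p H N \<theta>"
  shows "x \<in> G" "x \<in> H" "\<sigma> \<in> GalAb" "char_act \<Gamma> N x \<sigma> \<theta> = \<theta>" "char_act \<Gamma> M x \<sigma> \<phi> = \<phi>"
  using assms assms[unfolded stabs] HG Hgal_GalAb by (auto simp: stabH_def)

text \<open>Here the equality of the two functions \<open>mu\<close> enters: it makes restriction of
  parameters compatible with the action of \<open>(x, \<sigma>)\<close>.\<close>

lemma restr_twist:
  assumes a: "(x, \<sigma>) \<in> stabH \<Gamma> p H N \<theta>"
  shows "restr (A.twist x \<sigma> q) = B.twist x \<sigma> (restr q)"
proof
  fix y
  note s = stabHD[OF a]
  show "restr (A.twist x \<sigma> q) y = B.twist x \<sigma> (restr q) y"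
  proof (cases "y \<in> B.T")
    case True
    have "x \<otimes> y \<otimes> inv x \<in> B.T" by (rule B.conj_T[OF s(2,3,5) True])
    thus ?thesis using True BT_AT mu_eq[OF a, of y] by (simp add: restr_def A.twist_def B.twist_def BT_eq(1))
  qed (simp add: restr_def B.twist_def)
qed

theorem character_bijection:
  "\<exists>\<tau>. bij_betw \<tau> (Irr_over_orb \<Gamma> p G N \<theta>) (Irr_over_orb \<Gamma> p H M \<phi>) \<and>
     (\<forall>\<chi>\<in>Irr_over_orb \<Gamma> p G N \<theta>.
        (\<forall>\<sigma>\<in>Hgal p. \<tau> (char_act \<Gamma> G \<one> \<sigma> \<chi>) = char_act \<Gamma> H \<one> \<sigma> (\<tau> \<chi>)) \<and>
        \<chi> \<one> / \<theta> \<one> = \<tau> \<chi> \<one> / \<phi> \<one>)"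
proof -
  let ?E = "{q. tw_fun \<Gamma> A.T N \<alpha> q}" and ?E' = "{q. tw_fun \<Gamma> B.T M \<alpha>' q}"
  let ?X = "{\<chi> \<in> Irr \<Gamma> G. cinner N \<chi> \<theta> \<noteq> 0}"
    and ?Y = "{\<chi> \<in> Irr \<Gamma> H. cinner M \<chi> \<phi> \<noteq> 0}"
  define f where "f = B.tw_ind \<circ> restr \<circ> inv_into ?E A.tw_ind"
  have bf: "bij_betw f ?X ?Y"
    unfolding f_def by (intro bij_betw_trans[OF bij_betw_inv_into[OF A.tw_ind_bij]] bij_betw_trans[OF restr_bij] B.tw_ind_bij)
  have f: "f (A.tw_ind q) = B.tw_ind (restr q)" if "tw_fun \<Gamma> A.T N \<alpha> q" for q
    using bij_betw_inv_into_left[OF A.tw_ind_bij, of q] that by (simp add: f_def)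
  have X: "\<exists>q. tw_fun \<Gamma> A.T N \<alpha> q \<and> \<chi> = A.tw_ind q" if "\<chi> \<in> ?X" for \<chi>
  proof -
    have "\<chi> \<in> A.tw_ind ` ?E" using A.tw_ind_bij that unfolding bij_betw_def by simp
    thus ?thesis by auto
  qed
  have fY: "f \<chi> \<in> ?Y" if "\<chi> \<in> ?X" for \<chi> using bij_betw_apply[OF bf that] .
  have C: "char_act \<Gamma> G \<one> \<sigma> \<chi> \<in> ?X \<and> f (char_act \<Gamma> G \<one> \<sigma> \<chi>) = char_act \<Gamma> H \<one> \<sigma> (f \<chi>)"
    if a: "(x, \<sigma>) \<in> stabH \<Gamma> p H N \<theta>" and \<chi>: "\<chi> \<in> ?X" for x \<sigma> \<chi>
  proof -
    note s = stabHD[OF a]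
    from X[OF \<chi>] obtain q where q: "tw_fun \<Gamma> A.T N \<alpha> q" "\<chi> = A.tw_ind q" by blast
    have q': "tw_fun \<Gamma> B.T M \<alpha>' (restr q)" using bij_betw_apply[OF restr_bij, of q] q by simp
    note t = A.twist_tw_ind[OF s(1,3,4) q(1)]
    have "A.tw_ind (A.twist x \<sigma> q) \<in> ?X" using bij_betw_apply[OF A.tw_ind_bij, of "A.twist x \<sigma> q"] t by blast
    moreover have "f (char_act \<Gamma> G \<one> \<sigma> \<chi>) = char_act \<Gamma> H \<one> \<sigma> (f \<chi>)"
      using f[OF t(1)] f[OF q(1)] t(2) q(2) restr_twist[OF a] B.twist_tw_ind(2)[OF s(2,3,5) q'] by simp
    ultimately show ?thesis using t(2) q(2) by simp
  qed
  have D: "\<exists>x. (x, \<sigma>) \<in> stabH \<Gamma> p H N \<theta>" if \<sigma>: "\<sigma> \<in> Hgal p"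
    and \<chi>: "\<chi> \<in> ?X" "char_act \<Gamma> G \<one> \<sigma> \<chi> \<in> ?X" for \<sigma> \<chi>
  proof -
    have "\<exists>g\<in>G. char_act \<Gamma> N g \<sigma> \<theta> = \<theta>"
      using \<chi> Hgal_GalAb[OF \<sigma>] by (intro A.semi_stabilizer[of \<chi>]) auto
    then obtain g where g: "g \<in> G" "char_act \<Gamma> N g \<sigma> \<theta> = \<theta>" by blast
    from prod_cases[OF g(1)] obtain n h where nh: "n \<in> N" "h \<in> H" "g = n \<otimes> h" by blast
    have "char_act \<Gamma> N h \<sigma> \<theta> = char_act \<Gamma> N h \<sigma> (char_act \<Gamma> N n id \<theta>)"
      using A.N.char_act_inner[OF A.\<theta> nh(1)] by simp
    also have "\<dots> = char_act \<Gamma> N g (\<sigma> \<circ> id) \<theta>"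
      unfolding nh(3) using nh HG A.NG by (intro A.N.char_act_comp A.normN) auto
    finally have "char_act \<Gamma> N h \<sigma> \<theta> = \<theta>" using g(2) by simp
    thus ?thesis using nh(2) \<sigma> by (auto simp: stabH_def)
  qed
  have D': "\<exists>x. (x, \<sigma>) \<in> stabH \<Gamma> p H N \<theta>" if \<sigma>: "\<sigma> \<in> Hgal p"
    and \<chi>: "\<chi> \<in> ?Y" "char_act \<Gamma> H \<one> \<sigma> \<chi> \<in> ?Y" for \<sigma> \<chi>
  proof -
    have "\<exists>g\<in>H. char_act \<Gamma> M g \<sigma> \<phi> = \<phi>"
      using \<chi> Hgal_GalAb[OF \<sigma>] by (intro B.semi_stabilizer[of \<chi>]) auto
    thus ?thesis unfolding stabs using \<sigma> by (auto simp: stabH_def)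
  qed
  have "\<exists>F. bij_betw F (\<Union>\<sigma>\<in>Hgal p. char_act \<Gamma> G \<one> \<sigma> ` ?X) (\<Union>\<sigma>\<in>Hgal p. char_act \<Gamma> H \<one> \<sigma> ` ?Y) \<and>
     (\<forall>\<sigma>\<in>Hgal p. \<forall>a\<in>(\<Union>\<sigma>\<in>Hgal p. char_act \<Gamma> G \<one> \<sigma> ` ?X). F (char_act \<Gamma> G \<one> \<sigma> a) = char_act \<Gamma> H \<one> \<sigma> (F a)) \<and>
     (\<forall>\<sigma>\<in>Hgal p. \<forall>a\<in>?X. F (char_act \<Gamma> G \<one> \<sigma> a) = char_act \<Gamma> H \<one> \<sigma> (f a))"
  proof (rule equivariant_extension[OF Hgal_id Hgal_comp _ _ _ _ _ bf])
    show "\<exists>\<tau>\<in>Hgal p. \<sigma> \<circ> \<tau> = id \<and> \<tau> \<circ> \<sigma> = id" if "\<sigma> \<in> Hgal p"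
      for \<sigma>
      using Hgal_inv[OF that] Hgal_inv_comp[OF that] by blast
    show "f (char_act \<Gamma> G \<one> \<sigma> a) = char_act \<Gamma> H \<one> \<sigma> (f a)"
      if "\<sigma> \<in> Hgal p" "a \<in> ?X" "char_act \<Gamma> G \<one> \<sigma> a \<in> ?X" for \<sigma> a
      using C D that by blast
    show "char_act \<Gamma> G \<one> \<sigma> a \<in> ?X"
      if "\<sigma> \<in> Hgal p" "a \<in> ?X" "char_act \<Gamma> H \<one> \<sigma> (f a) \<in> ?Y" for \<sigma> a
      using C D'[OF that(1) fY[OF that(2)] that(3)] that(2) by blast
  qed (auto simp: A.G.char_act_one_id B.G.char_act_one_id A.gal_comp B.gal_comp)
  hence "\<exists>F. bij_betw F (Irr_over_orb \<Gamma> p G N \<theta>) (Irr_over_orb \<Gamma> p H M \<phi>) \<and>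
     (\<forall>\<sigma>\<in>Hgal p. \<forall>a\<in>Irr_over_orb \<Gamma> p G N \<theta>. F (char_act \<Gamma> G \<one> \<sigma> a) = char_act \<Gamma> H \<one> \<sigma> (F a)) \<and>
     (\<forall>\<sigma>\<in>Hgal p. \<forall>a\<in>?X. F (char_act \<Gamma> G \<one> \<sigma> a) = char_act \<Gamma> H \<one> \<sigma> (f a))"
    by (simp only: A.Irr_over_orb_eq B.Irr_over_orb_eq)
  then obtain F where F: "bij_betw F (Irr_over_orb \<Gamma> p G N \<theta>) (Irr_over_orb \<Gamma> p H M \<phi>)"
    "\<And>\<sigma> \<chi>. \<sigma> \<in> Hgal p \<Longrightarrow> \<chi> \<in> Irr_over_orb \<Gamma> p G N \<theta> \<Longrightarrow> F (char_act \<Gamma> G \<one> \<sigma> \<chi>) = char_act \<Gamma> H \<one> \<sigma> (F \<chi>)"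
    "\<And>\<sigma> \<chi>. \<sigma> \<in> Hgal p \<Longrightarrow> \<chi> \<in> ?X \<Longrightarrow> F (char_act \<Gamma> G \<one> \<sigma> \<chi>) = char_act \<Gamma> H \<one> \<sigma> (f \<chi>)"
    by blast
  have "\<chi> \<one> / \<theta> \<one> = F \<chi> \<one> / \<phi> \<one>"
    if \<chi>: "\<chi> \<in> Irr_over_orb \<Gamma> p G N \<theta>" for \<chi>
  proof -
    from \<chi> obtain \<sigma> \<chi>0
      where s: "\<sigma> \<in> Hgal p" "\<chi>0 \<in> ?X" "\<chi> = char_act \<Gamma> G \<one> \<sigma> \<chi>0"
      unfolding A.Irr_over_orb_eq by blast
    \<comment> \<open>Degrees are natural numbers and fixed by \<sigma>, so the ratio has to be
      computed only for a character over \<theta> itself.\<close>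
    have fixed: "\<sigma> (\<eta> \<one>) = \<eta> \<one>" if "\<exists>n::nat. \<eta> \<one> = of_nat n"
      for \<eta> :: "'g \<Rightarrow> complex"
      using that GalAbD(11)[OF Hgal_GalAb[OF s(1)]] by auto
    have "\<chi> \<one> = \<chi>0 \<one>" using s fixed[of \<chi>0] A.G.Irr_degree[of \<chi>0] by (auto simp: char_act_def)
    moreover have "F \<chi> \<one> = f \<chi>0 \<one>"
      using F(3)[OF s(1,2)] s(3) fixed[of "f \<chi>0"] B.G.Irr_degree[of "f \<chi>0"] fY[OF s(2)] by (auto simp: char_act_def)
    moreover have "\<chi>0 \<one> / \<theta> \<one> = f \<chi>0 \<one> / \<phi> \<one>"
    proof -
      from X[OF s(2)] obtain q where q: "tw_fun \<Gamma> A.T N \<alpha> q" "\<chi>0 = A.tw_ind q" by blast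
      have "\<chi>0 \<one> / \<theta> \<one> = of_nat (card G) / of_nat (card A.T) * q \<one>"
        unfolding q(2) A.tw_ind_one A.\<theta>_one using A.d_pos by simp
      moreover have "f \<chi>0 \<one> / \<phi> \<one> = of_nat (card H) / of_nat (card B.T) * q \<one>"
        unfolding q(2) f[OF q(1)] B.tw_ind_one B.\<theta>_one using B.d_pos by (simp add: restr_def)
      moreover have "(of_nat (card G) / of_nat (card A.T) :: complex) = of_nat (card H) / of_nat (card B.T)"
      proof -
        \<comment> \<open>The two coset counts are multiplied crosswise; cancelling
          \<open>card M * card N\<close> leaves equality of the indices of the stabilizers.\<close>
        have "card M * card G * (card N * card B.T) = card N * card H * (card M * card A.T)"
          using card_G card_T by simp
        hence "card G * card B.T = card H * card A.T" by (simp add: mult_ac)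
        hence "(of_nat (card G) * of_nat (card B.T) :: complex) = of_nat (card H) * of_nat (card A.T)"
          by (metis of_nat_mult)
        thus ?thesis by (simp add: field_simps)
      qed
      ultimately show ?thesis by simp
    qed
    ultimately show ?thesis by simp
  qed
  thus ?thesis using F(1,2) by blast
qed

end

section \<open>Central products\<close>

lemma root_of_unity_mult: "root_of_unity x \<Longrightarrow> root_of_unity y \<Longrightarrow> root_of_unity (x * y)"
proof -
  assume "root_of_unity x" "root_of_unity y"
  then obtain n m :: nat where nm: "n > 0" "x ^ n = 1" "m > 0" "y ^ m = 1" by (auto simp: root_of_unity_def)
  have "x ^ (n * m) = 1" using nm by (simp add: power_mult)
  moreover have "y ^ (n * m) = 1" using nm by (metis mult.commute power_mult power_one)
  ultimately have "(x * y) ^ (n * m) = 1" by (simp add: power_mult_distrib)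
  thus ?thesis using nm unfolding root_of_unity_def by (intro exI[of _ "n * m"]) auto
qed

lemma root_of_unity_inverse: "root_of_unity x \<Longrightarrow> root_of_unity (inverse x)"
  by (auto simp: root_of_unity_def power_inverse intro!: exI)

lemma root_of_unity_divide: "root_of_unity x \<Longrightarrow> root_of_unity y \<Longrightarrow> root_of_unity (x / y)"
  unfolding divide_inverse by (intro root_of_unity_mult root_of_unity_inverse)

lemma root_of_unity_nz: "root_of_unity x \<Longrightarrow> x \<noteq> 0"
  by (auto simp: root_of_unity_def power_0_left)

lemma root_of_unity_norm: "root_of_unity x \<Longrightarrow> x * cnj x = 1"
  unfolding root_of_unity_def
  by (metis complex_norm_square not_gr_zero of_real_1 power_eq_1_iff power_one)

lemma root_of_unity_prod: "finite A \<Longrightarrow> (\<And>x. x \<in> A \<Longrightarrow> root_of_unity (f x)) \<Longrightarrow> root_of_unity (\<Prod>x\<in>A. f x)"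
  by (induction A rule: finite_induct) (auto intro: root_of_unity_mult simp: root_of_unity_def[of 1])

lemma root_of_unity_of_power: "root_of_unity (x ^ n) \<Longrightarrow> n > 0 \<Longrightarrow> root_of_unity x"
  unfolding root_of_unity_def by (metis mult_pos_pos power_mult)

section \<open>Linear characters\<close>

context fsub
begin

text \<open>In an abelian group all summands of the functional equation are equal, so it becomes
  multiplicativity up to the degree; the norm condition and positivity make the degree 1.\<close>

lemma abelian_Irr:
  assumes ab: "\<And>x y. x \<in> K \<Longrightarrow> y \<in> K \<Longrightarrow> x \<otimes> y = y \<otimes> x"
    and \<chi>: "\<chi> \<in> Irr \<Gamma> K"
  shows "\<chi> \<one> = 1" "x \<in> K \<Longrightarrow> y \<in> K \<Longrightarrow> \<chi> (x \<otimes> y) = \<chi> x * \<chi> y" "x \<in> K \<Longrightarrow> root_of_unity (\<chi> x)"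
proof -
  note I = irr_funD[OF Irr_imp_irr_fun[OF \<chi>]]
  have FE: "\<chi> x * \<chi> y = \<chi> \<one> * \<chi> (x \<otimes> y)" if xy: "x \<in> K" "y \<in> K" for x y
  proof -
    have "x \<otimes> g \<otimes> y \<otimes> inv g = x \<otimes> y" if g: "g \<in> K" for g
    proof -
      have "x \<otimes> g \<otimes> y \<otimes> inv g = x \<otimes> (g \<otimes> y) \<otimes> inv g" using xy g
        by (simp add: m_assoc)
      thus ?thesis unfolding ab[OF g xy(2)] using xy g by (simp add: m_assoc)
    qed
    thus ?thesis using I(3)[OF xy] by simp
  qed
  obtain r :: real where r: "r > 0" "\<chi> \<one> = of_real r" using Irr_imp_irr_fun[OF \<chi>] by (auto simp: irr_fun_def)
  have "of_nat (card K) * (\<chi> \<one> * \<chi> \<one>) = of_nat (card K)"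
    using I(4) FE[of _ "inv _"] by simp
  hence "\<chi> \<one> * \<chi> \<one> = 1" by simp
  hence "r * r = 1" unfolding r(2) by (metis of_real_eq_1_iff of_real_mult)
  hence "r = 1" using r(1) by (metis abs_of_pos abs_mult_self_eq mult_cancel_right2 real_sqrt_abs2 real_sqrt_one)
  thus 1: "\<chi> \<one> = 1" using r(2) by simp
  show m: "\<chi> (x \<otimes> y) = \<chi> x * \<chi> y" if "x \<in> K" "y \<in> K" for x y using FE[OF that] 1 by simp
  show "root_of_unity (\<chi> x)" if x: "x \<in> K"
  proof -
    have "x [^] (j::nat) \<in> K \<and> \<chi> (x [^] j) = \<chi> x ^ j" for j
      by (induction j) (use x 1 m in auto)
    from this[of "card K"] have "\<chi> x ^ card K = 1" using pow_card_eq_one[OF x] 1 by simp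
    thus ?thesis unfolding root_of_unity_def using card_nz(2) by blast
  qed
qed

text \<open>Shifting the sum by \<open>b\<close> multiplies it by \<open>f b * cnj (h b)\<close>,
  which must be 1 as the sum is nonzero.\<close>

lemma linear_eq:
  assumes f: "\<And>x y. x \<in> K \<Longrightarrow> y \<in> K \<Longrightarrow> f (x \<otimes> y) = f x * f y"
    and h: "\<And>x y. x \<in> K \<Longrightarrow> y \<in> K \<Longrightarrow> h (x \<otimes> y) = h x * h y"
    and norm: "\<And>x. x \<in> K \<Longrightarrow> h x * cnj (h x) = 1" and nz: "cinner K f h \<noteq> 0" and b: "b \<in> K"
  shows "f b = h b"
proof -
  let ?S = "\<Sum>x\<in>K. f x * cnj (h x)"
  have S: "?S \<noteq> 0" using nz by (auto simp: cinner_def)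
  have "f b * cnj (h b) * ?S = (\<Sum>x\<in>K. f (b \<otimes> x) * cnj (h (b \<otimes> x)))"
    using b f h by (simp add: sum_distrib_left mult_ac)
  also have "\<dots> = ?S" by (rule sum_left[OF b])
  finally have "f b * cnj (h b) = 1" using S by simp
  hence "f b * (h b * cnj (h b)) = h b" by (simp add: mult_ac)
  thus ?thesis using norm[OF b] by simp
qed

end

section \<open>The stabilizer of a Galois orbit\<close>

context nchar
begin

text \<open>Closure under inverses turns the orbit condition into the existence of a pair
  \<open>(g, \<sigma>)\<close> fixing \<theta>; in this form products of elements are handled by
  \<open>char_act_comp\<close>.\<close>

lemma stab_orb_iff:
  "g \<in> stab_orb \<Gamma> p G N \<theta> \<longleftrightarrow> g \<in> G \<and> (\<exists>\<sigma>\<in>Hgal p. char_act \<Gamma> N g \<sigma> \<theta> = \<theta>)"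
proof (cases "g \<in> G")
  case g: True
  have o: "N.normalizes \<one>" by (rule normN) simp
  have comp: "char_act \<Gamma> N \<one> \<tau> (char_act \<Gamma> N g \<sigma> \<theta>) = char_act \<Gamma> N g (\<tau> \<circ> \<sigma>) \<theta>" for \<sigma> \<tau>
    using N.char_act_comp[OF normN[OF g] o, of \<tau> \<sigma> \<theta>] g by simp
  have comp1: "char_act \<Gamma> N \<one> \<tau> (char_act \<Gamma> N \<one> \<sigma> \<theta>) = char_act \<Gamma> N \<one> (\<tau> \<circ> \<sigma>) \<theta>" for \<sigma> \<tau>
    using N.char_act_comp[OF o o, of \<tau> \<sigma> \<theta>] by simp
  note one = N.char_act_one_id[OF \<theta>]
  have "char_act \<Gamma> N g id \<theta> \<in> Horbit \<Gamma> p N \<theta> \<longleftrightarrow> (\<exists>\<sigma>\<in>Hgal p. char_act \<Gamma> N g \<sigma> \<theta> = \<theta>)"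
  proof
    assume "char_act \<Gamma> N g id \<theta> \<in> Horbit \<Gamma> p N \<theta>"
    then obtain \<sigma> where s: "\<sigma> \<in> Hgal p" "char_act \<Gamma> N g id \<theta> = char_act \<Gamma> N \<one> \<sigma> \<theta>" by (auto simp: Horbit_def)
    have "char_act \<Gamma> N g (inv_into UNIV \<sigma>) \<theta> = \<theta>"
      using comp[of "inv_into UNIV \<sigma>" id] comp1[of "inv_into UNIV \<sigma>" \<sigma>] s Hgal_inv_comp(2)[OF s(1)] one
        by simp
    thus "\<exists>\<sigma>\<in>Hgal p. char_act \<Gamma> N g \<sigma> \<theta> = \<theta>" using Hgal_inv[OF s(1)] by blast
  next
    assume "\<exists>\<sigma>\<in>Hgal p. char_act \<Gamma> N g \<sigma> \<theta> = \<theta>"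
    then obtain \<sigma> where s: "\<sigma> \<in> Hgal p" "char_act \<Gamma> N g \<sigma> \<theta> = \<theta>" by blast
    have "char_act \<Gamma> N g id \<theta> = char_act \<Gamma> N \<one> (inv_into UNIV \<sigma>) \<theta>"
      using comp[of "inv_into UNIV \<sigma>" \<sigma>] s Hgal_inv_comp(2)[OF s(1)] by simp
    thus "char_act \<Gamma> N g id \<theta> \<in> Horbit \<Gamma> p N \<theta>" using Hgal_inv[OF s(1)] by (auto simp: Horbit_def)
  qed
  thus ?thesis using g by (simp add: stab_orb_def)
qed (simp add: stab_orb_def)

lemma stab_orb_subgroup: "subgroup (stab_orb \<Gamma> p G N \<theta>) \<Gamma>"
proof
  show "stab_orb \<Gamma> p G N \<theta> \<subseteq> carrier \<Gamma>" using stab_orb_iff by auto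
  show "\<one> \<in> stab_orb \<Gamma> p G N \<theta>" using stab_orb_iff N.char_act_one_id[OF \<theta>] Hgal_id by auto
  fix x y assume "x \<in> stab_orb \<Gamma> p G N \<theta>" "y \<in> stab_orb \<Gamma> p G N \<theta>"
  then obtain \<sigma> \<tau> where x: "x \<in> G" "\<sigma> \<in> Hgal p" "char_act \<Gamma> N x \<sigma> \<theta> = \<theta>"
    and y: "y \<in> G" "\<tau> \<in> Hgal p" "char_act \<Gamma> N y \<tau> \<theta> = \<theta>" unfolding stab_orb_iff by blast
  have "char_act \<Gamma> N (x \<otimes> y) (\<tau> \<circ> \<sigma>) \<theta> = \<theta>"
    using N.char_act_comp[OF normN[OF x(1)] normN[OF y(1)], of \<tau> \<sigma> \<theta>] x y by simp
  thus "x \<otimes> y \<in> stab_orb \<Gamma> p G N \<theta>" unfolding stab_orb_iff using Hgal_comp[OF y(2) x(2)] x y by auto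
next
  fix x assume "x \<in> stab_orb \<Gamma> p G N \<theta>"
  then obtain \<sigma> where x: "x \<in> G" "\<sigma> \<in> Hgal p" "char_act \<Gamma> N x \<sigma> \<theta> = \<theta>"
    unfolding stab_orb_iff by blast
  have xi: "inv x \<in> G" using x by simp
  have "char_act \<Gamma> N (inv x) (inv_into UNIV \<sigma>) \<theta> = \<theta>"
    using N.char_act_comp[OF normN[OF x(1)] normN[OF xi], of "inv_into UNIV \<sigma>" \<sigma> \<theta>] x
      Hgal_inv_comp(2)[OF x(2)] N.char_act_one_id[OF \<theta>] by simp
  thus "inv x \<in> stab_orb \<Gamma> p G N \<theta>" unfolding stab_orb_iff using Hgal_inv[OF x(2)] xi by auto
qed

lemma N_stab_orb: "n \<in> N \<Longrightarrow> n \<in> stab_orb \<Gamma> p G N \<theta>"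
  unfolding stab_orb_iff using N.char_act_inner[OF \<theta>] Hgal_id NG by blast

lemma nsub_stab_orb: "nsub \<Gamma> N (stab_orb \<Gamma> p G N \<theta>)"
  unfolding nsub_def using stab_orb_subgroup N.sub N_stab_orb conjN by (auto simp: stab_orb_iff)

lemma nchar_stab_orb: "nchar \<Gamma> (stab_orb \<Gamma> p G N \<theta>) N \<theta>"
proof (intro nchar.intro nchar_axioms.intro is_group nsub_stab_orb \<theta>)
  show "finite (stab_orb \<Gamma> p G N \<theta>)" using finG by (rule finite_subset[rotated]) (auto simp: stab_orb_iff)
qed

lemma Htriple_stab_orb: "Htriple \<Gamma> p (stab_orb \<Gamma> p G N \<theta>) N \<theta>"
  unfolding Htriple_def using nsub_stab_orb \<theta> by (auto simp: stab_orb_def)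

end

section \<open>The product of N and Z and its character\<close>

locale central = projchar_Qab \<Gamma> G N \<theta> d P \<alpha>
  for \<Gamma> :: "('g, 'b) monoid_scheme" (structure) and G N \<theta> d P \<alpha> +
  fixes Z :: "'g set" and lam \<zeta> :: "'g \<Rightarrow> complex"
  assumes ZG: "nsub \<Gamma> Z G"
    and Zab: "\<And>a b. a \<in> Z \<Longrightarrow> b \<in> Z \<Longrightarrow> a \<otimes> b = b \<otimes> a"
    and ZC: "Z \<subseteq> centr \<Gamma> G N" and lam: "lam \<in> Irr \<Gamma> Z"
    and Pz: "\<And>z. z \<in> Z \<Longrightarrow> P z = \<zeta> z \<cdot>\<^sub>m 1\<^sub>m d"
    and lam_\<zeta>: "\<And>c. c \<in> Z \<Longrightarrow> c \<in> N \<Longrightarrow> lam c = \<zeta> c"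
    and \<alpha>_root: "\<And>x y. x \<in> stab \<Gamma> G N \<theta> \<Longrightarrow> y \<in> stab \<Gamma> G N \<theta> \<Longrightarrow> root_of_unity (\<alpha> x y)"
begin

sublocale Z: fsub \<Gamma> Z
  by (intro fsub.intro fsub_axioms.intro is_group nsubD(2)[OF ZG] finite_subset[OF nsubD(3)[OF ZG] finG])

lemma ZinG: "z \<in> Z \<Longrightarrow> z \<in> G" using nsubD(3)[OF ZG] by auto

lemma conjZ: "g \<in> G \<Longrightarrow> z \<in> Z \<Longrightarrow> g \<otimes> z \<otimes> inv g \<in> Z"
  using nsubD(4)[OF ZG] .

lemma zn: "z \<in> Z \<Longrightarrow> n \<in> N \<Longrightarrow> z \<otimes> n = n \<otimes> z" using ZC
  by (auto simp: centr_def)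

lemma ZT: assumes z: "z \<in> Z" shows "z \<in> T"
proof -
  have "z \<otimes> n \<otimes> inv z = n" if n: "n \<in> N" for n
    unfolding zn[OF z n] using z n by (simp add: m_assoc NG ZinG)
  thus ?thesis using ZinG[OF z] by (simp add: T_iff)
qed

lemma lam_one: "lam \<one> = 1"
  and lam_mult: "z \<in> Z \<Longrightarrow> w \<in> Z \<Longrightarrow> lam (z \<otimes> w) = lam z * lam w"
  and lam_root: "z \<in> Z \<Longrightarrow> root_of_unity (lam z)"
  using Z.abelian_Irr[OF Zab lam] by auto

lemma lam_out: "z \<notin> Z \<Longrightarrow> lam z = 0"
  by (rule Z.irr_funD(1)[OF Z.Irr_imp_irr_fun[OF lam]])

lemma \<theta>_out: "n \<notin> N \<Longrightarrow> \<theta> n = 0"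
  by (rule N.irr_funD(1)[OF N.Irr_imp_irr_fun[OF \<theta>]])

text \<open>\<zeta> is multiplicative only up to the factor set, while \<open>lam\<close> is a
  genuine linear character; on \<open>Z \<inter> N\<close> the two agree by
  \<open>lam_\<zeta>\<close>.\<close>

lemma \<zeta>_mult: assumes "z \<in> Z" "w \<in> Z" shows "\<zeta> z * \<zeta> w = \<alpha> z w * \<zeta> (z \<otimes> w)"
proof -
  have "P z * P w = (\<zeta> z * \<zeta> w) \<cdot>\<^sub>m 1\<^sub>m d"
    unfolding Pz[OF assms(1)] Pz[OF assms(2)] by (intro eq_matI) (auto simp: mult_smult_assoc_mat[of _ d d _ d])
  moreover have "\<alpha> z w \<cdot>\<^sub>m P (z \<otimes> w) = (\<alpha> z w * \<zeta> (z \<otimes> w)) \<cdot>\<^sub>m 1\<^sub>m d"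
    using Pz[of "z \<otimes> w"] assms by (intro eq_matI) auto
  ultimately show ?thesis using P_mult[OF ZT[OF assms(1)] ZT[OF assms(2)]] smult_one_eq_iff[OF d_pos] by metis
qed

lemma \<zeta>_nz: "z \<in> Z \<Longrightarrow> \<zeta> z \<noteq> 0"
proof
  assume z: "z \<in> Z" and "\<zeta> z = 0"
  hence "P z = 0\<^sub>m d d" using Pz[OF z] by (intro eq_matI) auto
  thus False using P_nz[OF ZT[OF z]] by simp
qed

text \<open>\<open>\<zeta>_mult\<close> is multiplied over all \<open>w\<close> in \<open>Z\<close>.
  The product of \<zeta> cancels since \<open>w\<close> and \<open>z \<otimes> w\<close> run through
  the same set, and a power of \<open>\<zeta> z\<close> is left as a product of values of
  \<alpha>.\<close>

lemma \<zeta>_root: assumes z: "z \<in> Z" shows "root_of_unity (\<zeta> z)"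
proof -
  have nz: "(\<Prod>w\<in>Z. \<zeta> w) \<noteq> 0" using \<zeta>_nz Z.fin by simp
  have "\<zeta> z ^ card Z * (\<Prod>w\<in>Z. \<zeta> w) = (\<Prod>w\<in>Z. \<zeta> z * \<zeta> w)" by (simp add: prod.distrib)
  also have "\<dots> = (\<Prod>w\<in>Z. \<alpha> z w) * (\<Prod>w\<in>Z. \<zeta> (z \<otimes> w))" using z
    by (simp add: \<zeta>_mult prod.distrib)
  also have "(\<Prod>w\<in>Z. \<zeta> (z \<otimes> w)) = (\<Prod>w\<in>Z. \<zeta> w)"
    by (rule prod.reindex_bij_witness[of _ "\<lambda>x. inv z \<otimes> x" "\<lambda>x. z \<otimes> x"]) (use z in auto)
  finally have "\<zeta> z ^ card Z = (\<Prod>w\<in>Z. \<alpha> z w)" using nz by simp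
  moreover have "root_of_unity (\<Prod>w\<in>Z. \<alpha> z w)" using Z.fin z ZT by (intro root_of_unity_prod \<alpha>_root) auto
  ultimately show ?thesis using root_of_unity_of_power[of "\<zeta> z" "card Z"] by simp
qed

lemma P_nz_mult: "n \<in> N \<Longrightarrow> z \<in> Z \<Longrightarrow> P (n \<otimes> z) = \<zeta> z \<cdot>\<^sub>m P n"
  using P_left[of n z] ZT[of z] NT[of n] Pz[of z]
  by (simp add: mult_smult_distrib[of _ d d _ d] right_mult_one_mat[of _ d d])

abbreviation NZ where "NZ \<equiv> setprod \<Gamma> N Z"

abbreviation \<theta>h where "\<theta>h \<equiv> cprod \<Gamma> N Z \<theta> lam"

lemma NZ_I: "n \<in> N \<Longrightarrow> z \<in> Z \<Longrightarrow> n \<otimes> z \<in> NZ" by (auto simp: setprod_def)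

lemma NZ_E: assumes "x \<in> NZ" obtains n z where "n \<in> N" "z \<in> Z" "x = n \<otimes> z"
  using assms by (auto simp: setprod_def)

lemma N_NZ: "n \<in> N \<Longrightarrow> n \<in> NZ" using NZ_I[of n \<one>] by (simp add: NG)

lemma Z_NZ: "z \<in> Z \<Longrightarrow> z \<in> NZ" using NZ_I[of \<one> z] by (simp add: ZinG)

lemma nz_mult: "n \<in> N \<Longrightarrow> z \<in> Z \<Longrightarrow> m \<in> N \<Longrightarrow> w \<in> Z \<Longrightarrow> (n \<otimes> z) \<otimes> (m \<otimes> w) = (n \<otimes> m) \<otimes> (z \<otimes> w)"
proof -
  assume h: "n \<in> N" "z \<in> Z" "m \<in> N" "w \<in> Z"
  have "(n \<otimes> z) \<otimes> (m \<otimes> w) = n \<otimes> (z \<otimes> m) \<otimes> w" using h by (simp add: m_assoc)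
  also have "\<dots> = (n \<otimes> m) \<otimes> (z \<otimes> w)" unfolding zn[OF h(2,3)] using h by (simp add: m_assoc)
  finally show ?thesis .
qed

lemma nz_conj: "g \<in> G \<Longrightarrow> n \<in> N \<Longrightarrow> z \<in> Z \<Longrightarrow> g \<otimes> (n \<otimes> z) \<otimes> inv g = (g \<otimes> n \<otimes> inv g) \<otimes> (g \<otimes> z \<otimes> inv g)"
  by (simp add: m_assoc)

lemma NZ_subgroup: "subgroup NZ \<Gamma>"
proof
  show "NZ \<subseteq> carrier \<Gamma>" using NG ZinG by (auto elim!: NZ_E)
  show "\<one> \<in> NZ" using N_NZ by simp
  fix x y assume "x \<in> NZ" "y \<in> NZ"
  then obtain n z m w where "n \<in> N" "z \<in> Z" "x = n \<otimes> z" "m \<in> N" "w \<in> Z" "y = m \<otimes> w"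
    by (metis NZ_E)
  thus "x \<otimes> y \<in> NZ" by (simp add: nz_mult NZ_I)
next
  fix x assume "x \<in> NZ"
  then obtain n z where nz: "n \<in> N" "z \<in> Z" "x = n \<otimes> z" by (rule NZ_E)
  have "inv x = inv n \<otimes> inv z" using nz zn[of "inv z" "inv n"] by (simp add: inv_mult_group)
  thus "inv x \<in> NZ" using nz NZ_I by simp
qed

lemma NZ_nsub: "nsub \<Gamma> NZ G"
  unfolding nsub_def
proof (intro conjI ballI)
  show "subgroup G \<Gamma>" by (rule G.sub)
  show "subgroup NZ \<Gamma>" by (rule NZ_subgroup)
  show "NZ \<subseteq> G" using NG ZinG by (auto elim!: NZ_E)
  fix g x assume g: "g \<in> G" and "x \<in> NZ"
  then obtain n z where nz: "n \<in> N" "z \<in> Z" "x = n \<otimes> z" by (metis NZ_E)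
  show "g \<otimes> x \<otimes> inv g \<in> NZ"
    unfolding nz(3) nz_conj[OF g nz(1,2)] by (intro NZ_I conjN conjZ g nz)
qed

lemma nz_unique:
  assumes "n \<in> N" "z \<in> Z" "m \<in> N" "w \<in> Z" "n \<otimes> z = m \<otimes> w"
  shows "\<exists>c. c \<in> Z \<and> c \<in> N \<and> n = m \<otimes> c \<and> w = c \<otimes> z"
proof -
  have G: "n \<in> G" "z \<in> G" "m \<in> G" "w \<in> G" using assms NG ZinG by auto
  have "inv m \<otimes> n = inv m \<otimes> (n \<otimes> z) \<otimes> inv z" using G by (simp add: m_assoc)
  also have "\<dots> = w \<otimes> inv z" unfolding assms(5) using G by (simp add: m_assoc)
  finally have e: "inv m \<otimes> n = w \<otimes> inv z" .
  have "inv m \<otimes> n \<in> N" using assms(1,3) by simp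
  moreover have "inv m \<otimes> n \<in> Z" unfolding e using assms(2,4) by simp
  moreover have "n = m \<otimes> (inv m \<otimes> n)" using G by simp
  moreover have "w = (inv m \<otimes> n) \<otimes> z" unfolding e using G by (simp add: m_assoc)
  ultimately show ?thesis by blast
qed

text \<open>The choice in \<open>cprod\<close> is harmless: two factorizations differ by an element
  \<open>c\<close> of \<open>Z \<inter> N\<close>, which contributes \<open>\<zeta> c\<close> to
  \<theta> and, by \<open>lam_\<zeta>\<close>, also to \<open>lam\<close>.\<close>

lemma \<theta>h_val: assumes n: "n \<in> N" and z: "z \<in> Z" shows "\<theta>h (n \<otimes> z) = \<theta> n * lam z"
proof -
  have "v = \<theta> n * lam z" if mw: "m \<in> N" "w \<in> Z" "n \<otimes> z = m \<otimes> w" "v = \<theta> m * lam w" for m w v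
  proof -
    from nz_unique[OF n z mw(1-3)] obtain c where c: "c \<in> Z" "c \<in> N" "n = m \<otimes> c" "w = c \<otimes> z" by blast
    have "\<theta> n = \<zeta> c * \<theta> m"
      using P_nz_mult[OF mw(1) c(1)] \<theta>_trace[OF n] \<theta>_trace[OF mw(1)] c(3) NT[OF mw(1)]
        by (simp add: mtrace_smult[of _ d])
    moreover have "lam w = \<zeta> c * lam z" using c lam_mult[OF c(1) z] lam_\<zeta> by simp
    ultimately show ?thesis using mw(4) by simp
  qed
  hence "(SOME v. \<exists>m\<in>N. \<exists>w\<in>Z. n \<otimes> z = m \<otimes> w \<and> v = \<theta> m * lam w) = \<theta> n * lam z"
    using n z by (intro some_equality) blast+
  thus ?thesis using NZ_I[OF n z] by (simp add: cprod_def)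
qed

lemma \<theta>h_out: "x \<notin> NZ \<Longrightarrow> \<theta>h x = 0" by (simp add: cprod_def)

text \<open>Evaluation on \<open>N\<close> and on \<open>Z\<close> separates the two factors,
  because both degrees are nonzero and fixed by \<sigma>.\<close>

lemma semi_iff:
  assumes g: "g \<in> G" and \<sigma>: "\<sigma> \<in> GalAb"
  shows "char_act \<Gamma> NZ g \<sigma> \<theta>h = \<theta>h \<longleftrightarrow> char_act \<Gamma> N g \<sigma> \<theta> = \<theta> \<and> char_act \<Gamma> Z g \<sigma> lam = lam"
proof -
  note s = GalAbD[OF \<sigma>]
  have v: "char_act \<Gamma> NZ g \<sigma> \<theta>h (n \<otimes> z) = \<sigma> (\<theta> (g \<otimes> n \<otimes> inv g)) * \<sigma> (lam (g \<otimes> z \<otimes> inv g))"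
    if "n \<in> N" "z \<in> Z" for n z
    using that NZ_I[OF that] N.Irr_Qab[OF \<theta>] Z.Irr_Qab[OF lam]
    by (simp add: char_act_def nz_conj[OF g] \<theta>h_val conjN[OF g] conjZ[OF g] s(3))
  show ?thesis
  proof
    assume e: "char_act \<Gamma> NZ g \<sigma> \<theta>h = \<theta>h"
    have e': "\<sigma> (\<theta> (g \<otimes> n \<otimes> inv g)) * \<sigma> (lam (g \<otimes> z \<otimes> inv g)) = \<theta> n * lam z" if "n \<in> N" "z \<in> Z" for n z
      using v[OF that] e \<theta>h_val[OF that] by simp
    have "\<sigma> (\<theta> (g \<otimes> n \<otimes> inv g)) = \<theta> n" if "n \<in> N" for n
      using e'[OF that Z.memb(1)] g by (simp add: lam_one s(6))
    moreover have "\<sigma> (lam (g \<otimes> z \<otimes> inv g)) = lam z" if "z \<in> Z" for z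
      using e'[OF N.memb(1) that] g d_pos by (simp add: \<theta>_one s(11))
    ultimately show "char_act \<Gamma> N g \<sigma> \<theta> = \<theta> \<and> char_act \<Gamma> Z g \<sigma> lam = lam"
      by (auto simp: char_act_def fun_eq_iff \<theta>_out lam_out)
  next
    assume e: "char_act \<Gamma> N g \<sigma> \<theta> = \<theta> \<and> char_act \<Gamma> Z g \<sigma> lam = lam"
    show "char_act \<Gamma> NZ g \<sigma> \<theta>h = \<theta>h"
    proof
      fix x
      show "char_act \<Gamma> NZ g \<sigma> \<theta>h x = \<theta>h x"
      proof (cases "x \<in> NZ")
        case True
        then obtain n z where nz: "n \<in> N" "z \<in> Z" "x = n \<otimes> z" by (rule NZ_E)
        have "\<sigma> (\<theta> (g \<otimes> n \<otimes> inv g)) = \<theta> n" "\<sigma> (lam (g \<otimes> z \<otimes> inv g)) = lam z"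
          using fun_cong[OF conjunct1[OF e], of n] fun_cong[OF conjunct2[OF e], of z] nz by (auto simp: char_act_def)
        thus ?thesis using v[OF nz(1,2)] \<theta>h_val[OF nz(1,2)] nz(3) by simp
      qed (simp add: char_act_def \<theta>h_out)
    qed
  qed
qed

text \<open>\<open>P\<close> is not associated with \<open>\<theta>h\<close>, since \<open>P z\<close> is the scalar \<open>\<zeta> z\<close> rather than
  \<open>lam z\<close>; multiplication by \<open>\<kappa>\<close> repairs this on every coset of \<open>NZ\<close>.\<close>
lemma exists_kappa:
  "\<exists>\<kappa>. \<kappa> \<one> = 1 \<and> (\<forall>x\<in>T. root_of_unity (\<kappa> x)) \<and> (\<forall>n\<in>N. \<forall>x\<in>T. \<kappa> (n \<otimes> x) = \<kappa> x) \<and>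
     (\<forall>z\<in>Z. \<forall>x\<in>T. \<kappa> (z \<otimes> x) * \<zeta> z = lam z * \<alpha> z x * \<kappa> x)"
proof -
  define C where "C x = {m \<otimes> x | m. m \<in> NZ}" for x
  \<comment> \<open>A representative of the coset of \<open>NZ\<close>. With value 1 at the
    representatives, the required equations force the formula in \<open>k\<close>;
    \<open>kval\<close> shows that it does not depend on the factorization.\<close>
  define r where "r x = (SOME y. y \<in> C x)" for x
  define k where "k x = (SOME v. \<exists>n\<in>N. \<exists>z\<in>Z. x = n \<otimes> z \<otimes> r x \<and> v = lam z * \<alpha> z (r x) / \<zeta> z)" for x
  interpret NZ: fsub \<Gamma> NZ
    by (intro fsub.intro fsub_axioms.intro is_group NZ_subgroup finite_subset[OF nsubD(3)[OF NZ_nsub] finG])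
  have NZT: "m \<in> T" if "m \<in> NZ" for m using that NT ZT by (auto elim!: NZ_E)
  have C: "C (m \<otimes> x) = C x" if m: "m \<in> NZ" and x: "x \<in> T" for m x
  proof (intro equalityI subsetI)
    fix y assume "y \<in> C (m \<otimes> x)"
    then obtain m' where m': "m' \<in> NZ" "y = m' \<otimes> (m \<otimes> x)" by (auto simp: C_def)
    hence "y = (m' \<otimes> m) \<otimes> x" using m x by (simp add: m_assoc)
    thus "y \<in> C x" using m m' unfolding C_def by (auto intro!: exI[of _ "m' \<otimes> m"])
  next
    fix y assume "y \<in> C x"
    then obtain m' where m': "m' \<in> NZ" "y = m' \<otimes> x" by (auto simp: C_def)
    hence "y = (m' \<otimes> inv m) \<otimes> (m \<otimes> x)" using m x by (simp add: m_assoc)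
    thus "y \<in> C (m \<otimes> x)" using m m' unfolding C_def by (auto intro!: exI[of _ "m' \<otimes> inv m"])
  qed
  have rinv: "r (m \<otimes> x) = r x" if "m \<in> NZ" "x \<in> T" for m x by (simp add: r_def C[OF that])
  have r: "\<exists>n\<in>N. \<exists>z\<in>Z. x = n \<otimes> z \<otimes> r x" "r x \<in> T" if x: "x \<in> T" for x
  proof -
    have "\<one> \<otimes> x \<in> C x" unfolding C_def using NZ.memb(1) by blast
    hence "r x \<in> C x" unfolding r_def by (rule someI)
    then obtain m where m: "m \<in> NZ" "r x = m \<otimes> x" by (auto simp: C_def)
    thus "r x \<in> T" using NZT x by simp
    have "x = inv m \<otimes> r x" unfolding m(2) using m x by simp
    moreover obtain n z where nz: "n \<in> N" "z \<in> Z" "inv m = n \<otimes> z" using NZ_E[OF NZ.memb(3)[OF m(1)]] by blast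
    ultimately show "\<exists>n\<in>N. \<exists>z\<in>Z. x = n \<otimes> z \<otimes> r x" by metis
  qed
  have kval: "k x = lam z * \<alpha> z (r x) / \<zeta> z" if x: "x \<in> T"
    and nz: "n \<in> N" "z \<in> Z" "x = n \<otimes> z \<otimes> r x" for x n z
    unfolding k_def
  proof (rule some_equality)
    show "\<exists>n\<in>N. \<exists>z'\<in>Z. x = n \<otimes> z' \<otimes> r x \<and> lam z * \<alpha> z (r x) / \<zeta> z = lam z' * \<alpha> z' (r x) / \<zeta> z'" using nz by blast
    fix v assume "\<exists>n\<in>N. \<exists>z\<in>Z. x = n \<otimes> z \<otimes> r x \<and> v = lam z * \<alpha> z (r x) / \<zeta> z"
    then obtain m w where mw: "m \<in> N" "w \<in> Z" "x = m \<otimes> w \<otimes> r x" "v = lam w * \<alpha> w (r x) / \<zeta> w"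
      by blast
    have G: "n \<in> G" "z \<in> G" "m \<in> G" "w \<in> G" "r x \<in> G" using nz mw NG ZinG TG r[OF x] by auto
    have "n \<otimes> z \<otimes> r x = m \<otimes> w \<otimes> r x" using nz(3) mw(3) by simp
    hence "n \<otimes> z = m \<otimes> w" using G by simp
    from nz_unique[OF nz(1,2) mw(1,2) this] obtain c where c: "c \<in> Z" "c \<in> N" "w = c \<otimes> z" by blast
    have "\<alpha> w (r x) = \<alpha> z (r x)" unfolding c(3) by (rule \<alpha>_left[OF c(2) ZT[OF nz(2)] r(2)[OF x]])
    moreover have "lam w = \<zeta> c * lam z" using c lam_mult[OF c(1) nz(2)] lam_\<zeta> by simp
    moreover have "\<zeta> w = \<zeta> c * \<zeta> z"
    proof -
      have "\<zeta> w \<cdot>\<^sub>m 1\<^sub>m d = P (c \<otimes> z)" using Pz[OF mw(2)] c(3) by simp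
      also have "\<dots> = (\<zeta> z * \<zeta> c) \<cdot>\<^sub>m 1\<^sub>m d" unfolding P_nz_mult[OF c(2) nz(2)] Pz[OF c(1)]
        by (intro eq_matI) auto
      finally show ?thesis using smult_one_eq_iff[OF d_pos] by (simp add: mult.commute)
    qed
    ultimately show "v = lam z * \<alpha> z (r x) / \<zeta> z" using mw(4) \<zeta>_nz[OF c(1)] by simp
  qed
  have kroot: "root_of_unity (k x)" if x: "x \<in> T" for x
  proof -
    from r(1)[OF x] obtain n z where nz: "n \<in> N" "z \<in> Z" "x = n \<otimes> z \<otimes> r x" by blast
    show ?thesis unfolding kval[OF x nz]
      by (intro root_of_unity_divide root_of_unity_mult lam_root \<alpha>_root \<zeta>_root nz ZT r(2)[OF x])
  qed
  have kN: "k (m \<otimes> x) = k x" if m: "m \<in> N" and x: "x \<in> T" for m x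
  proof -
    from r(1)[OF x] obtain n z where nz: "n \<in> N" "z \<in> Z" "x = n \<otimes> z \<otimes> r x" by blast
    have mx: "m \<otimes> x \<in> T" using NT[OF m] x by simp
    have re: "r (m \<otimes> x) = r x" by (rule rinv[OF N_NZ[OF m] x])
    have "m \<otimes> (n \<otimes> z \<otimes> r x) = (m \<otimes> n) \<otimes> z \<otimes> r x" using m nz(1,2) r(2)[OF x]
      by (simp add: m_assoc NG ZinG TG)
    hence "m \<otimes> x = (m \<otimes> n) \<otimes> z \<otimes> r (m \<otimes> x)" using nz(3) re by simp
    hence "k (m \<otimes> x) = lam z * \<alpha> z (r (m \<otimes> x)) / \<zeta> z" using m nz by (intro kval[OF mx]) auto
    thus ?thesis using kval[OF x nz] re by simp
  qed
  have kZ: "k (w \<otimes> x) * \<zeta> w = lam w * \<alpha> w x * k x" if w: "w \<in> Z" and x: "x \<in> T" for w x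
  proof -
    from r(1)[OF x] obtain n z where nz: "n \<in> N" "z \<in> Z" "x = n \<otimes> z \<otimes> r x" by blast
    let ?r = "r x"
    have rT: "?r \<in> T" by (rule r(2)[OF x])
    have G: "n \<in> G" "z \<in> G" "w \<in> G" "?r \<in> G" "x \<in> G" using nz w NG ZinG TG rT x by auto
    have wx: "w \<otimes> x \<in> T" using ZT[OF w] x by simp
    have re: "r (w \<otimes> x) = ?r" by (rule rinv[OF Z_NZ[OF w] x])
    have "w \<otimes> (n \<otimes> z \<otimes> ?r) = (w \<otimes> n) \<otimes> z \<otimes> ?r" using G by (simp add: m_assoc)
    also have "\<dots> = n \<otimes> (w \<otimes> z) \<otimes> ?r" unfolding zn[OF w nz(1)] using G by (simp add: m_assoc)
    finally have "w \<otimes> x = n \<otimes> (w \<otimes> z) \<otimes> r (w \<otimes> x)" using nz(3) re by simp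
    hence k1: "k (w \<otimes> x) = lam (w \<otimes> z) * \<alpha> (w \<otimes> z) (r (w \<otimes> x)) / \<zeta> (w \<otimes> z)"
      using w nz by (intro kval[OF wx]) auto
    have zT: "z \<in> T" "w \<in> T" using ZT nz w by auto
    have "x = n \<otimes> (z \<otimes> ?r)" using nz(3) G by (simp add: m_assoc)
    hence "\<alpha> w x = \<alpha> w (n \<otimes> (z \<otimes> ?r))" by simp
    also have "\<dots> = \<alpha> w (z \<otimes> ?r)" using zT rT by (intro \<alpha>_right'[OF nz(1)]) auto
    finally have a1: "\<alpha> w x = \<alpha> w (z \<otimes> ?r)" .
    \<comment> \<open>The cocycle identity for \<open>w\<close>, \<open>z\<close> and the
      representative, from associativity of the matrix product.\<close>
    have "(\<alpha> w z * \<alpha> (w \<otimes> z) ?r) \<cdot>\<^sub>m P (w \<otimes> z \<otimes> ?r) = (P w * P z) * P ?r"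
      using zT rT P_mult[of "w \<otimes> z" ?r] unfolding P_mult[OF zT(2,1)]
      by (simp add: mult_smult_assoc_mat[of _ d d _ d]) (intro eq_matI, auto)
    also have "\<dots> = P w * (P z * P ?r)" using zT rT by (intro assoc_mult_mat[of _ d d _ d _ d]) auto
    also have "\<dots> = (\<alpha> w (z \<otimes> ?r) * \<alpha> z ?r) \<cdot>\<^sub>m P (w \<otimes> z \<otimes> ?r)"
      using zT rT P_mult[of w "z \<otimes> ?r"] G unfolding P_mult[OF zT(1) rT]
      by (simp add: mult_smult_distrib[of _ d d _ d] m_assoc) (intro eq_matI, auto)
    finally have coc: "\<alpha> w z * \<alpha> (w \<otimes> z) ?r = \<alpha> w (z \<otimes> ?r) * \<alpha> z ?r"
      using smult_P_eq_iff[of "w \<otimes> z \<otimes> ?r"] zT rT by simp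
    have nzs: "\<zeta> (w \<otimes> z) \<noteq> 0" "\<zeta> z \<noteq> 0" using \<zeta>_nz w nz by auto
    have z1: "\<zeta> w / \<zeta> (w \<otimes> z) = \<alpha> w z / \<zeta> z"
      using \<zeta>_mult[OF w nz(2)] nzs by (simp add: field_simps)
    have "k (w \<otimes> x) * \<zeta> w = lam w * lam z * \<alpha> (w \<otimes> z) ?r * (\<zeta> w / \<zeta> (w \<otimes> z))"
      unfolding k1 re using lam_mult[OF w nz(2)] by simp
    also have "\<dots> = lam w * lam z * (\<alpha> w z * \<alpha> (w \<otimes> z) ?r) / \<zeta> z" unfolding z1 by simp
    also have "\<dots> = lam w * \<alpha> w x * k x" unfolding coc a1 kval[OF x nz] by simp
    finally show ?thesis .
  qed
  have k1: "k \<one> \<noteq> 0" using root_of_unity_nz[OF kroot[OF T.memb(1)]] .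
  \<comment> \<open>The representative of \<open>NZ\<close> itself need not be the identity, so the
    value there is divided out; the equations are linear in \<kappa> and keep their form.\<close>
  define \<kappa> where "\<kappa> x = k x / k \<one>" for x
  have "\<kappa> \<one> = 1" using k1 by (simp add: \<kappa>_def)
  moreover have "root_of_unity (\<kappa> x)" if "x \<in> T" for x
    unfolding \<kappa>_def by (intro root_of_unity_divide kroot that T.memb(1))
  moreover have "\<kappa> (n \<otimes> x) = \<kappa> x" if "n \<in> N" "x \<in> T" for n x using kN[OF that]
    by (simp add: \<kappa>_def)
  moreover have "\<kappa> (z \<otimes> x) * \<zeta> z = lam z * \<alpha> z x * \<kappa> x" if "z \<in> Z" "x \<in> T" for z x
    using kZ[OF that] by (simp add: \<kappa>_def)
  ultimately show ?thesis by blast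
qed

end

section \<open>The projective representation corrected by \<kappa>\<close>

locale central_kappa = central +
  fixes \<kappa> :: "'a \<Rightarrow> complex" and p :: nat
  assumes \<kappa>_one: "\<kappa> \<one>\<^bsub>\<Gamma>\<^esub> = 1"
    and \<kappa>_root: "\<And>x. x \<in> stab \<Gamma> G N \<theta> \<Longrightarrow> root_of_unity (\<kappa> x)"
    and \<kappa>_N: "\<And>n x. n \<in> N \<Longrightarrow> x \<in> stab \<Gamma> G N \<theta> \<Longrightarrow> \<kappa> (n \<otimes>\<^bsub>\<Gamma>\<^esub> x) = \<kappa> x"
    and \<kappa>_Z: "\<And>z x. z \<in> Z \<Longrightarrow> x \<in> stab \<Gamma> G N \<theta> \<Longrightarrow> \<kappa> (z \<otimes>\<^bsub>\<Gamma>\<^esub> x) * \<zeta> z = lam z * \<alpha> z x * \<kappa> x"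
begin

definition Ph :: "'a \<Rightarrow> complex mat" where "Ph x = \<kappa> x \<cdot>\<^sub>m P x"

definition \<alpha>h :: "'a \<Rightarrow> 'a \<Rightarrow> complex"
  where "\<alpha>h x y = \<kappa> x * \<kappa> y * \<alpha> x y / \<kappa> (x \<otimes> y)"

abbreviation Gh where "Gh \<equiv> stab_orb \<Gamma> p G NZ \<theta>h"

abbreviation Th where "Th \<equiv> stab \<Gamma> Gh NZ \<theta>h"

lemma \<kappa>_nz: "x \<in> T \<Longrightarrow> \<kappa> x \<noteq> 0" by (rule root_of_unity_nz[OF \<kappa>_root])

text \<open>The factor \<open>\<alpha> z g\<close> arising from \<open>P z * P g\<close> cancels
  against the one in \<open>\<kappa>_Z\<close>, which at the same time exchanges
  \<open>\<zeta> z\<close> for \<open>lam z\<close>.\<close>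

lemma Ph_left: assumes n: "n \<in> N" and z: "z \<in> Z" and g: "g \<in> T"
  shows "Ph (n \<otimes> z \<otimes> g) = (lam z \<cdot>\<^sub>m P n) * Ph g"
proof -
  have zg: "z \<otimes> g \<in> T" using ZT[OF z] g by simp
  have c: "P n \<in> carrier_mat d d" "P g \<in> carrier_mat d d" using NT[OF n] g by auto
  have a: "\<alpha> z g \<noteq> 0" using ZT[OF z] g by simp
  have e: "n \<otimes> z \<otimes> g = n \<otimes> (z \<otimes> g)" using n z g by (simp add: m_assoc NG ZinG TG)
  have k: "\<kappa> (n \<otimes> (z \<otimes> g)) = lam z * \<alpha> z g * \<kappa> g / \<zeta> z"
    using \<kappa>_N[OF n zg] \<kappa>_Z[OF z g] \<zeta>_nz[OF z] by (simp add: field_simps)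
  have "\<alpha> z g \<cdot>\<^sub>m P (z \<otimes> g) = \<zeta> z \<cdot>\<^sub>m P g"
    using P_mult[OF ZT[OF z] g] Pz[OF z] c by (simp add: mult_smult_assoc_mat[of _ d d _ d] left_mult_one_mat[of _ d d])
  hence "(1 / \<alpha> z g) \<cdot>\<^sub>m (\<alpha> z g \<cdot>\<^sub>m P (z \<otimes> g)) = (1 / \<alpha> z g) \<cdot>\<^sub>m (\<zeta> z \<cdot>\<^sub>m P g)" by simp
  moreover have "(1 / \<alpha> z g) \<cdot>\<^sub>m (\<alpha> z g \<cdot>\<^sub>m P (z \<otimes> g)) = P (z \<otimes> g)" using a
    by (intro eq_matI) auto
  ultimately have pz: "P (z \<otimes> g) = (\<zeta> z / \<alpha> z g) \<cdot>\<^sub>m P g" by (auto intro!: eq_matI)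
  have "P (n \<otimes> (z \<otimes> g)) = (\<zeta> z / \<alpha> z g) \<cdot>\<^sub>m (P n * P g)"
    unfolding P_left[OF n zg] pz using c by (intro mult_smult_distrib) auto
  hence "Ph (n \<otimes> z \<otimes> g) = (lam z * \<kappa> g) \<cdot>\<^sub>m (P n * P g)"
    unfolding Ph_def e k using a \<zeta>_nz[OF z] by (auto intro!: eq_matI)
  also have "\<dots> = (lam z \<cdot>\<^sub>m P n) * Ph g"
    unfolding Ph_def using c
      by (simp add: mult_smult_assoc_mat[of _ d d _ d] mult_smult_distrib[of _ d d _ d]) (intro eq_matI, auto)
  finally show ?thesis .
qed

lemma Ph_one: "Ph \<one> = 1\<^sub>m d" by (auto simp: Ph_def \<kappa>_one P_one intro!: eq_matI)

lemma Ph_nz: assumes n: "n \<in> N" and z: "z \<in> Z" shows "Ph (n \<otimes> z) = lam z \<cdot>\<^sub>m P n"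
proof -
  have c: "P n \<in> carrier_mat d d" using NT[OF n] by simp
  have "n \<otimes> z = n \<otimes> z \<otimes> \<one>" using n z by (simp add: NG ZinG)
  thus ?thesis using Ph_left[OF n z T.memb(1)] c Ph_one by (simp add: right_mult_one_mat[of _ d d])
qed

lemma Ph_N: "n \<in> N \<Longrightarrow> Ph n = P n"
  using Ph_nz[of n \<one>] lam_one by (auto simp: NG intro!: eq_matI)

lemma NZ_T: "m \<in> NZ \<Longrightarrow> m \<in> T" using NT ZT by (auto elim!: NZ_E)

lemma Ph_rep: "is_rep \<Gamma> NZ d Ph"
  unfolding is_rep_def
proof (intro conjI ballI)
  show "Ph x \<in> carrier_mat d d" if "x \<in> NZ" for x using NZ_T[OF that] by (simp add: Ph_def)
  show "Ph \<one> = 1\<^sub>m d" by (rule Ph_one)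
  fix x y assume x: "x \<in> NZ" and y: "y \<in> NZ"
  then obtain n z where nz: "n \<in> N" "z \<in> Z" "x = n \<otimes> z" by (metis NZ_E)
  show "Ph (x \<otimes> y) = Ph x * Ph y"
    unfolding nz(3) Ph_left[OF nz(1,2) NZ_T[OF y]] Ph_nz[OF nz(1,2)] ..
qed

lemma Ph_char: "char_of NZ Ph = \<theta>h"
proof
  fix x
  show "char_of NZ Ph x = \<theta>h x"
  proof (cases "x \<in> NZ")
    case True
    then obtain n z where nz: "n \<in> N" "z \<in> Z" "x = n \<otimes> z" by (rule NZ_E)
    show ?thesis using True Ph_nz[OF nz(1,2)] \<theta>h_val[OF nz(1,2)] nz NT[OF nz(1)] \<theta>_trace[OF nz(1)]
      by (simp add: char_of_def mtrace_smult[of _ d])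
  qed (simp add: char_of_def \<theta>h_out)
qed

text \<open>\<open>Ph\<close> agrees with \<open>P\<close> on \<open>N\<close>, so a subspace
  invariant under the larger group is invariant for the irreducible \<open>P\<close>.\<close>

lemma Ph_irred: "irred_rep \<Gamma> NZ d Ph"
  unfolding irred_rep_def
proof (intro conjI allI impI)
  show "0 < d" by (rule d_pos)
  show "is_rep \<Gamma> NZ d Ph" by (rule Ph_rep)
  fix W assume "inv_subspace NZ d Ph W"
  hence "inv_subspace N d P W" using N_NZ Ph_N unfolding inv_subspace_def by metis
  thus "W = {0\<^sub>v d} \<or> W = carrier_vec d" using P_irred unfolding irred_rep_def by blast
qed

lemma \<theta>h_Irr: "\<theta>h \<in> Irr \<Gamma> NZ"
  unfolding Irr_def mem_Collect_eq by (intro exI[of _ d] exI[of _ Ph] conjI Ph_irred Ph_char[symmetric])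

lemma hat_nchar: "nchar \<Gamma> G NZ \<theta>h"
  by (intro nchar.intro nchar_axioms.intro is_group finG NZ_nsub \<theta>h_Irr)

lemma Gh_iff: "g \<in> Gh \<longleftrightarrow> g \<in> G \<and> (\<exists>\<sigma>\<in>Hgal p. char_act \<Gamma> N g \<sigma> \<theta> = \<theta> \<and> char_act \<Gamma> Z g \<sigma> lam = lam)"
  unfolding nchar.stab_orb_iff[OF hat_nchar] using semi_iff Hgal_GalAb by blast

lemma Th_iff: "x \<in> Th \<longleftrightarrow> x \<in> T \<and> char_act \<Gamma> Z x id lam = lam"
proof -
  have "x \<in> Gh" if "x \<in> G" "char_act \<Gamma> NZ x id \<theta>h = \<theta>h"
    unfolding nchar.stab_orb_iff[OF hat_nchar] using that Hgal_id by blast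
  thus ?thesis using semi_iff[OF _ GalAb_id, of x] Gh_iff[of x] by (auto simp: stab_def)
qed

lemma Th_T: "x \<in> Th \<Longrightarrow> x \<in> T" using Th_iff by simp

lemma lam_conj: "x \<in> Th \<Longrightarrow> z \<in> Z \<Longrightarrow> lam (x \<otimes> z \<otimes> inv x) = lam z"
proof -
  assume x: "x \<in> Th" and z: "z \<in> Z"
  hence "char_act \<Gamma> Z x id lam z = lam z" using Th_iff by simp
  thus ?thesis using z by (simp add: char_act_def)
qed

lemma hat_projchar: "projchar_Qab \<Gamma> Gh NZ \<theta>h d Ph \<alpha>h"
proof -
  interpret Q: nchar \<Gamma> Gh NZ \<theta>h by (rule nchar.nchar_stab_orb[OF hat_nchar])
  have pr: "proj_rep \<Gamma> Th d Ph \<alpha>h"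
    unfolding proj_rep_def
  proof (intro conjI ballI)
    fix x assume x: "x \<in> Th"
    have xT: "x \<in> T" by (rule Th_T[OF x])
    show c: "Ph x \<in> carrier_mat d d" using xT by (simp add: Ph_def)
    have "Ph x * ((1 / \<kappa> x) \<cdot>\<^sub>m Pinv x) = 1\<^sub>m d" "((1 / \<kappa> x) \<cdot>\<^sub>m Pinv x) * Ph x = 1\<^sub>m d"
      using xT \<kappa>_nz[OF xT] P_Pinv[OF xT]
      by (auto simp: Ph_def mult_smult_assoc_mat[of _ d d _ d] mult_smult_distrib[of _ d d _ d] intro!: eq_matI)
    thus "invertible_mat (Ph x)" using c carrier_matD(1)[OF Pinv_carr[OF xT]] unfolding invertible_mat_def inverts_mat_def
      by (auto intro!: exI[of _ "(1 / \<kappa> x) \<cdot>\<^sub>m Pinv x"])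
  next
    fix x y assume xy: "x \<in> Th" "y \<in> Th"
    have T': "x \<in> T" "y \<in> T" "x \<otimes> y \<in> T" using Th_T[OF xy(1)] Th_T[OF xy(2)] by auto
    show "\<alpha>h x y \<noteq> 0" using T' \<kappa>_nz by (simp add: \<alpha>h_def)
    have "Ph x * Ph y = (\<kappa> x * \<kappa> y) \<cdot>\<^sub>m (P x * P y)"
      using T' by (simp add: Ph_def mult_smult_assoc_mat[of _ d d _ d] mult_smult_distrib[of _ d d _ d]) (intro eq_matI, auto)
    also have "\<dots> = \<alpha>h x y \<cdot>\<^sub>m Ph (x \<otimes> y)"
      unfolding P_mult[OF T'(1,2)] using \<kappa>_nz[OF T'(3)] by (auto simp: \<alpha>h_def Ph_def intro!: eq_matI)
    finally show "Ph x * Ph y = \<alpha>h x y \<cdot>\<^sub>m Ph (x \<otimes> y)" .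
  qed
  have left: "Ph (m \<otimes> g) = Ph m * Ph g" if m: "m \<in> NZ" and g: "g \<in> Th" for m g
  proof -
    from m obtain n z where nz: "n \<in> N" "z \<in> Z" "m = n \<otimes> z" by (rule NZ_E)
    show ?thesis unfolding nz(3) Ph_left[OF nz(1,2) Th_T[OF g]] Ph_nz[OF nz(1,2)] ..
  qed
  \<comment> \<open>\<kappa> obeys conditions for factors on the left only. So
    \<open>g \<otimes> m\<close> is rewritten with the conjugate of \<open>m\<close> in front, and
    \<open>lam\<close> is unchanged by this conjugation because \<open>g\<close> lies in
    \<open>Th\<close>.\<close>
  have right: "Ph (g \<otimes> m) = Ph g * Ph m" if m: "m \<in> NZ" and g: "g \<in> Th" for m g
  proof -
    from m obtain n z where nz: "n \<in> N" "z \<in> Z" "m = n \<otimes> z" by (rule NZ_E)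
    have gT: "g \<in> T" by (rule Th_T[OF g])
    have gG: "g \<in> G" by (rule TG[OF gT])
    have n': "g \<otimes> n \<otimes> inv g \<in> N" "g \<otimes> z \<otimes> inv g \<in> Z"
      using conjN[OF gG nz(1)] conjZ[OF gG nz(2)] by auto
    have c: "P g \<in> carrier_mat d d" "P n \<in> carrier_mat d d" "P (g \<otimes> n \<otimes> inv g) \<in> carrier_mat d d"
      using gT NT[OF nz(1)] NT[OF n'(1)] by auto
    have e: "g \<otimes> m = (g \<otimes> n \<otimes> inv g) \<otimes> (g \<otimes> z \<otimes> inv g) \<otimes> g"
      unfolding nz(3) using gG nz by (simp add: m_assoc NG ZinG)
    have "Ph (g \<otimes> m) = (lam z \<cdot>\<^sub>m P (g \<otimes> n \<otimes> inv g)) * Ph g"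
      unfolding e Ph_left[OF n' gT] lam_conj[OF g nz(2)] ..
    also have "\<dots> = (lam z * \<kappa> g) \<cdot>\<^sub>m (P (g \<otimes> n \<otimes> inv g) * P g)"
      unfolding Ph_def using c
        by (simp add: mult_smult_assoc_mat[of _ d d _ d] mult_smult_distrib[of _ d d _ d]) (intro eq_matI, auto)
    also have "\<dots> = Ph g * Ph m"
      unfolding P_conjN[OF gT nz(1)] nz(3) Ph_nz[OF nz(1,2)] unfolding Ph_def using c
      by (simp add: mult_smult_assoc_mat[of _ d d _ d] mult_smult_distrib[of _ d d _ d]) (intro eq_matI, auto)
    finally show ?thesis .
  qed
  have as: "assoc_with \<Gamma> Th NZ d Ph \<theta>h"
    unfolding assoc_with_def using Ph_rep Ph_char left right by blast
  have en: "entries_Qab Th d Ph"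
    unfolding entries_Qab_def
  proof (intro ballI allI impI)
    fix x i j assume x: "x \<in> Th" and ij: "i < d" "j < d"
    have xT: "x \<in> T" by (rule Th_T[OF x])
    have "Ph x $$ (i,j) = \<kappa> x * P x $$ (i,j)" using P_carr[OF xT] ij by (simp add: Ph_def)
    thus "Ph x $$ (i,j) \<in> Qab" using \<kappa>_root[OF xT] P_Qab[OF xT ij] by simp
  qed
  show ?thesis
    by (intro projchar_Qab.intro projchar.intro projchar_axioms.intro projchar_Qab_axioms.intro pr as en Q.nchar_axioms)
qed

lemma \<alpha>h_root: "x \<in> Th \<Longrightarrow> y \<in> Th \<Longrightarrow> root_of_unity (\<alpha>h x y)"
  unfolding \<alpha>h_def by (intro root_of_unity_divide root_of_unity_mult \<kappa>_root \<alpha>_root T.memb Th_T)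

text \<open>\<open>Ph\<close> and \<open>P\<close> agree on \<open>N\<close>, so one pair
  \<open>A\<close>, \<open>B\<close> serves both and \<open>mu_unique\<close> compares the factors.
  Only \<kappa> and the old \<open>mu\<close> occur in the result, so equality of the old functions
  for two triples passes to the new ones.\<close>

lemma mu_hat:
  assumes x: "x \<in> Gh" and \<sigma>: "\<sigma> \<in> GalAb" and st: "char_act \<Gamma> NZ x \<sigma> \<theta>h = \<theta>h"
    and y: "y \<in> Th"
  shows "mu \<Gamma> Th NZ d Ph x \<sigma> y = \<sigma> (\<kappa> (x \<otimes> y \<otimes> inv x)) * mu \<Gamma> T N d P x \<sigma> y / \<kappa> y"
proof -
  interpret Q: projchar_Qab \<Gamma> Gh NZ \<theta>h d Ph \<alpha>h by (rule hat_projchar)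
  have xG: "x \<in> G" using x Gh_iff by simp
  have st': "char_act \<Gamma> N x \<sigma> \<theta> = \<theta>" using st semi_iff[OF xG \<sigma>] by simp
  note m = Q.mu_spec[OF x \<sigma> st]
  let ?m = "mu \<Gamma> Th NZ d Ph x \<sigma>"
  have yT: "y \<in> T" by (rule Th_T[OF y])
  have xyx: "x \<otimes> y' \<otimes> inv x \<in> T" if "y' \<in> T" for y' by (rule conj_T[OF xG \<sigma> st' that])
  from m(5) obtain A B where A: "A \<in> carrier_mat d d" "B \<in> carrier_mat d d" "A * B = 1\<^sub>m d" "B * A = 1\<^sub>m d"
    and R: "\<And>y. y \<in> Th \<Longrightarrow> Pconj \<Gamma> Ph x \<sigma> y = ?m y \<cdot>\<^sub>m (B * Ph y * A)" by blast
  have PhR: "Pconj \<Gamma> Ph x \<sigma> y' = \<sigma> (\<kappa> (x \<otimes> y' \<otimes> inv x)) \<cdot>\<^sub>m Pconj \<Gamma> P x \<sigma> y'" if y': "y' \<in> T" for y'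
  proof -
    have T': "x \<otimes> y' \<otimes> inv x \<in> T" by (rule xyx[OF y'])
    have "\<kappa> (x \<otimes> y' \<otimes> inv x) \<in> Qab" using \<kappa>_root[OF T'] by simp
    thus ?thesis unfolding Pconj_def Ph_def using P_carr[OF T'] P_Qab[OF T'] GalAbD(3)[OF \<sigma>]
      by (intro eq_matI) auto
  qed
  have BA: "B * Ph y' * A = \<kappa> y' \<cdot>\<^sub>m (B * P y' * A)" if "y' \<in> T" for y'
    using A(1,2) P_carr[OF that] by (simp add: Ph_def mult_smult_assoc_mat[of _ d d _ d] mult_smult_distrib[of _ d d _ d])
  have N: "Pconj \<Gamma> P x \<sigma> n = B * P n * A" if n: "n \<in> N" for n
  proof -
    have nNZ: "n \<in> NZ" by (rule N_NZ[OF n])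
    have nTh: "n \<in> Th" by (rule Q.NT[OF nNZ])
    have xn: "x \<otimes> n \<otimes> inv x \<in> N" by (rule conjN[OF xG n])
    have "?m n = ?m (n \<otimes> \<one>)" using n by (simp add: NG)
    also have "\<dots> = 1" using m(3)[OF Q.T.memb(1) nNZ] m(4) by simp
    finally have "Pconj \<Gamma> Ph x \<sigma> n = 1 \<cdot>\<^sub>m (B * Ph n * A)" using R[OF nTh] by simp
    also have "\<dots> = B * P n * A" using Ph_N[OF n] by (auto intro!: eq_matI)
    finally have "Pconj \<Gamma> Ph x \<sigma> n = B * P n * A" .
    moreover have "Pconj \<Gamma> Ph x \<sigma> n = Pconj \<Gamma> P x \<sigma> n" using Ph_N[OF xn] by (simp add: Pconj_def)
    ultimately show ?thesis by simp
  qed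
  let ?s = "\<sigma> (\<kappa> (x \<otimes> y \<otimes> inv x))"
  have s: "?s \<noteq> 0" using \<kappa>_nz[OF xyx[OF yT]] GalAbD(9)[OF \<sigma>] by simp
  have "?s \<cdot>\<^sub>m Pconj \<Gamma> P x \<sigma> y = ?m y \<cdot>\<^sub>m (\<kappa> y \<cdot>\<^sub>m (B * P y * A))"
    using PhR[OF yT] R[OF y] BA[OF yT] by simp
  hence "(1 / ?s) \<cdot>\<^sub>m (?s \<cdot>\<^sub>m Pconj \<Gamma> P x \<sigma> y) = (1 / ?s) \<cdot>\<^sub>m (?m y \<cdot>\<^sub>m (\<kappa> y \<cdot>\<^sub>m (B * P y * A)))" by simp
  moreover have "(1 / ?s) \<cdot>\<^sub>m (?s \<cdot>\<^sub>m Pconj \<Gamma> P x \<sigma> y) = Pconj \<Gamma> P x \<sigma> y"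
    using s by (intro eq_matI) auto
  moreover have "(1 / ?s) \<cdot>\<^sub>m (?m y \<cdot>\<^sub>m (\<kappa> y \<cdot>\<^sub>m (B * P y * A))) = (?m y * \<kappa> y / ?s) \<cdot>\<^sub>m (B * P y * A)"
    by (intro eq_matI) (auto simp del: index_mult_mat(1))
  ultimately have "Pconj \<Gamma> P x \<sigma> y = (?m y * \<kappa> y / ?s) \<cdot>\<^sub>m (B * P y * A)" by simp
  from mu_unique[OF xG \<sigma> st' A N yT this] have "?m y * \<kappa> y / ?s = mu \<Gamma> T N d P x \<sigma> y" .
  thus ?thesis using s \<kappa>_nz[OF yT] by (simp add: field_simps)
qed

end

section \<open>Ordered pairs of triples\<close>

lemma Htriple_nchar:
  "group \<Gamma> \<Longrightarrow> finite G \<Longrightarrow> Htriple \<Gamma> p G N \<theta> \<Longrightarrow> nchar \<Gamma> G N \<theta>"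
  by (simp add: nchar_def nchar_axioms_def Htriple_def)

lemma geq_cE:
  assumes "group \<Gamma>" "finite G" "geq_c \<Gamma> p G N \<theta> H M \<phi>"
  obtains d P \<alpha> d' P' \<alpha>' where "projpair \<Gamma> G N \<theta> d P \<alpha> H M \<phi> d' P' \<alpha>' p"
    "\<And>x y. x \<in> stab \<Gamma> G N \<theta> \<Longrightarrow> y \<in> stab \<Gamma> G N \<theta> \<Longrightarrow> root_of_unity (\<alpha> x y)"
    "\<And>x y. x \<in> stab \<Gamma> H M \<phi> \<Longrightarrow> y \<in> stab \<Gamma> H M \<phi> \<Longrightarrow> root_of_unity (\<alpha>' x y)"
    "\<And>c. c \<in> centr \<Gamma> G N \<Longrightarrow> \<exists>s. P c = s \<cdot>\<^sub>m 1\<^sub>m d \<and> P' c = s \<cdot>\<^sub>m 1\<^sub>m d'"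
proof -
  from assms(3) have tri: "Htriple \<Gamma> p G N \<theta>" "Htriple \<Gamma> p H M \<phi>"
    and HG: "H \<subseteq> G" "G = setprod \<Gamma> N H" "N \<inter> H = M"
      and st: "stabH \<Gamma> p H N \<theta> = stabH \<Gamma> p H M \<phi>"
    by (auto simp: geq_c_def)
  from assms(3) obtain d d' P P' \<alpha> \<alpha>' where
    P: "proj_rep \<Gamma> (stab \<Gamma> G N \<theta>) d P \<alpha>" "assoc_with \<Gamma> (stab \<Gamma> G N \<theta>) N d P \<theta>" "entries_Qab (stab \<Gamma> G N \<theta>) d P"
    and P': "proj_rep \<Gamma> (stab \<Gamma> H M \<phi>) d' P' \<alpha>'" "assoc_with \<Gamma> (stab \<Gamma> H M \<phi>) M d' P' \<phi>" "entries_Qab (stab \<Gamma> H M \<phi>) d' P'"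
    and r: "\<forall>x\<in>stab \<Gamma> G N \<theta>. \<forall>y\<in>stab \<Gamma> G N \<theta>. root_of_unity (\<alpha> x y)"
      "\<forall>x\<in>stab \<Gamma> H M \<phi>. \<forall>y\<in>stab \<Gamma> H M \<phi>. root_of_unity (\<alpha>' x y)"
    and eq: "\<forall>x\<in>stab \<Gamma> H N \<theta>. \<forall>y\<in>stab \<Gamma> H N \<theta>. \<alpha> x y = \<alpha>' x y"
    and c: "\<forall>c\<in>centr \<Gamma> G N. \<exists>s. P c = s \<cdot>\<^sub>m 1\<^sub>m d \<and> P' c = s \<cdot>\<^sub>m 1\<^sub>m d'"
    and mu: "\<forall>(x, \<sigma>)\<in>stabH \<Gamma> p H N \<theta>. \<forall>y\<in>stab \<Gamma> H N \<theta>.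
            mu \<Gamma> (stab \<Gamma> G N \<theta>) N d P x \<sigma> y = mu \<Gamma> (stab \<Gamma> H M \<phi>) M d' P' x \<sigma> y"
    unfolding geq_c_def by blast
  have n: "nchar \<Gamma> G N \<theta>" by (rule Htriple_nchar[OF assms(1,2) tri(1)])
  have n': "nchar \<Gamma> H M \<phi>" by (rule Htriple_nchar[OF assms(1) finite_subset[OF HG(1) assms(2)] tri(2)])
  have "projpair_axioms \<Gamma> G N \<theta> d P \<alpha> H M \<phi> d' P' \<alpha>' p"
    unfolding projpair_axioms_def using HG st eq mu by blast
  hence "projpair \<Gamma> G N \<theta> d P \<alpha> H M \<phi> d' P' \<alpha>' p"
    by (intro projpair.intro projchar_Qab.intro projchar.intro projchar_axioms.intro projchar_Qab_axioms.intro n n' P P')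
  thus ?thesis using that r c by blast
qed

theorem geq_c_character_bijection:
  assumes "group \<Gamma>" "finite G" "geq_c \<Gamma> p G N \<theta> H M \<phi>"
  shows "\<exists>\<tau>. bij_betw \<tau> (Irr_over_orb \<Gamma> p G N \<theta>) (Irr_over_orb \<Gamma> p H M \<phi>) \<and>
     (\<forall>\<chi>\<in>Irr_over_orb \<Gamma> p G N \<theta>.
        (\<forall>\<sigma>\<in>Hgal p. \<tau> (char_act \<Gamma> G \<one>\<^bsub>\<Gamma>\<^esub> \<sigma> \<chi>) = char_act \<Gamma> H \<one>\<^bsub>\<Gamma>\<^esub> \<sigma> (\<tau> \<chi>)) \<and>
        \<chi> \<one>\<^bsub>\<Gamma>\<^esub> / \<theta> \<one>\<^bsub>\<Gamma>\<^esub> = \<tau> \<chi> \<one>\<^bsub>\<Gamma>\<^esub> / \<phi> \<one>\<^bsub>\<Gamma>\<^esub>)"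
  using geq_cE[OF assms] projpair.character_bijection by metis

section \<open>The pair of central products\<close>

locale centralpair = projpair \<Gamma> G N \<theta> d P \<alpha> H M \<phi> d' P' \<alpha>' p +
    CA: central_kappa \<Gamma> G N \<theta> d P \<alpha> Z lam \<zeta> \<kappa> p + CB: central_kappa \<Gamma> H M \<phi> d' P' \<alpha>' Z lam \<zeta> \<kappa> p
  for \<Gamma> :: "('g, 'b) monoid_scheme" (structure)
    and G N \<theta> d P \<alpha> H M \<phi> d' P' \<alpha>' p Z lam \<zeta> \<kappa> +
  assumes centr_H: "centr \<Gamma> G N \<subseteq> H"
    and centr_scalar: "\<And>c. c \<in> centr \<Gamma> G N \<Longrightarrow> \<exists>s. P c = s \<cdot>\<^sub>m 1\<^sub>m d \<and> P' c = s \<cdot>\<^sub>m 1\<^sub>m d'"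
begin

lemma hat_semi_iff:
  assumes h: "h \<in> H" and \<sigma>: "\<sigma> \<in> Hgal p"
  shows "char_act \<Gamma> CA.NZ h \<sigma> CA.\<theta>h = CA.\<theta>h \<longleftrightarrow> char_act \<Gamma> CB.NZ h \<sigma> CB.\<theta>h = CB.\<theta>h"
proof -
  have hG: "h \<in> G" using h HG by auto
  have "(h, \<sigma>) \<in> stabH \<Gamma> p H N \<theta> \<longleftrightarrow> (h, \<sigma>) \<in> stabH \<Gamma> p H M \<phi>"
    unfolding stabs ..
  hence "char_act \<Gamma> N h \<sigma> \<theta> = \<theta> \<longleftrightarrow> char_act \<Gamma> M h \<sigma> \<phi> = \<phi>"
    using h \<sigma> by (simp add: stabH_def)
  thus ?thesis using CA.semi_iff[OF hG Hgal_GalAb[OF \<sigma>]] CB.semi_iff[OF h Hgal_GalAb[OF \<sigma>]] by simp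
qed

lemma Hh_iff: "h \<in> CB.Gh \<longleftrightarrow> h \<in> CA.Gh \<and> h \<in> H"
  unfolding nchar.stab_orb_iff[OF CA.hat_nchar] nchar.stab_orb_iff[OF CB.hat_nchar]
  using hat_semi_iff HG by blast

lemma ZH: "z \<in> Z \<Longrightarrow> z \<in> H" by (rule CB.ZinG)

text \<open>\<open>N\<close> lies in \<open>CA.Gh\<close>, so when an element of
  \<open>CA.Gh\<close> is factored along \<open>G = N H\<close>, the factor in \<open>H\<close> lies
  there too.\<close>

lemma hat_prod: "CA.Gh = setprod \<Gamma> CA.NZ CB.Gh"
proof (intro equalityI subsetI)
  interpret Q: nchar \<Gamma> CA.Gh CA.NZ CA.\<theta>h by (rule nchar.nchar_stab_orb[OF CA.hat_nchar])
  fix g assume g: "g \<in> CA.Gh"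
  hence gG: "g \<in> G" using CA.Gh_iff by simp
  from prod_cases[OF gG] obtain n h where nh: "n \<in> N" "h \<in> H" "g = n \<otimes> h" .
  have nNZ: "n \<in> CA.NZ" by (rule CA.N_NZ[OF nh(1)])
  have "h = inv n \<otimes> g" using nh A.NG HG by auto
  hence "h \<in> CA.Gh" using g Q.NG[OF nNZ] by simp
  hence "h \<in> CB.Gh" using Hh_iff nh(2) by simp
  thus "g \<in> setprod \<Gamma> CA.NZ CB.Gh" using nNZ nh(3) by (auto simp: setprod_def)
next
  interpret Q: nchar \<Gamma> CA.Gh CA.NZ CA.\<theta>h by (rule nchar.nchar_stab_orb[OF CA.hat_nchar])
  fix g assume "g \<in> setprod \<Gamma> CA.NZ CB.Gh"
  then obtain m h where mh: "m \<in> CA.NZ" "h \<in> CB.Gh" "g = m \<otimes> h" by (auto simp: setprod_def)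
  have "m \<in> CA.Gh" by (rule Q.NG[OF mh(1)])
  moreover have "h \<in> CA.Gh" using mh(2) Hh_iff by simp
  ultimately show "g \<in> CA.Gh" unfolding mh(3) by (rule Q.G.memb(2))
qed

text \<open>Since \<open>Z\<close> is contained in \<open>H\<close>, the part in \<open>N\<close> of
  an element of \<open>CA.NZ\<close> lying in \<open>H\<close> is itself in \<open>H\<close>, hence
  in \<open>M\<close>.\<close>

lemma hat_inter: "CA.NZ \<inter> CB.Gh = CB.NZ"
proof (intro equalityI subsetI)
  fix x assume "x \<in> CA.NZ \<inter> CB.Gh"
  hence xN: "x \<in> CA.NZ" and xH: "x \<in> H" using Hh_iff by auto
  from xN obtain n z where nz: "n \<in> N" "z \<in> Z" "x = n \<otimes> z" by (rule CA.NZ_E)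
  have "n = x \<otimes> inv z" using nz by (simp add: A.m_assoc A.NG CA.ZinG)
  hence "n \<in> H" using xH ZH[OF nz(2)] by simp
  hence "n \<in> M" using NH nz(1) by auto
  thus "x \<in> CB.NZ" using nz CB.NZ_I by simp
next
  fix x assume x: "x \<in> CB.NZ"
  then obtain m z where mz: "m \<in> M" "z \<in> Z" "x = m \<otimes> z" by (rule CB.NZ_E)
  have "m \<in> N" using mz NH by auto
  hence "x \<in> CA.NZ" using mz CA.NZ_I by simp
  moreover have "x \<in> CB.Gh" by (rule nchar.N_stab_orb[OF CB.hat_nchar x])
  ultimately show "x \<in> CA.NZ \<inter> CB.Gh" by simp
qed

text \<open>What centralizes \<open>CA.NZ\<close> centralizes \<open>N\<close>, so the scalars given
  for the original pair apply.\<close>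

lemma hat_centr: assumes "c \<in> centr \<Gamma> CA.Gh CA.NZ" shows "c \<in> CA.Gh" "c \<in> centr \<Gamma> G N"
  using assms CA.N_NZ CA.Gh_iff by (auto simp: centr_def)

lemma hat_stabH: "stabH \<Gamma> p CB.Gh CA.NZ CA.\<theta>h = stabH \<Gamma> p CB.Gh CB.NZ CB.\<theta>h"
  using hat_semi_iff Hh_iff by (auto simp: stabH_def)

lemma hat_stab:
  assumes "y \<in> stab \<Gamma> CB.Gh CA.NZ CA.\<theta>h"
  shows "y \<in> CA.Th" "y \<in> CB.Th" "y \<in> stab \<Gamma> H N \<theta>"
proof -
  from assms have y: "y \<in> CB.Gh" "char_act \<Gamma> CA.NZ y id CA.\<theta>h = CA.\<theta>h" by (auto simp: stab_def)
  have yH: "y \<in> H" "y \<in> CA.Gh" "y \<in> G" using y Hh_iff HG by auto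
  show "y \<in> CA.Th" using y yH by (simp add: stab_def)
  show "y \<in> CB.Th" using y hat_semi_iff[OF yH(1) Hgal_id] by (simp add: stab_def)
  show "y \<in> stab \<Gamma> H N \<theta>" using yH y CA.semi_iff[OF yH(3) GalAb_id] by (simp add: stab_def)
qed

theorem hat_geq_c: "geq_c \<Gamma> p CA.Gh CA.NZ CA.\<theta>h CB.Gh CB.NZ CB.\<theta>h"
proof -
  have PA: "proj_rep \<Gamma> CA.Th d CA.Ph CA.\<alpha>h \<and> assoc_with \<Gamma> CA.Th CA.NZ d CA.Ph CA.\<theta>h \<and> entries_Qab CA.Th d CA.Ph"
    using CA.hat_projchar by (simp add: projchar_Qab_def projchar_Qab_axioms_def projchar_def projchar_axioms_def)
  have PB: "proj_rep \<Gamma> CB.Th d' CB.Ph CB.\<alpha>h \<and> assoc_with \<Gamma> CB.Th CB.NZ d' CB.Ph CB.\<theta>h \<and> entries_Qab CB.Th d' CB.Ph"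
    using CB.hat_projchar by (simp add: projchar_Qab_def projchar_Qab_axioms_def projchar_def projchar_axioms_def)
  have al: "CA.\<alpha>h x y = CB.\<alpha>h x y"
    if "x \<in> stab \<Gamma> CB.Gh CA.NZ CA.\<theta>h" "y \<in> stab \<Gamma> CB.Gh CA.NZ CA.\<theta>h" for x y
    using \<alpha>_eq[OF hat_stab(3)[OF that(1)] hat_stab(3)[OF that(2)]] by (simp add: CA.\<alpha>h_def CB.\<alpha>h_def)
  have sc: "\<exists>s. CA.Ph c = s \<cdot>\<^sub>m 1\<^sub>m d \<and> CB.Ph c = s \<cdot>\<^sub>m 1\<^sub>m d'"
    if c: "c \<in> centr \<Gamma> CA.Gh CA.NZ" for c
  proof -
    from centr_scalar[OF hat_centr(2)[OF c]] obtain s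
      where "P c = s \<cdot>\<^sub>m 1\<^sub>m d" "P' c = s \<cdot>\<^sub>m 1\<^sub>m d'" by blast
    hence "CA.Ph c = (\<kappa> c * s) \<cdot>\<^sub>m 1\<^sub>m d \<and> CB.Ph c = (\<kappa> c * s) \<cdot>\<^sub>m 1\<^sub>m d'"
      by (auto simp: CA.Ph_def CB.Ph_def intro!: eq_matI)
    thus ?thesis by blast
  qed
  have mu: "mu \<Gamma> CA.Th CA.NZ d CA.Ph x \<sigma> y = mu \<Gamma> CB.Th CB.NZ d' CB.Ph x \<sigma> y"
    if a: "(x, \<sigma>) \<in> stabH \<Gamma> p CB.Gh CA.NZ CA.\<theta>h" and y: "y \<in> stab \<Gamma> CB.Gh CA.NZ CA.\<theta>h"
      for x \<sigma> y
  proof -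
    from a have x: "x \<in> CB.Gh" "\<sigma> \<in> Hgal p" "char_act \<Gamma> CA.NZ x \<sigma> CA.\<theta>h = CA.\<theta>h"
      by (auto simp: stabH_def)
    have x': "x \<in> CA.Gh" "x \<in> H" "x \<in> G" using x(1) Hh_iff HG by auto
    have g: "\<sigma> \<in> GalAb" by (rule Hgal_GalAb[OF x(2)])
    have st: "char_act \<Gamma> CB.NZ x \<sigma> CB.\<theta>h = CB.\<theta>h" using hat_semi_iff[OF x'(2) x(2)] x(3) by simp
    have "(x, \<sigma>) \<in> stabH \<Gamma> p H N \<theta>" using CA.semi_iff[OF x'(3) g] x x' by (simp add: stabH_def)
    from mu_eq[OF this hat_stab(3)[OF y]] show ?thesis
      unfolding CA.mu_hat[OF x'(1) g x(3) hat_stab(1)[OF y]] CB.mu_hat[OF x(1) g st hat_stab(2)[OF y]] by simp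
  qed
  show ?thesis
    unfolding geq_c_def
  proof (intro conjI exI)
    show "Htriple \<Gamma> p CA.Gh CA.NZ CA.\<theta>h" by (rule nchar.Htriple_stab_orb[OF CA.hat_nchar])
    show "Htriple \<Gamma> p CB.Gh CB.NZ CB.\<theta>h" by (rule nchar.Htriple_stab_orb[OF CB.hat_nchar])
    show "CB.Gh \<subseteq> CA.Gh" using Hh_iff by auto
    show "CA.Gh = setprod \<Gamma> CA.NZ CB.Gh" by (rule hat_prod)
    show "CA.NZ \<inter> CB.Gh = CB.NZ" by (rule hat_inter)
    show "centr \<Gamma> CA.Gh CA.NZ \<subseteq> CB.Gh" using hat_centr centr_H Hh_iff by blast
    show "stabH \<Gamma> p CB.Gh CA.NZ CA.\<theta>h = stabH \<Gamma> p CB.Gh CB.NZ CB.\<theta>h" by (rule hat_stabH)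
    show "proj_rep \<Gamma> CA.Th d CA.Ph CA.\<alpha>h" "assoc_with \<Gamma> CA.Th CA.NZ d CA.Ph CA.\<theta>h" "entries_Qab CA.Th d CA.Ph"
      using PA by auto
    show "proj_rep \<Gamma> CB.Th d' CB.Ph CB.\<alpha>h" "assoc_with \<Gamma> CB.Th CB.NZ d' CB.Ph CB.\<theta>h" "entries_Qab CB.Th d' CB.Ph"
      using PB by auto
    show "\<forall>x\<in>CA.Th. \<forall>y\<in>CA.Th. root_of_unity (CA.\<alpha>h x y)" using CA.\<alpha>h_root by blast
    show "\<forall>x\<in>CB.Th. \<forall>y\<in>CB.Th. root_of_unity (CB.\<alpha>h x y)" using CB.\<alpha>h_root by blast
    show "\<forall>x\<in>stab \<Gamma> CB.Gh CA.NZ CA.\<theta>h. \<forall>y\<in>stab \<Gamma> CB.Gh CA.NZ CA.\<theta>h. CA.\<alpha>h x y = CB.\<alpha>h x y" using al by blast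
    show "\<forall>c\<in>centr \<Gamma> CA.Gh CA.NZ. \<exists>s. CA.Ph c = s \<cdot>\<^sub>m 1\<^sub>m d \<and> CB.Ph c = s \<cdot>\<^sub>m 1\<^sub>m d'" using sc by blast
    show "\<forall>(x, \<sigma>)\<in>stabH \<Gamma> p CB.Gh CA.NZ CA.\<theta>h. \<forall>y\<in>stab \<Gamma> CB.Gh CA.NZ CA.\<theta>h.
       mu \<Gamma> CA.Th CA.NZ d CA.Ph x \<sigma> y = mu \<Gamma> CB.Th CB.NZ d' CB.Ph x \<sigma> y" using mu by blast
  qed
qed

end

text \<open>What has to be supplied is the agreement of \<open>lam\<close> with the scalar \<zeta>
  on \<open>Z \<inter> N\<close>. Both are linear there and not orthogonal to \<nu>:
  \<open>lam\<close> by choice, \<zeta> because \<theta> restricts to \<open>d\<close> times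
  \<zeta>. So both equal \<nu>.\<close>

lemma central_geq_c:
  assumes grp: "group \<Gamma>" and fin: "finite G" and geq: "geq_c \<Gamma> p G N \<theta> H M \<phi>"
    and ZG: "nsub \<Gamma> Z G"
      and Zab: "\<forall>a\<in>Z. \<forall>b\<in>Z. a \<otimes>\<^bsub>\<Gamma>\<^esub> b = b \<otimes>\<^bsub>\<Gamma>\<^esub> a"
        and ZC: "Z \<subseteq> centr \<Gamma> G N"
    and \<nu>: "\<nu> \<in> Irr \<Gamma> (Z \<inter> N)" "cinner (Z \<inter> N) \<theta> \<nu> \<noteq> 0"
      and lam: "lam \<in> Irr_over \<Gamma> Z (Z \<inter> N) \<nu>"
  shows "geq_c \<Gamma> p
           (stab_orb \<Gamma> p G (setprod \<Gamma> N Z) (cprod \<Gamma> N Z \<theta> lam)) (setprod \<Gamma> N Z) (cprod \<Gamma> N Z \<theta> lam)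
           (stab_orb \<Gamma> p H (setprod \<Gamma> M Z) (cprod \<Gamma> M Z \<phi> lam)) (setprod \<Gamma> M Z) (cprod \<Gamma> M Z \<phi> lam)"
proof -
  from geq_cE[OF grp fin geq] obtain d P \<alpha> d' P' \<alpha>'
    where pp: "projpair \<Gamma> G N \<theta> d P \<alpha> H M \<phi> d' P' \<alpha>' p"
    and root: "\<And>x y. x \<in> stab \<Gamma> G N \<theta> \<Longrightarrow> y \<in> stab \<Gamma> G N \<theta> \<Longrightarrow> root_of_unity (\<alpha> x y)"
    and root': "\<And>x y. x \<in> stab \<Gamma> H M \<phi> \<Longrightarrow> y \<in> stab \<Gamma> H M \<phi> \<Longrightarrow> root_of_unity (\<alpha>' x y)"
    and scal: "\<And>c. c \<in> centr \<Gamma> G N \<Longrightarrow> \<exists>s. P c = s \<cdot>\<^sub>m 1\<^sub>m d \<and> P' c = s \<cdot>\<^sub>m 1\<^sub>m d'" by blast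
  interpret projpair \<Gamma> G N \<theta> d P \<alpha> H M \<phi> d' P' \<alpha>' p by (rule pp)
  \<comment> \<open>A single scalar function for \<open>P\<close> and \<open>P'\<close>, so that the
    conditions on \<kappa> have the same \<zeta> on both sides.\<close>
  from scal obtain \<zeta>
    where \<zeta>: "\<And>c. c \<in> centr \<Gamma> G N \<Longrightarrow> P c = \<zeta> c \<cdot>\<^sub>m 1\<^sub>m d \<and> P' c = \<zeta> c \<cdot>\<^sub>m 1\<^sub>m d'" by metis
  have centr_H: "centr \<Gamma> G N \<subseteq> H" using geq unfolding geq_c_def by blast
  have lamI: "lam \<in> Irr \<Gamma> Z" "cinner (Z \<inter> N) lam \<nu> \<noteq> 0" using lam by (auto simp: Irr_over_def)
  have Zs: "subgroup Z \<Gamma>" by (rule nsubD(2)[OF ZG])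
  interpret Z: fsub \<Gamma> Z
    by (intro fsub.intro fsub_axioms.intro A.is_group Zs finite_subset[OF nsubD(3)[OF ZG] fin])
  interpret ZN: fsub \<Gamma> "Z \<inter> N"
    by (intro fsub.intro fsub_axioms.intro A.is_group A.subgroups_Inter_pair[OF Zs A.N.sub] finite_Int disjI1 Z.fin)
  have ZNab: "x \<otimes>\<^bsub>\<Gamma>\<^esub> y = y \<otimes>\<^bsub>\<Gamma>\<^esub> x"
    if "x \<in> Z \<inter> N" "y \<in> Z \<inter> N" for x y using that Zab by auto
  have nu: "\<nu> (x \<otimes>\<^bsub>\<Gamma>\<^esub> y) = \<nu> x * \<nu> y" "root_of_unity (\<nu> x)"
    if "x \<in> Z \<inter> N" "y \<in> Z \<inter> N" for x y
    using ZN.abelian_Irr(2,3)[OF _ \<nu>(1)] ZNab that by blast+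
  have Zab': "x \<otimes>\<^bsub>\<Gamma>\<^esub> y = y \<otimes>\<^bsub>\<Gamma>\<^esub> x" if "x \<in> Z" "y \<in> Z" for x y
    using that Zab by auto
  have lamh: "lam (x \<otimes>\<^bsub>\<Gamma>\<^esub> y) = lam x * lam y" if "x \<in> Z" "y \<in> Z" for x y
    using Z.abelian_Irr(2)[OF _ lamI(1)] Zab' that by blast
  have norm: "\<nu> x * cnj (\<nu> x) = 1" if "x \<in> Z \<inter> N" for x
    using root_of_unity_norm[OF nu(2)[OF that that]] .
  have lam\<nu>: "lam c = \<nu> c" if "c \<in> Z \<inter> N" for c
    by (rule ZN.linear_eq[OF _ nu(1) norm lamI(2) that]) (auto simp: lamh)
  have \<zeta>_mult: "\<zeta> (x \<otimes>\<^bsub>\<Gamma>\<^esub> y) = \<zeta> x * \<zeta> y"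
    if xy: "x \<in> Z \<inter> N" "y \<in> Z \<inter> N" for x y
  proof -
    have c: "x \<in> centr \<Gamma> G N" "y \<in> centr \<Gamma> G N" "x \<otimes>\<^bsub>\<Gamma>\<^esub> y \<in> centr \<Gamma> G N" using xy ZC by auto
    have "\<zeta> (x \<otimes>\<^bsub>\<Gamma>\<^esub> y) \<cdot>\<^sub>m 1\<^sub>m d = P x * P y"
      using A.N.repD(3)[OF A.P_repN, of x y] xy \<zeta>[OF c(3)] by simp
    also have "\<dots> = (\<zeta> x * \<zeta> y) \<cdot>\<^sub>m 1\<^sub>m d"
      using \<zeta>[OF c(1)] \<zeta>[OF c(2)]
      by (auto simp: mult_smult_assoc_mat[of _ d d _ d] intro!: eq_matI)
    finally show ?thesis using smult_one_eq_iff[OF A.d_pos] by simp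
  qed
  have \<theta>\<zeta>: "\<theta> c = of_nat d * \<zeta> c" if c: "c \<in> Z \<inter> N" for c
    using A.\<theta>_trace[of c] c \<zeta>[of c] ZC by (auto simp: mtrace_smult[of _ d] mult.commute)
  have "cinner (Z \<inter> N) \<theta> \<nu> = of_nat d * cinner (Z \<inter> N) \<zeta> \<nu>"
    using \<theta>\<zeta> by (simp add: cinner_def sum_distrib_left mult.assoc)
  hence "cinner (Z \<inter> N) \<zeta> \<nu> \<noteq> 0" using \<nu>(2) by auto
  hence \<zeta>\<nu>: "\<zeta> c = \<nu> c" if "c \<in> Z \<inter> N" for c
    using ZN.linear_eq[OF \<zeta>_mult nu(1) norm _ that] by blast
  have CA: "central \<Gamma> G N \<theta> d P \<alpha> Z lam \<zeta>"
    using ZG Zab' ZC lamI(1) \<zeta> lam\<nu> \<zeta>\<nu> root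
    by (intro central.intro central_axioms.intro A.projchar_Qab_axioms) auto
  interpret CA: central \<Gamma> G N \<theta> d P \<alpha> Z lam \<zeta> by (rule CA)
  have ZH: "Z \<subseteq> H" using ZC centr_H by auto
  have MN: "M \<subseteq> N" using NH by auto
  have ZnH: "nsub \<Gamma> Z H" using ZG ZH HG B.G.sub by (auto simp: nsub_def)
  have ZCH: "Z \<subseteq> centr \<Gamma> H M" using ZC ZH MN by (auto simp: centr_def)
  have CB: "central \<Gamma> H M \<phi> d' P' \<alpha>' Z lam \<zeta>"
    using ZnH Zab' ZCH ZC lamI(1) \<zeta> lam\<nu> \<zeta>\<nu> MN root'
    by (intro central.intro central_axioms.intro B.projchar_Qab_axioms) auto
  interpret CB: central \<Gamma> H M \<phi> d' P' \<alpha>' Z lam \<zeta> by (rule CB)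
  from CA.exists_kappa obtain \<kappa>
    where \<kappa>: "\<kappa> \<one>\<^bsub>\<Gamma>\<^esub> = 1" "\<And>x. x \<in> A.T \<Longrightarrow> root_of_unity (\<kappa> x)"
    "\<And>n x. n \<in> N \<Longrightarrow> x \<in> A.T \<Longrightarrow> \<kappa> (n \<otimes>\<^bsub>\<Gamma>\<^esub> x) = \<kappa> x"
    "\<And>z x. z \<in> Z \<Longrightarrow> x \<in> A.T \<Longrightarrow> \<kappa> (z \<otimes>\<^bsub>\<Gamma>\<^esub> x) * \<zeta> z = lam z * \<alpha> z x * \<kappa> x" by blast
  \<comment> \<open>Both \<open>z\<close> and \<open>x\<close> lie in \<open>B.T\<close>, where
    \<alpha> and \<open>\<alpha>'\<close> coincide.\<close>
  have \<kappa>': "\<kappa> (z \<otimes>\<^bsub>\<Gamma>\<^esub> x) * \<zeta> z = lam z * \<alpha>' z x * \<kappa> x"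
    if "z \<in> Z" "x \<in> B.T" for z x
    using \<kappa>(4)[OF that(1) BT_AT[OF that(2)]] \<alpha>_eq[of z x] CB.ZT[OF that(1)] that(2) unfolding BT_eq(1) by simp
  have "centralpair \<Gamma> G N \<theta> d P \<alpha> H M \<phi> d' P' \<alpha>' p Z lam \<zeta> \<kappa>"
  proof (intro centralpair.intro central_kappa.intro central_kappa_axioms.intro centralpair_axioms.intro pp CA CB)
    show "\<kappa> (n \<otimes>\<^bsub>\<Gamma>\<^esub> x) = \<kappa> x" if "n \<in> M" "x \<in> B.T" for n x
      using \<kappa>(3)[of n x] that MN BT_AT by auto
  qed (use \<kappa> \<kappa>' BT_AT centr_H scal in blast)+
  thus ?thesis by (rule centralpair.hat_geq_c)
qed

theorem theorem2p8:
  fixes \<Gamma> :: "'g monoid" and p :: nat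
    and G N H M Z :: "'g set" and \<theta> \<phi> \<nu> lam :: "'g \<Rightarrow> complex"
  assumes "prime p" and "group \<Gamma>" and "finite G"
    and "geq_c \<Gamma> p G N \<theta> H M \<phi>"
    and "nsub \<Gamma> Z G" and "\<forall>a\<in>Z. \<forall>b\<in>Z. a \<otimes>\<^bsub>\<Gamma>\<^esub> b = b \<otimes>\<^bsub>\<Gamma>\<^esub> a"
    and "Z \<subseteq> centr \<Gamma> G N"
    and "\<nu> \<in> Irr \<Gamma> (Z \<inter> N)" and "cinner (Z \<inter> N) \<theta> \<nu> \<noteq> 0"
    and "lam \<in> Irr_over \<Gamma> Z (Z \<inter> N) \<nu>"
  shows "geq_c \<Gamma> p
           (stab_orb \<Gamma> p G (setprod \<Gamma> N Z) (cprod \<Gamma> N Z \<theta> lam)) (setprod \<Gamma> N Z) (cprod \<Gamma> N Z \<theta> lam)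
           (stab_orb \<Gamma> p H (setprod \<Gamma> M Z) (cprod \<Gamma> M Z \<phi> lam)) (setprod \<Gamma> M Z) (cprod \<Gamma> M Z \<phi> lam)
       \<and> (\<exists>\<tau>. bij_betw \<tau>
              (Irr_over_orb \<Gamma> p (stab_orb \<Gamma> p G (setprod \<Gamma> N Z) (cprod \<Gamma> N Z \<theta> lam)) (setprod \<Gamma> N Z) (cprod \<Gamma> N Z \<theta> lam))
              (Irr_over_orb \<Gamma> p (stab_orb \<Gamma> p H (setprod \<Gamma> M Z) (cprod \<Gamma> M Z \<phi> lam)) (setprod \<Gamma> M Z) (cprod \<Gamma> M Z \<phi> lam))
            \<and> (\<forall>\<chi>\<in>Irr_over_orb \<Gamma> p (stab_orb \<Gamma> p G (setprod \<Gamma> N Z) (cprod \<Gamma> N Z \<theta> lam)) (setprod \<Gamma> N Z) (cprod \<Gamma> N Z \<theta> lam).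
                 (\<forall>\<sigma>\<in>Hgal p.
                    \<tau> (char_act \<Gamma> (stab_orb \<Gamma> p G (setprod \<Gamma> N Z) (cprod \<Gamma> N Z \<theta> lam)) \<one>\<^bsub>\<Gamma>\<^esub> \<sigma> \<chi>)
                  = char_act \<Gamma> (stab_orb \<Gamma> p H (setprod \<Gamma> M Z) (cprod \<Gamma> M Z \<phi> lam)) \<one>\<^bsub>\<Gamma>\<^esub> \<sigma> (\<tau> \<chi>))
               \<and> \<chi> \<one>\<^bsub>\<Gamma>\<^esub> / cprod \<Gamma> N Z \<theta> lam \<one>\<^bsub>\<Gamma>\<^esub> = \<tau> \<chi> \<one>\<^bsub>\<Gamma>\<^esub> / cprod \<Gamma> M Z \<phi> lam \<one>\<^bsub>\<Gamma>\<^esub>))"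
proof -
  note geq = central_geq_c[OF assms(2-10)]
  have "finite (stab_orb \<Gamma> p G (setprod \<Gamma> N Z) (cprod \<Gamma> N Z \<theta> lam))"
    using assms(3) by (rule finite_subset[rotated]) (auto simp: stab_orb_def)
  from geq_c_character_bijection[OF assms(2) this geq] geq show ?thesis by blast
qed

end
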